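(* Let $K$ be an algebraically closed field of characteristic $0$, let $A\subset K$ be a finite set and let $\alpha>0$ be a real number with $|A\cdot A|\leq \alpha|A|$, where $A\cdot A=\{aa':a,a'\in A\}$. Then for every integer $h\geq 2$, $$|hA|\geq e^{-h^{65h}(\alpha+1)}\,|A|^h,$$ where $hA=\{a_1+\dots+a_h: a_i\in A\}$. *)

theory Defs
  imports "HOL-Analysis.Analysis" "HOL-Computational_Algebra.Polynomial"
begin

definition prodset :: "'a::times set \<Rightarrow> 'a set" where
  "prodset A = {a * b | a b. a \<in> A \<and> b \<in> A}"

definition hsumset :: "nat \<Rightarrow> 'a::comm_monoid_add set \<Rightarrow> 'a set" where
  "hsumset h A = {(\<Sum>i<h. f i) | f. \<forall>i<h. f i \<in> A}"

end

theory Submission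
  imports Defs "Jordan_Normal_Form.Char_Poly" "HOL-Computational_Algebra.Computational_Algebra"
    "HOL-Library.Function_Algebras" "HOL-Real_Asymp.Real_Asymp"
begin

text \<open>A ring homomorphism from \<open>\<int>[A]\<close> to the complex numbers with algebraic values, injective on \<open>A\<close>,
  does not enlarge the sets involved. So the elements of \<open>A\<close>, apart from zero, may be taken to be units of a
  ring \<open>R\<close> of \<open>S\<close>-integers of a number field, and one may pass to a sector in which the arguments of their
  quotients are small.

  By Cauchy-Schwarz it suffices to bound the number of solutions of a linear equation in \<open>N = 2 h\<close> elements
  of \<open>A\<close>. Splitting into minimal vanishing subsums, one counts the projective non-degenerate
  solutions. The logarithms of the absolute values map \<open>A\<close> to a space where by Freiman's lemma it
  has dimension less than \<open>2 \<alpha>\<close>, so few balls are needed to cover the solutions of comparable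
  height, and the inequality of Plunnecke limits the number of scales that occur. Solutions of large
  height in the same small ball satisfy a further relation, because by the product formula the minors
  of the matrix that they form are too small to be non-zero. For solutions of small height, the
  determinant of as many solutions as there are unknowns vanishes, and its Leibniz expansion is a
  vanishing sum of units that stays zero when its terms are raised to the power \<open>p\<close>, for suitable
  primes \<open>p\<close>: the new sum is divisible by \<open>p\<close> and too small to be non-zero. A Vandermonde argument
  turns this into identities between exponential sums, whose leading exponents provide relations with
  two terms. In both cases the solutions split into solutions of equations with fewer terms, and one
  concludes by induction.\<close>

section \<open>Relations from vanishing minors\<close>

text \<open>The obstacle is that small doubling does not control heights: the number of dyadic
  scales that occur is bounded only by a multiple of |A|^(1/j), for each j. This is affordable
  because vanishing pairs alone already contribute |A|^h to the energy, so a minimal vanishing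
  subsum with three or more terms may have about |A|^(3/2) solutions. Each step of the induction on
  the number of terms squares the count, hence the number of scales enters with exponent at most
  \<open>2 ^ N\<close>, and \<open>j = 2 * 2 ^ N\<close> leaves a square root of |A|. Otherwise
  \<alpha> enters only through its own powers and through a dimension d < 2 \<alpha>, in the form
  C(N)^d, so the final exponent is linear in \<alpha>. For small heights the exponents have the form
  1 + j t, since Vandermonde requires the powers of fixed numbers, here t-th powers; t is a
  factorial, which makes all prime factors of 1 + j t large. Equal t-th powers determine a number
  only up to roots of unity, and this is the reason for the sector.\<close>

definition leibniz :: "nat \<Rightarrow> (nat \<Rightarrow> nat \<Rightarrow> 'a::comm_ring_1) \<Rightarrow> 'a" where
  "leibniz m M = (\<Sum>p | p permutes {0..<m}. of_int (sign p) * (\<Prod>i<m. M i (p i)))"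

lemma leibniz_det: "leibniz m M = Determinant.det (Matrix.mat m m (\<lambda>(i, j). M i j))"
proof -
  have "(\<Prod>i = 0..<m. Matrix.mat m m (\<lambda>(i, j). M i j) $$ (i, p i)) = (\<Prod>i<m. M i (p i))"
    if "p permutes {0..<m}" for p
    using permutes_in_image[OF that]
    by (auto simp: atLeast0LessThan intro!: prod.cong)
  then show ?thesis
    unfolding leibniz_def by (subst det_def'[of _ m]) (auto intro!: sum.cong)
qed

text \<open>Cramer's rule in column form. It serves both to exchange a column in the gap principle
  and to make a determinant with dependent columns vanish.\<close>

lemma leibniz_cramer:
  fixes M :: "nat \<Rightarrow> nat \<Rightarrow> 'a::comm_ring_1"
  assumes "k < m"
  shows "leibniz m (\<lambda>i j. if j = k then (\<Sum>l<m. M i l * x l) else M i j) = x k * leibniz m M"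
proof -
  let ?A = "Matrix.mat m m (\<lambda>(i, j). M i j)" and ?x = "Matrix.vec m x"
  have "Determinant.det (replace_col ?A (?A *\<^sub>v ?x) k) = ?x $ k * Determinant.det ?A"
    by (rule cramer_lemma_mat) (use assms in auto)
  moreover have "replace_col ?A (?A *\<^sub>v ?x) k
      = Matrix.mat m m (\<lambda>(i, j). if j = k then (\<Sum>l<m. M i l * x l) else M i j)"
    by (rule eq_matI) (auto simp: replace_col_def scalar_prod_def atLeast0LessThan)
  ultimately show ?thesis using assms by (simp add: leibniz_det)
qed

text \<open>The last row is the one that will vary: the cofactors involve only the rows above it.
  The function \<open>insert_index j\<close> enumerates the columns other than
  \<open>j\<close>.\<close>

lemma leibniz_last_row:
  fixes M :: "nat \<Rightarrow> nat \<Rightarrow> 'a::comm_ring_1"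
  shows "leibniz (Suc m) M
    = (\<Sum>j\<le>m. M m j * ((-1) ^ (m + j) * leibniz m (\<lambda>i l. M i (insert_index j l))))"
proof -
  have "mat_delete (Matrix.mat (Suc m) (Suc m) (\<lambda>(i, j). M i j)) m j
      = Matrix.mat m m (\<lambda>(i, l). M i (insert_index j l))" for j
    by (rule eq_matI) (auto simp: mat_delete_def insert_index_def)
  then show ?thesis
    unfolding leibniz_det
    by (subst laplace_expansion_row[of _ "Suc m" m])
       (auto simp: cofactor_def lessThan_Suc_atMost intro!: sum.cong)
qed

text \<open>The relation is the Laplace expansion, along a varying row, of a minor one size larger than
  the largest non-vanishing one.\<close>

lemma relation_of_vanishing_minors:
  fixes Z :: "(nat \<Rightarrow> 'a::comm_ring_1) set" and S :: "'a set"
  assumes van: "\<And>r. (\<And>i. i < m \<Longrightarrow> r i \<in> Z) \<Longrightarrow> leibniz m r = 0"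
    and S: "0 \<in> S" "1 \<in> S" "\<And>x. x \<in> S \<Longrightarrow> - x \<in> S" "\<And>x y. x \<in> S \<Longrightarrow> y \<in> S \<Longrightarrow> x + y \<in> S"
      "\<And>x y. x \<in> S \<Longrightarrow> y \<in> S \<Longrightarrow> x * y \<in> S"
    and ZS: "\<And>z j. z \<in> Z \<Longrightarrow> j < m \<Longrightarrow> z j \<in> S"
  obtains c where "\<exists>j<m. c j \<noteq> 0" "\<And>j. j < m \<Longrightarrow> c j \<in> S" "\<And>z. z \<in> Z \<Longrightarrow> (\<Sum>j<m. c j * z j) = 0"
proof -
  have m0: "m > 0"
    using van[of undefined] by (cases m) (auto simp: leibniz_def)
  \<comment> \<open>A non-vanishing minor of size \<open>k\<close>: \<open>r\<close> chooses its
    rows from \<open>Z\<close> and \<open>q\<close> its columns. Size \<open>m\<close> would use all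
    columns, in an order that affects only the sign, and is excluded by \<open>van\<close>.\<close>
  define good where "good k \<longleftrightarrow> (\<exists>r q. (\<forall>i<k. r i \<in> Z) \<and> inj_on q {..<k} \<and> q ` {..<k} \<subseteq> {..<m}
    \<and> leibniz k (\<lambda>i j. r i (q j)) \<noteq> 0)" for k
  have bnd: "k < m" if gk: "good k" for k
  proof -
    obtain r q where rq: "\<forall>i<k. r i \<in> Z" "inj_on q {..<k}" "q ` {..<k} \<subseteq> {..<m}"
      "leibniz k (\<lambda>i j. r i (q j)) \<noteq> 0" using gk unfolding good_def by blast
    have "k \<le> m" using card_inj_on_le[OF rq(2,3)] by simp
    moreover have "k \<noteq> m"
    proof
      assume km: "k = m"
      have bij: "q ` {..<m} = {..<m}"
        using rq(2,3) km by (intro card_subset_eq) (auto simp: card_image)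
      define q' where "q' = (\<lambda>i. if i < m then q i else i)"
      have q': "q' permutes {0..<m}"
      proof (rule bij_imp_permutes)
        show "bij_betw q' {0..<m} {0..<m}"
          unfolding q'_def using rq(2) bij km
          by (auto simp: bij_betw_def atLeast0LessThan inj_on_def)
      qed (auto simp: q'_def)
      have "leibniz m (\<lambda>i j. r i (q j)) = leibniz m (\<lambda>i j. r i (q' j))"
        unfolding leibniz_def
      proof (intro sum.cong refl arg_cong2[of _ _ _ _ "(*)"] prod.cong)
        fix p i assume "p \<in> {p. p permutes {0..<m}}" "i \<in> {..<m}"
        then have "p i < m" using permutes_in_image[of p "{0..<m}" i] by auto
        then show "r i (q (p i)) = r i (q' (p i))" by (simp add: q'_def)
      qed
      also have "\<dots> = (\<Sum>p | p permutes {0..<m}. of_int (sign q') * of_int (sign (q' \<circ> p)) * (\<Prod>i<m. r i ((q' \<circ> p) i)))"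
        unfolding leibniz_def
      proof (intro sum.cong refl)
        fix p assume "p \<in> {p. p permutes {0..<m}}"
        then have p: "p permutes {0..<m}" by simp
        have "sign (q' \<circ> p) = sign q' * sign p"
          using p q' by (intro sign_compose) (auto simp: permutation_permutes)
        then have "sign q' * sign (q' \<circ> p) = sign p"
          by (simp flip: mult.assoc)
        then have "(of_int (sign q') * of_int (sign (q' \<circ> p)) :: 'a) = of_int (sign p)"
          by (metis of_int_mult)
        then show "of_int (sign p) * (\<Prod>i<m. r i (q' (p i))) =
         of_int (sign q') * of_int (sign (q' \<circ> p)) * (\<Prod>i<m. r i ((q' \<circ> p) i))" by simp
      qed
      also have "\<dots> = (\<Sum>p | p permutes {0..<m}. of_int (sign q') * of_int (sign p) * (\<Prod>i<m. r i (p i)))"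
        by (rule sum.reindex_bij_witness[where i = "\<lambda>p. Hilbert_Choice.inv q' \<circ> p" and j = "\<lambda>p. q' \<circ> p"])
          (use q' in \<open>auto simp: o_assoc permutes_inv_o permutes_compose permutes_inv\<close>)
      also have "\<dots> = of_int (sign q') * leibniz m r"
        unfolding leibniz_def by (simp add: sum_distrib_left mult.assoc)
      also have "leibniz m r = 0" using van rq(1) km by blast
      finally show False using rq(4) km by simp
    qed
    ultimately show ?thesis by simp
  qed
  have g0: "good 0" by (auto simp: good_def leibniz_def)
  define k where "k = (GREATEST k. good k)"
  have gk: "good k"
    unfolding k_def by (rule GreatestI_nat[where P = good and k = 0 and b = m]) (use g0 bnd in force)+
  have kmax: "\<not> good (Suc k)"
    using Greatest_le_nat[where P = good and k = "Suc k" and b = m] bnd unfolding k_def[symmetric] by force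
  obtain r q where rq: "\<forall>i<k. r i \<in> Z" "inj_on q {..<k}" "q ` {..<k} \<subseteq> {..<m}"
    "leibniz k (\<lambda>i j. r i (q j)) \<noteq> 0" using gk unfolding good_def by blast
  have "k < m" using bnd gk by simp
  have "\<exists>j0<m. j0 \<notin> q ` {..<k}"
  proof (rule ccontr)
    assume "\<not> ?thesis"
    then have "{..<m} \<subseteq> q ` {..<k}" by auto
    from card_mono[OF _ this] show False using \<open>k < m\<close> card_image[OF rq(2)] by simp
  qed
  then obtain j0 where j0: "j0 < m" "j0 \<notin> q ` {..<k}" by blast
  define q' where "q' = q(k := j0)"
  have q'inj: "inj_on q' {..k}"
    using rq(2) j0(2) unfolding q'_def inj_on_def by (auto simp: le_less image_iff)
  have q'm: "q' l < m" if "l \<le> k" for l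
    using that rq(3) j0(1) by (auto simp: q'_def image_subset_iff)
  define C where "C l = (-1) ^ (k + l) * leibniz k (\<lambda>i j. r i (q' (insert_index l j)))" for l
  have Ck: "C k \<noteq> 0"
  proof -
    have "leibniz k (\<lambda>i j. r i (q' (insert_index k j))) = leibniz k (\<lambda>i j. r i (q j))"
      unfolding leibniz_def
    proof (intro sum.cong refl arg_cong2[of _ _ _ _ "(*)"] prod.cong)
      fix p i assume "p \<in> {p. p permutes {0..<k}}" "i \<in> {..<k}"
      then have "p i < k" using permutes_in_image[of p "{0..<k}" i] by auto
      then show "r i (q' (insert_index k (p i))) = r i (q (p i))"
        by (simp add: q'_def insert_index_def)
    qed
    then show ?thesis using rq(4) by (simp add: C_def flip: power_add mult_2)
  qed
  have rel: "(\<Sum>l\<le>k. z (q' l) * C l) = 0" if z: "z \<in> Z" for z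
  proof -
    define r' where "r' = r(k := z)"
    have r'Z: "\<forall>i<Suc k. r' i \<in> Z" using rq(1) z by (auto simp: r'_def less_Suc_eq)
    have inj': "inj_on q' {..<Suc k}" using q'inj by (simp add: lessThan_Suc_atMost)
    have im': "q' ` {..<Suc k} \<subseteq> {..<m}" using q'm by (auto simp: less_Suc_eq_le)
    have "leibniz (Suc k) (\<lambda>i j. r' i (q' j)) = 0"
    proof (rule ccontr)
      assume "leibniz (Suc k) (\<lambda>i j. r' i (q' j)) \<noteq> 0"
      with r'Z inj' im' have "good (Suc k)" unfolding good_def by blast
      then show False using kmax by simp
    qed
    moreover have "leibniz (Suc k) (\<lambda>i j. r' i (q' j)) = (\<Sum>l\<le>k. z (q' l) * C l)"
      unfolding leibniz_last_row C_def
      by (intro sum.cong refl) (auto simp: r'_def leibniz_def intro!: sum.cong prod.cong)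
    ultimately show ?thesis by simp
  qed
  have CS: "C l \<in> S" if "l \<le> k" for l
  proof -
    have pw: "x \<in> S \<Longrightarrow> x ^ n \<in> S" for x n by (induction n) (auto intro: S)
    have ofn: "of_nat n \<in> S" for n by (induction n) (auto intro: S)
    have sg: "of_int (sign p) \<in> S" for p :: "nat \<Rightarrow> nat"
      by (auto simp: sign_def intro: S)
    have pr: "finite A \<Longrightarrow> (\<And>i. i \<in> A \<Longrightarrow> f i \<in> S) \<Longrightarrow> prod f A \<in> S" for f and A :: "nat set"
      by (induction A rule: finite_induct) (auto intro: S)
    have sm: "(\<And>i. i \<in> A \<Longrightarrow> f i \<in> S) \<Longrightarrow> sum f A \<in> S" for f and A :: "(nat \<Rightarrow> nat) set"
      by (induction A rule: infinite_finite_induct) (auto intro: S)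
    have "r i (q' (insert_index l (p i))) \<in> S" if "p permutes {0..<k}" "i < k" for p i
    proof -
      have "p i < k" using permutes_in_image[OF that(1), of i] that(2) by auto
      then have "insert_index l (p i) \<le> k" using \<open>l \<le> k\<close> by (auto simp: insert_index_def)
      then show ?thesis using ZS rq(1) q'm that(2) by blast
    qed
    then show ?thesis unfolding C_def leibniz_def
      by (intro S pw sm sg pr) auto
  qed
  define c where "c j = (if j \<in> q' ` {..k} then C (the_inv_into {..k} q' j) else 0)" for j
  have cq: "c (q' l) = C l" if "l \<le> k" for l
    using that the_inv_into_f_f[OF q'inj, of l] by (simp add: c_def)
  show ?thesis
  proof (rule that[of c])
    show "\<exists>j<m. c j \<noteq> 0" using cq[of k] Ck q'm[of k] by auto
    show "c j \<in> S" if "j < m" for j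
      unfolding c_def using CS the_inv_into_into[OF q'inj _ subset_refl, of j] S(1) by auto
    show "(\<Sum>j<m. c j * z j) = 0" if "z \<in> Z" for z
    proof -
      have "(\<Sum>j<m. c j * z j) = (\<Sum>j\<in>q' ` {..k}. c j * z j)"
        by (rule sum.mono_neutral_right) (auto simp: c_def q'm)
      also have "\<dots> = (\<Sum>l\<le>k. z (q' l) * C l)"
        by (subst sum.reindex[OF q'inj]) (auto simp: cq mult.commute)
      finally show ?thesis using rel[OF that] by simp
    qed
  qed
qed

text \<open>By linearity the hypothesis extends from powers to every polynomial of degree less than
  \<open>card T\<close>. The polynomial that vanishes at all values of \<open>w\<close> except
  \<open>c\<close> isolates the class of \<open>c\<close>.\<close>

lemma vandermonde_classes:
  fixes w a :: "'i \<Rightarrow> 'a::field"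
  assumes "finite T" "\<And>j. j < card T \<Longrightarrow> (\<Sum>\<sigma>\<in>T. a \<sigma> * w \<sigma> ^ j) = 0"
  shows "(\<Sum>\<sigma> | \<sigma> \<in> T \<and> w \<sigma> = c. a \<sigma>) = 0"
proof (cases "c \<in> w ` T")
  case False
  then have e: "{\<sigma>. \<sigma> \<in> T \<and> w \<sigma> = c} = {}" by auto
  show ?thesis unfolding e by simp
next
  case True
  define q where "q = (\<Prod>c'\<in>w ` T - {c}. [:- c', 1:])"
  have "degree q \<le> card (w ` T - {c})"
    unfolding q_def by (rule order.trans[OF degree_prod_sum_le]) (use assms in auto)
  also have "\<dots> < card T"
    using True assms(1) card_image_le[OF assms(1), of w] card_Diff1_less[of "w ` T" c] by auto
  finally have dq: "degree q < card T" .
  have pq: "poly q x = (\<Prod>c'\<in>w ` T - {c}. x - c')" for x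
    by (simp add: q_def poly_prod)
  have "(\<Sum>\<sigma>\<in>T. a \<sigma> * poly q (w \<sigma>)) = (\<Sum>\<sigma>\<in>T. \<Sum>j\<le>degree q. a \<sigma> * (coeff q j * w \<sigma> ^ j))"
    by (simp add: poly_altdef sum_distrib_left)
  also have "\<dots> = (\<Sum>j\<le>degree q. coeff q j * (\<Sum>\<sigma>\<in>T. a \<sigma> * w \<sigma> ^ j))"
    by (subst sum.swap) (simp add: sum_distrib_left mult_ac)
  also have "\<dots> = 0" using assms(2) dq by (intro sum.neutral) auto
  also have "(\<Sum>\<sigma>\<in>T. a \<sigma> * poly q (w \<sigma>)) = (\<Sum>\<sigma> | \<sigma> \<in> T \<and> w \<sigma> = c. a \<sigma> * poly q c)"
    using assms(1) by (intro sum.mono_neutral_cong_right) (auto simp: pq)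
  finally have "(\<Sum>\<sigma> | \<sigma> \<in> T \<and> w \<sigma> = c. a \<sigma>) * poly q c = 0"
    by (simp add: sum_distrib_right)
  moreover have "poly q c \<noteq> 0" using assms(1) by (auto simp: pq)
  ultimately show ?thesis by simp
qed

section \<open>Freiman's lemma\<close>

text \<open>The real line as a vector space over the rationals. A generic logarithm maps the units
  into it, so that single real numbers replace vectors of logarithms.\<close>

definition rscale :: "rat \<Rightarrow> real \<Rightarrow> real" where
  "rscale q x = of_rat q * x"

interpretation rv: vector_space rscale
  by unfold_locales (auto simp: rscale_def of_rat_add of_rat_mult algebra_simps)

lemma rv_dim_mono:
  assumes "finite W" "V \<subseteq> rv.span W"
  shows "rv.dim V \<le> rv.dim W"
proof -
  obtain B where B: "B \<subseteq> W" "rv.independent B" "W \<subseteq> rv.span B" "card B = rv.dim W"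
    using rv.basis_exists by blast
  have "V \<subseteq> rv.span B"
    using assms(2) B(3) rv.span_mono[OF B(3)] rv.span_span by blast
  then show ?thesis
    using rv.dim_le_card[of V B] B(1,4) assms(1) finite_subset by metis
qed

text \<open>The coefficients are rational: with real ones the cone of any set of negative numbers
  would be a half-line, and the geometry of the rational span would be lost.\<close>

definition rcone :: "real set \<Rightarrow> real set" where
  "rcone E = {\<Sum>e\<in>E. of_rat (c e) * e | c. \<forall>e\<in>E. c e \<ge> 0}"

lemma rcone_base: "finite E \<Longrightarrow> e \<in> E \<Longrightarrow> e \<in> rcone E"
  unfolding rcone_def
proof (intro CollectI exI conjI ballI)
  assume e: "finite E" "e \<in> E"
  have "(\<Sum>x\<in>E. of_rat (if x = e then 1 else 0) * x) = (\<Sum>x\<in>E. if x = e then x else 0)"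
    by (intro sum.cong) auto
  also have "\<dots> = e" using e by simp
  finally show "e = (\<Sum>x\<in>E. of_rat (if x = e then 1 else 0) * x)" by (rule sym)
qed auto

lemma rcone_scale: "x \<in> rcone E \<Longrightarrow> q \<ge> 0 \<Longrightarrow> of_rat q * x \<in> rcone E"
  unfolding rcone_def
proof clarify
  fix c assume c: "\<forall>e\<in>E. c e \<ge> (0::rat)" and q: "q \<ge> 0"
  show "\<exists>c'. of_rat q * (\<Sum>e\<in>E. of_rat (c e) * e) = (\<Sum>e\<in>E. of_rat (c' e) * e) \<and> (\<forall>e\<in>E. 0 \<le> c' e)"
    using c q by (intro exI[of _ "\<lambda>e. q * c e"]) (auto simp: sum_distrib_left of_rat_mult mult.assoc)
qed

lemma rcone_add: "x \<in> rcone E \<Longrightarrow> y \<in> rcone E \<Longrightarrow> x + y \<in> rcone E"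
  unfolding rcone_def
proof clarify
  fix c d assume c: "\<forall>e\<in>E. c e \<ge> (0::rat)" "\<forall>e\<in>E. d e \<ge> (0::rat)"
  show "\<exists>c'. (\<Sum>e\<in>E. of_rat (c e) * e) + (\<Sum>e\<in>E. of_rat (d e) * e)
    = (\<Sum>e\<in>E. of_rat (c' e) * e) \<and> (\<forall>e\<in>E. 0 \<le> c' e)"
    using c by (intro exI[of _ "\<lambda>e. c e + d e"]) (auto simp: sum.distrib of_rat_add algebra_simps)
qed

lemma rcone_zero: "0 \<in> rcone E"
  unfolding rcone_def by (rule CollectI, rule exI[of _ "\<lambda>_. 0"]) auto

lemma rcone_sum: "finite I \<Longrightarrow> (\<And>i. i \<in> I \<Longrightarrow> g i \<in> rcone E) \<Longrightarrow> sum g I \<in> rcone E"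
  by (induction I rule: finite_induct) (auto intro: rcone_zero rcone_add)

lemma rcone_mono:
  assumes "finite E" "E \<subseteq> rcone E'" 
  shows "rcone E \<subseteq> rcone E'"
proof
  fix x assume "x \<in> rcone E"
  then obtain c where c: "x = (\<Sum>e\<in>E. of_rat (c e) * e)" "\<forall>e\<in>E. c e \<ge> (0::rat)"
    unfolding rcone_def by blast
  show "x \<in> rcone E'"
    unfolding c(1) using assms c(2) by (intro rcone_sum rcone_scale) auto
qed

lemma rcone_span: "rcone E \<subseteq> rv.span E"
proof
  fix x assume "x \<in> rcone E"
  then obtain c where x: "x = (\<Sum>e\<in>E. rscale (c e) e)"
    unfolding rcone_def rscale_def[symmetric] by blast
  show "x \<in> rv.span E"
    unfolding x by (rule rv.span_sum, rule rv.span_scale, rule rv.span_base)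
qed

text \<open>The set \<open>E\<close> minimises the total length among the generating subsets, so it consists of the
  points of \<open>Y\<close> nearest to the origin on the extreme rays of the cone of \<open>Y\<close>.\<close>

lemma exists_primitive_generators:
  assumes "finite Y" and neg: "\<And>y. y \<in> Y \<Longrightarrow> y < 0"
  obtains E where "E \<subseteq> Y" "Y \<subseteq> rcone E" "\<And>e x y. e \<in> E \<Longrightarrow> x \<in> Y \<Longrightarrow> y \<in> Y \<Longrightarrow> x + y \<noteq> e"
proof -
  define \<mu> :: "real set \<Rightarrow> real" where "\<mu> E = (\<Sum>e\<in>E. - e)" for E
  define \<F> where "\<F> = {E. E \<subseteq> Y \<and> Y \<subseteq> rcone E}"
  have "finite \<F>" unfolding \<F>_def using assms(1) by auto
  moreover have "Y \<in> \<F>" unfolding \<F>_def using rcone_base assms(1) by auto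
  ultimately have "\<exists>E\<in>\<F>. \<forall>E'\<in>\<F>. \<mu> E \<le> \<mu> E'"
    using ex_min_if_finite[of "\<mu> ` \<F>"] by force
  then obtain E where E: "E \<subseteq> Y" "Y \<subseteq> rcone E" and min: "\<And>E'. E' \<subseteq> Y \<Longrightarrow> Y \<subseteq> rcone E' \<Longrightarrow> \<mu> E \<le> \<mu> E'"
    unfolding \<F>_def by auto
  have finE: "finite E" using E(1) assms(1) finite_subset by blast
  have no: False if e: "e \<in> E" and x: "x \<in> Y" and y: "y \<in> Y" and xy: "x + y = e" for e x y
  proof -
    obtain c where c: "x = (\<Sum>f\<in>E. of_rat (c f) * f)" "\<forall>f\<in>E. c f \<ge> (0::rat)"
      using x E(2) unfolding rcone_def by blast
    obtain d where d: "y = (\<Sum>f\<in>E. of_rat (d f) * f)" "\<forall>f\<in>E. d f \<ge> (0::rat)"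
      using y E(2) unfolding rcone_def by blast
    define s where "s = c e + d e"
    define g where "g f = c f + d f" for f
    let ?E = "E - {e}"
    have e0: "e < 0" using e E(1) neg by blast
    have eq: "e = of_rat s * e + (\<Sum>f\<in>?E. of_rat (g f) * f)"
    proof -
      have "e = (\<Sum>f\<in>E. of_rat (g f) * f)"
        unfolding xy[symmetric] c(1) d(1) g_def by (simp add: sum.distrib of_rat_add algebra_simps)
      also have "\<dots> = of_rat (g e) * e + (\<Sum>f\<in>?E. of_rat (g f) * f)"
        using finE e by (rule sum.remove)
      finally show ?thesis by (simp add: g_def s_def)
    qed
    have g0: "g f \<ge> 0" if "f \<in> E" for f using c(2) d(2) that by (auto simp: g_def)
    have gf: "of_rat (g f) * f \<le> 0" if "f \<in> ?E" for f
      using g0[of f] neg[of f] that E(1) by (intro mult_nonneg_nonpos) auto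
    show False
    proof (cases "s < 1")
      case True
      have "(1 - of_rat s) * e = (\<Sum>f\<in>?E. of_rat (g f) * f)"
        using eq by (simp add: algebra_simps)
      then have "of_rat (1 - s) * e \<in> rcone ?E"
        unfolding rcone_def using g0 by (auto simp: of_rat_diff)
      then have "of_rat (inverse (1 - s)) * (of_rat (1 - s) * e) \<in> rcone ?E"
        by (rule rcone_scale) (use True in simp)
      moreover have "of_rat (inverse (1 - s)) * (of_rat (1 - s) * e) = e"
        unfolding mult.assoc[symmetric] of_rat_mult[symmetric] using True by simp
      ultimately have "E \<subseteq> rcone ?E" using rcone_base[of ?E] finE by auto
      then have "Y \<subseteq> rcone ?E" using rcone_mono[OF finE] E(2) by blast
      then have "\<mu> E \<le> \<mu> ?E" using min[of ?E] E(1) by blast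
      moreover have "\<mu> E = - e + \<mu> ?E" unfolding \<mu>_def using finE e by (rule sum.remove)
      ultimately show False using e0 by simp
    next
      case False
      \<comment> \<open>As all terms have the same sign, \<open>s = 1\<close> and no other generator
        occurs: \<open>x\<close> and \<open>y\<close> are multiples of \<open>e\<close> by positive
        factors with sum one. Replacing \<open>e\<close> by \<open>x\<close>, which is nearer to
        zero, lowers \<mu>.\<close>
      have le: "(\<Sum>f\<in>?E. of_rat (g f) * f) \<le> 0" using gf by (rule sum_nonpos)
      have "(1 - of_rat s) * e = (\<Sum>f\<in>?E. of_rat (g f) * f)"
        using eq by (simp add: algebra_simps)
      moreover have "(1 - of_rat s) * e \<ge> 0"
        using False e0 by (intro mult_nonpos_nonpos) (auto simp: of_rat_le_1_iff not_less)
      ultimately have z: "(1 - of_rat s) * e = 0" "(\<Sum>f\<in>?E. of_rat (g f) * f) = 0"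
        using le by linarith+
      then have s1: "s = 1" using e0 by simp
      have z': "of_rat (g f) * f = 0" if "f \<in> ?E" for f
        using sum_nonneg_eq_0_iff[of ?E "\<lambda>f. - (of_rat (g f) * f)"] gf z(2) finE that
        by (auto simp: sum_negf)
      have "g f = 0" if "f \<in> ?E" for f using z'[OF that] neg[of f] that E(1) by force
      then have cf: "c f = 0" "d f = 0" if "f \<in> ?E" for f
        using that c(2) d(2) by (auto simp: g_def add_nonneg_eq_0_iff)
      have xe: "x = of_rat (c e) * e"
      proof -
        have "x = of_rat (c e) * e + (\<Sum>f\<in>?E. of_rat (c f) * f)"
          unfolding c(1) using finE e by (rule sum.remove)
        then show ?thesis using cf by simp
      qed
      have ye: "y = of_rat (d e) * e"
      proof -
        have "y = of_rat (d e) * e + (\<Sum>f\<in>?E. of_rat (d f) * f)"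
          unfolding d(1) using finE e by (rule sum.remove)
        then show ?thesis using cf by simp
      qed
      have ce: "c e > 0" using xe neg[OF x] c(2) e by (cases "c e = 0") (auto simp: less_le)
      have de: "d e > 0" using ye neg[OF y] d(2) e by (cases "d e = 0") (auto simp: less_le)
      have ce1: "c e < 1" using de s1 by (simp add: s_def)
      let ?F = "insert x ?E"
      have "of_rat (inverse (c e)) * x \<in> rcone ?F"
        using ce finE by (intro rcone_scale rcone_base) auto
      moreover have "of_rat (inverse (c e)) * x = e"
        unfolding xe mult.assoc[symmetric] of_rat_mult[symmetric] using ce by simp
      ultimately have "E \<subseteq> rcone ?F" using rcone_base[of ?F] finE by auto
      then have "Y \<subseteq> rcone ?F" using rcone_mono[OF finE] E(2) by blast
      then have "\<mu> E \<le> \<mu> ?F" using min[of ?F] E(1) x by blast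
      also have "\<mu> ?F \<le> - x + \<mu> ?E"
        unfolding \<mu>_def using finE neg[OF x] by (cases "x \<in> ?E") (auto simp: insert_absorb)
      also have "\<dots> < - e + \<mu> ?E"
        unfolding xe using ce1 e0 of_rat_less_1_iff[of "c e", where ?'a = real] by simp
      also have "\<dots> = \<mu> E" unfolding \<mu>_def by (rule sum.remove[symmetric, OF finE e])
      finally show False by simp
    qed
  qed
  show ?thesis by (rule that[OF E]) (use no in blast)
qed

lemma finite_prodset [simp]: "finite A \<Longrightarrow> finite (prodset A)"
proof -
  assume "finite A"
  then have "finite ((\<lambda>(a, b). a * b) ` (A \<times> A))" by simp
  moreover have "prodset A = (\<lambda>(a, b). a * b) ` (A \<times> A)" by (auto simp: prodset_def)
  ultimately show ?thesis by simp
qed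

lemma prodsetI: "a \<in> A \<Longrightarrow> b \<in> A \<Longrightarrow> a * b \<in> prodset A"
  by (auto simp: prodset_def)

lemma card_mult_left_le:
  fixes a :: "'a::field"
  assumes "finite P" "a \<noteq> 0" "\<And>x. x \<in> X \<Longrightarrow> a * x \<in> P"
  shows "card X \<le> card P"
  by (rule card_inj_on_le[where f = "(*) a"]) (use assms in \<open>auto simp: inj_on_def\<close>)

definition diffset :: "('a \<Rightarrow> real) \<Rightarrow> 'a set \<Rightarrow> real set" where
  "diffset f A = {f a - f b | a b. a \<in> A \<and> b \<in> A}"

lemma finite_diffset: "finite A \<Longrightarrow> finite (diffset f A)"
proof -
  assume "finite A"
  then have "finite ((\<lambda>(a, b). f a - f b) ` (A \<times> A))" by simp
  moreover have "diffset f A = (\<lambda>(a, b). f a - f b) ` (A \<times> A)" by (auto simp: diffset_def)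
  ultimately show ?thesis by simp
qed

text \<open>Freiman's lemma. The fibres of \<open>f\<close> are allowed to be non-trivial because of torsion; the
  induction removes the top fibre.\<close>

lemma freiman_dim:
  fixes f :: "'a::field \<Rightarrow> real"
  assumes "finite A" "A \<noteq> {}" "0 \<notin> A" "\<And>a b. a \<in> A \<Longrightarrow> b \<in> A \<Longrightarrow> f (a * b) = f a + f b"
  shows "(rv.dim (diffset f A) + 1) * card A \<le> 2 * card (prodset A)"
  using assms
proof (induction A rule: finite_psubset_induct)
  case (psubset A)
  note hom = psubset.prems(3)
  define v where "v = Max (f ` A)"
  define Fv where "Fv = {a \<in> A. f a = v}"
  define B where "B = A - Fv"
  have v: "v \<in> f ` A" "\<And>a. a \<in> A \<Longrightarrow> f a \<le> v"
    unfolding v_def using psubset by auto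
  then obtain a0 where a0: "a0 \<in> A" "f a0 = v" by blast
  have a0F: "a0 \<in> Fv" using a0 by (auto simp: Fv_def)
  have finP: "finite (prodset A)" using psubset by simp
  have fin: "finite A" "finite B" "finite Fv" using psubset by (auto simp: B_def Fv_def)
  have nz: "a \<noteq> 0" if "a \<in> A" for a using that psubset by auto
  show ?case
  proof (cases "B = {}")
    case True
    then have "\<And>a. a \<in> A \<Longrightarrow> f a = v" by (auto simp: B_def Fv_def)
    then have "diffset f A \<subseteq> {0}" by (auto simp: diffset_def)
    then have "rv.dim (diffset f A) \<le> card ({} :: real set)"
      by (intro rv.dim_le_card) (auto simp: rv.span_zero)
    then have "rv.dim (diffset f A) = 0" by simp
    moreover have "card A \<le> card (prodset A)"
      by (rule card_mult_left_le[of _ a0]) (use finP a0 nz in \<open>auto intro: prodsetI\<close>)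
    ultimately show ?thesis by simp
  next
    case False
    then obtain b0 where b0: "b0 \<in> B" by blast
    define x0 where "x0 = f b0"
    have BA: "B \<subset> A" using a0F Fv_def B_def by auto
    have IH: "(rv.dim (diffset f B) + 1) * card B \<le> 2 * card (prodset B)"
      by (rule psubset.IH[OF BA False]) (use psubset.prems BA in auto)
    have lt: "f b < v" if "b \<in> B" for b using that v(2)[of b] by (auto simp: B_def Fv_def)
    define k where "k = card Fv"
    have cA: "card A = card B + k"
      unfolding k_def B_def using fin by (subst card_Diff_subset) (auto simp: Fv_def card_mono)
    define fib where "fib s = {p \<in> prodset A. f p = s}" for s
    have finfib: "finite (fib s)" for s unfolding fib_def using finP by simp
    \<comment> \<open>Fibres over sums that products in \<open>B\<close> do not attain are disjoint
      from \<open>prodset B\<close>, so they count in addition to it.\<close>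
    have new: "card (prodset B) + (\<Sum>s\<in>S. card (fib s)) \<le> card (prodset A)"
      if "finite S" "S \<inter> f ` prodset B = {}" for S
    proof -
      have "(\<Sum>s\<in>S. card (fib s)) = card (\<Union>s\<in>S. fib s)"
        by (rule card_UN_disjoint[symmetric]) (use that finfib in \<open>auto simp: fib_def\<close>)
      moreover have "prodset B \<inter> (\<Union>s\<in>S. fib s) = {}" using that(2) by (auto simp: fib_def)
      ultimately have "card (prodset B) + (\<Sum>s\<in>S. card (fib s)) = card (prodset B \<union> (\<Union>s\<in>S. fib s))"
        using fin that finfib by (subst card_Un_disjoint) auto
      also have "\<dots> \<le> card (prodset A)"
        by (rule card_mono[OF finP]) (use BA in \<open>auto simp: fib_def prodset_def\<close>)
      finally show ?thesis .
    qed
    have fibk: "k \<le> card (fib (v + f a))" if "a \<in> A" for a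
      unfolding k_def
      by (rule card_mult_left_le[of _ a])
        (use that nz finfib in \<open>auto simp: fib_def Fv_def mult.commute[of a] hom intro: prodsetI\<close>)
    have fprod: "\<exists>b b'. b \<in> B \<and> b' \<in> B \<and> s = f b + f b'" if s: "s \<in> f ` prodset B" for s
    proof -
      obtain b b' where "b \<in> B" "b' \<in> B" "s = f (b * b')" using s by (auto simp: prodset_def)
      then show ?thesis using hom[of b b'] BA by blast
    qed
    have top: "2 * v \<notin> f ` prodset B"
    proof
      assume "2 * v \<in> f ` prodset B"
      from fprod[OF this] obtain b b' where "b \<in> B" "b' \<in> B" "2 * v = f b + f b'" by blast
      then show False using lt[of b] lt[of b'] by simp
    qed
    have ftop: "k \<le> card (fib (2 * v))" using fibk[OF a0(1)] a0(2) by simp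
    let ?dA = "rv.dim (diffset f A)" and ?dB = "rv.dim (diffset f B)"
    show ?thesis
    proof (cases "v - x0 \<in> rv.span (diffset f B)")
      case True
      \<comment> \<open>The dimension does not grow. Relative to the top value, \<open>B\<close>
        lies on the negative side, and the generators \<open>E\<close> of its cone provide new sums
        \<open>2 * v + e\<close>: such a sum comes from two values of \<open>B\<close> only if
        \<open>e\<close> is decomposable. As \<open>E\<close> spans, it has at least
        \<open>?dA\<close> elements.\<close>
      define Y where "Y = (\<lambda>b. f b - v) ` B"
      have Y: "finite Y" "\<And>y. y \<in> Y \<Longrightarrow> y < 0" using fin lt by (auto simp: Y_def)
      obtain E where E: "E \<subseteq> Y" "Y \<subseteq> rcone E"
        and prim: "\<And>e x y. e \<in> E \<Longrightarrow> x \<in> Y \<Longrightarrow> y \<in> Y \<Longrightarrow> x + y \<noteq> e"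
        using exists_primitive_generators[OF Y] by metis
      have finE: "finite E" using E(1) Y(1) finite_subset by blast
      have YE: "Y \<subseteq> rv.span E" using E(2) rcone_span by blast
      have in_span: "f a - v \<in> rv.span E" if "a \<in> A" for a
      proof (cases "a \<in> B")
        case True then show ?thesis using YE by (auto simp: Y_def)
      next
        case False then show ?thesis using that by (auto simp: B_def Fv_def rv.span_zero)
      qed
      have "diffset f A \<subseteq> rv.span E"
      proof
        fix x assume "x \<in> diffset f A"
        then obtain a b where ab: "a \<in> A" "b \<in> A" "x = f a - f b" by (auto simp: diffset_def)
        have "(f a - v) - (f b - v) \<in> rv.span E" by (rule rv.span_diff) (use in_span ab in auto)
        then show "x \<in> rv.span E" using ab by simp
      qed
      then have dE: "?dA \<le> card E" using finE by (rule rv.dim_le_card)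
      have spB: "f a - x0 \<in> rv.span (diffset f B)" if "a \<in> A" for a
      proof (cases "a \<in> B")
        case True
        then show ?thesis using b0 by (auto simp: x0_def diffset_def intro!: rv.span_base)
      next
        case False
        then have "f a = v" using that by (auto simp: B_def Fv_def)
        then show ?thesis using \<open>v - x0 \<in> rv.span (diffset f B)\<close> by simp
      qed
      have "diffset f A \<subseteq> rv.span (diffset f B)"
      proof
        fix x assume "x \<in> diffset f A"
        then obtain a b where ab: "a \<in> A" "b \<in> A" "x = f a - f b" by (auto simp: diffset_def)
        have "(f a - x0) - (f b - x0) \<in> rv.span (diffset f B)" by (rule rv.span_diff) (use spB ab in auto)
        then show "x \<in> rv.span (diffset f B)" using ab by simp
      qed
      then have dAB: "?dA \<le> ?dB" using finite_diffset[OF fin(2)] by (intro rv_dim_mono) auto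
      define S where "S = insert (2 * v) ((\<lambda>e. 2 * v + e) ` E)"
      have "2 * v \<notin> (\<lambda>e. 2 * v + e) ` E" using Y(2) E(1) by force
      then have cS: "card S = card E + 1" unfolding S_def using finE
        by (simp add: card_image inj_on_def)
      have disj: "S \<inter> f ` prodset B = {}"
      proof -
        have "2 * v + e \<notin> f ` prodset B" if "e \<in> E" for e
        proof
          assume "2 * v + e \<in> f ` prodset B"
          from fprod[OF this] obtain b b' where "b \<in> B" "b' \<in> B" "2 * v + e = f b + f b'" by blast
          then show False using prim[OF that, of "f b - v" "f b' - v"] by (auto simp: Y_def)
        qed
        then show ?thesis using top by (auto simp: S_def)
      qed
      have kS: "k \<le> card (fib s)" if s: "s \<in> S" for s
      proof (cases "s = 2 * v")
        case True then show ?thesis using ftop by simp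
      next
        case False
        then obtain e where "e \<in> E" "s = 2 * v + e" using s by (auto simp: S_def)
        then obtain b where "b \<in> B" "s = v + f b" using E(1) by (auto simp: Y_def)
        then show ?thesis using fibk[of b] BA by auto
      qed
      have "card S * k \<le> (\<Sum>s\<in>S. card (fib s))"
        using sum_bounded_below[of S k "\<lambda>s. card (fib s)"] kS by simp
      then have "card (prodset B) + (card E + 1) * k \<le> card (prodset A)"
        using new[OF _ disj] finE cS by (simp add: S_def)
      moreover have "(?dA + 1) * k \<le> (card E + 1) * k" using dE by (intro mult_right_mono) auto
      moreover have "(?dA + 1) * card B \<le> (?dB + 1) * card B" using dAB by (intro mult_right_mono) auto
      ultimately show ?thesis using IH unfolding cA distrib_left by linarith
    next
      case False
      \<comment> \<open>The dimension may grow by one, but now every sum \<open>v + x\<close> with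
        \<open>x\<close> in \<open>X\<close> is new, because \<open>v - x0\<close> lies outside the
        span of the differences of \<open>B\<close>. Its fibre has at least \<open>k\<close>
        elements and at least as many as the fibre of \<open>x\<close>; adding both estimates gives
        the terms with \<open>k\<close> and with \<open>card B\<close>.\<close>
      define X where "X = f ` B"
      have finX: "finite X" using fin by (simp add: X_def)
      define S where "S = insert (2 * v) ((\<lambda>x. v + x) ` X)"
      have n2v: "2 * v \<notin> (\<lambda>x. v + x) ` X" using lt by (force simp: X_def)
      have disj: "S \<inter> f ` prodset B = {}"
      proof -
        have "v + f b \<notin> f ` prodset B" if "b \<in> B" for b
        proof
          assume "v + f b \<in> f ` prodset B"
          from fprod[OF this] obtain b1 b2 where bb: "b1 \<in> B" "b2 \<in> B" "v + f b = f b1 + f b2" by blast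
          have "(f b1 - f b) + (f b2 - x0) \<in> rv.span (diffset f B)"
            by (rule rv.span_add; rule rv.span_base) (use bb that b0 in \<open>auto simp: diffset_def x0_def\<close>)
          moreover have "(f b1 - f b) + (f b2 - x0) = v - x0" using bb(3) by simp
          ultimately show False using False by simp
        qed
        then show ?thesis using top by (auto simp: S_def X_def)
      qed
      have dAB: "?dA \<le> ?dB + 1"
      proof -
        obtain Bs where Bs: "Bs \<subseteq> diffset f B" "rv.independent Bs" "diffset f B \<subseteq> rv.span Bs" "card Bs = ?dB"
          using rv.basis_exists by blast
        have finBs: "finite Bs" using Bs(1) finite_diffset[OF fin(2)] finite_subset by blast
        have sp: "f a - x0 \<in> rv.span (insert (v - x0) Bs)" if "a \<in> A" for a
        proof (cases "a \<in> B")
          case True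
          then have "f a - x0 \<in> diffset f B" using b0 by (auto simp: diffset_def x0_def)
          then show ?thesis using Bs(3) rv.span_mono[of Bs "insert (v - x0) Bs"] by blast
        next
          case False
          then have "f a = v" using that by (auto simp: B_def Fv_def)
          then show ?thesis by (auto intro: rv.span_base)
        qed
        have "diffset f A \<subseteq> rv.span (insert (v - x0) Bs)"
        proof
          fix x assume "x \<in> diffset f A"
          then obtain a b where ab: "a \<in> A" "b \<in> A" "x = f a - f b" by (auto simp: diffset_def)
          have "(f a - x0) - (f b - x0) \<in> rv.span (insert (v - x0) Bs)"
            by (rule rv.span_diff) (use sp ab in auto)
          then show "x \<in> rv.span (insert (v - x0) Bs)" using ab by simp
        qed
        then have "?dA \<le> card (insert (v - x0) Bs)" using finBs by (intro rv.dim_le_card) auto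
        also have "\<dots> \<le> card Bs + 1" using finBs by (simp add: card_insert_if)
        finally show ?thesis using Bs(4) by simp
      qed
      have dX: "?dB + 1 \<le> card X"
      proof -
        let ?W = "(\<lambda>x. x - x0) ` (X - {x0})"
        have x0X: "x0 \<in> X" using b0 by (auto simp: X_def x0_def)
        have sp: "f b - x0 \<in> rv.span ?W" if "b \<in> B" for b
          using that by (cases "f b = x0") (auto simp: X_def rv.span_zero intro!: rv.span_base)
        have "diffset f B \<subseteq> rv.span ?W"
        proof
          fix x assume "x \<in> diffset f B"
          then obtain a b where ab: "a \<in> B" "b \<in> B" "x = f a - f b" by (auto simp: diffset_def)
          have "(f a - x0) - (f b - x0) \<in> rv.span ?W" by (rule rv.span_diff) (use sp ab in auto)
          then show "x \<in> rv.span ?W" using ab by simp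
        qed
        then have "?dB \<le> card ?W" using finX by (intro rv.dim_le_card) auto
        also have "\<dots> = card X - 1" using x0X finX by (subst card_image) (auto simp: inj_on_def)
        finally show ?thesis using x0X finX card_gt_0_iff[of X] by auto
      qed
      have fibx: "card {b \<in> B. f b = x} \<le> card (fib (v + x))" for x
        by (rule card_mult_left_le[of _ a0])
          (use a0 nz finfib BA in \<open>auto simp: fib_def hom intro!: prodsetI\<close>)
      have sumB: "(\<Sum>x\<in>X. card {b \<in> B. f b = x}) = card B"
        unfolding X_def using sum.image_gen[OF fin(2), of "\<lambda>_. 1::nat" f] by simp
      have fk: "k \<le> card (fib (v + x))" if "x \<in> X" for x
        using that fibk BA by (auto simp: X_def)
      have "card X * k + card B = (\<Sum>x\<in>X. k + card {b \<in> B. f b = x})"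
        by (simp add: sum.distrib sumB)
      also have "\<dots> \<le> (\<Sum>x\<in>X. 2 * card (fib (v + x)))"
        by (rule sum_mono) (use fibx fk in \<open>auto intro!: add_mono simp: mult_2\<close>)
      finally have 1: "card X * k + card B \<le> 2 * (\<Sum>x\<in>X. card (fib (v + x)))"
        by (simp add: sum_distrib_left)
      have "(\<Sum>s\<in>S. card (fib s)) = card (fib (2 * v)) + (\<Sum>x\<in>X. card (fib (v + x)))"
        unfolding S_def using finX n2v by (subst sum.insert) (auto simp: sum.reindex inj_on_def)
      with new[OF _ disj] ftop finX 1
      have 2: "2 * card (prodset B) + 2 * k + card X * k + card B \<le> 2 * card (prodset A)"
        by (simp add: S_def)
      have "(?dB + 1) * k \<le> card X * k" using dX by (intro mult_right_mono) auto
      moreover have "(?dA + 1) * (card B + k) \<le> (?dB + 2) * (card B + k)"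
        using dAB by (intro mult_right_mono) auto
      ultimately show ?thesis using IH 2 unfolding cA distrib_left distrib_right by linarith
    qed
  qed
qed

section \<open>Growth of sums and products\<close>

lemma finite_hsumset: "finite A \<Longrightarrow> finite (hsumset h A)"
proof -
  assume "finite A"
  then have "finite ((\<lambda>f. \<Sum>i<h. f i) ` ({..<h} \<rightarrow>\<^sub>E A))" by (intro finite_imageI finite_PiE) auto
  moreover have "hsumset h A \<subseteq> (\<lambda>f. \<Sum>i<h. f i) ` ({..<h} \<rightarrow>\<^sub>E A)"
  proof
    fix x assume "x \<in> hsumset h A"
    then obtain f where f: "x = (\<Sum>i<h. f i)" "\<forall>i<h. f i \<in> A" by (auto simp: hsumset_def)
    show "x \<in> (\<lambda>f. \<Sum>i<h. f i) ` ({..<h} \<rightarrow>\<^sub>E A)"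
      by (rule image_eqI[of _ _ "restrict f {..<h}"]) (use f in auto)
  qed
  ultimately show ?thesis using finite_subset by blast
qed

lemma common_denominator:
  assumes "finite Q"
  shows "\<exists>D::int. D > 0 \<and> (\<forall>q\<in>Q. \<exists>n::int. q * of_int D = (of_int n :: rat))"
  using assms
proof (induction Q rule: finite_induct)
  case empty show ?case by (rule exI[of _ 1]) auto
next
  case (insert q Q)
  then obtain D :: int where D: "D > 0" "\<And>q. q \<in> Q \<Longrightarrow> \<exists>n::int. q * of_int D = of_int n" by blast
  obtain a b where ab: "quotient_of q = (a, b)" by (cases "quotient_of q")
  have b: "b > 0" "q = of_int a / of_int b"
    using quotient_of_denom_pos[OF ab] quotient_of_div[OF ab] by auto
  show ?case
  proof (rule exI[of _ "D * b"], intro conjI ballI)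
    fix q' assume "q' \<in> insert q Q"
    then consider "q' = q" | "q' \<in> Q" by blast
    then show "\<exists>n::int. q' * of_int (D * b) = of_int n"
    proof cases
      case 1
      then show ?thesis using b by (intro exI[of _ "a * D"]) auto
    next
      case 2
      then obtain n :: int where "q' * of_int D = of_int n" using D(2) by blast
      then have "q' * of_int (D * b) = of_int (n * b)" by (simp add: mult.assoc[symmetric])
      then show ?thesis by blast
    qed
  next
    show "D * b > 0" using D b by simp
  qed
qed

text \<open>In a basis the points of \<open>Y\<close> have coordinates with a common denominator, so
  the numerators of a \<open>k\<close>-fold sum are integers of size O(k). The constant depends on
  \<open>Y\<close>, which is harmless: only the order of growth matters in
  \<open>packing\<close>.\<close>

lemma hsumset_growth:
  assumes Y: "finite Y" and W: "finite W" "Y \<subseteq> rv.span W"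
  shows "\<exists>C>0. \<forall>k\<ge>1. real (card (hsumset k Y)) \<le> C * real k ^ rv.dim W"
proof -
  obtain B where B: "B \<subseteq> W" "rv.independent B" "W \<subseteq> rv.span B" "card B = rv.dim W"
    using rv.basis_exists by blast
  have finB: "finite B" using B(1) W(1) finite_subset by blast
  have YB: "Y \<subseteq> rv.span B" using W(2) rv.span_mono[OF B(3)] rv.span_span by blast
  have "\<exists>u. y = (\<Sum>b\<in>B. rscale (u b) b)" if "y \<in> Y" for y
    using that YB rv.span_finite[OF finB] by auto
  then obtain u where u: "\<And>y. y \<in> Y \<Longrightarrow> y = (\<Sum>b\<in>B. rscale (u y b) b)" by metis
  obtain D :: int where D: "D > 0"
    "\<forall>q\<in>(\<lambda>(y, b). u y b) ` (Y \<times> B). \<exists>n::int. q * of_int D = of_int n"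
    using common_denominator[of "(\<lambda>(y, b). u y b) ` (Y \<times> B)"] Y finB by auto
  then have "\<forall>y\<in>Y. \<forall>b\<in>B. \<exists>n::int. u y b * of_int D = of_int n" by auto
  then obtain n :: "real \<Rightarrow> real \<Rightarrow> int" where n: "\<And>y b. y \<in> Y \<Longrightarrow> b \<in> B \<Longrightarrow> u y b * of_int D = of_int (n y b)"
    by metis
  define M where "M = Max (insert 0 ((\<lambda>(y, b). \<bar>n y b\<bar>) ` (Y \<times> B)))"
  have M: "M \<ge> 0" "\<And>y b. y \<in> Y \<Longrightarrow> b \<in> B \<Longrightarrow> \<bar>n y b\<bar> \<le> M"
    unfolding M_def using Y finB by (auto intro!: Max_ge)
  define C where "C = real_of_int (2 * M + 1) ^ card B"
  show ?thesis
  proof (intro exI[of _ C] conjI allI impI)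
    show "C > 0" using M by (simp add: C_def)
    fix k :: nat assume k: "k \<ge> 1"
    let ?P = "B \<rightarrow>\<^sub>E {- (int k * M)..int k * M}"
    let ?g = "\<lambda>m::real \<Rightarrow> int. \<Sum>b\<in>B. of_int (m b) / of_int D * b"
    have "hsumset k Y \<subseteq> ?g ` ?P"
    proof
      fix x assume "x \<in> hsumset k Y"
      then obtain f where f: "x = (\<Sum>i<k. f i)" "\<And>i. i < k \<Longrightarrow> f i \<in> Y" by (auto simp: hsumset_def)
      define m where "m = restrict (\<lambda>b. \<Sum>i<k. n (f i) b) B"
      have "f i = (\<Sum>b\<in>B. of_int (n (f i) b) / of_int D * b)" if "i < k" for i
      proof -
        have "of_rat (u (f i) b) = (of_int (n (f i) b) / of_int D :: real)" if "b \<in> B" for b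
        proof -
          have "u (f i) b = of_int (n (f i) b) / of_int D"
            using n[OF f(2)[OF \<open>i < k\<close>] that] D(1) by (simp add: field_simps)
          then show ?thesis by (simp add: of_rat_divide)
        qed
        then show ?thesis by (subst u[OF f(2)[OF that]]) (simp add: rscale_def)
      qed
      then have "x = (\<Sum>i<k. \<Sum>b\<in>B. of_int (n (f i) b) / of_int D * b)"
        unfolding f(1) by (intro sum.cong) auto
      also have "\<dots> = ?g m"
        by (subst sum.swap) (auto simp: m_def sum_distrib_right sum_divide_distrib intro!: sum.cong)
      finally have "x = ?g m" .
      moreover have "m \<in> ?P"
      proof -
        have "\<bar>\<Sum>i<k. n (f i) b\<bar> \<le> int k * M" if "b \<in> B" for b
        proof -
          have "\<bar>\<Sum>i<k. n (f i) b\<bar> \<le> (\<Sum>i<k. \<bar>n (f i) b\<bar>)" by (rule sum_abs)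
          also have "\<dots> \<le> (\<Sum>i<k. M)" by (rule sum_mono) (use M f that in auto)
          finally show ?thesis by simp
        qed
        then show ?thesis unfolding m_def by (fastforce simp: abs_le_iff)
      qed
      ultimately show "x \<in> ?g ` ?P" by blast
    qed
    then have "card (hsumset k Y) \<le> card ?P"
      by (intro surj_card_le[of ?P _ ?g]) (auto intro!: finite_PiE finB)
    also have "card ?P = nat (2 * int k * M + 1) ^ card B"
      using finB by (simp add: card_PiE mult_ac)
    finally have "real (card (hsumset k Y)) \<le> real (nat (2 * int k * M + 1)) ^ card B"
      by (metis of_nat_le_iff of_nat_power)
    also have "\<dots> = (2 * real k * M + 1) ^ card B" using M by simp
    also have "\<dots> \<le> ((2 * M + 1) * real k) ^ card B"
      using M k by (intro power_mono) (auto simp: algebra_simps)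
    also have "\<dots> = C * real k ^ rv.dim W" by (simp add: C_def B(4) power_mult_distrib)
    finally show "real (card (hsumset k Y)) \<le> C * real k ^ rv.dim W" .
  qed
qed

text \<open>A volume-packing bound without volumes: the role of a small ball is played by \<open>hsumset k Y\<close>,
  for a \<open>k\<close> at which the growth of the iterated sumsets is regular.\<close>

lemma packing:
  fixes \<nu> :: "real \<Rightarrow> real"
  assumes Y: "finite Y" "Y \<subseteq> H"
    and H: "0 \<in> H" "\<And>x y. x \<in> H \<Longrightarrow> y \<in> H \<Longrightarrow> x + y \<in> H" "\<And>x. x \<in> H \<Longrightarrow> - x \<in> H"
    and \<nu>: "\<And>x y. x \<in> H \<Longrightarrow> y \<in> H \<Longrightarrow> \<nu> (x + y) \<le> \<nu> x + \<nu> y" "\<And>x. x \<in> H \<Longrightarrow> \<nu> (- x) = \<nu> x"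
      "\<And>x m. x \<in> H \<Longrightarrow> \<nu> (real m * x) = real m * \<nu> x"
    and growth: "C > 0" "\<And>k. k \<ge> 1 \<Longrightarrow> real (card (hsumset k Y)) \<le> C * real k ^ d"
    and R: "\<And>y. y \<in> Y \<Longrightarrow> \<nu> y \<le> R"
    and sep: "\<And>y y'. y \<in> Y \<Longrightarrow> y' \<in> Y \<Longrightarrow> y \<noteq> y' \<Longrightarrow> \<nu> (y - y') > r"
    and \<mu>: "real \<mu> * r \<ge> 2 * R" "\<mu> \<ge> 1"
  shows "card Y \<le> 2 * (\<mu> + 1) ^ d"
proof (cases "Y = {}")
  case False
  define L where "L = \<mu> + 1"
  have fin: "finite (hsumset k Y)" for k using Y(1) by (rule finite_hsumset)
  have ne: "hsumset k Y \<noteq> {}" for k using False by (auto simp: hsumset_def)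
  \<comment> \<open>If the ratio were larger at every power of \<open>L\<close>, the sumsets would
    grow like \<open>(2 * L ^ d) ^ i\<close>, faster than \<open>C * (L ^ i) ^ d\<close> whatever
    the constant \<open>C\<close> is.\<close>
  have "\<exists>i. card (hsumset (L ^ Suc i) Y) \<le> 2 * L ^ d * card (hsumset (L ^ i) Y)"
  proof (rule ccontr)
    assume "\<not> ?thesis"
    then have big: "card (hsumset (L ^ Suc i) Y) \<ge> 2 * L ^ d * card (hsumset (L ^ i) Y)" for i
      by (meson not_le less_imp_le)
    have pw: "(2 * L ^ d) ^ i \<le> card (hsumset (L ^ i) Y)" for i
    proof (induction i)
      case 0
      have "card (hsumset 1 Y) > 0" using fin ne card_gt_0_iff by metis
      then show ?case by (simp add: Suc_leI)
    next
      case (Suc i)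
      have "(2 * L ^ d) ^ Suc i \<le> 2 * L ^ d * card (hsumset (L ^ i) Y)"
        using mult_left_mono[OF Suc, of "2 * L ^ d"] by simp
      then show ?case using big[of i] by linarith
    qed
    have "real ((2 * L ^ d) ^ i) \<le> C * real (L ^ i) ^ d" for i
    proof -
      have "L ^ i \<ge> 1" by (simp add: L_def)
      then have "real (card (hsumset (L ^ i) Y)) \<le> C * real (L ^ i) ^ d" by (rule growth(2))
      then show ?thesis using of_nat_mono[OF pw[of i], where ?'a = real] by linarith
    qed
    then have "2 ^ i * (real L ^ d) ^ i \<le> C * (real L ^ d) ^ i" for i
      by (simp add: power_mult_distrib power_mult[symmetric] mult.commute[of d])
    moreover have "(real L ^ d) ^ i > 0" for i by (simp add: L_def)
    ultimately have "2 ^ i \<le> C" for i :: nat by (metis mult_le_cancel_right_pos)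
    moreover obtain i :: nat where "C < 2 ^ i" using real_arch_pow[of 2 C] by auto
    ultimately show False by (meson not_le)
  qed
  then obtain i where i: "card (hsumset (L ^ Suc i) Y) \<le> 2 * L ^ d * card (hsumset (L ^ i) Y)" by blast
  define k where "k = L ^ i"
  have k: "k > 0" by (simp add: k_def L_def)
  \<comment> \<open>The translates of \<open>hsumset k Y\<close> by \<open>\<mu> * k * y\<close> are
    disjoint: their centres are at distance more than \<open>\<mu> * k * r\<close>, which is at
    least twice the radius \<open>k * R\<close>. They all lie in \<open>hsumset (L * k) Y\<close>
    because \<open>L = \<mu> + 1\<close>.\<close>
  define \<Phi> where "\<Phi> = (\<lambda>(y, w). real (\<mu> * k) * y + w)"
  have sumH: "(\<And>i. i < l \<Longrightarrow> f i \<in> Y) \<Longrightarrow> (\<Sum>i<l. f i) \<in> H \<and> \<nu> (\<Sum>i<l. f i) \<le> real l * R" for f and l :: nat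
  proof (induction l)
    case 0
    have "\<nu> 0 = 0" using \<nu>(3)[OF H(1), of 0] by simp
    then show ?case using H(1) by simp
  next
    case (Suc l)
    then have IH: "(\<Sum>i<l. f i) \<in> H" "\<nu> (\<Sum>i<l. f i) \<le> real l * R" by auto
    have fl: "f l \<in> H" "\<nu> (f l) \<le> R" using Suc.prems Y(2) R by auto
    have "\<nu> ((\<Sum>i<l. f i) + f l) \<le> real l * R + R" using \<nu>(1)[OF IH(1) fl(1)] IH(2) fl(2) by linarith
    then show ?case using H(2)[OF IH(1) fl(1)] by (simp add: algebra_simps)
  qed
  have wH: "w \<in> H \<and> \<nu> w \<le> real k * R" if "w \<in> hsumset k Y" for w
    using that sumH unfolding hsumset_def by blast
  have "inj_on \<Phi> (Y \<times> hsumset k Y)"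
  proof (rule inj_onI, clarify)
    fix y w y' w' assume y: "y \<in> Y" "y' \<in> Y" and w: "w \<in> hsumset k Y" "w' \<in> hsumset k Y"
      and "\<Phi> (y, w) = \<Phi> (y', w')"
    then have eq: "real (\<mu> * k) * (y - y') = w' - w" by (simp add: \<Phi>_def algebra_simps)
    have yH: "y - y' \<in> H" using H(2)[of y "- y'"] H(3) y Y(2) by auto
    have "\<nu> (w' - w) \<le> 2 * (real k * R)"
      using \<nu>(1)[of w' "- w"] \<nu>(2)[of w] wH[OF w(1)] wH[OF w(2)] H(3)[of w] by auto
    then have "real (\<mu> * k) * \<nu> (y - y') \<le> 2 * (real k * R)" using \<nu>(3)[OF yH, of "\<mu> * k"] eq by simp
    then have "real k * (real \<mu> * \<nu> (y - y')) \<le> real k * (2 * R)" by (simp add: mult_ac)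
    then have "real \<mu> * \<nu> (y - y') \<le> 2 * R" using k by simp
    moreover have "real \<mu> * r < real \<mu> * \<nu> (y - y')" if "y \<noteq> y'" using sep[OF y that] \<mu>(2) by simp
    ultimately have "y = y'" using \<mu>(1) by (cases "y = y'") auto
    then show "y = y' \<and> w = w'" using eq by simp
  qed
  then have "card (Y \<times> hsumset k Y) = card (\<Phi> ` (Y \<times> hsumset k Y))" by (rule card_image[symmetric])
  also have "\<dots> \<le> card (hsumset (L * k) Y)"
  proof (rule card_mono[OF fin], clarify)
    fix y w assume y: "y \<in> Y" and w: "w \<in> hsumset k Y"
    then obtain f where f: "w = (\<Sum>i<k. f i)" "\<forall>i<k. f i \<in> Y" by (auto simp: hsumset_def)
    define g where "g i = (if i < k then f i else y)" for i
    have "(\<Sum>i<L * k. g i) = (\<Sum>i<k. g i) + (\<Sum>i=k..<L * k. g i)"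
    proof -
      have "{..<L * k} = {..<k} \<union> {k..<L * k}" by (auto simp: L_def)
      then show ?thesis by (simp add: sum.union_disjoint ivl_disj_int)
    qed
    also have "(\<Sum>i<k. g i) = w" unfolding f(1) by (intro sum.cong) (auto simp: g_def)
    also have "(\<Sum>i=k..<L * k. g i) = (\<Sum>i=k..<L * k. y)" by (intro sum.cong) (auto simp: g_def)
    also have "\<dots> = real (\<mu> * k) * y" by (simp add: L_def)
    finally have "\<Phi> (y, w) = (\<Sum>i<L * k. g i)" by (simp add: \<Phi>_def)
    moreover have "\<forall>i<L * k. g i \<in> Y" using f y by (auto simp: g_def)
    ultimately show "\<Phi> (y, w) \<in> hsumset (L * k) Y" by (auto simp: hsumset_def)
  qed
  also have "\<dots> \<le> 2 * L ^ d * card (hsumset k Y)" using i by (simp add: k_def)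
  finally have "card Y * card (hsumset k Y) \<le> 2 * L ^ d * card (hsumset k Y)"
    by (simp add: card_cartesian_product)
  moreover have "card (hsumset k Y) > 0" using fin ne card_gt_0_iff by metis
  ultimately show ?thesis by (simp add: L_def)
qed simp

section \<open>Plunnecke's inequality for product sets\<close>

definition mprod :: "'a::times set \<Rightarrow> 'a set \<Rightarrow> 'a set" where
  "mprod X Y = (\<lambda>(x, y). x * y) ` (X \<times> Y)"

lemma finite_mprod [simp]: "finite X \<Longrightarrow> finite Y \<Longrightarrow> finite (mprod X Y)"
  by (simp add: mprod_def)

lemma mprodI: "x \<in> X \<Longrightarrow> y \<in> Y \<Longrightarrow> x * y \<in> mprod X Y"
  by (auto simp: mprod_def)

lemma mprod_assoc: "mprod (mprod X Y) (Z :: 'a::semigroup_mult set) = mprod X (mprod Y Z)"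
  by (force simp: mprod_def mult.assoc image_iff)

lemma mprod_commute: "mprod X (Y :: 'a::ab_semigroup_mult set) = mprod Y X"
  by (force simp: mprod_def mult.commute image_iff)

lemma prodset_eq_mprod: "prodset A = mprod A A"
  by (auto simp: prodset_def mprod_def)

primrec mpow :: "'a::comm_monoid_mult set \<Rightarrow> nat \<Rightarrow> 'a set" where
  "mpow A 0 = {1}"
| "mpow A (Suc k) = mprod (mpow A k) A"

lemma finite_mpow [simp]: "finite A \<Longrightarrow> finite (mpow A k)"
  by (induction k) auto

lemma mpow_add: "x \<in> mpow A m \<Longrightarrow> y \<in> mpow A n \<Longrightarrow> x * y \<in> mpow A (m + n)"
proof (induction n arbitrary: y)
  case (Suc n)
  then obtain y' a where "y = y' * a" "y' \<in> mpow A n" "a \<in> A" by (auto simp: mprod_def)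
  then show ?case using Suc.IH[of y'] Suc.prems(1) by (auto simp: mprod_def mult.assoc[symmetric])
qed simp

lemma card_scaled: "c \<noteq> (0::'a::field) \<Longrightarrow> card ((*) c ` X) = card X"
  by (rule card_image) (auto simp: inj_on_def)

text \<open>Induction on \<open>C\<close>. When \<open>c\<close> is added, \<open>Xs\<close>
  consists of the points of \<open>X\<close> all of whose products with \<open>c\<close> and
  \<open>A\<close> occur already. The new products avoid \<open>c\<close> times
  \<open>mprod Xs A\<close>, and the minimality of \<open>K\<close>, applied to \<open>Xs\<close>,
  bounds from below how much this saves.\<close>

lemma petridis:
  fixes A :: "'a::field set"
  assumes A: "finite A" "0 \<notin> A"
    and X: "X \<subseteq> A" "X \<noteq> {}"
    and min: "\<And>X'. X' \<subseteq> X \<Longrightarrow> real (card (mprod X' A)) \<ge> K * real (card X')"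
    and K: "real (card (mprod X A)) = K * real (card X)"
    and C: "finite C" "0 \<notin> C"
  shows "real (card (mprod (mprod C X) A)) \<le> K * real (card (mprod C X))"
  using C
proof (induction C rule: finite_induct)
  case empty
  then show ?case by (simp add: mprod_def)
next
  case (insert c C)
  have finX: "finite X" using X A finite_subset by blast
  have K0: "K \<ge> 0"
  proof (rule ccontr)
    assume "\<not> K \<ge> 0"
    then have "K * real (card X) < 0" using X finX by (simp add: mult_neg_pos card_gt_0_iff)
    then show False using K by linarith
  qed
  have c0: "c \<noteq> 0" using insert by auto
  define P where "P = mprod (mprod C X) A"
  have finP: "finite P" using insert finX A by (simp add: P_def)
  define Xs where "Xs = {x \<in> X. \<forall>a\<in>A. c * x * a \<in> P}"
  have XsX: "Xs \<subseteq> X" by (auto simp: Xs_def)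
  have finm: "finite (mprod X A)" "finite (mprod Xs A)"
    using finX A finite_subset[OF XsX] by auto
  have sub: "mprod Xs A \<subseteq> mprod X A" using XsX by (auto simp: mprod_def)
  have "mprod (mprod (insert c C) X) A \<subseteq> P \<union> (*) c ` (mprod X A - mprod Xs A)"
  proof
    fix z assume "z \<in> mprod (mprod (insert c C) X) A"
    then obtain c' x a where z: "z = c' * x * a" "c' \<in> insert c C" "x \<in> X" "a \<in> A"
      by (auto simp: mprod_def)
    show "z \<in> P \<union> (*) c ` (mprod X A - mprod Xs A)"
    proof (cases "z \<in> P")
      case False
      then have "c' = c" using z by (auto simp: P_def mprod_def)
      moreover have "x * a \<notin> mprod Xs A"
      proof
        assume "x * a \<in> mprod Xs A"
        then obtain x' a' where "x * a = x' * a'" "x' \<in> Xs" "a' \<in> A" by (auto simp: mprod_def)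
        then have "z \<in> P" using z(1) \<open>c' = c\<close> by (auto simp: Xs_def mult.assoc)
        then show False using False by simp
      qed
      ultimately show ?thesis using z by (auto simp: mult.assoc intro: mprodI)
    qed simp
  qed
  then have "card (mprod (mprod (insert c C) X) A) \<le> card (P \<union> (*) c ` (mprod X A - mprod Xs A))"
    using finP finm by (intro card_mono) auto
  also have "\<dots> \<le> card P + card ((*) c ` (mprod X A - mprod Xs A))" by (rule card_Un_le)
  also have "card ((*) c ` (mprod X A - mprod Xs A)) = card (mprod X A) - card (mprod Xs A)"
    using c0 finm sub by (simp add: card_scaled card_Diff_subset)
  finally have 1: "real (card (mprod (mprod (insert c C) X) A))
      \<le> real (card P) + real (card (mprod X A)) - real (card (mprod Xs A))"
    using card_mono[OF finm(1) sub] by linarith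
  have "card (mprod C X) + card ((*) c ` (X - Xs)) = card (mprod C X \<union> (*) c ` (X - Xs))"
  proof (rule card_Un_disjoint[symmetric])
    show "mprod C X \<inter> (*) c ` (X - Xs) = {}"
    proof (rule ccontr)
      assume "\<not> ?thesis"
      then obtain x where x: "x \<in> X" "x \<notin> Xs" "c * x \<in> mprod C X" by auto
      then have "c * x * a \<in> P" if "a \<in> A" for a using that by (auto simp: P_def intro: mprodI)
      then show False using x by (auto simp: Xs_def)
    qed
  qed (use insert finX in auto)
  also have "\<dots> \<le> card (mprod (insert c C) X)"
    using insert finX by (intro card_mono) (auto simp: mprod_def)
  finally have "card (mprod C X) + card X \<le> card (mprod (insert c C) X) + card Xs"
    using c0 XsX finX finite_subset[OF XsX] by (simp add: card_scaled card_Diff_subset)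
  then have "real (card (mprod C X)) + real (card X) \<le> real (card (mprod (insert c C) X)) + real (card Xs)"
    by linarith
  then have "K * (real (card (mprod C X)) + real (card X)) \<le> K * (real (card (mprod (insert c C) X)) + real (card Xs))"
    using K0 by (rule mult_left_mono)
  moreover have "real (card P) \<le> K * real (card (mprod C X))" using insert by (simp add: P_def)
  moreover have "real (card (mprod Xs A)) \<ge> K * real (card Xs)" by (rule min[OF XsX])
  ultimately show ?case using 1 K by (simp add: algebra_simps)
qed

text \<open>Plunnecke's inequality in the form needed below: Petridis' set \<open>X\<close> of minimal expansion
  combined with Ruzsa's triangle inequality.\<close>

lemma plunnecke_quotient:
  fixes A :: "'a::field set"
  assumes A: "finite A" "A \<noteq> {}" "0 \<notin> A"
    and dbl: "real (card (prodset A)) \<le> \<alpha> * real (card A)"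
  shows "real (card {b / c | b c. b \<in> mpow A k \<and> c \<in> mpow A k}) \<le> \<alpha> ^ (2 * k) * real (card A)"
proof -
  define \<F> where "\<F> = {X. X \<subseteq> A \<and> X \<noteq> {}}"
  define rt where "rt X = real (card (mprod X A)) / real (card X)" for X
  have "finite \<F>" using A by (auto simp: \<F>_def)
  moreover have "A \<in> \<F>" using A by (auto simp: \<F>_def)
  ultimately have "\<exists>X\<in>\<F>. \<forall>X'\<in>\<F>. rt X \<le> rt X'"
    using ex_min_if_finite[of "rt ` \<F>"] by force
  then obtain X where X: "X \<subseteq> A" "X \<noteq> {}" and Xmin: "\<And>X'. X' \<subseteq> A \<Longrightarrow> X' \<noteq> {} \<Longrightarrow> rt X \<le> rt X'"
    unfolding \<F>_def by blast
  define K where "K = rt X"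
  have finX: "finite X" using X A finite_subset by blast
  have cX: "card X > 0" using finX X by (simp add: card_gt_0_iff)
  have cA: "card A > 0" using A by (simp add: card_gt_0_iff)
  have "K \<le> rt A" unfolding K_def using Xmin A by blast
  also have "\<dots> \<le> \<alpha>" using dbl cA by (simp add: rt_def prodset_eq_mprod[symmetric] field_simps)
  finally have K\<alpha>: "K \<le> \<alpha>" .
  have K0: "K \<ge> 0" by (simp add: K_def rt_def)
  have pow: "0 \<notin> mpow A k" for k using A(3) by (induction k) (auto simp: mprod_def)
  have pl: "real (card (mprod (mpow A k) X)) \<le> K ^ k * real (card X)" for k
  proof (induction k)
    case 0
    have "mprod {1} X = X" by (force simp: mprod_def)
    then show ?case by simp
  next
    case (Suc k)
    have "mprod (mpow A (Suc k)) X = mprod (mprod (mpow A k) X) A"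
      by (simp add: mprod_assoc mprod_commute[of A X])
    moreover have "real (card (mprod (mprod (mpow A k) X) A)) \<le> K * real (card (mprod (mpow A k) X))"
    proof (rule petridis[OF A(1,3) X])
      show "real (card (mprod X A)) = K * real (card X)" using cX by (simp add: K_def rt_def)
      fix X' assume X': "X' \<subseteq> X"
      show "K * real (card X') \<le> real (card (mprod X' A))"
      proof (cases "X' = {}")
        case False
        then have "card X' > 0" using X' finX finite_subset card_gt_0_iff by blast
        moreover have "K \<le> rt X'" unfolding K_def using Xmin False X' X by blast
        ultimately show ?thesis by (simp add: rt_def field_simps)
      qed simp
    qed (use A pow in auto)
    moreover have "K * real (card (mprod (mpow A k) X)) \<le> K * (K ^ k * real (card X))"
      using Suc K0 by (rule mult_left_mono)
    ultimately show ?case by (simp add: mult.assoc)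
  qed
  define Q where "Q = {b / c | b c. b \<in> mpow A k \<and> c \<in> mpow A k}"
  have "\<forall>g\<in>Q. \<exists>b c. b \<in> mpow A k \<and> c \<in> mpow A k \<and> g = b / c" by (auto simp: Q_def)
  then obtain b c where bc: "\<And>g. g \<in> Q \<Longrightarrow> b g \<in> mpow A k \<and> c g \<in> mpow A k \<and> g = b g / c g"
    by metis
  let ?S = "mprod (mpow A k) X"
  have finS: "finite ?S" using A finX by simp
  \<comment> \<open>Ruzsa's triangle argument: the quotient of the two products recovers
    \<open>g\<close>, and then either of them recovers \<open>x\<close>.\<close>
  have "card (X \<times> Q) \<le> card (?S \<times> ?S)"
  proof (rule card_inj_on_le[where f = "\<lambda>(x, g). (b g * x, c g * x)"])
    show "inj_on (\<lambda>(x, g). (b g * x, c g * x)) (X \<times> Q)"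
    proof (rule inj_onI, clarify)
      fix x g x' g' assume g: "x \<in> X" "g \<in> Q" "x' \<in> X" "g' \<in> Q"
        and eq: "b g * x = b g' * x'" "c g * x = c g' * x'"
      have nz: "x \<noteq> 0" "x' \<noteq> 0" "c g \<noteq> 0" "c g' \<noteq> 0"
        using g X A(3) bc[OF g(2)] bc[OF g(4)] pow[of k] by auto
      have "b g / c g = (b g * x) / (c g * x)" using nz by simp
      also have "\<dots> = b g' / c g'" unfolding eq using nz by simp
      finally have "g = g'" using bc g by metis
      then show "x = x' \<and> g = g'" using eq nz by simp
    qed
    show "(\<lambda>(x, g). (b g * x, c g * x)) ` (X \<times> Q) \<subseteq> ?S \<times> ?S"
      using bc by (auto intro!: mprodI)
  qed (use finS in simp)
  then have "card X * card Q \<le> card ?S * card ?S" by (simp add: card_cartesian_product)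
  then have "real (card X) * real (card Q) \<le> real (card ?S) * real (card ?S)"
    by (metis of_nat_le_iff of_nat_mult)
  also have "\<dots> \<le> (K ^ k * real (card X)) * (K ^ k * real (card X))"
    by (intro mult_mono pl) (use K0 in auto)
  finally have "real (card X) * real (card Q) \<le> real (card X) * (K ^ (2 * k) * real (card X))"
    by (simp add: mult_ac power_add mult_2_right)
  then have "real (card Q) \<le> K ^ (2 * k) * real (card X)" using cX by simp
  also have "\<dots> \<le> \<alpha> ^ (2 * k) * real (card A)"
    using K0 K\<alpha> X(1) A(1) by (intro mult_mono power_mono) (auto intro: card_mono)
  finally show ?thesis unfolding Q_def .
qed

text \<open>The products of \<open>j\<close> of the \<open>g i\<close> are quotients of elements of
  \<open>mpow A (l * j)\<close>, of which Plunnecke's inequality allows few. This turns a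
  multiplicatively independent family into a bound on its size.\<close>

lemma binomial_le_of_distinct_products:
  fixes A :: "'a::field set" and g :: "'i \<Rightarrow> 'a"
  assumes A: "finite A" "A \<noteq> {}" "0 \<notin> A"
    and dbl: "real (card (prodset A)) \<le> \<alpha> * real (card A)"
    and I: "finite I" and g: "\<And>i. i \<in> I \<Longrightarrow> \<exists>b c. b \<in> mpow A l \<and> c \<in> mpow A l \<and> g i = b / c"
    and inj: "inj_on (\<lambda>T. \<Prod>i\<in>T. g i) {T. T \<subseteq> I \<and> card T = j}"
  shows "real (card I choose j) \<le> \<alpha> ^ (2 * (l * j)) * real (card A)"
proof -
  let ?Q = "\<lambda>k. {b / c | b c. b \<in> mpow A k \<and> c \<in> mpow A k}"
  have finQ: "finite (?Q k)" for k
  proof -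
    have "?Q k = (\<lambda>(b, c). b / c) ` (mpow A k \<times> mpow A k)" by auto
    then show ?thesis using A by simp
  qed
  have in_Q: "finite T \<Longrightarrow> T \<subseteq> I \<Longrightarrow> (\<Prod>i\<in>T. g i) \<in> ?Q (l * card T)" for T
  proof (induction T rule: finite_induct)
    case empty
    then show ?case by auto
  next
    case (insert i T)
    then obtain b c where bc: "b \<in> mpow A (l * card T)" "c \<in> mpow A (l * card T)" "(\<Prod>i\<in>T. g i) = b / c" by auto
    obtain b' c' where bc': "b' \<in> mpow A l" "c' \<in> mpow A l" "g i = b' / c'" using g insert by blast
    have "(\<Prod>i\<in>insert i T. g i) = (b' * b) / (c' * c)" using insert bc bc' by simp
    moreover have "b' * b \<in> mpow A (l * card (insert i T))" "c' * c \<in> mpow A (l * card (insert i T))"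
      using mpow_add[OF bc'(1) bc(1)] mpow_add[OF bc'(2) bc(2)] insert by simp_all
    ultimately show ?case by blast
  qed
  have "(card I choose j) = card {T. T \<subseteq> I \<and> card T = j}" using n_subsets[OF I] by simp
  also have "\<dots> \<le> card (?Q (l * j))"
  proof (rule card_inj_on_le[OF inj _ finQ], clarify)
    fix T assume "T \<subseteq> I" "j = card T"
    then show "\<exists>b c. (\<Prod>i\<in>T. g i) = b / c \<and> b \<in> mpow A (l * card T) \<and> c \<in> mpow A (l * card T)"
      using in_Q[of T] I finite_subset by blast
  qed
  finally have "real (card I choose j) \<le> real (card (?Q (l * j)))" by simp
  also have "\<dots> \<le> \<alpha> ^ (2 * (l * j)) * real (card A)" by (rule plunnecke_quotient[OF A dbl])
  finally show ?thesis .
qed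

section \<open>Places and raising vanishing sums to prime powers\<close>

text \<open>The places above infinity and above finitely many primes of a number field \<open>F\<close> of degree
  \<open>deg\<close>, each repeated according to its local degree. Outside of \<open>V\<close> the elements of \<open>R\<close> are
  integral, which is why the product formula becomes an inequality on \<open>R\<close>.\<close>

locale places =
  fixes F R :: "complex set" and V Vinf :: "nat set" and deg :: nat
    and av :: "nat \<Rightarrow> complex \<Rightarrow> real" and P :: "nat set" and Vp :: "nat \<Rightarrow> nat set"
  assumes F_1: "1 \<in> F" and F_add: "x \<in> F \<Longrightarrow> y \<in> F \<Longrightarrow> x + y \<in> F" and F_minus: "x \<in> F \<Longrightarrow> - x \<in> F"
    and F_mult: "x \<in> F \<Longrightarrow> y \<in> F \<Longrightarrow> x * y \<in> F" and F_inv: "x \<in> F \<Longrightarrow> inverse x \<in> F"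
    and F_countable: "countable F"
    and R_F: "R \<subseteq> F" and R_1: "1 \<in> R" and R_add: "x \<in> R \<Longrightarrow> y \<in> R \<Longrightarrow> x + y \<in> R"
    and R_minus: "x \<in> R \<Longrightarrow> - x \<in> R" and R_mult: "x \<in> R \<Longrightarrow> y \<in> R \<Longrightarrow> x * y \<in> R"
    and V: "finite V" "Vinf \<subseteq> V" "card Vinf = deg" "deg > 0"
    and av_0: "v \<in> V \<Longrightarrow> av v 0 = 0"
    and av_pos: "v \<in> V \<Longrightarrow> x \<in> F \<Longrightarrow> x \<noteq> 0 \<Longrightarrow> av v x > 0"
    and av_mult: "v \<in> V \<Longrightarrow> x \<in> F \<Longrightarrow> y \<in> F \<Longrightarrow> av v (x * y) = av v x * av v y"
    and av_inf: "v \<in> Vinf \<Longrightarrow> x \<in> F \<Longrightarrow> y \<in> F \<Longrightarrow> av v (x + y) \<le> av v x + av v y"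
    and av_fin: "v \<in> V - Vinf \<Longrightarrow> x \<in> F \<Longrightarrow> y \<in> F \<Longrightarrow> av v (x + y) \<le> max (av v x) (av v y)"
    and Vp: "p \<in> P \<Longrightarrow> prime p" "p \<in> P \<Longrightarrow> Vp p \<subseteq> V - Vinf" "p \<in> P \<Longrightarrow> card (Vp p) = deg"
    and av_p: "p \<in> P \<Longrightarrow> v \<in> Vp p \<Longrightarrow> av v (of_nat p) = 1 / real p"
    and av_R: "y \<in> R \<Longrightarrow> y \<noteq> 0 \<Longrightarrow> (\<Prod>v\<in>V. av v y) \<ge> 1"
begin

lemma F_0: "0 \<in> F" using F_add[OF F_1 F_minus[OF F_1]] by simp

lemma R_0: "0 \<in> R" using R_add[OF R_1 R_minus[OF R_1]] by simp

lemma F_diff: "x \<in> F \<Longrightarrow> y \<in> F \<Longrightarrow> x - y \<in> F"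
  using F_add[of x "- y"] F_minus by simp

lemma F_div: "x \<in> F \<Longrightarrow> y \<in> F \<Longrightarrow> x / y \<in> F"
  using F_mult[of x "inverse y"] F_inv by (simp add: divide_inverse)

lemma F_sum: "(\<And>i. i \<in> A \<Longrightarrow> f i \<in> F) \<Longrightarrow> sum f A \<in> F"
  by (induction A rule: infinite_finite_induct) (auto intro: F_0 F_add)

lemma F_prod: "(\<And>i. i \<in> A \<Longrightarrow> f i \<in> F) \<Longrightarrow> prod f A \<in> F"
  by (induction A rule: infinite_finite_induct) (auto intro: F_1 F_mult)

lemma F_power: "x \<in> F \<Longrightarrow> x ^ n \<in> F"
  by (induction n) (auto intro: F_1 F_mult)

lemma F_of_nat: "of_nat n \<in> F"
  by (induction n) (auto intro: F_0 F_1 F_add)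

lemma R_sum: "(\<And>i. i \<in> A \<Longrightarrow> f i \<in> R) \<Longrightarrow> sum f A \<in> R"
  by (induction A rule: infinite_finite_induct) (auto intro: R_0 R_add)

lemma R_prod: "(\<And>i. i \<in> A \<Longrightarrow> f i \<in> R) \<Longrightarrow> prod f A \<in> R"
  by (induction A rule: infinite_finite_induct) (auto intro: R_1 R_mult)

lemma R_power: "x \<in> R \<Longrightarrow> x ^ n \<in> R"
  by (induction n) (auto intro: R_1 R_mult)

lemma R_signed: "\<bar>e\<bar> = 1 \<Longrightarrow> x \<in> R \<Longrightarrow> of_int e * x \<in> R"
  by (auto simp: abs_if R_minus split: if_splits)

lemma av_ge0: "v \<in> V \<Longrightarrow> x \<in> F \<Longrightarrow> av v x \<ge> 0"
  by (cases "x = 0") (auto simp: av_0 less_imp_le[OF av_pos])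

lemma av_1: "v \<in> V \<Longrightarrow> av v 1 = 1"
  using av_mult[of v 1 1] av_pos[of v 1] F_1 by auto

lemma av_minus1: "v \<in> V \<Longrightarrow> av v (- 1) = 1"
proof -
  assume v: "v \<in> V"
  have m: "- 1 \<in> F" using F_minus F_1 by blast
  have "av v (- 1) * av v (- 1) = 1" using av_mult[OF v m m] av_1[OF v] by simp
  then have "av v (- 1) ^ 2 = 1 ^ 2" by (simp add: power2_eq_square)
  then show ?thesis by (rule power2_eq_imp_eq) (use av_ge0[OF v m] in auto)
qed

lemma av_minus: "v \<in> V \<Longrightarrow> x \<in> F \<Longrightarrow> av v (- x) = av v x"
  using av_mult[of v "- 1" x] av_minus1[of v] F_minus[OF F_1] by simp

lemma av_signed: "v \<in> V \<Longrightarrow> x \<in> F \<Longrightarrow> \<bar>e\<bar> = 1 \<Longrightarrow> av v (of_int e * x) = av v x"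
proof -
  assume "v \<in> V" "x \<in> F" "\<bar>e\<bar> = 1"
  moreover from this have "e = 1 \<or> e = - 1" by auto
  ultimately show ?thesis by (auto simp: av_minus)
qed

lemma av_power: "v \<in> V \<Longrightarrow> x \<in> F \<Longrightarrow> av v (x ^ n) = av v x ^ n"
  by (induction n) (auto simp: av_1 av_mult F_power)

lemma av_inverse: "v \<in> V \<Longrightarrow> x \<in> F \<Longrightarrow> x \<noteq> 0 \<Longrightarrow> av v (inverse x) = inverse (av v x)"
  using av_mult[of v x "inverse x"] av_1[of v] F_inv[of x] av_pos[of v x]
  by (simp add: field_simps)

lemma av_sum_inf:
  assumes v: "v \<in> Vinf" and "finite T" "\<And>i. i \<in> T \<Longrightarrow> f i \<in> F" "\<And>i. i \<in> T \<Longrightarrow> av v (f i) \<le> B"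
  shows "av v (sum f T) \<le> real (card T) * B"
  using assms(2-)
proof (induction T rule: finite_induct)
  case empty then show ?case using v V(2) by (auto simp: av_0)
next
  case (insert i T)
  have "av v (f i + sum f T) \<le> av v (f i) + av v (sum f T)"
    by (rule av_inf[OF v]) (use insert in \<open>auto intro!: F_sum\<close>)
  also have "\<dots> \<le> B + real (card T) * B" using insert by (intro add_mono) auto
  finally show ?case using insert by (simp add: algebra_simps)
qed

lemma av_sum_fin:
  assumes v: "v \<in> V - Vinf" and "finite T" "\<And>i. i \<in> T \<Longrightarrow> f i \<in> F" "\<And>i. i \<in> T \<Longrightarrow> av v (f i) \<le> B"
    and B: "B \<ge> 0"
  shows "av v (sum f T) \<le> B"
  using assms(2-4)
proof (induction T rule: finite_induct)
  case empty then show ?case using v B by (auto simp: av_0)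
next
  case (insert i T)
  have "av v (f i + sum f T) \<le> max (av v (f i)) (av v (sum f T))"
    by (rule av_fin[OF v]) (use insert in \<open>auto intro!: F_sum\<close>)
  also have "\<dots> \<le> B" using insert by simp
  finally show ?case using insert by simp
qed

lemma av_of_nat_fin: "v \<in> V - Vinf \<Longrightarrow> av v (of_nat n) \<le> 1"
  using av_sum_fin[of v "{..<n}" "\<lambda>_. 1" 1] by (simp add: F_1 av_1)

definition lv :: "nat \<Rightarrow> complex \<Rightarrow> real" where "lv v x = ln (av v x)"

text \<open>On \<open>U\<close>, where the logarithms sum to zero, this plays the part of twice the
  logarithmic Weil height. It is even, subadditive and homogeneous, hence behaves as a norm.\<close>

definition nm :: "complex \<Rightarrow> real" where "nm x = (\<Sum>v\<in>V. \<bar>lv v x\<bar>) / real deg"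

definition U :: "complex set" where "U = {x \<in> R. x \<noteq> 0 \<and> inverse x \<in> R}"

lemma U_R: "x \<in> U \<Longrightarrow> x \<in> R" and U_nz: "x \<in> U \<Longrightarrow> x \<noteq> 0" and U_F: "x \<in> U \<Longrightarrow> x \<in> F"
  using R_F by (auto simp: U_def)

lemma U_mult: "x \<in> U \<Longrightarrow> y \<in> U \<Longrightarrow> x * y \<in> U"
  by (auto simp: U_def R_mult)

lemma U_inverse: "x \<in> U \<Longrightarrow> inverse x \<in> U"
  by (auto simp: U_def)

lemma U_divide: "x \<in> U \<Longrightarrow> y \<in> U \<Longrightarrow> x / y \<in> U"
  by (simp add: divide_inverse U_mult U_inverse)

lemma U_1: "1 \<in> U" by (simp add: U_def R_1)

lemma U_power: "x \<in> U \<Longrightarrow> x ^ n \<in> U"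
  by (induction n) (auto intro: U_1 U_mult)

lemma U_prod: "(\<And>i. i \<in> A \<Longrightarrow> f i \<in> U) \<Longrightarrow> prod f A \<in> U"
  by (induction A rule: infinite_finite_induct) (auto intro: U_1 U_mult)

lemma exp_lv: "v \<in> V \<Longrightarrow> x \<in> F \<Longrightarrow> x \<noteq> 0 \<Longrightarrow> exp (lv v x) = av v x"
  by (simp add: lv_def av_pos)

lemma lv_mult: "v \<in> V \<Longrightarrow> x \<in> F \<Longrightarrow> y \<in> F \<Longrightarrow> x \<noteq> 0 \<Longrightarrow> y \<noteq> 0 \<Longrightarrow> lv v (x * y) = lv v x + lv v y"
  by (simp add: lv_def av_mult ln_mult_pos av_pos)

lemma lv_inverse: "v \<in> V \<Longrightarrow> x \<in> F \<Longrightarrow> x \<noteq> 0 \<Longrightarrow> lv v (inverse x) = - lv v x"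
  by (simp add: lv_def av_inverse ln_inverse av_pos)

lemma lv_divide: "v \<in> V \<Longrightarrow> x \<in> F \<Longrightarrow> y \<in> F \<Longrightarrow> x \<noteq> 0 \<Longrightarrow> y \<noteq> 0 \<Longrightarrow> lv v (x / y) = lv v x - lv v y"
  by (simp add: divide_inverse lv_mult lv_inverse F_inv)

lemma lv_power: "v \<in> V \<Longrightarrow> x \<in> F \<Longrightarrow> x \<noteq> 0 \<Longrightarrow> lv v (x ^ n) = real n * lv v x"
  by (simp add: lv_def av_power ln_realpow av_pos)

lemma lv_1: "v \<in> V \<Longrightarrow> lv v 1 = 0" by (simp add: lv_def av_1)

lemma lv_prod: "finite A \<Longrightarrow> v \<in> V \<Longrightarrow> (\<And>i. i \<in> A \<Longrightarrow> f i \<in> F \<and> f i \<noteq> 0) \<Longrightarrow> lv v (prod f A) = (\<Sum>i\<in>A. lv v (f i))"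
proof (induction A rule: finite_induct)
  case (insert i A)
  have "prod f A \<in> F" "prod f A \<noteq> 0" using insert by (auto intro!: F_prod)
  then show ?case using insert by (simp add: lv_mult)
qed (simp add: lv_1)

lemma sum_lv_R: "y \<in> R \<Longrightarrow> y \<noteq> 0 \<Longrightarrow> (\<Sum>v\<in>V. lv v y) \<ge> 0"
proof -
  assume y: "y \<in> R" "y \<noteq> 0"
  have yF: "y \<in> F" using y R_F by blast
  have "(\<Sum>v\<in>V. lv v y) = ln (\<Prod>v\<in>V. av v y)"
    unfolding lv_def by (rule ln_prod[symmetric]) (use V(1) av_pos[OF _ yF y(2)] in fastforce)+
  then show ?thesis using av_R[OF y] by simp
qed

lemma sum_lv_U: "x \<in> U \<Longrightarrow> (\<Sum>v\<in>V. lv v x) = 0"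
proof -
  assume x: "x \<in> U"
  have "(\<Sum>v\<in>V. lv v (inverse x)) \<ge> 0" using x by (intro sum_lv_R) (auto simp: U_def)
  moreover have "(\<Sum>v\<in>V. lv v (inverse x)) = - (\<Sum>v\<in>V. lv v x)"
    using x by (simp add: lv_inverse U_F U_nz sum_negf)
  moreover have "(\<Sum>v\<in>V. lv v x) \<ge> 0" using x by (intro sum_lv_R) (auto simp: U_def)
  ultimately show ?thesis by simp
qed

lemma nm_1: "nm 1 = 0" by (simp add: nm_def lv_1)

lemma nm_inverse: "x \<in> U \<Longrightarrow> nm (inverse x) = nm x"
  by (simp add: nm_def lv_inverse U_F U_nz)

lemma nm_mult: "x \<in> U \<Longrightarrow> y \<in> U \<Longrightarrow> nm (x * y) \<le> nm x + nm y"
proof -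
  assume xy: "x \<in> U" "y \<in> U"
  have "(\<Sum>v\<in>V. \<bar>lv v (x * y)\<bar>) \<le> (\<Sum>v\<in>V. \<bar>lv v x\<bar> + \<bar>lv v y\<bar>)"
    using xy by (intro sum_mono) (simp add: lv_mult U_F U_nz)
  then show ?thesis unfolding nm_def by (simp add: add_divide_distrib[symmetric] sum.distrib divide_right_mono)
qed

lemma nm_divide: "x \<in> U \<Longrightarrow> y \<in> U \<Longrightarrow> nm (x / y) \<le> nm x + nm y"
  using nm_mult[of x "inverse y"] by (simp add: nm_inverse U_inverse divide_inverse)

lemma nm_divide_commute: "x \<in> U \<Longrightarrow> y \<in> U \<Longrightarrow> nm (x / y) = nm (y / x)"
  using nm_inverse[of "x / y"] by (simp add: U_divide)

lemma nm_power: "x \<in> U \<Longrightarrow> nm (x ^ n) = real n * nm x"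
  by (simp add: nm_def lv_power U_F U_nz abs_mult sum_distrib_left)

lemma nm_prod: "finite A \<Longrightarrow> (\<And>i. i \<in> A \<Longrightarrow> f i \<in> U) \<Longrightarrow> nm (prod f A) \<le> (\<Sum>i\<in>A. nm (f i))"
proof (induction A rule: finite_induct)
  case (insert i A)
  have "nm (f i * prod f A) \<le> nm (f i) + nm (prod f A)" by (rule nm_mult) (use insert in \<open>auto intro!: U_prod\<close>)
  then show ?case using insert by simp
qed (simp add: nm_1)

text \<open>The product formula inequality with local estimates inserted; the constant
  \<open>c\<close> is paid only at the \<open>deg\<close> infinite places. It is applied in
  contraposition, to show that elements of \<open>R\<close> that are too small vanish.\<close>

lemma size_bound:
  assumes y: "y \<in> R" "y \<noteq> 0" and c: "c > 0"
    and inf: "\<And>v. v \<in> Vinf \<Longrightarrow> av v y \<le> c * exp (b v)"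
    and fin: "\<And>v. v \<in> V - Vinf \<Longrightarrow> av v y \<le> exp (b v)"
  shows "real deg * ln c + (\<Sum>v\<in>V. b v) \<ge> 0"
proof -
  have yF: "y \<in> F" using y R_F by blast
  have "0 \<le> (\<Sum>v\<in>V. lv v y)" by (rule sum_lv_R[OF y])
  also have "\<dots> \<le> (\<Sum>v\<in>V. (if v \<in> Vinf then ln c else 0) + b v)"
  proof (rule sum_mono)
    fix v assume v: "v \<in> V"
    have pos: "av v y > 0" using av_pos[OF v yF y(2)] .
    show "lv v y \<le> (if v \<in> Vinf then ln c else 0) + b v"
    proof (cases "v \<in> Vinf")
      case True
      have "ln (av v y) \<le> ln (c * exp (b v))" using inf[OF True] pos by (subst ln_le_cancel_iff) auto
      then show ?thesis using True c by (simp add: lv_def ln_mult_pos)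
    next
      case False
      have "ln (av v y) \<le> ln (exp (b v))" using fin[of v] False v pos by (subst ln_le_cancel_iff) auto
      then show ?thesis using False by (simp add: lv_def)
    qed
  qed
  also have "\<dots> = real deg * ln c + (\<Sum>v\<in>V. b v)"
    using V by (simp add: sum.distrib sum.If_cases Int_absorb1)
  finally show ?thesis .
qed

text \<open>Raising to the power \<open>p\<close> is additive modulo \<open>p\<close>: the inner
  binomial coefficients are divisible by \<open>p\<close>, which has absolute value
  \<open>1 / p\<close> at the places of \<open>Vp p\<close>.\<close>

lemma frobenius_congruence:
  assumes p: "p \<in> P" "v \<in> Vp p" and "finite T" "\<And>i. i \<in> T \<Longrightarrow> f i \<in> F" "\<And>i. i \<in> T \<Longrightarrow> av v (f i) \<le> B"
    and B: "B \<ge> 0"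
  shows "av v ((\<Sum>i\<in>T. f i) ^ p - (\<Sum>i\<in>T. f i ^ p)) \<le> B ^ p / real p"
  using assms(3-5)
proof (induction T rule: finite_induct)
  case empty
  have "p > 0" using Vp(1)[OF p(1)] prime_gt_0_nat by blast
  moreover have "v \<in> V" using Vp(2)[OF p(1)] p(2) by blast
  ultimately show ?case using B by (simp add: av_0 power_0_left)
next
  case (insert i T)
  have pr: "prime p" using Vp(1) p by blast
  have v: "v \<in> V - Vinf" using Vp(2)[OF p(1)] p(2) by blast
  define a s where "a = f i" and "s = (\<Sum>i\<in>T. f i)"
  have a: "a \<in> F" "av v a \<le> B" using insert by (auto simp: a_def)
  have s: "s \<in> F" "av v s \<le> B" unfolding s_def
    using insert av_sum_fin[OF v insert.hyps(1) _ _ B] by (auto intro: F_sum)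
  have ps: "{..p} = insert 0 (insert p {0<..<p})" using prime_gt_0_nat[OF pr] by auto
  have "(a + s) ^ p = (\<Sum>k\<le>p. of_nat (p choose k) * a ^ k * s ^ (p - k))" by (rule binomial_ring)
  also have "\<dots> = s ^ p + a ^ p + (\<Sum>k\<in>{0<..<p}. of_nat (p choose k) * a ^ k * s ^ (p - k))"
    unfolding ps using prime_gt_0_nat[OF pr] by simp
  finally have bin: "(a + s) ^ p - a ^ p - s ^ p = (\<Sum>k\<in>{0<..<p}. of_nat (p choose k) * a ^ k * s ^ (p - k))"
    by simp
  have "av v (\<Sum>k\<in>{0<..<p}. of_nat (p choose k) * a ^ k * s ^ (p - k)) \<le> B ^ p / real p"
  proof (rule av_sum_fin[OF v])
    fix k assume k: "k \<in> {0<..<p}"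
    show "of_nat (p choose k) * a ^ k * s ^ (p - k) \<in> F" using a s by (intro F_mult F_power F_of_nat)
    obtain c where c: "p choose k = p * c" using dvd_choose_prime[of k p] pr k by auto
    have "av v (of_nat (p choose k) * a ^ k * s ^ (p - k)) = 1 / real p * av v (of_nat c) * av v a ^ k * av v s ^ (p - k)"
      using v a s p by (simp add: c av_mult F_mult F_power F_of_nat av_power av_p)
    also have "\<dots> \<le> 1 / real p * 1 * B ^ k * B ^ (p - k)"
      using a s v av_of_nat_fin[OF v] B av_ge0[of v] F_of_nat
      by (intro mult_mono power_mono) (auto intro!: mult_nonneg_nonneg)
    also have "\<dots> = B ^ p / real p" using k by (simp add: power_add[symmetric])
    finally show "av v (of_nat (p choose k) * a ^ k * s ^ (p - k)) \<le> B ^ p / real p" .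
  qed (use B in auto)
  then have 1: "av v ((a + s) ^ p - a ^ p - s ^ p) \<le> B ^ p / real p" by (simp add: bin)
  have 2: "av v (s ^ p - (\<Sum>i\<in>T. f i ^ p)) \<le> B ^ p / real p" unfolding s_def using insert by auto
  have "av v (((a + s) ^ p - a ^ p - s ^ p) + (s ^ p - (\<Sum>i\<in>T. f i ^ p)))
      \<le> max (av v ((a + s) ^ p - a ^ p - s ^ p)) (av v (s ^ p - (\<Sum>i\<in>T. f i ^ p)))"
    using a s insert by (intro av_fin[OF v] F_diff F_power F_add F_sum) auto
  also have "\<dots> \<le> B ^ p / real p" using 1 2 by simp
  finally show ?case using insert by (simp add: a_def s_def algebra_simps)
qed

text \<open>A vanishing sum of units of small height remains zero when its terms are raised to the power
  \<open>p\<close>: the new sum is divisible by \<open>p\<close>, which exceeds its size.\<close>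

lemma vanishing_sum_power_prime:
  fixes e :: "'i \<Rightarrow> int"
  assumes T: "finite T" "T \<noteq> {}" and e: "\<And>i. i \<in> T \<Longrightarrow> \<bar>e i\<bar> = 1" and u: "\<And>i. i \<in> T \<Longrightarrow> u i \<in> U"
    and b: "\<And>i v. i \<in> T \<Longrightarrow> v \<in> V \<Longrightarrow> lv v (u i) \<le> b v"
    and zero: "(\<Sum>i\<in>T. of_int (e i) * u i) = 0"
    and p: "p \<in> P" "odd p" and big: "real (card T) * exp (real p * ((\<Sum>v\<in>V. b v) / real deg)) < real p"
  shows "(\<Sum>i\<in>T. of_int (e i) * u i ^ p) = 0"
proof (rule ccontr)
  define y where "y = (\<Sum>i\<in>T. of_int (e i) * u i ^ p)"
  assume "(\<Sum>i\<in>T. of_int (e i) * u i ^ p) \<noteq> 0"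
  then have y0: "y \<noteq> 0" by (simp add: y_def)
  have p0: "real p > 0" using Vp(1)[OF p(1)] prime_gt_0_nat by simp
  have cT: "real (card T) > 0" using T by (simp add: card_gt_0_iff)
  have yR: "y \<in> R" unfolding y_def using e u by (intro R_sum R_signed R_power) (auto intro: U_R)
  have avu: "av v (u i) \<le> exp (b v)" if "i \<in> T" "v \<in> V" for i v
  proof -
    have "exp (lv v (u i)) \<le> exp (b v)" using b that by simp
    then show ?thesis using exp_lv[of v "u i"] u[OF that(1)] that U_F U_nz by simp
  qed
  have tF: "of_int (e i) * u i \<in> F" "of_int (e i) * u i ^ p \<in> F" if "i \<in> T" for i
    using R_signed[OF e[OF that]] U_R[OF u[OF that]] R_power R_F by blast+
  have avt: "av v (of_int (e i) * u i ^ p) \<le> exp (real p * b v)" if "i \<in> T" "v \<in> V" for i v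
  proof -
    have "av v (of_int (e i) * u i ^ p) = av v (u i) ^ p"
      using that u e by (simp add: av_signed av_power F_power U_F)
    also have "\<dots> \<le> exp (b v) ^ p" using avu[OF that] that u by (intro power_mono av_ge0) (auto intro: U_F)
    finally show ?thesis by (simp add: exp_of_nat_mult)
  qed
  \<comment> \<open>Divisibility by \<open>p\<close> gains \<open>ln p\<close> at each of the
    \<open>deg\<close> places above \<open>p\<close>, in total \<open>deg * ln p\<close>.\<close>
  define b' where "b' v = real p * b v - (if v \<in> Vp p then ln (real p) else 0)" for v
  have "real deg * ln (real (card T)) + (\<Sum>v\<in>V. b' v) \<ge> 0"
  proof (rule size_bound[OF yR y0 cT])
    fix v assume v: "v \<in> Vinf"
    have "av v y \<le> real (card T) * exp (real p * b v)"
      unfolding y_def using v V(2) T(1) tF(2) avt by (intro av_sum_inf) auto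
    moreover have "v \<notin> Vp p" using Vp(2)[OF p(1)] v by blast
    ultimately show "av v y \<le> real (card T) * exp (b' v)" by (simp add: b'_def)
  next
    fix v assume v: "v \<in> V - Vinf"
    show "av v y \<le> exp (b' v)"
    proof (cases "v \<in> Vp p")
      case False
      have "av v y \<le> exp (real p * b v)"
        unfolding y_def using v T(1) tF(2) avt by (intro av_sum_fin) auto
      then show ?thesis using False by (simp add: b'_def)
    next
      case True
      have av1: "av v (of_int (e i) * u i) \<le> exp (b v)" if "i \<in> T" for i
        using avu[OF that, of v] that v u e by (simp add: av_signed U_F)
      have "av v ((\<Sum>i\<in>T. of_int (e i) * u i) ^ p - (\<Sum>i\<in>T. (of_int (e i) * u i) ^ p)) \<le> exp (b v) ^ p / real p"
        by (rule frobenius_congruence[OF p(1) True T(1)]) (use tF(1) av1 in auto)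
      \<comment> \<open>The signs are unchanged by the power because \<open>p\<close> is
        odd.\<close>
      moreover have "(\<Sum>i\<in>T. (of_int (e i) * u i) ^ p) = y"
        unfolding y_def
      proof (intro sum.cong refl)
        fix i assume "i \<in> T"
        then have "e i = 1 \<or> e i = - 1" using e by fastforce
        then show "(of_int (e i) * u i) ^ p = of_int (e i) * u i ^ p"
          using p(2) by (auto simp: power_minus_odd)
      qed
      ultimately have "av v (- y) \<le> exp (b v) ^ p / real p"
        using zero p0 by (simp add: power_0_left)
      then have "av v y \<le> exp (real p * b v) / real p"
        using av_minus[of v y] v yR R_F by (auto simp: exp_of_nat_mult)
      then show ?thesis using True p0 by (simp add: b'_def exp_diff)
    qed
  qed
  moreover have "(\<Sum>v\<in>V. b' v) = real p * (\<Sum>v\<in>V. b v) - real deg * ln (real p)"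
    using V(1) Vp[OF p(1)]
    by (simp add: b'_def sum_subtractf sum_distrib_left sum.If_cases Int_absorb1 subset_iff)
  ultimately have "real deg * (ln (real (card T)) + real p * ((\<Sum>v\<in>V. b v) / real deg) - ln (real p)) \<ge> 0"
    using V(4) by (simp add: algebra_simps)
  then have "ln (real p) \<le> ln (real (card T)) + real p * ((\<Sum>v\<in>V. b v) / real deg)"
    using V(4) by (simp add: zero_le_mult_iff)
  also have "\<dots> = ln (real (card T) * exp (real p * ((\<Sum>v\<in>V. b v) / real deg)))"
    using cT by (simp add: ln_mult_pos)
  finally have "real p \<le> real (card T) * exp (real p * ((\<Sum>v\<in>V. b v) / real deg))"
    using p0 cT by (subst (asm) ln_le_cancel_iff) auto
  then show False using big by simp
qed

text \<open>The prime factors of \<open>m\<close> are peeled off one at a time. The bound on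
  \<open>m\<close> times the size keeps the exponential factor at each step below e, which is at
  most 3; this is why primes larger than \<open>3 * card T\<close> suffice.\<close>

lemma vanishing_sum_power:
  fixes e :: "'i \<Rightarrow> int"
  assumes T: "finite T" "T \<noteq> {}" and e: "\<And>i. i \<in> T \<Longrightarrow> \<bar>e i\<bar> = 1" and u: "\<And>i. i \<in> T \<Longrightarrow> u i \<in> U"
    and b: "\<And>i v. i \<in> T \<Longrightarrow> v \<in> V \<Longrightarrow> lv v (u i) \<le> b v" "\<And>v. v \<in> V \<Longrightarrow> b v \<ge> 0"
    and zero: "(\<Sum>i\<in>T. of_int (e i) * u i) = 0"
    and m: "m > 0" "\<And>p. prime p \<Longrightarrow> p dvd m \<Longrightarrow> p \<in> P \<and> p > 3 * card T"
      "real m * ((\<Sum>v\<in>V. b v) / real deg) \<le> 1"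
  shows "(\<Sum>i\<in>T. of_int (e i) * u i ^ m) = 0"
  using m
proof (induction m rule: less_induct)
  case (less m)
  show ?case
  proof (cases "m = 1")
    case True
    then show ?thesis using zero by simp
  next
    case False
    then obtain p where p: "prime p" "p dvd m" using prime_factor_nat by blast
    then obtain m' where m': "m = p * m'" by blast
    have m'0: "m' > 0" "m' < m" using less.prems(1) m' prime_gt_1_nat[OF p(1)] by auto
    have \<Sigma>: "(\<Sum>v\<in>V. b v) / real deg \<ge> 0" using b(2) by (simp add: sum_nonneg)
    have cT: "card T \<ge> 1" using T by (simp add: Suc_le_eq card_gt_0_iff)
    have pP: "p \<in> P" "p > 3 * card T" using less.prems(2)[OF p] by auto
    have "odd p" using pP(2) cT prime_odd_nat[OF p(1)] by simp
    have IH: "(\<Sum>i\<in>T. of_int (e i) * u i ^ m') = 0"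
    proof (rule less.IH[OF m'0(2,1)])
      show "p \<in> P \<and> p > 3 * card T" if "prime p" "p dvd m'" for p
        using less.prems(2)[OF that(1)] that(2) m' by auto
      have "real m' * ((\<Sum>v\<in>V. b v) / real deg) \<le> real m * ((\<Sum>v\<in>V. b v) / real deg)"
        using \<Sigma> m'0 by (intro mult_right_mono) auto
      then show "real m' * ((\<Sum>v\<in>V. b v) / real deg) \<le> 1" using less.prems(3) by linarith
    qed
    have "(\<Sum>i\<in>T. of_int (e i) * (u i ^ m') ^ p) = 0"
    proof (rule vanishing_sum_power_prime[where b = "\<lambda>v. real m' * b v"])
      show "lv v (u i ^ m') \<le> real m' * b v" if "i \<in> T" "v \<in> V" for i v
        using that b u by (simp add: lv_power U_F U_nz mult_left_mono)
      have "real p * ((\<Sum>v\<in>V. real m' * b v) / real deg) = real m * ((\<Sum>v\<in>V. b v) / real deg)"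
        by (simp add: m' sum_distrib_left[symmetric])
      then have "exp (real p * ((\<Sum>v\<in>V. real m' * b v) / real deg)) \<le> exp 1"
        using less.prems(3) by (simp only: exp_le_cancel_iff)
      also have "\<dots> \<le> 3" by (rule exp_le)
      finally have "real (card T) * exp (real p * ((\<Sum>v\<in>V. real m' * b v) / real deg)) \<le> real (card T) * 3"
        by (rule mult_left_mono) simp
      also have "\<dots> < real p" using pP(2) by linarith
      finally show "real (card T) * exp (real p * ((\<Sum>v\<in>V. real m' * b v) / real deg)) < real p" .
    qed (use T e u U_power IH pP \<open>odd p\<close> in auto)
    then show ?thesis by (simp add: m' power_mult[symmetric] mult.commute)
  qed
qed

end

section \<open>The gap principle\<close>

definition expsum :: "(real \<Rightarrow> real) set" where
  "expsum = {f. \<exists>X a. finite X \<and> f = (\<lambda>s. \<Sum>x\<in>X. a x * exp (s * x))}"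

lemma expsumI: "finite X \<Longrightarrow> (\<And>s. f s = (\<Sum>x\<in>X. a x * exp (s * x))) \<Longrightarrow> f \<in> expsum"
  unfolding expsum_def by blast

lemma expsum_exp: "(\<lambda>s. exp (s * x)) \<in> expsum"
  by (rule expsumI[of "{x}" _ "\<lambda>_. 1"]) auto

lemma expsum_0: "0 \<in> expsum"
  by (rule expsumI[of "{}" _ "\<lambda>_. 1"]) auto

lemma expsum_1: "1 \<in> expsum"
  by (rule expsumI[of "{0}" _ "\<lambda>_. 1"]) auto

lemma expsum_minus: "f \<in> expsum \<Longrightarrow> - f \<in> expsum"
proof -
  assume "f \<in> expsum"
  then obtain X a where "finite X" "f = (\<lambda>s. \<Sum>x\<in>X. a x * exp (s * x))" unfolding expsum_def by blast
  then show ?thesis by (intro expsumI[of X _ "\<lambda>x. - a x"]) (auto simp: sum_negf)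
qed

lemma expsum_add:
  assumes "f \<in> expsum" "g \<in> expsum"
  shows "f + g \<in> expsum"
proof -
  obtain X a where f: "finite X" "f = (\<lambda>s. \<Sum>x\<in>X. a x * exp (s * x))" using assms(1) unfolding expsum_def by blast
  obtain Y b where g: "finite Y" "g = (\<lambda>s. \<Sum>x\<in>Y. b x * exp (s * x))" using assms(2) unfolding expsum_def by blast
  show ?thesis
  proof (rule expsumI[of "X \<union> Y" _ "\<lambda>x. (if x \<in> X then a x else 0) + (if x \<in> Y then b x else 0)"])
    fix s
    have "(\<Sum>x\<in>X. a x * exp (s * x)) = (\<Sum>x\<in>X \<union> Y. (if x \<in> X then a x else 0) * exp (s * x))"
      using f(1) g(1) by (intro sum.mono_neutral_cong_left) auto
    moreover have "(\<Sum>x\<in>Y. b x * exp (s * x)) = (\<Sum>x\<in>X \<union> Y. (if x \<in> Y then b x else 0) * exp (s * x))"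
      using f(1) g(1) by (intro sum.mono_neutral_cong_left) auto
    ultimately show "(f + g) s = (\<Sum>x\<in>X \<union> Y. ((if x \<in> X then a x else 0) + (if x \<in> Y then b x else 0)) * exp (s * x))"
      using f(2) g(2) by (simp add: distrib_right sum.distrib)
  qed (use f g in auto)
qed

lemma expsum_mult:
  assumes "f \<in> expsum" "g \<in> expsum"
  shows "f * g \<in> expsum"
proof -
  obtain X a where f: "finite X" "f = (\<lambda>s. \<Sum>x\<in>X. a x * exp (s * x))" using assms(1) unfolding expsum_def by blast
  obtain Y b where g: "finite Y" "g = (\<lambda>s. \<Sum>x\<in>Y. b x * exp (s * x))" using assms(2) unfolding expsum_def by blast
  let ?h = "\<lambda>(x, y). x + y"
  show ?thesis
  proof (rule expsumI[of "?h ` (X \<times> Y)" _ "\<lambda>z. \<Sum>q\<in>{q \<in> X \<times> Y. ?h q = z}. a (fst q) * b (snd q)"])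
    fix s
    have "(f * g) s = (\<Sum>q\<in>X \<times> Y. a (fst q) * b (snd q) * exp (s * ?h q))"
      by (simp add: f g sum_product sum.cartesian_product case_prod_unfold exp_add distrib_left mult_ac)
    also have "\<dots> = (\<Sum>z\<in>?h ` (X \<times> Y). \<Sum>q\<in>{q \<in> X \<times> Y. ?h q = z}. a (fst q) * b (snd q) * exp (s * ?h q))"
      by (rule sum.image_gen) (use f g in auto)
    also have "\<dots> = (\<Sum>z\<in>?h ` (X \<times> Y). (\<Sum>q\<in>{q \<in> X \<times> Y. ?h q = z}. a (fst q) * b (snd q)) * exp (s * z))"
      by (intro sum.cong refl) (auto simp: sum_distrib_right intro!: sum.cong)
    finally show "(f * g) s = \<dots>" .
  qed (use f g in auto)
qed

lemma tendsto_exp_decay: "x < 0 \<Longrightarrow> ((\<lambda>s. exp (s * x)) \<longlongrightarrow> (0::real)) at_top"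
  by real_asymp

text \<open>The largest exponent with a non-zero coefficient dominates. Thus \<beta> behaves as a
  valuation on this ring of functions.\<close>

lemma expsum_leading:
  assumes "f \<in> expsum" "f \<noteq> 0"
  shows "\<exists>\<beta> c. c \<noteq> 0 \<and> ((\<lambda>s. f s * exp (- (s * \<beta>))) \<longlongrightarrow> c) at_top"
proof -
  obtain X a where f: "finite X" "f = (\<lambda>s. \<Sum>x\<in>X. a x * exp (s * x))" using assms(1) unfolding expsum_def by blast
  define X' where "X' = {x \<in> X. a x \<noteq> 0}"
  have f': "f s = (\<Sum>x\<in>X'. a x * exp (s * x))" for s
    unfolding f(2) X'_def by (rule sum.mono_neutral_right) (use f in auto)
  have fin: "finite X'" using f by (simp add: X'_def)
  have "X' \<noteq> {}" using assms(2) f' by (auto simp: fun_eq_iff)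
  define \<beta> where "\<beta> = Max X'"
  have \<beta>: "\<beta> \<in> X'" "\<And>x. x \<in> X' \<Longrightarrow> x \<le> \<beta>" using fin \<open>X' \<noteq> {}\<close> by (auto simp: \<beta>_def)
  have "((\<lambda>s. \<Sum>x\<in>X'. a x * exp (s * (x - \<beta>))) \<longlongrightarrow> (\<Sum>x\<in>X'. if x = \<beta> then a \<beta> else 0)) at_top"
  proof (rule tendsto_sum)
    fix x assume "x \<in> X'"
    show "((\<lambda>s. a x * exp (s * (x - \<beta>))) \<longlongrightarrow> (if x = \<beta> then a \<beta> else 0)) at_top"
    proof (cases "x = \<beta>")
      case False
      then have "x - \<beta> < 0" using \<beta>(2)[OF \<open>x \<in> X'\<close>] by simp
      then show ?thesis using tendsto_mult_left[OF tendsto_exp_decay, of "x - \<beta>" "a x"] False by simp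
    qed simp
  qed
  moreover have "(\<Sum>x\<in>X'. a x * exp (s * (x - \<beta>))) = f s * exp (- (s * \<beta>))" for s
    unfolding f' sum_distrib_right
    by (intro sum.cong refl) (simp add: right_diff_distrib exp_diff exp_minus divide_inverse)
  ultimately have "((\<lambda>s. f s * exp (- (s * \<beta>))) \<longlongrightarrow> a \<beta>) at_top" using \<beta>(1) fin by simp
  then show ?thesis using \<beta>(1) by (auto simp: X'_def)
qed

lemma sum_fun_apply: "(\<Sum>x\<in>A. f x) s = (\<Sum>x\<in>A. f x (s :: 'b))" for f :: "'a \<Rightarrow> 'b \<Rightarrow> real"
  by (induction A rule: infinite_finite_induct) auto

lemma prod_fun_apply: "(\<Prod>x\<in>A. f x) s = (\<Prod>x\<in>A. f x (s :: 'b))" for f :: "'a \<Rightarrow> 'b \<Rightarrow> real"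
  by (induction A rule: infinite_finite_induct) auto

text \<open>Allows minors over the ring of exponential sums to be tested pointwise.\<close>

lemma leibniz_fun_apply: "leibniz n M s = leibniz n (\<lambda>i j. M i j s)" for M :: "nat \<Rightarrow> nat \<Rightarrow> 'b \<Rightarrow> real"
proof -
  have "(of_int (sign p) :: 'b \<Rightarrow> real) s = of_int (sign p)" for p :: "nat \<Rightarrow> nat"
    by (auto simp: sign_def)
  then show ?thesis by (simp add: leibniz_def sum_fun_apply prod_fun_apply)
qed

text \<open>Tropical version of the existence of a linear relation: compare the leading exponents, as
  \<open>s\<close> tends to infinity, of the terms of a relation between exponential sums.\<close>

lemma tropical_relation:
  fixes Z :: "(nat \<Rightarrow> real) set"
  assumes van: "\<And>r s. (\<And>i. i < n \<Longrightarrow> r i \<in> Z) \<Longrightarrow> leibniz n (\<lambda>i j. exp (s * r i j)) = (0::real)"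
  obtains J \<beta> where "J \<subseteq> {..<n}"
    "\<And>x. x \<in> Z \<Longrightarrow> \<exists>i\<in>J. \<exists>j\<in>J. i \<noteq> j \<and> x i + \<beta> i = x j + \<beta> j"
proof -
  define E :: "(nat \<Rightarrow> real) \<Rightarrow> nat \<Rightarrow> real \<Rightarrow> real" where "E x j = (\<lambda>s. exp (s * x j))" for x j
  obtain c where c: "\<exists>j<n. c j \<noteq> 0" "\<And>j. j < n \<Longrightarrow> c j \<in> expsum"
    "\<And>z. z \<in> E ` Z \<Longrightarrow> (\<Sum>j<n. c j * z j) = 0"
  proof (rule relation_of_vanishing_minors[of n "E ` Z" expsum])
    show "leibniz n r = 0" if r: "\<And>i. i < n \<Longrightarrow> r i \<in> E ` Z" for r
    proof (rule ext)
      fix s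
      have "\<forall>i. \<exists>x. i < n \<longrightarrow> x \<in> Z \<and> r i = E x" using r by blast
      then obtain x where x: "\<And>i. i < n \<Longrightarrow> x i \<in> Z" "\<And>i. i < n \<Longrightarrow> r i = E (x i)" by metis
      have "leibniz n r s = leibniz n (\<lambda>i j. exp (s * x i j))"
        unfolding leibniz_fun_apply unfolding leibniz_def
        by (intro sum.cong prod.cong refl arg_cong2[of _ _ _ _ "(*)"]) (auto simp: x E_def)
      then show "leibniz n r s = 0 s" using van[of x s] x(1) by simp
    qed
  qed (auto simp: E_def intro: expsum_0 expsum_1 expsum_minus expsum_add expsum_mult expsum_exp)
  \<comment> \<open>Only the indices whose coefficient is not the zero function have a leading
    exponent.\<close>
  define J where "J = {j. j < n \<and> c j \<noteq> 0}"
  have "\<forall>j. \<exists>\<beta> a. j \<in> J \<longrightarrow> a \<noteq> 0 \<and> ((\<lambda>s. c j s * exp (- (s * \<beta>))) \<longlongrightarrow> a) at_top"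
    using expsum_leading c(2) unfolding J_def by blast
  then obtain \<beta> a where lead: "\<And>j. j \<in> J \<Longrightarrow> a j \<noteq> 0"
    "\<And>j. j \<in> J \<Longrightarrow> ((\<lambda>s. c j s * exp (- (s * \<beta> j))) \<longlongrightarrow> a j) at_top" by metis
  show ?thesis
  proof (rule that[of J \<beta>])
    show "J \<subseteq> {..<n}" by (auto simp: J_def)
    fix x assume x: "x \<in> Z"
    show "\<exists>i\<in>J. \<exists>j\<in>J. i \<noteq> j \<and> x i + \<beta> i = x j + \<beta> j"
    proof (rule ccontr)
      assume neg: "\<not> ?thesis"
      have fin: "finite J" by (simp add: J_def)
      have "J \<noteq> {}" using c(1) by (auto simp: J_def)
      \<comment> \<open>If the largest value of \<open>x j + \<beta> j\<close> were attained only at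
        \<open>k\<close>, then after division of the relation by \<open>exp (s * top)\<close> all
        other terms would tend to zero, leaving the non-zero limit \<open>a k\<close>.\<close>
      define top where "top = Max ((\<lambda>j. x j + \<beta> j) ` J)"
      have "top \<in> (\<lambda>j. x j + \<beta> j) ` J" unfolding top_def using fin \<open>J \<noteq> {}\<close> by (intro Max_in) auto
      then obtain k where k: "k \<in> J" "top = x k + \<beta> k" by blast
      have lt: "x j + \<beta> j < top" if "j \<in> J" "j \<noteq> k" for j
      proof -
        have "x j + \<beta> j \<le> top" unfolding top_def using fin that by auto
        moreover have "x j + \<beta> j \<noteq> top" using neg that k by blast
        ultimately show ?thesis by simp
      qed
      have "((\<lambda>s. \<Sum>j\<in>J. (c j s * exp (- (s * \<beta> j))) * exp (s * (x j + \<beta> j - top)))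
          \<longlongrightarrow> (\<Sum>j\<in>J. a j * (if j = k then 1 else 0))) at_top"
      proof (intro tendsto_sum tendsto_mult lead(2))
        fix j assume "j \<in> J"
        show "((\<lambda>s. exp (s * (x j + \<beta> j - top))) \<longlongrightarrow> (if j = k then 1 else 0)) at_top"
        proof (cases "j = k")
          case True
          then show ?thesis by (simp add: k)
        next
          case False
          then show ?thesis using lt[OF \<open>j \<in> J\<close>] tendsto_exp_decay by simp
        qed
      qed
      moreover have "(\<Sum>j\<in>J. (c j s * exp (- (s * \<beta> j))) * exp (s * (x j + \<beta> j - top))) = 0" for s
      proof -
        have "(\<Sum>j\<in>J. (c j s * exp (- (s * \<beta> j))) * exp (s * (x j + \<beta> j - top)))
            = (\<Sum>j\<in>J. c j s * exp (s * x j)) * exp (- (s * top))"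
          unfolding sum_distrib_right
          by (intro sum.cong refl) (simp add: exp_add[symmetric] mult.assoc algebra_simps)
        also have "(\<Sum>j\<in>J. c j s * exp (s * x j)) = (\<Sum>j<n. c j s * exp (s * x j))"
          by (rule sum.mono_neutral_left) (auto simp: J_def)
        also have "\<dots> = (\<Sum>j<n. c j * E x j) s" by (simp add: sum_fun_apply E_def)
        also have "\<dots> = 0" using c(3)[of "E x"] x by simp
        finally show ?thesis by simp
      qed
      ultimately have "(\<Sum>j\<in>J. a j * (if j = k then 1 else 0)) = 0"
        using tendsto_unique[OF trivial_limit_at_top_linorder, of "\<lambda>_. 0::real" _ 0] by simp
      then show False using lead(1)[OF k(1)] k(1) fin by (simp add: if_distrib cong: if_cong)
    qed
  qed
qed

lemma sum_swap3:
  fixes f :: "'a \<Rightarrow> 'b \<Rightarrow> 'c \<Rightarrow> 'd::comm_monoid_add"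
  shows "(\<Sum>v\<in>V. \<Sum>i\<in>I. \<Sum>j\<in>J. f v i j) = (\<Sum>i\<in>I. \<Sum>j\<in>J. \<Sum>v\<in>V. f v i j)"
proof -
  have "(\<Sum>v\<in>V. \<Sum>i\<in>I. \<Sum>j\<in>J. f v i j) = (\<Sum>i\<in>I. \<Sum>v\<in>V. \<Sum>j\<in>J. f v i j)" by (rule sum.swap)
  also have "\<dots> = (\<Sum>i\<in>I. \<Sum>j\<in>J. \<Sum>v\<in>V. f v i j)" by (intro sum.cong refl sum.swap)
  finally show ?thesis .
qed

text \<open>Two distinct points coincide for at most one slope \<open>c\<close>, and finitely many
  slopes can be avoided. Comparing leading exponents requires real exponents, so complex logarithms
  are projected to the real line without merging those that matter.\<close>

lemma exists_separating_functional:
  fixes D :: "complex set"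
  assumes "finite D"
  obtains c :: real where "inj_on (\<lambda>z. Re z + c * Im z) D"
proof -
  define bad where "bad = (\<lambda>(z, z'). - (Re z - Re z') / (Im z - Im z')) ` (D \<times> D)"
  have "finite bad" using assms by (simp add: bad_def)
  then obtain c where c: "c \<notin> bad" using ex_new_if_finite infinite_UNIV_char_0 by blast
  show ?thesis
  proof (rule that[of c], rule inj_onI)
    fix z z' assume z: "z \<in> D" "z' \<in> D" "Re z + c * Im z = Re z' + c * Im z'"
    then have eq: "c * (Im z - Im z') = - (Re z - Re z')" by (simp add: algebra_simps)
    have "Im z = Im z'"
    proof (rule ccontr)
      assume "Im z \<noteq> Im z'"
      then have "c = - (Re z - Re z') / (Im z - Im z')" using eq by (simp add: field_simps)
      then have "c \<in> bad" unfolding bad_def using z by (intro image_eqI[of _ _ "(z, z')"]) auto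
      then show False using c by simp
    qed
    then show "z = z'" using eq by (simp add: complex_eq_iff)
  qed
qed

section \<open>Solutions of small height\<close>

context places
begin

text \<open>The terms \<open>u p\<close> of the Leibniz expansion keep a vanishing sum when raised
  to the powers \<open>1 + j * t\<close>. Vandermonde splits this sum according to the value of
  \<open>u p ^ t\<close>, and because arguments are small, equal \<open>t\<close>-th powers come
  from equal sums of logarithms. So the signs cancel within each set of terms with the same
  \<Lambda>, and this remains so when each logarithm is replaced by an additive function of
  it.\<close>

lemma twisted_minors:
  fixes \<zeta> :: "nat \<Rightarrow> nat \<Rightarrow> complex" and n' :: nat
  defines "t \<equiv> fact (3 * fact n') :: nat"
  assumes n: "n \<le> n'"
    and P: "\<And>p. prime p \<Longrightarrow> p \<le> 1 + fact n' * t \<Longrightarrow> p \<in> P"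
    and \<zeta>: "\<And>i j. i < n \<Longrightarrow> j < n \<Longrightarrow> \<zeta> i j \<in> U"
    and small: "\<And>i j. i < n \<Longrightarrow> j < n \<Longrightarrow> nm (\<zeta> i j) \<le> \<rho>" "real (n' ^ 2) * \<rho> * real (1 + fact n' * t) \<le> 1" "\<rho> \<ge> 0"
    and arg: "\<And>i j. i < n \<Longrightarrow> j < n \<Longrightarrow> \<bar>Im (Ln (\<zeta> i j))\<bar> \<le> \<delta>" "2 * real n' * real t * \<delta> < 2 * pi"
    and zero: "leibniz n \<zeta> = 0"
    and w: "\<And>x y. w (x + y) = w x + w y"
  shows "leibniz n (\<lambda>i j. exp (s * w (Ln (\<zeta> i j)))) = (0::real)"
proof -
  define T where "T = {p. p permutes {0..<n}}"
  define u where "u p = (\<Prod>i<n. \<zeta> i (p i))" for p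
  define \<Lambda> where "\<Lambda> p = (\<Sum>i<n. Ln (\<zeta> i (p i)))" for p
  \<comment> \<open>A bound for all terms at once, which is the origin of the factor
    \<open>n' ^ 2\<close> in the size condition.\<close>
  define b where "b v = (\<Sum>i<n. \<Sum>j<n. \<bar>lv v (\<zeta> i j)\<bar>)" for v
  have T: "finite T" "T \<noteq> {}" unfolding T_def by (auto intro: finite_permutations exI[of _ id] permutes_id)
  have cT: "card T = fact n" unfolding T_def by (simp add: card_permutations)
  have cT': "card T \<le> fact n'" unfolding cT using n by (rule fact_mono)
  have pn: "p i < n" if "p \<in> T" "i < n" for p i
    using that permutes_in_image[of p "{0..<n}" i] by (simp add: T_def)
  have uU: "u p \<in> U" if "p \<in> T" for p unfolding u_def using pn[OF that] \<zeta> by (intro U_prod) auto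
  have lb: "lv v (u p) \<le> b v" if "p \<in> T" "v \<in> V" for p v
  proof -
    have "lv v (u p) = (\<Sum>i<n. lv v (\<zeta> i (p i)))"
      unfolding u_def using pn[OF that(1)] \<zeta> that(2) by (intro lv_prod) (auto simp: U_F U_nz)
    also have "\<dots> \<le> b v"
      unfolding b_def
    proof (rule sum_mono)
      fix i assume "i \<in> {..<n}"
      then have "\<bar>lv v (\<zeta> i (p i))\<bar> \<le> (\<Sum>j<n. \<bar>lv v (\<zeta> i j)\<bar>)"
        using pn[OF that(1)] by (intro member_le_sum) auto
      then show "lv v (\<zeta> i (p i)) \<le> (\<Sum>j<n. \<bar>lv v (\<zeta> i j)\<bar>)" by linarith
    qed
    finally show ?thesis .
  qed
  have b0: "b v \<ge> 0" for v unfolding b_def by (intro sum_nonneg) auto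
  have bsum: "(\<Sum>v\<in>V. b v) / real deg \<le> real (n' ^ 2) * \<rho>"
  proof -
    have "(\<Sum>v\<in>V. b v) / real deg = (\<Sum>i<n. \<Sum>j<n. nm (\<zeta> i j))"
      unfolding b_def nm_def sum_divide_distrib[symmetric]
      by (rule arg_cong2[of _ _ _ _ "(/)"], rule sum_swap3, rule refl)
    also have "\<dots> \<le> (\<Sum>i<n. \<Sum>j<n. \<rho>)" by (intro sum_mono) (use small in auto)
    also have "\<dots> = real (n ^ 2) * \<rho>" by (simp add: power2_eq_square)
    also have "\<dots> \<le> real (n' ^ 2) * \<rho>" using n small(3) by (intro mult_right_mono) auto
    finally show ?thesis .
  qed
  have zero': "(\<Sum>p\<in>T. of_int (sign p) * u p) = 0" using zero by (simp add: leibniz_def T_def u_def)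
  have pw: "(\<Sum>p\<in>T. of_int (sign p) * u p ^ (1 + j * t)) = 0" if j: "j < card T" for j
  proof (rule vanishing_sum_power[OF T _ uU lb b0 zero'])
    have le: "1 + j * t \<le> 1 + fact n' * t" using j cT' by (intro add_mono mult_right_mono) auto
    \<comment> \<open>The factorial \<open>t\<close> is divisible by every prime up to
      \<open>3 * fact n'\<close>, so such a prime cannot divide \<open>1 + j * t\<close>.\<close>
    show "p \<in> P \<and> p > 3 * card T" if p: "prime p" "p dvd 1 + j * t" for p
    proof
      have "p \<le> 1 + j * t" using p(2) by (intro dvd_imp_le) auto
      then show "p \<in> P" using le by (intro P p(1)) linarith
      show "p > 3 * card T"
      proof (rule ccontr)
        assume "\<not> p > 3 * card T"
        then have "p \<le> 3 * fact n'" using cT' by linarith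
        then have "p dvd t" unfolding t_def using prime_ge_1_nat[OF p(1)] by (intro dvd_fact) auto
        then have "p dvd 1" using p(2) by (metis dvd_add_left_iff dvd_mult)
        then show False using p(1) by simp
      qed
    qed
    have "real (1 + j * t) * ((\<Sum>v\<in>V. b v) / real deg) \<le> real (1 + fact n' * t) * (real (n' ^ 2) * \<rho>)"
    proof (rule mult_mono)
      show "real (1 + j * t) \<le> real (1 + fact n' * t)" using le by (simp only: of_nat_le_iff)
    qed (use bsum b0 in \<open>auto intro!: divide_nonneg_nonneg sum_nonneg\<close>)
    then show "real (1 + j * t) * ((\<Sum>v\<in>V. b v) / real deg) \<le> 1" using small(2) by (simp add: mult_ac)
  qed (auto simp: sign_def)
  have eu: "u p = exp (\<Lambda> p)" if "p \<in> T" for p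
  proof -
    have "exp (\<Lambda> p) = (\<Prod>i<n. exp (Ln (\<zeta> i (p i))))" unfolding \<Lambda>_def by (simp add: exp_sum)
    also have "\<dots> = u p" unfolding u_def using pn[OF that] \<zeta> by (intro prod.cong) (auto simp: U_nz)
    finally show ?thesis ..
  qed
  have Im\<Lambda>: "\<bar>Im (\<Lambda> p)\<bar> \<le> real n' * \<delta>" if "p \<in> T" for p
  proof (cases "n = 0")
    case True
    have "n' = 0 \<or> \<delta> \<ge> 0 \<or> \<delta> < 0" by auto
    then show ?thesis
    proof (cases "\<delta> \<ge> 0")
      case True
      then show ?thesis using \<open>n = 0\<close> by (simp add: \<Lambda>_def)
    next
      case False
      \<comment> \<open>The empty determinant is one, contrary to \<open>zero\<close>.\<close>
      have "u p = 1" "T = {id}" using \<open>n = 0\<close> by (auto simp: u_def T_def)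
      then have "(\<Sum>p\<in>T. of_int (sign p) * u p) \<noteq> 0" using \<open>n = 0\<close> by (simp add: u_def)
      then show ?thesis using zero' by simp
    qed
  next
    case False
    have \<delta>0: "\<delta> \<ge> 0" using arg(1)[of 0 0] False by linarith
    have "\<bar>Im (\<Lambda> p)\<bar> \<le> (\<Sum>i<n. \<bar>Im (Ln (\<zeta> i (p i)))\<bar>)" unfolding \<Lambda>_def by (simp add: sum_abs)
    also have "\<dots> \<le> (\<Sum>i<n. \<delta>)" by (rule sum_mono) (use arg(1) pn[OF that] in auto)
    also have "\<dots> \<le> real n' * \<delta>" using n \<delta>0 by (simp add: mult_right_mono)
    finally show ?thesis .
  qed
  have t0: "t > 0" by (simp add: t_def)
  \<comment> \<open>Equality of the powers gives equality of \<open>t * \<Lambda>\<close> up to a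
    multiple of 2 pi i; the imaginary parts differ by less than 2 pi, so the multiple is
    zero.\<close>
  have same: "\<Lambda> p = \<Lambda> q" if "p \<in> T" "q \<in> T" "u p ^ t = u q ^ t" for p q
  proof -
    have "exp (of_nat t * \<Lambda> p) = exp (of_nat t * \<Lambda> q)"
      using that eu by (simp add: exp_of_nat_mult)
    then obtain k :: int where k: "of_nat t * \<Lambda> p = of_nat t * \<Lambda> q + complex_of_real (real_of_int (2 * k) * pi) * \<i>"
      unfolding exp_eq by blast
    have "Im (of_nat t * \<Lambda> p) = Im (of_nat t * \<Lambda> q) + 2 * real_of_int k * pi"
      unfolding k by simp
    then have "2 * real_of_int k * pi = real t * (Im (\<Lambda> p) - Im (\<Lambda> q))" by (simp add: algebra_simps)
    then have "\<bar>2 * real_of_int k * pi\<bar> = real t * \<bar>Im (\<Lambda> p) - Im (\<Lambda> q)\<bar>" by (simp add: abs_mult)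
    also have "\<dots> \<le> real t * (2 * real n' * \<delta>)"
      using Im\<Lambda>[OF that(1)] Im\<Lambda>[OF that(2)] by (intro mult_left_mono) auto
    also have "\<dots> < 2 * pi" using arg(2) by (simp add: mult_ac)
    finally have "\<bar>real_of_int k\<bar> < 1" by (simp add: abs_mult)
    then have "k = 0" by linarith
    then show ?thesis using k t0 by simp
  qed
  \<comment> \<open>Within a class \<open>u p\<close> is the constant \<open>exp c\<close> and can
    be cancelled, which leaves the sum of the signs, an integer.\<close>
  have cls: "(\<Sum>p | p \<in> T \<and> \<Lambda> p = c. real_of_int (sign p)) = 0" if c: "c \<in> \<Lambda> ` T" for c
  proof -
    obtain q where q: "q \<in> T" "c = \<Lambda> q" using c by blast
    have "(\<Sum>p | p \<in> T \<and> u p ^ t = u q ^ t. of_int (sign p) * u p) = 0"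
      by (rule vandermonde_classes[OF T(1)])
        (use pw in \<open>simp add: power_mult[symmetric] mult.commute[of t] mult.assoc\<close>)
    moreover have "{p. p \<in> T \<and> u p ^ t = u q ^ t} = {p. p \<in> T \<and> \<Lambda> p = c}"
      using same[OF _ q(1)] eu q by auto
    ultimately have "(\<Sum>p | p \<in> T \<and> \<Lambda> p = c. of_int (sign p) * exp c) = 0"
      using eu by (auto intro: trans[rotated] sum.cong)
    then have "(\<Sum>p | p \<in> T \<and> \<Lambda> p = c. of_int (sign p)) * exp c = 0" by (simp add: sum_distrib_right)
    then have "of_int (\<Sum>p | p \<in> T \<and> \<Lambda> p = c. sign p) = (0::complex)" by simp
    then have "(\<Sum>p | p \<in> T \<and> \<Lambda> p = c. sign p) = 0" using of_int_eq_0_iff by blast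
    then show ?thesis by (metis of_int_0 of_int_sum)
  qed
  have w0: "w 0 = 0" using w[of 0 0] by simp
  have ws: "w (\<Sum>i<k. f i) = (\<Sum>i<k. w (f i))" for f and k :: nat by (induction k) (auto simp: w w0)
  have "leibniz n (\<lambda>i j. exp (s * w (Ln (\<zeta> i j)))) = (\<Sum>p\<in>T. real_of_int (sign p) * exp (s * w (\<Lambda> p)))"
    unfolding leibniz_def T_def \<Lambda>_def by (simp add: ws sum_distrib_left exp_sum)
  also have "\<dots> = (\<Sum>c\<in>\<Lambda> ` T. \<Sum>p | p \<in> T \<and> \<Lambda> p = c. real_of_int (sign p) * exp (s * w (\<Lambda> p)))"
    by (rule sum.image_gen[OF T(1)])
  also have "\<dots> = (\<Sum>c\<in>\<Lambda> ` T. (\<Sum>p | p \<in> T \<and> \<Lambda> p = c. real_of_int (sign p)) * exp (s * w c))"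
    by (intro sum.cong refl) (auto simp: sum_distrib_right intro!: sum.cong)
  also have "\<dots> = 0" using cls by simp
  finally show ?thesis .
qed

text \<open>Comparing leading exponents gives each point a pair with
  \<open>w (Ln (\<zeta> i) - Ln (\<zeta> j)) = \<beta> j - \<beta> i\<close>. As \<open>w\<close>
  separates the finitely many differences of logarithms, the pair of indices alone determines the
  quotient of the two coordinates.\<close>

lemma small_ball:
  fixes Z :: "(nat \<Rightarrow> complex) set" and n' :: nat
  defines "t \<equiv> fact (3 * fact n') :: nat"
  assumes n: "n \<le> n'"
    and P: "\<And>p. prime p \<Longrightarrow> p \<le> 1 + fact n' * t \<Longrightarrow> p \<in> P"
    and Z: "finite Z" "\<And>\<zeta> j. \<zeta> \<in> Z \<Longrightarrow> j < n \<Longrightarrow> \<zeta> j \<in> U"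
    and small: "\<And>\<zeta> j. \<zeta> \<in> Z \<Longrightarrow> j < n \<Longrightarrow> nm (\<zeta> j) \<le> \<rho>" "real (n' ^ 2) * \<rho> * real (1 + fact n' * t) \<le> 1" "\<rho> \<ge> 0"
    and arg: "\<And>\<zeta> j. \<zeta> \<in> Z \<Longrightarrow> j < n \<Longrightarrow> \<bar>Im (Ln (\<zeta> j))\<bar> \<le> \<delta>" "2 * real n' * real t * \<delta> < 2 * pi"
    and zero: "\<And>r. (\<And>i. i < n \<Longrightarrow> r i \<in> Z) \<Longrightarrow> leibniz n r = 0"
  obtains \<kappa> where "\<And>\<zeta>. \<zeta> \<in> Z \<Longrightarrow> \<exists>i<n. \<exists>j<n. i \<noteq> j \<and> \<zeta> i = \<kappa> i j * \<zeta> j"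
    "\<And>i j. \<kappa> i j \<in> U"
proof -
  define D where "D = (\<lambda>(\<zeta>, i, j). Ln (\<zeta> i) - Ln (\<zeta> j)) ` (Z \<times> {..<n} \<times> {..<n})"
  have "finite D" unfolding D_def using Z(1) by simp
  then obtain c where inj: "inj_on (\<lambda>z. Re z + c * Im z) D" by (rule exists_separating_functional)
  define w where "w z = Re z + c * Im z" for z
  define E where "E \<zeta> j = w (Ln (\<zeta> j))" for \<zeta> and j :: nat
  have van: "leibniz n (\<lambda>i j. exp (s * r i j)) = 0" if r: "\<And>i. i < n \<Longrightarrow> r i \<in> E ` Z" for r s
  proof -
    have "\<forall>i. \<exists>x. i < n \<longrightarrow> x \<in> Z \<and> r i = E x" using r by blast
    then obtain x where x: "\<And>i. i < n \<Longrightarrow> x i \<in> Z" "\<And>i. i < n \<Longrightarrow> r i = E (x i)" by metis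
    have "leibniz n (\<lambda>i j. exp (s * r i j)) = leibniz n (\<lambda>i j. exp (s * w (Ln (x i j))))"
      unfolding leibniz_def
      by (intro sum.cong prod.cong refl arg_cong2[of _ _ _ _ "(*)"]) (auto simp: x E_def)
    also have "\<dots> = 0"
      by (rule twisted_minors[OF n P])
        (use x(1) Z small arg zero in \<open>auto simp: t_def w_def algebra_simps\<close>)
    finally show ?thesis .
  qed
  obtain J \<beta> where J: "J \<subseteq> {..<n}"
    "\<And>x. x \<in> E ` Z \<Longrightarrow> \<exists>i\<in>J. \<exists>j\<in>J. i \<noteq> j \<and> x i + \<beta> i = x j + \<beta> j"
    using tropical_relation[of n "E ` Z", OF van] by blast
  define good where "good \<zeta> i j \<longleftrightarrow> \<zeta> \<in> Z \<and> i < n \<and> j < n \<and> i \<noteq> j \<and> E \<zeta> i + \<beta> i = E \<zeta> j + \<beta> j" for \<zeta> i j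
  \<comment> \<open>For pairs that never occur the default value one keeps \<kappa> inside
    \<open>U\<close>.\<close>
  define \<kappa> where "\<kappa> i j = (if \<exists>\<zeta>. good \<zeta> i j then let \<zeta> = SOME \<zeta>. good \<zeta> i j in \<zeta> i / \<zeta> j else 1)" for i j
  have wdiff: "w (x - y) = w x - w y" for x y by (simp add: w_def algebra_simps)
  have uniq: "\<zeta> i / \<zeta> j = \<zeta>' i / \<zeta>' j" if g: "good \<zeta> i j" "good \<zeta>' i j" for \<zeta> \<zeta>' i j
  proof -
    have "w (Ln (\<zeta> i) - Ln (\<zeta> j)) = w (Ln (\<zeta>' i) - Ln (\<zeta>' j))"
      using g unfolding good_def E_def wdiff by linarith
    moreover have "Ln (\<zeta> i) - Ln (\<zeta> j) \<in> D" "Ln (\<zeta>' i) - Ln (\<zeta>' j) \<in> D"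
      unfolding D_def using g by (force simp: good_def)+
    ultimately have "Ln (\<zeta> i) - Ln (\<zeta> j) = Ln (\<zeta>' i) - Ln (\<zeta>' j)"
      using inj unfolding w_def inj_on_def by blast
    then have "exp (Ln (\<zeta> i)) / exp (Ln (\<zeta> j)) = exp (Ln (\<zeta>' i)) / exp (Ln (\<zeta>' j))"
      by (metis exp_diff)
    then show ?thesis using g Z(2) by (simp add: good_def U_nz)
  qed
  have \<kappa>: "\<kappa> i j = \<zeta> i / \<zeta> j" if "good \<zeta> i j" for \<zeta> i j
  proof -
    have ex: "\<exists>\<zeta>. good \<zeta> i j" using that by blast
    have "good (SOME \<zeta>. good \<zeta> i j) i j" by (rule someI[of "\<lambda>\<zeta>. good \<zeta> i j", OF that])
    then show ?thesis unfolding \<kappa>_def Let_def if_P[OF ex] by (rule uniq[OF _ that])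
  qed
  show ?thesis
  proof (rule that[of \<kappa>])
    fix \<zeta> assume \<zeta>: "\<zeta> \<in> Z"
    from J(2)[of "E \<zeta>"] \<zeta> obtain i j where "i \<in> J" "j \<in> J" "i \<noteq> j" "E \<zeta> i + \<beta> i = E \<zeta> j + \<beta> j" by blast
    then have g: "good \<zeta> i j" using \<zeta> J(1) by (auto simp: good_def)
    then have "\<zeta> i = \<kappa> i j * \<zeta> j" using \<kappa>[OF g] Z(2) by (simp add: good_def U_nz)
    then show "\<exists>i<n. \<exists>j<n. i \<noteq> j \<and> \<zeta> i = \<kappa> i j * \<zeta> j" using g by (auto simp: good_def)
  next
    fix i j
    show "\<kappa> i j \<in> U"
    proof (cases "\<exists>\<zeta>. good \<zeta> i j")
      case True
      then obtain \<zeta> where g: "good \<zeta> i j" by blast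
      then show ?thesis unfolding \<kappa>[OF g] using Z(2) by (auto simp: good_def intro: U_divide)
    qed (simp add: \<kappa>_def U_1)
  qed
qed

text \<open>Every term of the expansion takes one entry from each column, so the bounds
  \<open>g\<close> of the columns add up, while the deviations \<open>e\<close> of all entries
  together absorb the rest. The number of terms is paid only at infinite places.\<close>

lemma av_leibniz:
  assumes v: "v \<in> V" and M: "\<And>i j. i < m \<Longrightarrow> j < m \<Longrightarrow> M i j \<in> U"
    and le: "\<And>i j. i < m \<Longrightarrow> j < m \<Longrightarrow> lv v (M i j) \<le> g j + e i j" "\<And>i j. i < m \<Longrightarrow> j < m \<Longrightarrow> e i j \<ge> 0"
  shows "av v (leibniz m M) \<le> (if v \<in> Vinf then fact m else 1) * exp ((\<Sum>j<m. g j) + (\<Sum>i<m. \<Sum>j<m. e i j))"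
proof -
  define T where "T = {p. p permutes {0..<m}}"
  have finT: "finite T" unfolding T_def by (auto intro: finite_permutations)
  have cT: "card T = fact m" unfolding T_def by (simp add: card_permutations)
  let ?B = "exp ((\<Sum>j<m. g j) + (\<Sum>i<m. \<Sum>j<m. e i j))"
  have tU: "(\<Prod>i<m. M i (p i)) \<in> U" if "p \<in> T" for p
    using that permutes_in_image[of p "{0..<m}"] M by (intro U_prod) (auto simp: T_def)
  have tF: "of_int (sign p) * (\<Prod>i<m. M i (p i)) \<in> F" if "p \<in> T" for p
    using R_signed[OF _ U_R[OF tU[OF that]], of "sign p"] R_F by (auto simp: sign_def)
  have tb: "av v (of_int (sign p) * (\<Prod>i<m. M i (p i))) \<le> ?B" if p: "p \<in> T" for p
  proof -
    have pm: "p i < m" if "i < m" for i using that p permutes_in_image[of p "{0..<m}" i] by (simp add: T_def)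
    have "av v (of_int (sign p) * (\<Prod>i<m. M i (p i))) = av v (\<Prod>i<m. M i (p i))"
      using v tU[OF p] by (intro av_signed) (auto simp: U_F sign_def)
    also have "\<dots> = exp (lv v (\<Prod>i<m. M i (p i)))"
      using v U_F[OF tU[OF p]] U_nz[OF tU[OF p]] by (rule exp_lv[symmetric])
    also have "lv v (\<Prod>i<m. M i (p i)) = (\<Sum>i<m. lv v (M i (p i)))"
      using M pm v by (intro lv_prod) (auto simp: U_F U_nz)
    also have "\<dots> \<le> (\<Sum>i<m. g (p i) + (\<Sum>j<m. e i j))"
    proof (rule sum_mono)
      fix i assume i: "i \<in> {..<m}"
      have "e i (p i) \<le> (\<Sum>j<m. e i j)" using i pm le(2) by (intro member_le_sum) auto
      then show "lv v (M i (p i)) \<le> g (p i) + (\<Sum>j<m. e i j)" using le(1)[of i "p i"] i pm by force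
    qed
    also have "\<dots> = (\<Sum>j<m. g j) + (\<Sum>i<m. \<Sum>j<m. e i j)"
    proof -
      have "(\<Sum>i<m. g (p i)) = (\<Sum>j<m. g j)"
        using p by (intro sum.reindex_bij_betw) (simp add: T_def atLeast0LessThan permutes_imp_bij)
      then show ?thesis by (simp add: sum.distrib)
    qed
    finally show ?thesis by simp
  qed
  show ?thesis
  proof (cases "v \<in> Vinf")
    case True
    have "av v (leibniz m M) \<le> real (card T) * ?B"
      unfolding leibniz_def T_def[symmetric] by (rule av_sum_inf[OF True finT tF tb])
    then show ?thesis using True by (simp add: cT)
  next
    case False
    have "av v (leibniz m M) \<le> ?B"
      unfolding leibniz_def T_def[symmetric] by (rule av_sum_fin[OF _ finT tF tb]) (use v False in auto)
    then show ?thesis using False by simp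
  qed
qed

text \<open>The height, relative to the last coordinate and restricted to \<open>V\<close>, of the projective point
  with coordinates \<open>b k * u k\<close>.\<close>

definition height :: "nat \<Rightarrow> (nat \<Rightarrow> complex) \<Rightarrow> (nat \<Rightarrow> complex) \<Rightarrow> real" where
  "height m b u = (\<Sum>v\<in>V. Max ((\<lambda>k. lv v (b k) + lv v (u k) - lv v (b m) - lv v (u m)) ` {..m})) / real deg"

text \<open>The gap principle. At each place, the relation allows us to compute the minor from the columns
  other than the one of largest size.\<close>

lemma gap_principle:
  assumes b: "\<And>j. j \<le> m \<Longrightarrow> b j \<in> F \<and> b j \<noteq> 0"
    and u: "\<And>i j. i < m \<Longrightarrow> j \<le> m \<Longrightarrow> u i j \<in> U" "\<And>j. j \<le> m \<Longrightarrow> u0 j \<in> U" "\<And>j. j \<le> m \<Longrightarrow> e j \<in> U"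
    and rel: "\<And>i. i < m \<Longrightarrow> (\<Sum>j\<le>m. b j * u i j) = 0"
    and near: "\<And>i j. i < m \<Longrightarrow> j \<le> m \<Longrightarrow> nm (u i j / u0 j) \<le> \<epsilon>"
    and big: "ln (fact m) + real (m * (m + 1)) * \<epsilon> < height m b u0"
  shows "leibniz m (\<lambda>i j. u i j / e j) = 0"
proof (rule ccontr)
  define z where "z i j = u i j / e j" for i j
  define y where "y j = b j * e j" for j
  define z0 where "z0 j = u0 j / e j" for j
  assume "leibniz m (\<lambda>i j. u i j / e j) \<noteq> 0"
  then have D0: "leibniz m z \<noteq> 0" by (simp add: z_def[abs_def])
  have zU: "z i j \<in> U" if "i < m" "j \<le> m" for i j using u that by (simp add: z_def U_divide)
  have z0U: "z0 j \<in> U" if "j \<le> m" for j using u that by (simp add: z0_def U_divide)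
  have y: "y j \<in> F" "y j \<noteq> 0" if "j \<le> m" for j
    using b[OF that] u(3)[OF that] by (auto simp: y_def F_mult U_F U_nz)
  have zrel: "(\<Sum>j\<le>m. y j * z i j) = 0" if "i < m" for i
  proof -
    have "(\<Sum>j\<le>m. y j * z i j) = (\<Sum>j\<le>m. b j * u i j)"
      by (intro sum.cong refl) (use u(3) U_nz in \<open>auto simp: y_def z_def\<close>)
    then show ?thesis using rel[OF that] by simp
  qed
  have DR: "leibniz m z \<in> R"
  proof -
    have "(\<Prod>i<m. z i (p i)) \<in> R" if "p permutes {0..<m}" for p
      using that permutes_in_image[of p "{0..<m}"] zU by (intro R_prod U_R) (auto intro: less_imp_le)
    then show ?thesis unfolding leibniz_def by (intro R_sum R_signed) (auto simp: sign_def)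
  qed
  \<comment> \<open>The local size of the terms of the relation at the reference point; \<eta>
    measures how far the other points deviate from it.\<close>
  define h where "h v k = lv v (y k) + lv v (z0 k)" for v k
  define \<eta> where "\<eta> v i j = \<bar>lv v (z i j) - lv v (z0 j)\<bar>" for v i j
  have "\<exists>k\<le>m. \<forall>j\<le>m. h v j \<le> h v k" for v
  proof -
    have "Max (h v ` {..m}) \<in> h v ` {..m}" by (rule Max_in) auto
    then obtain k where k: "Max (h v ` {..m}) = h v k" "k \<in> {..m}" by (rule imageE)
    have "h v j \<le> h v k" if "j \<le> m" for j unfolding k(1)[symmetric] using that by simp
    then show ?thesis using k(2) by auto
  qed
  then obtain k where k: "\<And>v. k v \<le> m" "\<And>v j. j \<le> m \<Longrightarrow> h v j \<le> h v (k v)" by metis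
  \<comment> \<open>The columns other than \<open>k v\<close> contribute their sizes at the
    reference point, and exchanging column \<open>k v\<close> for column \<open>m\<close> costs the
    quotient of \<open>y m\<close> and \<open>y (k v)\<close>. Together this is the full sum over
    all \<open>m + 1\<close> columns minus the largest term, relative to \<open>y m\<close>.\<close>
  define B where "B v = lv v (y m) - h v (k v) + (\<Sum>j\<le>m. lv v (z0 j)) + (\<Sum>i<m. \<Sum>j\<le>m. \<eta> v i j)" for v
  have bound: "av v (leibniz m z) \<le> (if v \<in> Vinf then fact m else 1) * exp (B v)" if v: "v \<in> V" for v
  proof (cases "k v = m")
    case True
    have "av v (leibniz m z) \<le> (if v \<in> Vinf then fact m else 1) * exp ((\<Sum>j<m. lv v (z0 j)) + (\<Sum>i<m. \<Sum>j<m. \<eta> v i j))"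
      by (rule av_leibniz[OF v]) (auto simp: \<eta>_def intro: zU)
    also have "(\<Sum>j<m. lv v (z0 j)) + (\<Sum>i<m. \<Sum>j<m. \<eta> v i j) \<le> B v"
    proof -
      have "(\<Sum>i<m. \<Sum>j<m. \<eta> v i j) \<le> (\<Sum>i<m. \<Sum>j\<le>m. \<eta> v i j)"
        by (intro sum_mono sum_mono2) (auto simp: \<eta>_def)
      moreover have "(\<Sum>j\<le>m. lv v (z0 j)) = (\<Sum>j<m. lv v (z0 j)) + lv v (z0 m)"
        by (simp add: lessThan_Suc_atMost[symmetric])
      ultimately show ?thesis unfolding B_def True h_def by linarith
    qed
    finally show ?thesis by (simp add: mult_left_mono)
  next
    case False
    define q where "q = k v"
    have q: "q < m" using k(1)[of v] False by (simp add: q_def)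
    define z' where "z' i j = (if j = q then z i m else z i j)" for i j
    \<comment> \<open>The relation expresses column \<open>m\<close> by the others; by Cramer's rule
      only the contribution of column \<open>q\<close> remains.\<close>
    have "leibniz m z' = leibniz m (\<lambda>i j. if j = q then (\<Sum>l<m. z i l * (- y l / y m)) else z i j)"
      unfolding leibniz_def
    proof (intro sum.cong prod.cong refl arg_cong2[of _ _ _ _ "(*)"])
      fix p i assume "i \<in> {..<m}"
      then have i: "i < m" by simp
      have "(\<Sum>l<m. y l * z i l) + y m * z i m = 0"
        using zrel[OF i] by (simp add: lessThan_Suc_atMost[symmetric])
      then have "y m * z i m = - (\<Sum>l<m. y l * z i l)" by (simp add: eq_neg_iff_add_eq_0 add.commute)
      then have "z i m = - (\<Sum>l<m. y l * z i l) / y m" using y(2)[of m] by (simp add: field_simps)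
      also have "\<dots> = (\<Sum>l<m. z i l * (- y l / y m))"
        by (simp add: sum_negf[symmetric] sum_divide_distrib mult.commute)
      finally show "z' i (p i) = (if p i = q then (\<Sum>l<m. z i l * (- y l / y m)) else z i (p i))"
        by (simp add: z'_def)
    qed
    also have "\<dots> = (- y q / y m) * leibniz m z" using q by (rule leibniz_cramer)
    finally have Dq: "leibniz m z = - (y m / y q) * leibniz m z'"
      using y(2)[of m] y(2)[of q] q by (simp add: field_simps)
    have z'F: "leibniz m z' \<in> F"
    proof -
      have "(\<Prod>i<m. z' i (p i)) \<in> R" if "p permutes {0..<m}" for p
        using that permutes_in_image[of p "{0..<m}"] zU
        by (intro R_prod U_R) (auto intro: less_imp_le simp: z'_def)
      then have "leibniz m z' \<in> R" unfolding leibniz_def by (intro R_sum R_signed) (auto simp: sign_def)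
      then show ?thesis using R_F by blast
    qed
    define g where "g j = (if j = q then lv v (z0 m) else lv v (z0 j))" for j
    define d where "d i j = (if j = q then \<eta> v i m else \<eta> v i j)" for i j
    have "av v (leibniz m z') \<le> (if v \<in> Vinf then fact m else 1) * exp ((\<Sum>j<m. g j) + (\<Sum>i<m. \<Sum>j<m. d i j))"
      by (rule av_leibniz[OF v]) (auto simp: \<eta>_def z'_def g_def d_def intro: zU)
    then have "av v (y m / y q) * av v (leibniz m z')
      \<le> av v (y m / y q) * ((if v \<in> Vinf then fact m else 1) * exp ((\<Sum>j<m. g j) + (\<Sum>i<m. \<Sum>j<m. d i j)))"
      using v y q by (intro mult_left_mono av_ge0 F_div) auto
    moreover have "av v (y m / y q) = exp (lv v (y m) - lv v (y q))"
      using v y[of m] y[of q] q by (simp add: lv_divide[symmetric] exp_lv F_div)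
    moreover have "av v (leibniz m z) = av v (y m / y q) * av v (leibniz m z')"
    proof -
      have yF: "y m / y q \<in> F" using y[of m] y[of q] q by (intro F_div) auto
      show ?thesis unfolding Dq mult_minus_left
        by (simp only: av_minus[OF v F_mult[OF yF z'F]] av_mult[OF v yF z'F])
    qed
    ultimately have "av v (leibniz m z) \<le> (if v \<in> Vinf then fact m else 1) *
        exp (lv v (y m) - lv v (y q) + ((\<Sum>j<m. g j) + (\<Sum>i<m. \<Sum>j<m. d i j)))"
      by (simp add: exp_add mult_ac)
    also have "lv v (y m) - lv v (y q) + ((\<Sum>j<m. g j) + (\<Sum>i<m. \<Sum>j<m. d i j)) \<le> B v"
    proof -
      have swap: "(\<Sum>j<m. if j = q then f m else f j) = (\<Sum>j\<le>m. f j) - f q" for f :: "nat \<Rightarrow> real"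
      proof -
        have "(\<Sum>j<m. if j = q then f m else f j) = f m + (\<Sum>j\<in>{..<m} - {q}. f j)"
          using q by (subst sum.remove[of _ q]) (auto intro!: sum.cong)
        also have "\<dots> = f m + ((\<Sum>j<m. f j) - f q)" using q by (simp add: sum_diff1)
        finally show ?thesis by (simp add: lessThan_Suc_atMost[symmetric])
      qed
      have "(\<Sum>i<m. \<Sum>j<m. d i j) \<le> (\<Sum>i<m. \<Sum>j\<le>m. \<eta> v i j)"
        by (intro sum_mono) (auto simp: d_def swap[of "\<eta> v _"], simp add: \<eta>_def)
      moreover have "(\<Sum>j<m. g j) = (\<Sum>j\<le>m. lv v (z0 j)) - lv v (z0 q)" unfolding g_def by (rule swap)
      ultimately show ?thesis unfolding B_def q_def[symmetric] h_def by linarith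
    qed
    finally show ?thesis by (simp add: mult_left_mono)
  qed
  have "real deg * ln (fact m) + (\<Sum>v\<in>V. B v) \<ge> 0"
  proof (rule size_bound[OF DR D0])
    show "av v (leibniz m z) \<le> fact m * exp (B v)" if "v \<in> Vinf" for v
      using bound[of v] that V(2) by auto
    show "av v (leibniz m z) \<le> exp (B v)" if "v \<in> V - Vinf" for v
      using bound[of v] that by auto
  qed simp
  \<comment> \<open>The reference coordinates are units and drop out by the product formula. What
    remains is minus the height, up to the deviations.\<close>
  moreover have "(\<Sum>v\<in>V. B v) \<le> - (real deg * height m b u0) + real deg * (real (m * (m + 1)) * \<epsilon>)"
  proof -
    have "(\<Sum>v\<in>V. \<Sum>j\<le>m. lv v (z0 j)) = 0" using z0U by (subst sum.swap) (simp add: sum_lv_U)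
    moreover have "(\<Sum>v\<in>V. \<Sum>i<m. \<Sum>j\<le>m. \<eta> v i j) \<le> real deg * (real (m * (m + 1)) * \<epsilon>)"
    proof -
      have "(\<Sum>v\<in>V. \<Sum>i<m. \<Sum>j\<le>m. \<eta> v i j) = (\<Sum>i<m. \<Sum>j\<le>m. \<Sum>v\<in>V. \<eta> v i j)"
        by (rule sum_swap3)
      also have "\<dots> \<le> (\<Sum>i<m. \<Sum>j\<le>m. real deg * \<epsilon>)"
      proof (intro sum_mono)
        fix i j assume "i \<in> {..<m}" "j \<in> {..m}"
        then have ij: "i < m" "j \<le> m" by auto
        have "z i j / z0 j = u i j / u0 j" using u(3)[OF ij(2)] U_nz by (simp add: z_def z0_def)
        then have "(\<Sum>v\<in>V. \<eta> v i j) = real deg * nm (u i j / u0 j)"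
          using V(4) zU[OF ij] z0U[OF ij(2)]
          by (simp add: nm_def \<eta>_def lv_divide[symmetric] U_F U_nz)
        also have "\<dots> \<le> real deg * \<epsilon>" using near[OF ij] by (simp add: mult_left_mono)
        finally show "(\<Sum>v\<in>V. \<eta> v i j) \<le> real deg * \<epsilon>" .
      qed
      also have "\<dots> = real deg * (real (m * (m + 1)) * \<epsilon>)" by (simp add: algebra_simps)
      finally show ?thesis .
    qed
    moreover have "(\<Sum>v\<in>V. lv v (y m) - h v (k v)) = - (real deg * height m b u0)"
    proof -
      have "Max ((\<lambda>j. lv v (b j) + lv v (u0 j) - lv v (b m) - lv v (u0 m)) ` {..m}) = h v (k v) - lv v (y m) - lv v (z0 m)"
        if v: "v \<in> V" for v
      proof -
        have eq: "h v j - lv v (y m) - lv v (z0 m) = lv v (b j) + lv v (u0 j) - lv v (b m) - lv v (u0 m)" if "j \<le> m" for j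
          using that v b u by (simp add: h_def y_def z0_def lv_mult lv_divide U_F U_nz)
        show ?thesis
        proof (rule Max_eqI)
          fix x assume "x \<in> (\<lambda>j. lv v (b j) + lv v (u0 j) - lv v (b m) - lv v (u0 m)) ` {..m}"
          then obtain j where j: "j \<le> m" "x = lv v (b j) + lv v (u0 j) - lv v (b m) - lv v (u0 m)" by auto
          show "x \<le> h v (k v) - lv v (y m) - lv v (z0 m)" unfolding j(2) eq[OF j(1), symmetric] using k(2)[OF j(1)] by simp
        next
          show "h v (k v) - lv v (y m) - lv v (z0 m) \<in> (\<lambda>j. lv v (b j) + lv v (u0 j) - lv v (b m) - lv v (u0 m)) ` {..m}"
            using eq[OF k(1)] k(1)[of v] by auto
        qed simp
      qed
      then have "real deg * height m b u0 = (\<Sum>v\<in>V. h v (k v) - lv v (y m) - lv v (z0 m))"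
        using V(4) by (simp add: height_def)
      also have "\<dots> = (\<Sum>v\<in>V. h v (k v) - lv v (y m))"
        using sum_lv_U[OF z0U[of m]] by (simp add: sum_subtractf)
      finally show ?thesis by (simp add: sum_subtractf)
    qed
    ultimately show ?thesis unfolding B_def by (simp add: sum.distrib)
  qed
  ultimately have "real deg * (ln (fact m) + real (m * (m + 1)) * \<epsilon> - height m b u0) \<ge> 0"
    by (simp add: algebra_simps)
  then show False using big V(4) by (simp add: zero_le_mult_iff)
qed

text \<open>The height sees only maxima over the coordinates, whereas the norm needs absolute
  values. They are compared by |g| = 2 max(g, 0) - g, where the sum of g over the places is
  non-negative because \<open>b m\<close> has the least sum of logarithms. Dividing two points
  cancels the coefficients \<open>b\<close>.\<close>

lemma nm_le_height:
  assumes b: "\<And>j. j \<le> m \<Longrightarrow> b j \<in> F \<and> b j \<noteq> 0" and k: "k \<le> m"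
    and u: "\<And>j. j \<le> m \<Longrightarrow> u j \<in> U" "\<And>j. j \<le> m \<Longrightarrow> e j \<in> U"
    and min: "(\<Sum>v\<in>V. lv v (b m)) \<le> (\<Sum>v\<in>V. lv v (b k))"
  shows "nm ((u k / e k) / (u m / e m)) \<le> 2 * height m b u + 2 * height m b e"
proof -
  have key: "(\<Sum>v\<in>V. \<bar>lv v (b k) + lv v (x k) - lv v (b m) - lv v (x m)\<bar>) \<le> 2 * (real deg * height m b x)"
    if x: "\<And>j. j \<le> m \<Longrightarrow> x j \<in> U" for x
  proof -
    define g where "g v j = lv v (b j) + lv v (x j) - lv v (b m) - lv v (x m)" for v j
    \<comment> \<open>The maximum is non-negative because the entry with index \<open>m\<close> is
      zero.\<close>
    have "\<bar>g v k\<bar> \<le> 2 * Max (g v ` {..m}) - g v k" for v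
    proof -
      have "g v k \<le> Max (g v ` {..m})" using k by simp
      moreover have "g v m \<le> Max (g v ` {..m})" by simp
      ultimately show ?thesis by (simp add: g_def abs_if)
    qed
    then have "(\<Sum>v\<in>V. \<bar>g v k\<bar>) \<le> (\<Sum>v\<in>V. 2 * Max (g v ` {..m}) - g v k)" by (intro sum_mono)
    also have "\<dots> = 2 * (\<Sum>v\<in>V. Max (g v ` {..m})) - (\<Sum>v\<in>V. g v k)"
      by (simp add: sum_subtractf sum_distrib_left)
    also have "(\<Sum>v\<in>V. g v k) = (\<Sum>v\<in>V. lv v (b k)) - (\<Sum>v\<in>V. lv v (b m))"
      unfolding g_def using sum_lv_U[OF x[OF k]] sum_lv_U[OF x[of m]] by (simp add: sum_subtractf sum.distrib)
    finally show ?thesis using min V(4) by (simp add: g_def height_def)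
  qed
  have "real deg * nm ((u k / e k) / (u m / e m)) = (\<Sum>v\<in>V. \<bar>lv v ((u k / e k) / (u m / e m))\<bar>)"
    using V(4) by (simp add: nm_def)
  also have "\<dots> \<le> (\<Sum>v\<in>V. \<bar>lv v (b k) + lv v (u k) - lv v (b m) - lv v (u m)\<bar>
      + \<bar>lv v (b k) + lv v (e k) - lv v (b m) - lv v (e m)\<bar>)"
  proof (rule sum_mono)
    fix v assume v: "v \<in> V"
    have div: "lv v (x / y) = lv v x - lv v y" if "x \<in> U" "y \<in> U" for x y
      using lv_divide[OF v] that by (simp add: U_F U_nz)
    have "lv v ((u k / e k) / (u m / e m)) = (lv v (u k) - lv v (e k)) - (lv v (u m) - lv v (e m))"
      using div[OF U_divide[OF u(1)[OF k] u(2)[OF k]] U_divide[OF u(1)[of m] u(2)[of m]]]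
        div[OF u(1)[OF k] u(2)[OF k]] div[OF u(1)[of m] u(2)[of m]] by simp
    then show "\<bar>lv v ((u k / e k) / (u m / e m))\<bar> \<le> \<bar>lv v (b k) + lv v (u k) - lv v (b m) - lv v (u m)\<bar>
      + \<bar>lv v (b k) + lv v (e k) - lv v (b m) - lv v (e m)\<bar>" by linarith
  qed
  also have "\<dots> \<le> 2 * (real deg * height m b u) + 2 * (real deg * height m b e)"
    unfolding sum.distrib using u by (intro add_mono key) auto
  finally have "real deg * nm ((u k / e k) / (u m / e m)) \<le> real deg * (2 * height m b u + 2 * height m b e)"
    by (simp add: algebra_simps)
  then show ?thesis using V(4) by simp
qed

end

section \<open>Sets of units of small doubling\<close>

lemma leibniz_eq_0_of_relation:
  fixes M :: "nat \<Rightarrow> nat \<Rightarrow> 'a::idom"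
  assumes "q < n" "y q \<noteq> 0" "\<And>i. i < n \<Longrightarrow> (\<Sum>j<n. y j * M i j) = 0"
  shows "leibniz n M = 0"
proof -
  have "leibniz n (\<lambda>i j. if j = q then (\<Sum>l<n. M i l * y l) else M i j) = 0"
    unfolding leibniz_def
  proof (rule sum.neutral, clarify)
    fix p assume p: "p permutes {0..<n}"
    obtain i where i: "i < n" "p i = q"
      using permutes_image[OF p] assms(1) by (metis atLeastLessThan_iff imageE zero_le)
    have "(\<Prod>i<n. if p i = q then (\<Sum>l<n. M i l * y l) else M i (p i)) = 0"
      using i assms(3)[OF i(1)] by (intro prod_zero) (auto simp: mult.commute intro!: bexI[of _ i])
    then show "of_int (sign p) * (\<Prod>i<n. if p i = q then (\<Sum>l<n. M i l * y l) else M i (p i)) = 0"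
      by simp
  qed
  then show ?thesis using leibniz_cramer[OF assms(1), of M y] assms(2) by simp
qed

lemma card_le_fibres:
  assumes "finite S" "\<And>y. y \<in> f ` S \<Longrightarrow> card {u \<in> S. f u = y} \<le> k"
  shows "card S \<le> card (f ` S) * k"
proof -
  have "card S = (\<Sum>y\<in>f ` S. card {u \<in> S. f u = y})"
    using sum.image_gen[OF assms(1), of "\<lambda>_. 1::nat" f] by simp
  also have "\<dots> \<le> (\<Sum>y\<in>f ` S. k)" by (rule sum_mono) (use assms in auto)
  finally show ?thesis by simp
qed

text \<open>Minimality among the vanishing subsets through \<open>j0\<close> also excludes those
  that avoid \<open>j0\<close>: the complement of such a subset would be a smaller vanishing subset
  through \<open>j0\<close>.\<close>

lemma exists_minimal_vanishing_subset:
  fixes g :: "'i \<Rightarrow> 'a::ab_group_add"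
  assumes "finite J" "j0 \<in> J" "sum g J = 0"
  shows "\<exists>J'\<subseteq>J. j0 \<in> J' \<and> sum g J' = 0 \<and> (\<forall>K\<subseteq>J'. K \<noteq> {} \<and> K \<noteq> J' \<longrightarrow> sum g K \<noteq> 0)"
proof -
  define C where "C = {J'. J' \<subseteq> J \<and> j0 \<in> J' \<and> sum g J' = 0}"
  have "finite C" "C \<noteq> {}" unfolding C_def using assms by auto
  then obtain J' where J': "J' \<in> C" and min: "\<And>K. K \<in> C \<Longrightarrow> \<not> K \<subset> J'"
    using finite_has_minimal by (metis psubsetE subset_antisym)
  have fin: "finite J'" using J' assms(1) finite_subset by (auto simp: C_def)
  have "sum g K \<noteq> 0" if K: "K \<subseteq> J'" "K \<noteq> {}" "K \<noteq> J'" for K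
  proof
    assume s: "sum g K = 0"
    show False
    proof (cases "j0 \<in> K")
      case True
      then have "K \<in> C" using K J' s by (auto simp: C_def)
      then show False using min K by blast
    next
      case False
      have "sum g (J' - K) = 0" using sum_diff[OF fin K(1), of g] s J' by (simp add: C_def)
      then have "J' - K \<in> C" using K J' False by (auto simp: C_def)
      then show False using min[of "J' - K"] K by blast
    qed
  qed
  then show ?thesis using J' by (auto simp: C_def)
qed

context places
begin

text \<open>A generic combination of the logarithms reduces questions about \<open>U\<close> to sumsets in the real
  numbers.\<close>

lemma exists_generic_log:
  obtains \<Lambda> :: "complex \<Rightarrow> real" where "\<And>x y. x \<in> U \<Longrightarrow> y \<in> U \<Longrightarrow> \<Lambda> (x * y) = \<Lambda> x + \<Lambda> y"
    "\<And>x. x \<in> U \<Longrightarrow> \<Lambda> x = 0 \<Longrightarrow> nm x = 0"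
proof -
  \<comment> \<open>The logarithms become the coefficients of a polynomial. If \<open>s\<close>
    avoids the roots of the countably many non-zero polynomials, a zero value at \<open>s\<close>
    forces all coefficients to vanish.\<close>
  define q where "q x = (\<Sum>v\<in>V. monom (lv v x) v)" for x
  have cq: "coeff (q x) v = lv v x" if "v \<in> V" for x v
    using that V(1) by (simp add: q_def coeff_sum if_distrib cong: if_cong)
  have pq: "poly (q x) s = (\<Sum>v\<in>V. lv v x * s ^ v)" for x s
    by (simp add: q_def poly_sum poly_monom)
  define bad where "bad = (\<Union>x\<in>{x \<in> U. q x \<noteq> 0}. {s. poly (q x) s = 0})"
  have "countable {x \<in> U. q x \<noteq> 0}"
    by (rule countable_subset[OF _ F_countable]) (auto intro: U_F)
  then have "countable bad" unfolding bad_def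
    by (rule countable_UN) (auto intro!: countable_finite poly_roots_finite)
  then obtain s where s: "s \<notin> bad" using uncountable_UNIV_real by (metis UNIV_eq_I)
  show ?thesis
  proof (rule that[of "\<lambda>x. \<Sum>v\<in>V. lv v x * s ^ v"])
    show "(\<Sum>v\<in>V. lv v (x * y) * s ^ v) = (\<Sum>v\<in>V. lv v x * s ^ v) + (\<Sum>v\<in>V. lv v y * s ^ v)"
      if "x \<in> U" "y \<in> U" for x y
      using that by (simp add: lv_mult U_F U_nz distrib_right sum.distrib[symmetric])
    fix x assume x: "x \<in> U" "(\<Sum>v\<in>V. lv v x * s ^ v) = 0"
    then have "q x = 0" using s pq[of x s] by (auto simp: bad_def)
    then have "lv v x = 0" if "v \<in> V" for v using cq[OF that, of x] by simp
    then show "nm x = 0" by (simp add: nm_def)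
  qed
qed

end

lemma ln_fact_le: "ln (fact m) \<le> real m ^ 2"
proof (cases "m = 0")
  case False
  have "(fact m :: real) \<le> of_nat (m ^ m)" by (rule fact_le_power)
  then have "(fact m :: real) \<le> real m ^ m" by simp
  then have "ln (fact m) \<le> ln (real m ^ m)" using False by (subst ln_le_cancel_iff) auto
  also have "\<dots> = real m * ln (real m)" using False by (simp add: ln_realpow)
  also have "\<dots> \<le> real m * real m" using False ln_bound[of "real m"] by (intro mult_left_mono) auto
  finally show ?thesis by (simp add: power2_eq_square)
qed simp

text \<open>The doubling hypothesis is kept for \<open>A\<close>, while solutions are taken in the
  sector \<open>A'\<close>, which need not have small doubling. The range of primes and the bound on
  \<delta> are the conditions of \<open>small_ball\<close> for \<open>n' = N\<close>.\<close>

locale small_doubling = places +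
  fixes A A' :: "complex set" and \<alpha> \<delta> :: real and N :: nat
  assumes A: "finite A" "A \<subseteq> U" "A' \<subseteq> A" "A' \<noteq> {}"
    and doubling: "real (card (prodset A)) \<le> \<alpha> * real (card A)"
    and N: "N \<ge> 2"
    and small_primes: "\<And>p. prime p \<Longrightarrow> p \<le> 1 + fact N * fact (3 * fact N) \<Longrightarrow> p \<in> P"
    and arg: "\<And>a b c d. a \<in> A' \<Longrightarrow> b \<in> A' \<Longrightarrow> c \<in> A' \<Longrightarrow> d \<in> A' \<Longrightarrow> \<bar>Im (Ln ((a / b) * (c / d)))\<bar> \<le> \<delta>"
    and \<delta>: "2 * real N * real (fact (3 * fact N)) * \<delta> < 2 * pi"
begin

definition D :: "complex set" where "D = {a / b | a b. a \<in> A' \<and> b \<in> A'}"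

text \<open>The coordinates of normalised solutions lie in \<open>D\<close>, hence the
  coordinatewise quotients of two solutions lie in \<open>E\<close>. Arguments and norms are needed
  only there.\<close>

definition E :: "complex set" where "E = {x * y | x y. x \<in> D \<and> y \<in> D}"

lemma A_nz: "a \<in> A \<Longrightarrow> a \<noteq> 0" and A_ne: "A \<noteq> {}" and A'_U: "a \<in> A' \<Longrightarrow> a \<in> U"
  using A U_nz by auto

lemma finite_D: "finite D"
proof -
  have "D = (\<lambda>(a, b). a / b) ` (A' \<times> A')" by (auto simp: D_def)
  then show ?thesis using finite_subset[OF A(3,1)] by auto
qed

lemma D_U: "x \<in> D \<Longrightarrow> x \<in> U" by (auto simp: D_def intro: U_divide A'_U)

lemma D_inverse: "x \<in> D \<Longrightarrow> inverse x \<in> D"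
proof -
  assume "x \<in> D"
  then obtain a b where "a \<in> A'" "b \<in> A'" "x = a / b" by (auto simp: D_def)
  then show ?thesis unfolding D_def by (intro CollectI exI[of _ b] exI[of _ a]) simp
qed

lemma D_1: "1 \<in> D"
proof -
  obtain a where "a \<in> A'" using A by blast
  then show ?thesis using U_nz[OF A'_U] by (auto simp: D_def intro!: exI[of _ a])
qed

lemma finite_E: "finite E"
proof -
  have "E = (\<lambda>(a, b). a * b) ` (D \<times> D)" by (auto simp: E_def)
  then show ?thesis using finite_D by auto
qed

lemma E_U: "x \<in> E \<Longrightarrow> x \<in> U" by (auto simp: E_def intro: U_mult D_U)

lemma D_divide_E: "x \<in> D \<Longrightarrow> y \<in> D \<Longrightarrow> x / y \<in> E"
  unfolding E_def divide_inverse using D_inverse by blast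

lemma E_arg: "x \<in> E \<Longrightarrow> \<bar>Im (Ln x)\<bar> \<le> \<delta>"
  unfolding E_def D_def using arg by auto

lemma E_quotient: "x \<in> E \<Longrightarrow> \<exists>b c. b \<in> mpow A 2 \<and> c \<in> mpow A 2 \<and> x = b / c"
proof -
  assume "x \<in> E"
  then obtain a b c d where x: "a \<in> A'" "b \<in> A'" "c \<in> A'" "d \<in> A'" "x = (a / b) * (c / d)"
    by (auto simp: E_def D_def)
  have "a * c \<in> mpow A 2" "b * d \<in> mpow A 2"
    using x A(3) by (auto simp: numeral_2_eq_2 mprod_def image_iff)
  then show ?thesis using x(5) by (intro exI[of _ "a * c"] exI[of _ "b * d"]) simp
qed

lemma card_A: "real (card A) \<ge> 1"
  using A A_ne by (simp add: Suc_le_eq card_gt_0_iff)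

lemma alpha_ge_1: "\<alpha> \<ge> 1"
proof -
  obtain a where a: "a \<in> A" using A_ne by blast
  have "card A \<le> card (prodset A)"
    by (rule card_mult_left_le[of _ a]) (use A a A_nz in \<open>auto intro: prodsetI\<close>)
  then have "1 * real (card A) \<le> \<alpha> * real (card A)" using doubling by linarith
  then show ?thesis using card_A by (simp add: mult_le_cancel_right)
qed

text \<open>The packing bound of a \<open>d\<close>-dimensional normed space, restricted to
  \<open>E\<close>; the integer \<mu> measures the ratio of the radii. It collects all that later
  counting needs to know about the dimension.\<close>

definition packs :: "nat \<Rightarrow> bool" where
  "packs d \<longleftrightarrow> (\<forall>Y rad r \<mu>. Y \<subseteq> E \<longrightarrow> (\<forall>y\<in>Y. nm y \<le> rad) \<longrightarrow> r \<ge> 0 \<longrightarrow>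
    (\<forall>y\<in>Y. \<forall>y'\<in>Y. y \<noteq> y' \<longrightarrow> nm (y / y') > r) \<longrightarrow> real \<mu> * r \<ge> 2 * rad \<longrightarrow> \<mu> \<ge> 1 \<longrightarrow>
    card Y \<le> 2 * (\<mu> + 1) ^ d)"

text \<open>The generic logarithm carries \<open>E\<close> into the rational span of the differences
  of \<open>A\<close>, whose dimension Freiman's lemma bounds. The norm descends to the image,
  because units with the same logarithm differ by an element of norm zero.\<close>

lemma packing_E:
  obtains d where "real d + 1 \<le> 2 * \<alpha>"
    "packs d"
proof -
  obtain \<Lambda> :: "complex \<Rightarrow> real" where \<Lambda>: "\<And>x y. x \<in> U \<Longrightarrow> y \<in> U \<Longrightarrow> \<Lambda> (x * y) = \<Lambda> x + \<Lambda> y"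
    "\<And>x. x \<in> U \<Longrightarrow> \<Lambda> x = 0 \<Longrightarrow> nm x = 0" using exists_generic_log by blast
  have \<Lambda>1: "\<Lambda> 1 = 0" using \<Lambda>(1)[OF U_1 U_1] by simp
  have \<Lambda>i: "\<Lambda> (inverse x) = - \<Lambda> x" if "x \<in> U" for x
    using \<Lambda>(1)[OF that U_inverse[OF that]] \<Lambda>1 U_nz[OF that] by simp
  have \<Lambda>d: "\<Lambda> (x / y) = \<Lambda> x - \<Lambda> y" if "x \<in> U" "y \<in> U" for x y
    using \<Lambda>(1)[OF that(1) U_inverse[OF that(2)]] \<Lambda>i[OF that(2)] by (simp add: divide_inverse)
  have \<Lambda>p: "\<Lambda> (x ^ n) = real n * \<Lambda> x" if "x \<in> U" for x n
    by (induction n) (auto simp: \<Lambda>1 \<Lambda>(1) that U_power algebra_simps)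
  have nm_eq: "nm x = nm y" if "x \<in> U" "y \<in> U" "\<Lambda> x = \<Lambda> y" for x y
  proof -
    have z: "nm (x / y) = 0" "nm (y / x) = 0" using that \<Lambda>(2) \<Lambda>d U_divide by auto
    have "nm (x / y * y) \<le> nm (x / y) + nm y" "nm (y / x * x) \<le> nm (y / x) + nm x"
      by (rule nm_mult; use that U_divide in blast)+
    then show ?thesis using z U_nz that by simp
  qed
  \<comment> \<open>The norm transported to the image; the choice of the preimage is immaterial by
    \<open>nm_eq\<close>.\<close>
  define \<nu> where "\<nu> r = nm (SOME x. x \<in> U \<and> \<Lambda> x = r)" for r
  have \<nu>: "\<nu> (\<Lambda> x) = nm x" if "x \<in> U" for x
  proof -
    have "(SOME y. y \<in> U \<and> \<Lambda> y = \<Lambda> x) \<in> U \<and> \<Lambda> (SOME y. y \<in> U \<and> \<Lambda> y = \<Lambda> x) = \<Lambda> x"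
      by (rule someI[of "\<lambda>y. y \<in> U \<and> \<Lambda> y = \<Lambda> x"]) (use that in simp)
    then show ?thesis unfolding \<nu>_def using nm_eq that by blast
  qed
  define d where "d = rv.dim (diffset \<Lambda> A)"
  have "real ((d + 1) * card A) \<le> real (2 * card (prodset A))"
    unfolding d_def of_nat_le_iff
    by (rule freiman_dim) (use A A_ne A_nz \<Lambda>(1) in \<open>auto simp: subset_iff\<close>)
  also have "\<dots> \<le> (2 * \<alpha>) * real (card A)" using doubling by simp
  finally have "(real d + 1) * real (card A) \<le> (2 * \<alpha>) * real (card A)" by (simp add: algebra_simps)
  then have d: "real d + 1 \<le> 2 * \<alpha>" using card_A by (simp add: mult_le_cancel_right)
  show ?thesis
  proof (rule that[OF d], unfold packs_def, intro allI impI)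
    fix Y rad r and \<mu> :: nat
    assume "Y \<subseteq> E" "\<forall>y\<in>Y. nm y \<le> rad" "r \<ge> 0"
      "\<forall>y\<in>Y. \<forall>y'\<in>Y. y \<noteq> y' \<longrightarrow> nm (y / y') > r" "real \<mu> * r \<ge> 2 * rad" "\<mu> \<ge> 1"
    then have Y: "Y \<subseteq> E" "\<And>y. y \<in> Y \<Longrightarrow> nm y \<le> rad" "r \<ge> 0"
      "\<And>y y'. y \<in> Y \<Longrightarrow> y' \<in> Y \<Longrightarrow> y \<noteq> y' \<Longrightarrow> nm (y / y') > r" "real \<mu> * r \<ge> 2 * rad" "\<mu> \<ge> 1"
      by blast+
    have YU: "y \<in> U" if "y \<in> Y" for y using that Y(1) E_U by blast
    have finY: "finite Y" using Y(1) finite_E finite_subset by blast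
    have inj: "inj_on \<Lambda> Y"
    proof (rule inj_onI, rule ccontr)
      fix y y' assume y: "y \<in> Y" "y' \<in> Y" "\<Lambda> y = \<Lambda> y'" "y \<noteq> y'"
      then have "nm (y / y') = 0" using \<Lambda>d YU by (intro \<Lambda>(2) U_divide) auto
      then show False using Y(4)[OF y(1,2,4)] Y(3) by simp
    qed
    have "\<Lambda> ` Y \<subseteq> rv.span (diffset \<Lambda> A)"
    proof clarify
      fix y assume "y \<in> Y"
      then have "y \<in> E" using Y(1) by blast
      then obtain x1 x2 where "x1 \<in> D" "x2 \<in> D" "y = x1 * x2" unfolding E_def by blast
      then obtain a b c e where "a \<in> A'" "b \<in> A'" "c \<in> A'" "e \<in> A'" "y = (a / b) * (c / e)"
        unfolding D_def by blast
      then have x: "a \<in> A" "b \<in> A" "c \<in> A" "e \<in> A" "y = (a / b) * (c / e)" using A(3) by blast+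
      have "\<Lambda> y = (\<Lambda> a - \<Lambda> b) + (\<Lambda> c - \<Lambda> e)"
      proof -
        have xU: "a \<in> U" "b \<in> U" "c \<in> U" "e \<in> U" using x A(2) by auto
        show ?thesis unfolding x(5) \<Lambda>(1)[OF U_divide[OF xU(1,2)] U_divide[OF xU(3,4)]]
            \<Lambda>d[OF xU(1,2)] \<Lambda>d[OF xU(3,4)] ..
      qed
      also have "\<dots> \<in> rv.span (diffset \<Lambda> A)"
        by (rule rv.span_add; rule rv.span_base) (use x in \<open>auto simp: diffset_def\<close>)
      finally show "\<Lambda> y \<in> rv.span (diffset \<Lambda> A)" .
    qed
    then obtain C where C: "C > 0" "\<And>k. k \<ge> 1 \<Longrightarrow> real (card (hsumset k (\<Lambda> ` Y))) \<le> C * real k ^ d"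
      using hsumset_growth[of "\<Lambda> ` Y" "diffset \<Lambda> A"] finY finite_diffset A(1) unfolding d_def by blast
    have "card (\<Lambda> ` Y) \<le> 2 * (\<mu> + 1) ^ d"
    proof (rule packing[where H = "\<Lambda> ` U" and \<nu> = \<nu> and R = rad and r = r and C = C])
      show "\<Lambda> ` Y \<subseteq> \<Lambda> ` U" using YU by blast
      show "0 \<in> \<Lambda> ` U" using \<Lambda>1 U_1 by force
      show "x + y \<in> \<Lambda> ` U" if "x \<in> \<Lambda> ` U" "y \<in> \<Lambda> ` U" for x y
        using that by (auto simp: \<Lambda>(1)[symmetric] intro!: imageI U_mult)
      show "- x \<in> \<Lambda> ` U" if "x \<in> \<Lambda> ` U" for x
        using that by (auto simp: \<Lambda>i[symmetric] intro!: imageI U_inverse)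
      show "\<nu> (x + y) \<le> \<nu> x + \<nu> y" if "x \<in> \<Lambda> ` U" "y \<in> \<Lambda> ` U" for x y
        using that by (auto simp: \<Lambda>(1)[symmetric] \<nu> U_mult nm_mult)
      show "\<nu> (- x) = \<nu> x" if "x \<in> \<Lambda> ` U" for x
        using that by (auto simp: \<Lambda>i[symmetric] \<nu> U_inverse nm_inverse)
      show "\<nu> (real m * x) = real m * \<nu> x" if "x \<in> \<Lambda> ` U" for x m
        using that by (auto simp: \<Lambda>p[symmetric] \<nu> U_power nm_power)
      show "\<nu> y \<le> rad" if "y \<in> \<Lambda> ` Y" for y using that YU Y(2) by (auto simp: \<nu>)
      show "\<nu> (y - y') > r" if "y \<in> \<Lambda> ` Y" "y' \<in> \<Lambda> ` Y" "y \<noteq> y'" for y y'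
      proof -
        from that obtain x x' where x: "x \<in> Y" "x' \<in> Y" "y = \<Lambda> x" "y' = \<Lambda> x'" "x \<noteq> x'" by blast
        then have "\<nu> (y - y') = nm (x / x')" using \<Lambda>d[OF YU YU] \<nu>[OF U_divide[OF YU YU]] by metis
        then show ?thesis using Y(4)[OF x(1,2,5)] by simp
      qed
    qed (use finY C Y in auto)
    then show "card Y \<le> 2 * (\<mu> + 1) ^ d" using inj by (simp add: card_image)
  qed
qed

text \<open>A maximal separated set is also a net, and separation bounds its size.\<close>

lemma exists_clusters:
  assumes pack: "packs d"
    and r: "r \<ge> 0" "real \<mu> * r \<ge> 2 * rad" "\<mu> \<ge> 1"
  shows "\<exists>Y cl. finite Y \<and> card Y \<le> 2 * (\<mu> + 1) ^ d \<and> Y \<subseteq> U \<and> (\<forall>x\<in>E. nm x \<le> rad \<longrightarrow> cl x \<in> Y \<and> nm (x / cl x) \<le> r)"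
proof -
  define X where "X = {x \<in> E. nm x \<le> rad}"
  define \<S> where "\<S> = {Y. Y \<subseteq> X \<and> (\<forall>y\<in>Y. \<forall>y'\<in>Y. y \<noteq> y' \<longrightarrow> nm (y / y') > r)}"
  have finX: "finite X" using finite_E by (simp add: X_def)
  then have "finite \<S>" by (simp add: \<S>_def)
  moreover have "{} \<in> \<S>" by (simp add: \<S>_def)
  ultimately obtain Y where Y: "Y \<in> \<S>" and max: "\<And>Y'. Y' \<in> \<S> \<Longrightarrow> \<not> Y \<subset> Y'"
    using finite_has_maximal[of \<S>] by (metis empty_iff psubsetE subset_antisym)
  have finY: "finite Y" using Y finX finite_subset by (auto simp: \<S>_def)
  have near: "\<exists>y\<in>Y. nm (x / y) \<le> r" if x: "x \<in> X" for x
  proof (rule ccontr)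
    assume neg: "\<not> ?thesis"
    have xU: "x \<in> U" using x E_U by (auto simp: X_def)
    have YU: "y \<in> U" if "y \<in> Y" for y using that Y E_U by (auto simp: X_def \<S>_def)
    have "x \<notin> Y" using neg r(1) U_nz[OF xU] by (auto simp: nm_1)
    moreover have "insert x Y \<in> \<S>"
    proof -
      have "nm (x / y) > r" "nm (y / x) > r" if "y \<in> Y" for y
        using neg that nm_divide_commute[OF xU YU[OF that]] by (auto simp: not_le)
      then show ?thesis using Y x unfolding \<S>_def by blast
    qed
    ultimately show False using max by blast
  qed
  define cl where "cl x = (SOME y. y \<in> Y \<and> nm (x / y) \<le> r)" for x
  have cl: "cl x \<in> Y \<and> nm (x / cl x) \<le> r" if "x \<in> X" for x
    unfolding cl_def by (rule someI_ex[of "\<lambda>y. y \<in> Y \<and> nm (x / y) \<le> r"]) (use near[OF that] in blast)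
  have "card Y \<le> 2 * (\<mu> + 1) ^ d"
    by (rule pack[unfolded packs_def, rule_format, of Y rad r]) (use Y r in \<open>auto simp: \<S>_def X_def\<close>)
  moreover have "Y \<subseteq> U" using Y E_U by (auto simp: \<S>_def X_def)
  ultimately show ?thesis using finY cl by (intro exI[of _ Y] exI[of _ cl]) (auto simp: X_def)
qed

text \<open>The unit \<open>16 * N ^ 2\<close> is such that a distance of scale \<open>Suc k\<close>
  forces the height to be at least \<open>2 * N ^ 2 * 2 ^ k\<close>, as the gap principle requires
  in cells of diameter \<open>2 ^ k\<close>. All smaller distances share the scale zero.\<close>

definition scale :: "real \<Rightarrow> nat" where
  "scale x = (LEAST k. x < 16 * real (N ^ 2) * 2 ^ k)"

lemma scale_less: "x < 16 * real (N ^ 2) * 2 ^ scale x"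
proof -
  obtain k where "x / (16 * real (N ^ 2)) < 2 ^ k" using real_arch_pow[of 2] by auto
  then have "x < 16 * real (N ^ 2) * 2 ^ k" using N by (simp add: field_simps)
  then show ?thesis unfolding scale_def by (rule LeastI)
qed

lemma scale_ge: "scale x = Suc k \<Longrightarrow> x \<ge> 16 * real (N ^ 2) * 2 ^ k"
  unfolding scale_def using not_less_Least[of k "\<lambda>k. x < 16 * real (N ^ 2) * 2 ^ k"] by fastforce

definition Sc :: "nat set" where "Sc = (\<lambda>x. scale (nm x)) ` E"

lemma finite_Sc: "finite Sc" using finite_E by (simp add: Sc_def)

text \<open>With no two scales adjacent, the norm of each representative exceeds the sum of the
  norms of all earlier ones. Products over different subsets are then different, as the largest
  index in the symmetric difference shows. Elements of \<open>E\<close> are quotients of products of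
  two elements of \<open>A\<close>, so counting subsets of size \<open>j\<close> gives (card I /
  j)^j at most \<alpha>^(4 j) times the size of \<open>A\<close>.\<close>

lemma card_sparse_scales:
  assumes I: "I \<subseteq> Sc" "0 \<notin> I" and sparse: "\<And>k. k \<in> I \<Longrightarrow> Suc k \<notin> I" and j: "j \<ge> 1"
  shows "real (card I) \<le> real j * \<alpha> ^ 4 * root j (real (card A))"
proof -
  have "\<forall>k\<in>I. \<exists>x\<in>E. scale (nm x) = k" using I by (auto simp: Sc_def)
  then obtain g where g: "\<And>k. k \<in> I \<Longrightarrow> g k \<in> E \<and> scale (nm (g k)) = k" by metis
  define c where "c = 16 * real (N ^ 2)"
  have c: "c > 0" using N by (simp add: c_def)
  have gU: "g k \<in> U" if "k \<in> I" for k using g that E_U by blast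
  have up: "nm (g k) < c * 2 ^ k" if "k \<in> I" for k using g[OF that] scale_less[of "nm (g k)"] by (simp add: c_def)
  have lo: "nm (g k) \<ge> c * 2 ^ (k - 1)" if k: "k \<in> I" for k
  proof -
    obtain k' where "k = Suc k'" using k I(2) by (cases k) auto
    then show ?thesis using scale_ge[of "nm (g k)" k'] g[OF k] by (simp add: c_def)
  qed
  have finI: "finite I" using I(1) finite_Sc finite_subset by blast
  \<comment> \<open>The geometric series up to the scale before the previous one stays below the
    lower bound for \<open>nm (g i)\<close>.\<close>
  have sums: "(\<Sum>k\<in>K. nm (g k)) < nm (g i)" if K: "K \<subseteq> I" "i \<in> I" "\<And>k. k \<in> K \<Longrightarrow> k < i" for K i
  proof -
    obtain i' where i': "i = Suc i'" using K(2) I(2) by (cases i) auto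
    have Ki: "k < i'" if "k \<in> K" for k using K(3)[OF that] sparse[of k] K(1,2) that i' by (cases "k = i'") auto
    have "(\<Sum>k\<in>K. nm (g k)) \<le> (\<Sum>k\<in>K. c * 2 ^ k)" by (rule sum_mono) (use up K in \<open>auto intro: less_imp_le\<close>)
    also have "\<dots> \<le> (\<Sum>k<i'. c * 2 ^ k)" by (rule sum_mono2) (use Ki c in auto)
    also have "\<dots> = c * (2 ^ i' - 1)"
    proof -
      have "(\<Sum>k<i'. (2::real) ^ k) = 2 ^ i' - 1" by (induction i') auto
      then show ?thesis by (simp add: sum_distrib_left[symmetric])
    qed
    also have "\<dots> < c * 2 ^ i'" using c by simp
    also have "\<dots> \<le> nm (g i)" using lo[OF K(2)] i' by simp
    finally show ?thesis .
  qed
  have key: False if T: "T \<subseteq> I" "T' \<subseteq> I" "(\<Prod>i\<in>T. g i) = (\<Prod>i\<in>T'. g i)" "i \<in> T - T'"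
    "\<And>k. k \<in> (T - T') \<union> (T' - T) \<Longrightarrow> k \<le> i" for T T' i
  proof -
    have fin: "finite T" "finite T'" using T finI finite_subset by blast+
    let ?K = "T - T' - {i}" and ?L = "T' - T"
    have nz: "(\<Prod>i\<in>T \<inter> T'. g i) \<noteq> 0" using gU T(1) fin U_nz by (auto simp: subset_iff)
    have "(\<Prod>i\<in>T. g i) = (\<Prod>i\<in>T - T'. g i) * (\<Prod>i\<in>T \<inter> T'. g i)"
      using fin by (subst prod.union_disjoint[symmetric]) (auto intro: prod.cong)
    moreover have "(\<Prod>i\<in>T'. g i) = (\<Prod>i\<in>?L. g i) * (\<Prod>i\<in>T \<inter> T'. g i)"
      using fin by (subst prod.union_disjoint[symmetric]) (auto intro: prod.cong)
    ultimately have "(\<Prod>i\<in>T - T'. g i) = (\<Prod>i\<in>?L. g i)" using T(3) nz by simp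
    moreover have "(\<Prod>i\<in>T - T'. g i) = g i * (\<Prod>i\<in>?K. g i)" using fin T(4) by (intro prod.remove) auto
    ultimately have eq: "g i * (\<Prod>i\<in>?K. g i) = (\<Prod>i\<in>?L. g i)" by simp
    have KU: "(\<Prod>i\<in>?K. g i) \<in> U" "(\<Prod>i\<in>?L. g i) \<in> U" using gU T by (auto intro!: U_prod)
    have "g i = (\<Prod>i\<in>?L. g i) / (\<Prod>i\<in>?K. g i)"
      using eq U_nz[OF KU(1)] by (metis nonzero_mult_div_cancel_right)
    then have "nm (g i) \<le> nm (\<Prod>i\<in>?L. g i) + nm (\<Prod>i\<in>?K. g i)" using nm_divide[OF KU(2,1)] by simp
    also have "\<dots> \<le> (\<Sum>i\<in>?L. nm (g i)) + (\<Sum>i\<in>?K. nm (g i))"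
      using gU T fin by (intro add_mono nm_prod) auto
    also have "\<dots> = (\<Sum>i\<in>?L \<union> ?K. nm (g i))" using fin by (intro sum.union_disjoint[symmetric]) auto
    also have "\<dots> < nm (g i)"
    proof (rule sums)
      show "k < i" if "k \<in> ?L \<union> ?K" for k
      proof -
        have "k \<le> i" "k \<noteq> i" using T(4,5) that by auto
        then show ?thesis by simp
      qed
    qed (use T in auto)
    finally show False by simp
  qed
  have inj: "inj_on (\<lambda>T. \<Prod>i\<in>T. g i) {T. T \<subseteq> I \<and> card T = j}"
  proof (rule inj_onI, rule ccontr)
    fix T T' assume T: "T \<in> {T. T \<subseteq> I \<and> card T = j}" "T' \<in> {T. T \<subseteq> I \<and> card T = j}"
      and eq: "(\<Prod>i\<in>T. g i) = (\<Prod>i\<in>T'. g i)" and "T \<noteq> T'"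
    define S where "S = (T - T') \<union> (T' - T)"
    have S: "finite S" "S \<noteq> {}" using T \<open>T \<noteq> T'\<close> finite_subset[OF _ finI] by (auto simp: S_def)
    define i where "i = Max S"
    have i: "i \<in> S" "\<And>k. k \<in> S \<Longrightarrow> k \<le> i" using S by (auto simp: i_def)
    then consider "i \<in> T - T'" | "i \<in> T' - T" by (auto simp: S_def)
    then show False
    proof cases
      case 1 then show False using key[of T T' i] T eq i by (auto simp: S_def)
    next
      case 2 then show False using key[of T' T i] T eq i by (auto simp: S_def)
    qed
  qed
  have bin: "real (card I choose j) \<le> \<alpha> ^ (2 * (2 * j)) * real (card A)"
    by (rule binomial_le_of_distinct_products[OF A(1) A_ne _ doubling finI _ inj])
      (use A_nz g E_quotient in auto)
  have \<alpha>: "\<alpha> ^ 4 \<ge> 1" using alpha_ge_1 by simp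
  have rt: "root j (real (card A)) \<ge> 1" using card_A j by simp
  show ?thesis
  proof (cases "j \<le> card I")
    case False
    have "1 * 1 \<le> \<alpha> ^ 4 * root j (real (card A))" using \<alpha> rt by (intro mult_mono) auto
    then have "real j * (1 * 1) \<le> real j * (\<alpha> ^ 4 * root j (real (card A)))" by (intro mult_left_mono) auto
    then show ?thesis using False unfolding mult.assoc by linarith
  next
    case True
    have "(real (card I) / real j) ^ j \<le> real (card I choose j)"
      using binomial_ge_n_over_k_pow_k[OF True, where ?'a = real] by simp
    also have "\<dots> \<le> (\<alpha> ^ 4) ^ j * real (card A)" using bin by (simp add: power_mult[symmetric])
    also have "\<dots> = (\<alpha> ^ 4 * root j (real (card A))) ^ j" using j by (simp add: power_mult_distrib)
    finally have "real (card I) / real j \<le> \<alpha> ^ 4 * root j (real (card A))"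
      using \<alpha> rt j by (subst (asm) power_mono_iff) auto
    then show ?thesis using j by (simp add: field_simps)
  qed
qed

text \<open>Even and odd scales are treated separately so that no two are adjacent; the scale zero
  has no lower bound on norms and is counted by itself.\<close>

lemma card_Sc: 
  assumes "j \<ge> 1"
  shows "real (card Sc) \<le> 1 + 2 * (real j * \<alpha> ^ 4 * root j (real (card A)))"
proof -
  let ?E = "{k \<in> Sc. even k \<and> k \<noteq> 0}" and ?O = "{k \<in> Sc. odd k}"
  have "Sc \<subseteq> insert 0 (?E \<union> ?O)" by auto
  then have "card Sc \<le> card (insert 0 (?E \<union> ?O))" using finite_Sc by (intro card_mono) auto
  also have "\<dots> \<le> 1 + (card ?E + card ?O)"
    using card_Un_le[of ?E ?O] card_insert_le_m1[of "Suc (card (?E \<union> ?O))" "?E \<union> ?O" 0] finite_Sc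
    by (simp add: card_insert_if)
  finally have "real (card Sc) \<le> 1 + (real (card ?E) + real (card ?O))" by linarith
  moreover have "real (card ?E) \<le> real j * \<alpha> ^ 4 * root j (real (card A))"
    by (rule card_sparse_scales[OF _ _ _ assms]) auto
  moreover have "real (card ?O) \<le> real j * \<alpha> ^ 4 * root j (real (card A))"
    by (rule card_sparse_scales[OF _ _ _ assms]) (auto intro: Nat.gr0I)
  ultimately show ?thesis by linarith
qed

end

section \<open>Counting non-degenerate solutions\<close>

context small_doubling
begin

text \<open>Solutions matter only up to scaling, so their coordinate of least index is normalised to one.\<close>

definition Q :: "nat set \<Rightarrow> (nat \<Rightarrow> complex) \<Rightarrow> (nat \<Rightarrow> complex) set" where
  "Q I b = {u \<in> extensional I. u (Min I) = 1 \<and> (\<forall>i\<in>I. \<forall>j\<in>I. u i / u j \<in> D)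
    \<and> (\<Sum>i\<in>I. b i * u i) = 0 \<and> (\<forall>J\<subseteq>I. J \<noteq> {} \<and> J \<noteq> I \<longrightarrow> (\<Sum>i\<in>J. b i * u i) \<noteq> 0)}"

lemma QD:
  assumes "u \<in> Q I b"
  shows "u \<in> extensional I" "u (Min I) = 1" "\<And>i j. i \<in> I \<Longrightarrow> j \<in> I \<Longrightarrow> u i / u j \<in> D"
    "(\<Sum>i\<in>I. b i * u i) = 0" "\<And>J. J \<subseteq> I \<Longrightarrow> J \<noteq> {} \<Longrightarrow> J \<noteq> I \<Longrightarrow> (\<Sum>i\<in>J. b i * u i) \<noteq> 0"
  using assms unfolding Q_def by auto

lemma Q_D: "u \<in> Q I b \<Longrightarrow> finite I \<Longrightarrow> I \<noteq> {} \<Longrightarrow> i \<in> I \<Longrightarrow> u i \<in> D"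
  using QD(3)[of u I b i "Min I"] QD(2)[of u I b] by simp

lemma Q_U: "u \<in> Q I b \<Longrightarrow> finite I \<Longrightarrow> I \<noteq> {} \<Longrightarrow> i \<in> I \<Longrightarrow> u i \<in> U"
  using Q_D D_U by blast

lemma finite_Q: "finite I \<Longrightarrow> I \<noteq> {} \<Longrightarrow> finite (Q I b)"
proof -
  assume I: "finite I" "I \<noteq> {}"
  have "Q I b \<subseteq> I \<rightarrow>\<^sub>E D" using Q_D[OF _ I] QD(1) by (auto simp: PiE_def)
  then show ?thesis by (rule finite_subset) (use I(1) finite_D in \<open>auto intro!: finite_PiE\<close>)
qed

lemma card_Q_le_1:
  assumes I: "finite I" "I \<noteq> {}" "card I \<le> 2" and b: "\<And>i. i \<in> I \<Longrightarrow> b i \<noteq> 0"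
  shows "card (Q I b) \<le> 1"
proof -
  have "u = u'" if u: "u \<in> Q I b" "u' \<in> Q I b" for u u'
  proof (rule extensionalityI[OF QD(1)[OF u(1)] QD(1)[OF u(2)]])
    fix i assume i: "i \<in> I"
    define m where "m = Min I"
    have m: "m \<in> I" using I by (simp add: m_def)
    show "u i = u' i"
    proof (cases "i = m")
      case True
      then show ?thesis using QD(2)[OF u(1)] QD(2)[OF u(2)] by (simp add: m_def)
    next
      case False
      have "{m, i} = I" by (rule card_seteq[OF I(1)]) (use i m False I(3) in auto)
      then have I': "I = {m, i}" by simp
      have s: "(\<Sum>i\<in>I. b i * w i) = b m * w m + b i * w i" for w using False by (simp add: I')
      have "b m + b i * u i = 0" "b m + b i * u' i = 0"
        using QD(2,4)[OF u(1)] QD(2,4)[OF u(2)] s by (simp_all add: m_def)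
      then have "b i * u i = b i * u' i" by (metis add_left_cancel)
      then show ?thesis using b[OF i] by simp
    qed
  qed
  then have "\<exists>u. Q I b \<subseteq> {u}" by blast
  then show ?thesis using card_mono[of "{_}"] by fastforce
qed

definition normalize :: "nat set \<Rightarrow> (nat \<Rightarrow> complex) \<Rightarrow> nat \<Rightarrow> complex" where
  "normalize K u = (\<lambda>i\<in>K. u i / u (Min K))"

text \<open>A further relation \<open>c\<close> with fewer terms splits a solution into a solution of a subsum of \<open>c\<close>
  and a solution of the equation with the corresponding terms merged.\<close>

lemma card_le_of_relation:
  assumes I: "finite I" and b: "\<And>i. i \<in> I \<Longrightarrow> b i \<in> F \<and> b i \<noteq> 0"
    and S: "S \<subseteq> Q I b" and c: "\<And>i. i \<in> I \<Longrightarrow> c i \<in> F" "ia \<in> I" "c ia \<noteq> 0" "iz \<in> I" "c iz = 0"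
    and rel: "\<And>u. u \<in> S \<Longrightarrow> (\<Sum>i\<in>I. c i * u i) = 0"
    and IH: "\<And>I' b'. finite I' \<Longrightarrow> I' \<noteq> {} \<Longrightarrow> card I' < card I \<Longrightarrow> (\<And>i. i \<in> I' \<Longrightarrow> b' i \<in> F \<and> b' i \<noteq> 0) \<Longrightarrow>
      card (Q I' b') \<le> B"
  shows "card S \<le> 2 ^ card I * B ^ 2"
proof -
  have I0: "I \<noteq> {}" using c by auto
  define J where "J = {i \<in> I. c i \<noteq> 0}"
  have J: "finite J" "J \<subseteq> I" "ia \<in> J" "iz \<notin> J" using I c by (auto simp: J_def)
  have finS: "finite S" using S finite_Q[OF I I0] finite_subset by blast
  have u_nz: "u i \<noteq> 0" if "u \<in> S" "i \<in> I" for u i using Q_U[OF _ I I0 that(2)] S that(1) U_nz by blast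
  define S' where "S' J' = {u \<in> S. (\<Sum>i\<in>J'. c i * u i) = 0 \<and>
    (\<forall>K\<subseteq>J'. K \<noteq> {} \<and> K \<noteq> J' \<longrightarrow> (\<Sum>i\<in>K. c i * u i) \<noteq> 0)}" for J'
  have cover: "S \<subseteq> (\<Union>J'\<in>{J'. J' \<subseteq> J \<and> ia \<in> J'}. S' J')"
  proof
    fix u assume u: "u \<in> S"
    have "(\<Sum>i\<in>J. c i * u i) = (\<Sum>i\<in>I. c i * u i)"
      by (rule sum.mono_neutral_left) (use I in \<open>auto simp: J_def\<close>)
    then have "(\<Sum>i\<in>J. c i * u i) = 0" using rel[OF u] by simp
    from exists_minimal_vanishing_subset[OF J(1,3) this]
    show "u \<in> (\<Union>J'\<in>{J'. J' \<subseteq> J \<and> ia \<in> J'}. S' J')" using u by (auto simp: S'_def)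
  qed
  \<comment> \<open>The relation vanishes on \<open>J'\<close> minimally. Since \<open>iz\<close> is
    not in \<open>J'\<close>, both the subsum and the merged equation have fewer terms than the
    original one, and each contributes a factor \<open>B\<close>.\<close>
  have bound: "card (S' J') \<le> B ^ 2" if J': "J' \<subseteq> J" "ia \<in> J'" for J'
  proof (cases "card J' = 1")
    case True
    then obtain x where "J' = {x}" by (auto simp: card_1_singleton_iff)
    then have "J' = {ia}" using J'(2) by auto
    then have "S' J' = {}" using u_nz c(2,3) by (auto simp: S'_def)
    then show ?thesis by simp
  next
    case False
    have "iz \<notin> J'" using J'(1) J(4) by blast
    then have fJ': "finite J'" "J' \<noteq> {}" "J' \<subseteq> I" "J' \<noteq> I"
      using finite_subset[OF J'(1) J(1)] J' J(2) c(4) by auto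
    then have cJ': "card J' \<ge> 2" using False card_gt_0_iff[of J'] by linarith
    define m0 where "m0 = Min J'"
    have m0: "m0 \<in> J'" using fJ' by (simp add: m0_def)
    \<comment> \<open>The terms of \<open>J'\<close> are merged into one, placed at the index
      \<open>m0\<close>.\<close>
    define I2 where "I2 = insert m0 (I - J')"
    have I2: "finite I2" "I2 \<noteq> {}" "I2 \<subseteq> I" using I m0 fJ' by (auto simp: I2_def)
    have "card I2 = Suc (card I - card J')"
      unfolding I2_def using I fJ' m0 by (simp add: card_Diff_subset)
    then have cI2: "card I2 < card I" using cJ' card_mono[OF I fJ'(3)] by linarith
    have cJ'I: "card J' < card I" using I fJ' by (intro psubset_card_mono) auto
    \<comment> \<open>The merged coefficient depends on the normalised solution on
      \<open>J'\<close>. It is non-zero because the original solution is non-degenerate.\<close>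
    define bm where "bm \<kappa> i = (if i = m0 then (\<Sum>j\<in>J'. b j * \<kappa> j) else b i)" for \<kappa> :: "nat \<Rightarrow> complex" and i
    let ?K = "normalize J' ` S' J'"
    have SQ: "u \<in> Q I b" if "u \<in> S' J'" for u using that S by (auto simp: S'_def)
    have unz: "u i \<noteq> 0" if "u \<in> S' J'" "i \<in> I" for u i using that u_nz by (auto simp: S'_def)
    have m0I: "m0 \<in> I" using m0 fJ' by blast
    have K_in: "?K \<subseteq> Q J' c"
    proof clarify
      fix u assume u: "u \<in> S' J'"
      have sc: "(\<Sum>i\<in>K. c i * normalize J' u i) = (\<Sum>i\<in>K. c i * u i) / u m0" if "K \<subseteq> J'" for K
        unfolding sum_divide_distrib normalize_def m0_def[symmetric]
        by (intro sum.cong refl) (use that in auto)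
      have "normalize J' u i / normalize J' u j \<in> D" if "i \<in> J'" "j \<in> J'" for i j
        using QD(3)[OF SQ[OF u], of i j] that fJ'(3) unz[OF u m0I]
        by (auto simp: normalize_def m0_def[symmetric])
      moreover have "normalize J' u (Min J') = 1" using m0 unz[OF u m0I] by (simp add: normalize_def m0_def)
      moreover have "normalize J' u \<in> extensional J'" by (simp add: normalize_def)
      moreover have "(\<Sum>i\<in>J'. c i * normalize J' u i) = 0" using sc[of J'] u by (simp add: S'_def)
      moreover have "(\<Sum>i\<in>K. c i * normalize J' u i) \<noteq> 0" if "K \<subseteq> J'" "K \<noteq> {}" "K \<noteq> J'" for K
        using sc[OF that(1)] u unz[OF u m0I] that by (simp add: S'_def)
      ultimately show "normalize J' u \<in> Q J' c" unfolding Q_def by blast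
    qed
    have I2_in: "normalize I2 u \<in> Q I2 (bm (normalize J' u))" if u: "u \<in> S' J'" for u
    proof -
      define m2 where "m2 = Min I2"
      have "m2 \<in> I2" unfolding m2_def by (rule Min_in[OF I2(1,2)])
      then have m2: "m2 \<in> I2" "m2 \<in> I" using I2(3) by auto
      have bmu: "bm (normalize J' u) m0 * u m0 = (\<Sum>j\<in>J'. b j * u j)"
        unfolding bm_def normalize_def m0_def[symmetric]
        using unz[OF u m0I] by (auto simp: sum_distrib_right intro!: sum.cong)
      have sc: "(\<Sum>i\<in>K. bm (normalize J' u) i * normalize I2 u i)
          = (\<Sum>i\<in>(if m0 \<in> K then K \<union> J' else K). b i * u i) / u m2" if K: "K \<subseteq> I2" for K
      proof -
        have fK: "finite K" using K I2(1) finite_subset by blast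
        have "(\<Sum>i\<in>K. bm (normalize J' u) i * normalize I2 u i) = (\<Sum>i\<in>K. bm (normalize J' u) i * u i) / u m2"
          unfolding sum_divide_distrib by (intro sum.cong refl) (use K in \<open>auto simp: normalize_def m2_def\<close>)
        also have "(\<Sum>i\<in>K. bm (normalize J' u) i * u i) = (\<Sum>i\<in>(if m0 \<in> K then K \<union> J' else K). b i * u i)"
        proof (cases "m0 \<in> K")
          case True
          have "(\<Sum>i\<in>K. bm (normalize J' u) i * u i)
              = bm (normalize J' u) m0 * u m0 + (\<Sum>i\<in>K - {m0}. bm (normalize J' u) i * u i)"
            by (rule sum.remove[OF fK True])
          also have "(\<Sum>i\<in>K - {m0}. bm (normalize J' u) i * u i) = (\<Sum>i\<in>K - {m0}. b i * u i)"
            by (intro sum.cong) (auto simp: bm_def)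
          also have "bm (normalize J' u) m0 * u m0 + (\<Sum>i\<in>K - {m0}. b i * u i) = (\<Sum>i\<in>J' \<union> (K - {m0}). b i * u i)"
            unfolding bmu by (rule sum.union_disjoint[symmetric]) (use fJ' fK K in \<open>auto simp: I2_def\<close>)
          also have "J' \<union> (K - {m0}) = K \<union> J'" using m0 by auto
          finally show ?thesis using True by simp
        next
          case False
          then show ?thesis by (auto simp: bm_def intro!: sum.cong)
        qed
        finally show ?thesis .
      qed
      have "normalize I2 u i / normalize I2 u j \<in> D" if "i \<in> I2" "j \<in> I2" for i j
        using QD(3)[OF SQ[OF u], of i j] that I2(3) unz[OF u m2(2)]
        by (auto simp: normalize_def m2_def[symmetric])
      moreover have "normalize I2 u (Min I2) = 1" using m2 unz[OF u m2(2)] by (simp add: normalize_def m2_def)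
      moreover have "normalize I2 u \<in> extensional I2" by (simp add: normalize_def)
      moreover have "(\<Sum>i\<in>I2. bm (normalize J' u) i * normalize I2 u i) = 0"
      proof -
        have "I2 \<union> J' = I" using fJ'(3) m0 by (auto simp: I2_def)
        then show ?thesis using sc[of I2] QD(4)[OF SQ[OF u]] by (simp add: I2_def)
      qed
      \<comment> \<open>A proper subsum of the merged equation is a proper subsum of the original
        one, with \<open>m0\<close> expanded to \<open>J'\<close>.\<close>
      moreover have "(\<Sum>i\<in>K. bm (normalize J' u) i * normalize I2 u i) \<noteq> 0" if K: "K \<subseteq> I2" "K \<noteq> {}" "K \<noteq> I2" for K
      proof -
        have "(if m0 \<in> K then K \<union> J' else K) \<noteq> I"
          using K m0I m0 by (auto simp: I2_def)
        then have "(\<Sum>i\<in>(if m0 \<in> K then K \<union> J' else K). b i * u i) \<noteq> 0"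
          by (intro QD(5)[OF SQ[OF u]]) (use K I2(3) fJ'(3) in auto)
        then show ?thesis using sc[OF K(1)] unz[OF u m2(2)] by simp
      qed
      ultimately show ?thesis unfolding Q_def by blast
    qed
    have bmF: "bm \<kappa> i \<in> F \<and> bm \<kappa> i \<noteq> 0" if \<kappa>: "\<kappa> \<in> ?K" and i: "i \<in> I2" for \<kappa> i
    proof (cases "i = m0")
      case False
      then show ?thesis using b i I2(3) by (auto simp: bm_def)
    next
      case True
      obtain u where u: "u \<in> S' J'" "\<kappa> = normalize J' u" using \<kappa> by blast
      have "bm \<kappa> m0 = (\<Sum>j\<in>J'. b j * u j) / u m0"
        unfolding u(2) bm_def normalize_def m0_def[symmetric] by (auto simp: sum_divide_distrib intro!: sum.cong)
      moreover have "(\<Sum>j\<in>J'. b j * u j) \<noteq> 0" by (rule QD(5)[OF SQ[OF u(1)]]) (use fJ' in auto)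
      moreover have "u j \<in> F" if "j \<in> I" for j using Q_U[OF SQ[OF u(1)] I I0 that] U_F by blast
      ultimately show ?thesis
        using True m0I unz[OF u(1) m0I] b fJ'(3) by (auto intro!: F_div F_sum F_mult)
    qed
    \<comment> \<open>Both index sets contain \<open>m0\<close>, so the two normalised solutions
      determine all quotients of coordinates by the one at \<open>m0\<close>, and
      \<open>u (Min I) = 1\<close> fixes the scaling.\<close>
    have "card (S' J') \<le> card (Sigma ?K (\<lambda>\<kappa>. Q I2 (bm \<kappa>)))"
    proof (rule card_inj_on_le[where f = "\<lambda>u. (normalize J' u, normalize I2 u)"])
      show "inj_on (\<lambda>u. (normalize J' u, normalize I2 u)) (S' J')"
      proof (rule inj_onI, clarify)
        fix u w assume u: "u \<in> S' J'" "w \<in> S' J'" and eq: "normalize J' u = normalize J' w" "normalize I2 u = normalize I2 w"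
        have ratio: "u i / u m0 = w i / w m0" if i: "i \<in> I" for i
        proof (cases "i \<in> J'")
          case True
          then show ?thesis using fun_cong[OF eq(1), of i] by (simp add: normalize_def m0_def)
        next
          case False
          then have iz: "i \<in> I2" "m0 \<in> I2" using i by (auto simp: I2_def)
          have mI: "Min I2 \<in> I" using Min_in[OF I2(1,2)] I2(3) by blast
          have "u i / u (Min I2) = w i / w (Min I2)" "u m0 / u (Min I2) = w m0 / w (Min I2)"
            using fun_cong[OF eq(2), of i] fun_cong[OF eq(2), of m0] iz by (simp_all add: normalize_def)
          then have "(u i / u (Min I2)) / (u m0 / u (Min I2)) = (w i / w (Min I2)) / (w m0 / w (Min I2))" by simp
          then show ?thesis using unz[OF u(1) mI] unz[OF u(2) mI] by simp
        qed
        have mI: "Min I \<in> I" using I I0 by simp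
        have "1 / u m0 = 1 / w m0" using ratio[OF mI] QD(2)[OF SQ[OF u(1)]] QD(2)[OF SQ[OF u(2)]] by simp
        then have "u m0 = w m0" by simp
        then have "u i = w i" if "i \<in> I" for i using ratio[OF that] unz[OF u(2) m0I] by simp
        then show "u = w" using extensionalityI[OF QD(1)[OF SQ[OF u(1)]] QD(1)[OF SQ[OF u(2)]]] by blast
      qed
      show "(\<lambda>u. (normalize J' u, normalize I2 u)) ` S' J' \<subseteq> Sigma ?K (\<lambda>\<kappa>. Q I2 (bm \<kappa>))"
        using I2_in by auto
      show "finite (Sigma ?K (\<lambda>\<kappa>. Q I2 (bm \<kappa>)))"
        using finS finite_Q[OF I2(1,2)] by (intro finite_SigmaI finite_imageI) (auto simp: S'_def)
    qed
    also have "\<dots> = (\<Sum>\<kappa>\<in>?K. card (Q I2 (bm \<kappa>)))"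
      using finS finite_Q[OF I2(1,2)] by (intro card_SigmaI) (auto simp: S'_def)
    also have "\<dots> \<le> (\<Sum>\<kappa>\<in>?K. B)"
      by (intro sum_mono IH I2 cI2) (use bmF in blast)
    also have "\<dots> = card ?K * B" by simp
    also have "card ?K \<le> card (Q J' c)" by (rule card_mono[OF finite_Q[OF fJ'(1,2)] K_in])
    also have "card (Q J' c) \<le> B"
      by (intro IH fJ' cJ'I) (use J' c fJ'(3) in \<open>auto simp: J_def\<close>)
    finally show ?thesis by (simp add: power2_eq_square mult_right_mono)
  qed
  have "card S \<le> card (\<Union>J'\<in>{J'. J' \<subseteq> J \<and> ia \<in> J'}. S' J')"
    by (rule card_mono[OF _ cover]) (use J finS in \<open>auto simp: S'_def\<close>)
  also have "\<dots> \<le> (\<Sum>J'\<in>{J'. J' \<subseteq> J \<and> ia \<in> J'}. card (S' J'))"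
    by (rule card_UN_le) (use J in auto)
  also have "\<dots> \<le> (\<Sum>J'\<in>{J'. J' \<subseteq> J \<and> ia \<in> J'}. B ^ 2)" by (rule sum_mono) (use bound in auto)
  also have "\<dots> = card {J'. J' \<subseteq> J \<and> ia \<in> J'} * B ^ 2" by simp
  also have "card {J'. J' \<subseteq> J \<and> ia \<in> J'} \<le> card (Pow I)"
    by (rule card_mono) (use I J in auto)
  also have "card (Pow I) = 2 ^ card I" by (rule card_Pow[OF I])
  finally show ?thesis by (simp add: mult_right_mono)
qed

text \<open>By the gap principle every \<open>m\<close> points have vanishing determinant in the
  coordinates \<open>f 0\<close> to \<open>f (m - 1)\<close>, hence these satisfy a common relation.
  The coordinate \<open>f m\<close> is absent from it, which is the zero coefficient that
  \<open>card_le_of_relation\<close> demands.\<close>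

lemma cell_large:
  assumes I: "finite I" "card I \<ge> 3" "card I \<le> N" and b: "\<And>i. i \<in> I \<Longrightarrow> b i \<in> F \<and> b i \<noteq> 0"
    and S: "S \<subseteq> Q I b" and f: "bij_betw f {..m} I"
    and near: "\<And>u u' i. u \<in> S \<Longrightarrow> u' \<in> S \<Longrightarrow> i \<in> I \<Longrightarrow> nm (u i / u' i) \<le> \<epsilon>"
    and big: "\<And>u. u \<in> S \<Longrightarrow> ln (fact m) + real (m * (m + 1)) * \<epsilon> < height m (\<lambda>j. b (f j)) (\<lambda>j. u (f j))"
    and IH: "\<And>I' b'. finite I' \<Longrightarrow> I' \<noteq> {} \<Longrightarrow> card I' < card I \<Longrightarrow> (\<And>i. i \<in> I' \<Longrightarrow> b' i \<in> F \<and> b' i \<noteq> 0) \<Longrightarrow>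
      card (Q I' b') \<le> B"
  shows "card S \<le> 2 ^ card I * B ^ 2"
proof -
  have I0: "I \<noteq> {}" using I by auto
  have fI: "f j \<in> I" if "j \<le> m" for j using that f by (auto simp: bij_betw_def)
  have uU: "u i \<in> U" if "u \<in> S" "i \<in> I" for u i using that S Q_U[OF _ I(1) I0] by blast
  define Z where "Z = (\<lambda>u j. u (f j) :: complex) ` S"
  have van: "leibniz m r = 0" if r: "\<And>i. i < m \<Longrightarrow> r i \<in> Z" for r
  proof -
    have "card I = Suc m" using bij_betw_same_card[OF f] by simp
    then have m: "m > 0" using I by simp
    have "\<forall>i. \<exists>u. i < m \<longrightarrow> u \<in> S \<and> r i = (\<lambda>j. u (f j))" using r unfolding Z_def by blast
    then obtain w where w: "\<And>i. i < m \<Longrightarrow> w i \<in> S" "\<And>i. i < m \<Longrightarrow> r i = (\<lambda>j. w i (f j))" by metis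
    have "leibniz m (\<lambda>i j. w i (f j) / (1::complex)) = 0"
    proof (rule gap_principle[of m "\<lambda>j. b (f j)" "\<lambda>i j. w i (f j)" "\<lambda>j. w 0 (f j)" "\<lambda>_. 1" \<epsilon>])
      show "(\<Sum>j\<le>m. b (f j) * w i (f j)) = 0" if "i < m" for i
        using sum.reindex_bij_betw[OF f, of "\<lambda>i'. b i' * w i i'"] QD(4)[of "w i" I b] w(1)[OF that] S by auto
    qed (use b fI uU w(1) near big m U_1 in auto)
    then show ?thesis unfolding leibniz_def using w(2) by simp
  qed
  obtain c where c: "\<exists>j<m. c j \<noteq> 0" "\<And>j. j < m \<Longrightarrow> c j \<in> F" "\<And>z. z \<in> Z \<Longrightarrow> (\<Sum>j<m. c j * z j) = 0"
  proof (rule relation_of_vanishing_minors[of m Z F])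
    show "z j \<in> F" if "z \<in> Z" "j < m" for z j
      using that uU fI unfolding Z_def by (auto intro!: U_F)
  qed (auto intro: van F_0 F_1 F_minus F_add F_mult)
  define g where "g = the_inv_into {..m} f"
  have gf: "g (f j) = j" if "j \<le> m" for j
    unfolding g_def using f that by (intro the_inv_into_f_f) (auto simp: bij_betw_def)
  define c' where "c' i = (if g i < m then c (g i) else 0)" for i
  obtain j1 where j1: "j1 < m" "c j1 \<noteq> 0" using c(1) by blast
  show ?thesis
  proof (rule card_le_of_relation[OF I(1) b S, where c = c' and ia = "f j1" and iz = "f m"])
    show "c' i \<in> F" for i using c(2) by (auto simp: c'_def F_0)
    show "c' (f j1) \<noteq> 0" "c' (f m) = 0" using j1 gf[of j1] gf[of m] by (auto simp: c'_def)
    fix u assume u: "u \<in> S"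
    have "(\<Sum>i\<in>I. c' i * u i) = (\<Sum>j\<le>m. c' (f j) * u (f j))"
      by (rule sum.reindex_bij_betw[OF f, symmetric])
    also have "\<dots> = (\<Sum>j<m. c j * u (f j))"
      by (simp add: lessThan_Suc_atMost[symmetric] c'_def gf)
    also have "\<dots> = 0" using c(3)[of "\<lambda>j. u (f j)"] u by (auto simp: Z_def)
    finally show "(\<Sum>i\<in>I. c' i * u i) = 0" .
  qed (use IH fI j1 in auto)
qed

definition \<rho> :: real where "\<rho> = 1 / (real (N ^ 2) * real (1 + fact N * fact (3 * fact N)))"

lemma \<rho>_pos: "\<rho> > 0"
  unfolding \<rho>_def using N by (intro divide_pos_pos mult_pos_pos) (auto simp del: of_nat_Suc of_nat_add)

text \<open>Division by one solution brings all of them close to one in norm and argument. The full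
  determinants vanish because the equation itself makes the columns dependent. Each pair of
  coordinates yields a two-term relation on a part of \<open>S\<close>, which accounts for the
  factor \<open>N ^ 2\<close>.\<close>

lemma cell_small:
  assumes I: "finite I" "card I \<ge> 3" "card I \<le> N" and b: "\<And>i. i \<in> I \<Longrightarrow> b i \<in> F \<and> b i \<noteq> 0"
    and S: "S \<subseteq> Q I b"
    and near: "\<And>u u' i. u \<in> S \<Longrightarrow> u' \<in> S \<Longrightarrow> i \<in> I \<Longrightarrow> nm (u i / u' i) \<le> \<rho>"
    and IH: "\<And>I' b'. finite I' \<Longrightarrow> I' \<noteq> {} \<Longrightarrow> card I' < card I \<Longrightarrow> (\<And>i. i \<in> I' \<Longrightarrow> b' i \<in> F \<and> b' i \<noteq> 0) \<Longrightarrow>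
      card (Q I' b') \<le> B"
  shows "card S \<le> N ^ 2 * (2 ^ card I * B ^ 2)"
proof (cases "S = {}")
  case False
  then obtain u0 where u0: "u0 \<in> S" by blast
  have I0: "I \<noteq> {}" using I by auto
  define n where "n = card I"
  obtain f where f: "bij_betw f {..<n} I"
    using ex_bij_betw_nat_finite[OF I(1)] by (auto simp: n_def atLeast0LessThan)
  have fI: "f j \<in> I" if "j < n" for j using that f by (auto simp: bij_betw_def)
  have uU: "u i \<in> U" if "u \<in> S" "i \<in> I" for u i using that S Q_U[OF _ I(1) I0] by blast
  have uE: "u i / u' i \<in> E" if "u \<in> S" "u' \<in> S" "i \<in> I" for u u' i
    using that S Q_D[OF _ I(1) I0] D_divide_E by blast
  have finS: "finite S" using S finite_Q[OF I(1) I0] finite_subset by blast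
  define Z where "Z = (\<lambda>u j. u (f j) / u0 (f j)) ` S"
  obtain \<kappa> where \<kappa>: "\<And>\<zeta>. \<zeta> \<in> Z \<Longrightarrow> \<exists>i<n. \<exists>j<n. i \<noteq> j \<and> \<zeta> i = \<kappa> i j * \<zeta> j" "\<And>i j. \<kappa> i j \<in> U"
  proof (rule small_ball[where n = n and n' = N and Z = Z and \<rho> = \<rho> and \<delta> = \<delta>])
    show "n \<le> N" using I by (simp add: n_def)
    show "finite Z" using finS by (simp add: Z_def)
    show "\<zeta> j \<in> U" "nm (\<zeta> j) \<le> \<rho>" "\<bar>Im (Ln (\<zeta> j))\<bar> \<le> \<delta>" if "\<zeta> \<in> Z" "j < n" for \<zeta> j
      using that fI u0 near E_arg[OF uE] uU unfolding Z_def by (auto intro!: U_divide)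
    show "real (N ^ 2) * \<rho> * real (1 + fact N * fact (3 * fact N)) \<le> 1"
      using N by (simp add: \<rho>_def del: of_nat_Suc of_nat_add)
    show "leibniz n r = 0" if r: "\<And>i. i < n \<Longrightarrow> r i \<in> Z" for r
    proof (rule leibniz_eq_0_of_relation[of 0 n "\<lambda>j. b (f j) * u0 (f j)"])
      show "0 < n" using I by (simp add: n_def)
      then show "b (f 0) * u0 (f 0) \<noteq> 0" using b[OF fI[of 0]] U_nz[OF uU[OF u0 fI[of 0]]] by simp
      fix i assume i: "i < n"
      then obtain u where u: "u \<in> S" "r i = (\<lambda>j. u (f j) / u0 (f j))" using r unfolding Z_def by blast
      have "(\<Sum>j<n. b (f j) * u0 (f j) * r i j) = (\<Sum>j<n. b (f j) * u (f j))"
        unfolding u(2) by (intro sum.cong refl) (use U_nz[OF uU[OF u0 fI]] in auto)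
      also have "\<dots> = (\<Sum>i\<in>I. b i * u i)" by (rule sum.reindex_bij_betw[OF f])
      also have "\<dots> = 0" using u(1) S QD(4) by blast
      finally show "(\<Sum>j<n. b (f j) * u0 (f j) * r i j) = 0" .
    qed
  qed (use small_primes \<delta> \<rho>_pos in auto)
  define S' where "S' i j = {u \<in> S. u (f i) / u0 (f i) = \<kappa> i j * (u (f j) / u0 (f j))}" for i j
  define pairs where "pairs = {(i, j). i < n \<and> j < n \<and> i \<noteq> j}"
  have "pairs \<subseteq> {..<n} \<times> {..<n}" by (auto simp: pairs_def)
  then have pairs: "finite pairs" "card pairs \<le> n * n"
    using finite_subset[of pairs] card_mono[of "{..<n} \<times> {..<n}" pairs] by auto
  have bound: "card (S' i j) \<le> 2 ^ card I * B ^ 2" if ij: "i < n" "j < n" "i \<noteq> j" for i j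
  proof -
    have "card {f i, f j} \<le> 2" by (simp add: card_insert_if)
    \<comment> \<open>A third index exists because there are at least three terms; it has
      coefficient zero in the two-term relation.\<close>
    then have "\<not> I \<subseteq> {f i, f j}" using card_mono[of "{f i, f j}" I] I(2) by auto
    then obtain i2 where i2: "i2 \<in> I" "i2 \<noteq> f i" "i2 \<noteq> f j" by blast
    have ne: "f i \<noteq> f j" using f ij by (auto simp: bij_betw_def inj_on_def)
    define c where "c k = (if k = f i then 1 / u0 (f i) else if k = f j then - \<kappa> i j / u0 (f j) else 0)" for k
    show ?thesis
    proof (rule card_le_of_relation[OF I(1) b, where S = "S' i j" and c = c and ia = "f i" and iz = i2])
      show "S' i j \<subseteq> Q I b" using S by (auto simp: S'_def)
      have "u0 (f i) \<in> F" "u0 (f j) \<in> F" "\<kappa> i j \<in> F" using uU[OF u0] fI ij \<kappa>(2) U_F by auto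
      then show "c k \<in> F" for k by (auto simp: c_def intro!: F_div F_minus F_1 F_0)
      show "c (f i) \<noteq> 0" using U_nz[OF uU[OF u0 fI[OF ij(1)]]] by (simp add: c_def)
      fix u assume "u \<in> S' i j"
      have "(\<Sum>k\<in>I. c k * u k) = (\<Sum>k\<in>{f i, f j}. c k * u k)"
        by (rule sum.mono_neutral_right) (use I(1) fI ij in \<open>auto simp: c_def\<close>)
      also have "\<dots> = u (f i) / u0 (f i) - \<kappa> i j * (u (f j) / u0 (f j))" using ne by (simp add: c_def)
      also have "\<dots> = 0" using \<open>u \<in> S' i j\<close> by (simp add: S'_def)
      finally show "(\<Sum>k\<in>I. c k * u k) = 0" .
    qed (use i2 fI ij IH in \<open>auto simp: c_def\<close>)
  qed
  have "S \<subseteq> (\<Union>(i, j)\<in>pairs. S' i j)"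
  proof
    fix u assume u: "u \<in> S"
    then have "(\<lambda>j. u (f j) / u0 (f j)) \<in> Z" by (simp add: Z_def)
    from \<kappa>(1)[OF this] obtain i j where "i < n" "j < n" "i \<noteq> j" "u (f i) / u0 (f i) = \<kappa> i j * (u (f j) / u0 (f j))"
      by blast
    then show "u \<in> (\<Union>(i, j)\<in>pairs. S' i j)" using u by (auto simp: pairs_def S'_def)
  qed
  then have "card S \<le> card (\<Union>(i, j)\<in>pairs. S' i j)"
    using pairs finS by (intro card_mono finite_UN_I) (auto simp: S'_def)
  also have "\<dots> \<le> (\<Sum>(i, j)\<in>pairs. card (S' i j))"
    using card_UN_le[OF pairs(1), of "\<lambda>(i, j). S' i j"] by (simp add: case_prod_unfold)
  also have "\<dots> \<le> (\<Sum>(i, j)\<in>pairs. 2 ^ card I * B ^ 2)" by (rule sum_mono) (use bound in \<open>auto simp: pairs_def\<close>)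
  also have "\<dots> = card pairs * (2 ^ card I * B ^ 2)" by simp
  also have "\<dots> \<le> N ^ 2 * (2 ^ card I * B ^ 2)"
  proof (rule mult_right_mono)
    have "n * n \<le> N * N" using I by (intro mult_mono) (auto simp: n_def)
    then show "card pairs \<le> N ^ 2" using pairs(2) by (simp add: power2_eq_square)
  qed simp
  finally show ?thesis .
qed simp

text \<open>At scale zero this is exactly twice the ratio of the radius \<open>16 * N ^ 2\<close> to
  the cluster radius \<open>\<rho> / 2\<close>. At higher scales that ratio, doubled, is only
  \<open>128 * N ^ 2\<close>.\<close>

definition \<mu> :: nat where "\<mu> = 64 * N ^ 4 * (1 + fact N * fact (3 * fact N))"

text \<open>Solutions are sorted by the scale of their distance to a solution \<open>e\<close> of
  least height, and by the clusters of their coordinates. At scale zero a cell is small enough for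
  \<open>cell_small\<close>. At larger scales the distance to \<open>e\<close>, and hence the
  height, is large compared with the diameter of the cell, so \<open>cell_large\<close>
  applies.\<close>

lemma card_Q_step:
  assumes pack: "packs d"
    and I: "finite I" "card I \<ge> 3" "card I \<le> N" and b: "\<And>i. i \<in> I \<Longrightarrow> b i \<in> F \<and> b i \<noteq> 0"
    and IH: "\<And>I' b'. finite I' \<Longrightarrow> I' \<noteq> {} \<Longrightarrow> card I' < card I \<Longrightarrow> (\<And>i. i \<in> I' \<Longrightarrow> b' i \<in> F \<and> b' i \<noteq> 0) \<Longrightarrow>
      card (Q I' b') \<le> B"
  shows "card (Q I b) \<le> card Sc * (2 * (\<mu> + 1) ^ d) ^ card I * (N ^ 2 * (2 ^ card I * B ^ 2))"
proof (cases "Q I b = {}")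
  case False
  have I0: "I \<noteq> {}" using I by auto
  have finQ: "finite (Q I b)" by (rule finite_Q[OF I(1) I0])
  define m where "m = card I - 1"
  have cI: "card I = Suc m" using I by (simp add: m_def)
  \<comment> \<open>The index with the smallest sum of logarithms comes last, as
    \<open>nm_le_height\<close> requires.\<close>
  have "\<exists>im\<in>I. \<forall>k\<in>I. (\<Sum>v\<in>V. lv v (b im)) \<le> (\<Sum>v\<in>V. lv v (b k))"
    using ex_min_if_finite[of "(\<lambda>k. \<Sum>v\<in>V. lv v (b k)) ` I"] I(1) I0 by (force simp: not_less)
  then obtain im where im: "im \<in> I" "\<And>k. k \<in> I \<Longrightarrow> (\<Sum>v\<in>V. lv v (b im)) \<le> (\<Sum>v\<in>V. lv v (b k))" by blast
  have "card (I - {im}) = m" using I(1) im(1) cI by simp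
  then obtain f0 where f0: "bij_betw f0 {..<m} (I - {im})"
    using ex_bij_betw_nat_finite[of "I - {im}"] I(1) by (auto simp: atLeast0LessThan)
  define f where "f = f0(m := im)"
  have "bij_betw f {..<m} (I - {im})" using f0 by (subst bij_betw_cong[of _ _ f0]) (auto simp: f_def)
  moreover have "bij_betw f {m} {im}" by (simp add: f_def bij_betw_def)
  ultimately have "bij_betw f ({..<m} \<union> {m}) ((I - {im}) \<union> {im})" by (intro bij_betw_combine) auto
  moreover have "{..<m} \<union> {m} = {..m}" "(I - {im}) \<union> {im} = I" using im(1) by auto
  ultimately have f: "bij_betw f {..m} I" by simp
  have fm: "f m = im" by (simp add: f_def)
  have fI: "f j \<in> I" if "j \<le> m" for j using that f by (auto simp: bij_betw_def)
  define H where "H u = height m (\<lambda>j. b (f j)) (\<lambda>j. u (f j))" for u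
  \<comment> \<open>Since \<open>e\<close> has least height, its own height can be replaced by that
    of \<open>u\<close> in all estimates of the distance.\<close>
  have "\<exists>e\<in>Q I b. \<forall>u\<in>Q I b. H e \<le> H u"
    using ex_min_if_finite[of "H ` Q I b"] finQ False by (force simp: not_less)
  then obtain e where e: "e \<in> Q I b" "\<And>u. u \<in> Q I b \<Longrightarrow> H e \<le> H u" by blast
  have uU: "u i \<in> U" if "u \<in> Q I b" "i \<in> I" for u i using that Q_U[OF _ I(1) I0] by blast
  define z where "z u i = u i / e i" for u :: "nat \<Rightarrow> complex" and i
  have zE: "z u i \<in> E" if "u \<in> Q I b" "i \<in> I" for u i
    unfolding z_def using Q_D[OF _ I(1) I0 that(2)] that(1) e(1) D_divide_E by blast
  have zU: "z u i \<in> U" if "u \<in> Q I b" "i \<in> I" for u i using zE[OF that] E_U by blast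
  define s where "s u = Max ((\<lambda>i. nm (z u i)) ` I)" for u
  have s_ge: "nm (z u i) \<le> s u" if "i \<in> I" for u i unfolding s_def using I(1) that by simp
  have s_in: "\<exists>i\<in>I. s u = nm (z u i)" for u
  proof -
    have "s u \<in> (\<lambda>i. nm (z u i)) ` I" unfolding s_def using I(1) I0 by (intro Max_in) auto
    then show ?thesis by blast
  qed
  have s_H: "s u \<le> 8 * H u" if u: "u \<in> Q I b" for u
  proof -
    have key: "nm (z u (f k) / z u (f m)) \<le> 4 * H u" if k: "k \<le> m" for k
    proof -
      have "nm ((u (f k) / e (f k)) / (u (f m) / e (f m))) \<le> 2 * H u + 2 * H e"
        unfolding H_def
        by (rule nm_le_height[of m "\<lambda>j. b (f j)" k "\<lambda>j. u (f j)" "\<lambda>j. e (f j)"])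
          (use b fI k uU u e(1) im fm in auto)
      then show ?thesis using e(2)[OF u] by (simp add: z_def)
    qed
    \<comment> \<open>The coordinate of index \<open>Min I\<close> is one in both solutions; this
      turns the bound for quotients of coordinates into a bound for the coordinates
      themselves.\<close>
    obtain k0 where k0: "k0 \<le> m" "f k0 = Min I"
      using f Min_in[OF I(1) I0] by (metis atMost_iff bij_betw_def imageE)
    have "z u (f k0) = 1" using QD(2)[OF u] QD(2)[OF e(1)] k0(2) by (simp add: z_def)
    then have "nm (inverse (z u (f m))) \<le> 4 * H u" using key[OF k0(1)] by (simp add: divide_inverse)
    then have zm: "nm (z u (f m)) \<le> 4 * H u" using nm_inverse[OF zU[OF u fI[of m]]] by simp
    obtain i where i: "i \<in> I" "s u = nm (z u i)" using s_in by blast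
    obtain k where k: "k \<le> m" "i = f k" using f i(1) by (metis atMost_iff bij_betw_def imageE)
    have "nm (z u (f k) / z u (f m) * z u (f m)) \<le> nm (z u (f k) / z u (f m)) + nm (z u (f m))"
      by (intro nm_mult U_divide zU u fI k) auto
    moreover have "z u (f k) / z u (f m) * z u (f m) = z u i" using U_nz[OF zU[OF u fI[of m]]] k(2) by simp
    ultimately show ?thesis using key[OF k(1)] zm i(2) by simp
  qed
  define rad where "rad k = 16 * real (N ^ 2) * 2 ^ k" for k :: nat
  \<comment> \<open>Two points of a cluster are at distance at most \<open>2 * r k\<close>, that is
    \<rho> at scale zero and \<open>2 ^ (k - 1)\<close> otherwise.\<close>
  define r where "r k = (if k = 0 then \<rho> / 2 else 2 ^ k / 4)" for k :: nat
  have "\<exists>Y cl. finite Y \<and> card Y \<le> 2 * (\<mu> + 1) ^ d \<and> Y \<subseteq> U \<and> (\<forall>x\<in>E. nm x \<le> rad k \<longrightarrow> cl x \<in> Y \<and> nm (x / cl x) \<le> r k)" for k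
  proof (rule exists_clusters[OF pack])
    show "r k \<ge> 0" using \<rho>_pos by (simp add: r_def)
    show "\<mu> \<ge> 1" using N by (simp add: \<mu>_def Suc_le_eq)
    show "real \<mu> * r k \<ge> 2 * rad k"
    proof (cases "k = 0")
      case True
      define M where "M = real (1 + fact N * fact (3 * fact N))"
      have M: "M > 0" unfolding M_def by (simp del: of_nat_Suc of_nat_add)
      define K where "K = real (N ^ 2)"
      have K: "K > 0" using N by (simp add: K_def)
      have "real \<mu> = 64 * (K * K) * M" unfolding \<mu>_def M_def K_def
        by (simp only: of_nat_mult of_nat_power of_nat_numeral power4_eq_xxxx power2_eq_square mult.assoc)
      moreover have "\<rho> = 1 / (K * M)" by (simp add: \<rho>_def M_def K_def)
      ultimately have "real \<mu> * (\<rho> / 2) = 32 * real (N ^ 2)"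
        using M K unfolding K_def[symmetric] by (simp add: field_simps)
      then show ?thesis using True by (simp add: r_def rad_def)
    next
      case False
      have "128 * N ^ 2 \<le> \<mu>"
      proof -
        have f1: "(fact N :: nat) \<ge> 1" "(fact (3 * fact N) :: nat) \<ge> 1" by (simp_all add: fact_ge_1)
        have "64 * N ^ 2 * (1 * 2) \<le> 64 * N ^ 2 * (N ^ 2 * (1 + fact N * fact (3 * fact N)))"
          using N f1 by (intro mult_left_mono mult_mono) (auto simp: Suc_le_eq)
        also have "\<dots> = \<mu>" unfolding \<mu>_def by (simp only: power4_eq_xxxx power2_eq_square mult.assoc)
        finally show ?thesis by simp
      qed
      then have "real (128 * N ^ 2) \<le> real \<mu>" by (simp only: of_nat_le_iff)
      then have "real (128 * N ^ 2) * (2 ^ k / 4) \<le> real \<mu> * (2 ^ k / 4)" by (intro mult_right_mono) auto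
      then show ?thesis using False by (simp add: r_def rad_def)
    qed
  qed
  then obtain Y cl where Y: "\<And>k. finite (Y k)" "\<And>k. card (Y k) \<le> 2 * (\<mu> + 1) ^ d" "\<And>k. Y k \<subseteq> U"
    and cl: "\<And>k x. x \<in> E \<Longrightarrow> nm x \<le> rad k \<Longrightarrow> cl k x \<in> Y k \<and> nm (x / cl k x) \<le> r k" by metis
  define lab where "lab u = (scale (s u), \<lambda>i\<in>I. cl (scale (s u)) (z u i))" for u
  have zrad: "nm (z u i) \<le> rad (scale (s u))" if "i \<in> I" for u i
    using s_ge[OF that, of u] scale_less[of "s u"] unfolding rad_def by linarith
  have fib: "card (Q I b) \<le> card (lab ` Q I b) * (N ^ 2 * (2 ^ card I * B ^ 2))"
  proof (rule card_le_fibres[OF finQ])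
    fix y assume "y \<in> lab ` Q I b"
    then obtain w where w: "w \<in> Q I b" "y = lab w" by blast
    define S where "S = {u \<in> Q I b. lab u = lab w}"
    define k where "k = scale (s w)"
    have near: "nm (u i / u' i) \<le> 2 * r k" if u: "u \<in> S" "u' \<in> S" "i \<in> I" for u u' i
    proof -
      have uQ: "u \<in> Q I b" "u' \<in> Q I b" using u by (auto simp: S_def)
      have sc: "scale (s u) = k" "scale (s u') = k" using u by (auto simp: S_def lab_def k_def)
      have "cl k (z u i) = cl k (z u' i)"
        using u sc unfolding S_def lab_def by (auto simp: fun_eq_iff restrict_def) metis
      moreover have c: "cl k (z u i) \<in> Y k \<and> nm (z u i / cl k (z u i)) \<le> r k" "nm (z u' i / cl k (z u' i)) \<le> r k"
        using cl[OF zE[OF uQ(1) u(3)] zrad[OF u(3), of u]] cl[OF zE[OF uQ(2) u(3)] zrad[OF u(3), of u']]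
        unfolding sc by blast+
      moreover have "u i / u' i = (z u i / cl k (z u i)) / (z u' i / cl k (z u i))"
        using U_nz[OF uU[OF e(1) u(3)]] c(1) Y(3)[of k] U_nz by (auto simp: z_def)
      moreover have "nm ((z u i / cl k (z u i)) / (z u' i / cl k (z u i))) \<le> nm (z u i / cl k (z u i)) + nm (z u' i / cl k (z u i))"
        using u c(1) Y(3)[of k] by (intro nm_divide U_divide zU) (auto simp: S_def)
      ultimately show ?thesis by simp
    qed
    have SQ: "S \<subseteq> Q I b" by (auto simp: S_def)
    have "card S \<le> N ^ 2 * (2 ^ card I * B ^ 2)"
    proof (cases k)
      case 0
      show ?thesis
        by (rule cell_small[OF I b SQ]) (use near 0 IH in \<open>auto simp: r_def\<close>)
    next
      case (Suc k')
      have "card S \<le> 2 ^ card I * B ^ 2"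
      proof (rule cell_large[OF I b SQ f, of "2 ^ k'"])
        show "nm (u i / u' i) \<le> 2 ^ k'" if "u \<in> S" "u' \<in> S" "i \<in> I" for u u' i
          using near[OF that] Suc by (simp add: r_def)
        show "ln (fact m) + real (m * (m + 1)) * 2 ^ k' < height m (\<lambda>j. b (f j)) (\<lambda>j. u (f j))" if u: "u \<in> S" for u
        proof -
          have "scale (s u) = Suc k'" using u Suc by (auto simp: S_def lab_def k_def)
          then have "16 * real (N ^ 2) * 2 ^ k' \<le> 8 * H u"
            \<comment> \<open>The distance is at most eight times the height, so \<open>H u\<close>
              is at least \<open>2 * N ^ 2 * 2 ^ k'\<close>; this covers both
              \<open>ln (fact m)\<close>, at most \<open>m ^ 2\<close>, and the deviation
              \<open>m * (m + 1) * 2 ^ k'\<close>.\<close>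
            using scale_ge[of "s u" k'] s_H[OF subsetD[OF SQ u]] by linarith
          then have 1: "2 * real (N ^ 2) * 2 ^ k' \<le> H u" by linarith
          have mN: "m + 1 \<le> N" using cI I(3) by simp
          have "ln (fact m) \<le> real m ^ 2" by (rule ln_fact_le)
          also have "\<dots> \<le> real m ^ 2 * 2 ^ k'" by (simp add: mult_le_cancel_left1)
          finally have "ln (fact m) + real (m * (m + 1)) * 2 ^ k' \<le> (real m ^ 2 + real (m * (m + 1))) * 2 ^ k'"
            by (simp add: distrib_right)
          also have "\<dots> < (2 * real (N ^ 2)) * 2 ^ k'"
          proof (rule mult_strict_right_mono)
            have "m ^ 2 + m * (m + 1) < (m + 1) ^ 2 + (m + 1) ^ 2" by (simp add: power2_eq_square)
            also have "\<dots> \<le> N ^ 2 + N ^ 2" using mN by (intro add_mono power_mono) auto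
            finally have "m ^ 2 + m * (m + 1) < 2 * N ^ 2" by simp
            then have "real (m ^ 2 + m * (m + 1)) < real (2 * N ^ 2)" by (simp only: of_nat_less_iff)
            then show "real m ^ 2 + real (m * (m + 1)) < 2 * real (N ^ 2)" by simp
          qed simp
          also have "\<dots> \<le> H u" using 1 by simp
          finally show ?thesis by (simp add: H_def)
        qed
      qed (use IH in auto)
      also have "\<dots> \<le> N ^ 2 * (2 ^ card I * B ^ 2)" using N by simp
      finally show ?thesis .
    qed
    then show "card {u \<in> Q I b. lab u = y} \<le> N ^ 2 * (2 ^ card I * B ^ 2)" by (simp add: S_def w(2))
  qed
  have "card (lab ` Q I b) \<le> card (Sigma Sc (\<lambda>k. I \<rightarrow>\<^sub>E Y k))"
  proof (rule card_mono)
    show "finite (Sigma Sc (\<lambda>k. I \<rightarrow>\<^sub>E Y k))" using finite_Sc Y(1) I(1) by (intro finite_SigmaI finite_PiE) auto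
    show "lab ` Q I b \<subseteq> Sigma Sc (\<lambda>k. I \<rightarrow>\<^sub>E Y k)"
    proof (rule image_subsetI)
      fix u assume u: "u \<in> Q I b"
      have "scale (s u) \<in> Sc" using s_in[of u] zE[OF u] by (auto simp: Sc_def)
      moreover have "cl (scale (s u)) (z u i) \<in> Y (scale (s u))" if "i \<in> I" for i
        using cl[OF zE[OF u that] zrad[OF that]] by blast
      ultimately show "lab u \<in> Sigma Sc (\<lambda>k. I \<rightarrow>\<^sub>E Y k)" by (auto simp: lab_def)
    qed
  qed
  also have "\<dots> = (\<Sum>k\<in>Sc. card (I \<rightarrow>\<^sub>E Y k))"
    using finite_Sc Y(1) I(1) by (intro card_SigmaI) (auto intro!: finite_PiE)
  also have "\<dots> \<le> (\<Sum>k\<in>Sc. (2 * (\<mu> + 1) ^ d) ^ card I)"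
  proof (rule sum_mono)
    fix k
    show "card (I \<rightarrow>\<^sub>E Y k) \<le> (2 * (\<mu> + 1) ^ d) ^ card I"
      using power_mono[OF Y(2)[of k], of "card I"] I(1) by (simp add: card_PiE del: add_Suc_right)
  qed
  also have "\<dots> = card Sc * (2 * (\<mu> + 1) ^ d) ^ card I" by simp
  finally show ?thesis by (rule order.trans[OF fib mult_right_mono]) simp
qed simp

text \<open>The factor that a step of the induction contributes besides \<open>B ^ 2\<close>, made
  independent of the number of terms.\<close>

definition X :: "nat \<Rightarrow> nat" where
  "X d = card Sc * (2 * (\<mu> + 1) ^ d) ^ N * (N ^ 2 * 2 ^ N)"

lemma X_pos: "X d \<ge> 1"
proof -
  have "E \<noteq> {}" using D_divide_E[OF D_1 D_1] by auto
  then have "card Sc > 0" using finite_Sc by (simp add: Sc_def card_gt_0_iff)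
  then show ?thesis using N by (simp add: X_def Suc_le_eq)
qed

text \<open>The exponent solves the recursion in which each step squares the bound and multiplies it
  by \<open>X d\<close>: twice \<open>2 ^ (n - 1) - 1\<close>, plus one, is
  \<open>2 ^ n - 1\<close>.\<close>

lemma card_Q_bound:
  assumes pack: "packs d"
    and I: "finite I" "I \<noteq> {}" "card I \<le> N" and b: "\<And>i. i \<in> I \<Longrightarrow> b i \<in> F \<and> b i \<noteq> 0"
  shows "card (Q I b) \<le> X d ^ (2 ^ card I - 1)"
  using I b
proof (induction "card I" arbitrary: I b rule: less_induct)
  case less
  note X1 = X_pos[of d]
  show ?case
  proof (cases "card I \<le> 2")
    case True
    have "card (Q I b) \<le> 1" by (rule card_Q_le_1) (use less.prems True in auto)
    also have "1 \<le> X d ^ (2 ^ card I - 1)" using X1 by (rule one_le_power)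
    finally show ?thesis .
  next
    case False
    define n where "n = card I"
    define B where "B = X d ^ (2 ^ (n - 1) - 1)"
    have IH: "card (Q I' b') \<le> B" if "finite I'" "I' \<noteq> {}" "card I' < card I" "\<And>i. i \<in> I' \<Longrightarrow> b' i \<in> F \<and> b' i \<noteq> 0" for I' b'
    proof -
      have "card (Q I' b') \<le> X d ^ (2 ^ card I' - 1)" by (rule less.hyps[OF that(3,1,2)]) (use less.prems that in auto)
      also have "\<dots> \<le> B" unfolding B_def using X1 that(3)
        by (intro power_increasing diff_le_mono power_increasing) (auto simp: n_def)
      finally show ?thesis .
    qed
    have "card (Q I b) \<le> card Sc * (2 * (\<mu> + 1) ^ d) ^ n * (N ^ 2 * (2 ^ n * B ^ 2))"
      unfolding n_def by (rule card_Q_step[OF pack less.prems(1) _ less.prems(3,4) IH]) (use False in auto)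
    also have "\<dots> \<le> card Sc * (2 * (\<mu> + 1) ^ d) ^ N * (N ^ 2 * (2 ^ N * B ^ 2))"
    proof -
      have "(2 * (\<mu> + 1) ^ d) ^ n \<le> (2 * (\<mu> + 1) ^ d) ^ N" "(2::nat) ^ n \<le> 2 ^ N"
        using less.prems(3) by (intro power_increasing; simp add: n_def)+
      then show ?thesis by (intro mult_le_mono) auto
    qed
    also have "\<dots> = X d * B ^ 2" by (simp add: X_def)
    also have "\<dots> = X d ^ Suc (2 * (2 ^ (n - 1) - 1))" by (simp add: B_def power_mult[symmetric] mult.commute)
    also have "Suc (2 * (2 ^ (n - 1) - 1)) = 2 ^ n - 1"
    proof -
      obtain n' where "n = Suc n'" using False by (cases n) (auto simp: n_def)
      moreover have "Suc (2 * (w - 1)) = 2 * w - 1" if "w \<ge> 1" for w :: nat using that by simp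
      ultimately show ?thesis by simp
    qed
    finally show ?thesis by (simp add: n_def)
  qed
qed

lemma card_Q_le:
  obtains d where "real d + 1 \<le> 2 * \<alpha>"
    "\<And>I b. finite I \<Longrightarrow> I \<noteq> {} \<Longrightarrow> card I \<le> N \<Longrightarrow> (\<And>i. i \<in> I \<Longrightarrow> b i \<in> F \<and> b i \<noteq> 0) \<Longrightarrow> card (Q I b) \<le> X d ^ 2 ^ N"
proof -
  obtain d where d: "real d + 1 \<le> 2 * \<alpha>"
    and pack: "packs d"
    using packing_E by blast
  show ?thesis
  proof (rule that[OF d])
    fix I :: "nat set" and b assume I: "finite I" "I \<noteq> {}" "card I \<le> N" "\<And>i. i \<in> I \<Longrightarrow> b i \<in> F \<and> b i \<noteq> 0"
    have "card (Q I b) \<le> X d ^ (2 ^ card I - 1)" by (rule card_Q_bound[OF pack I])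
    also have "\<dots> \<le> X d ^ 2 ^ N"
      using X_pos[of d] I(3) by (intro power_increasing) (auto intro: order.trans[OF diff_le_self power_increasing])
    finally show "card (Q I b) \<le> X d ^ 2 ^ N" .
  qed
qed

end

section \<open>Additive energy\<close>

context small_doubling
begin

definition Sol :: "nat set \<Rightarrow> (nat \<Rightarrow> complex) \<Rightarrow> (nat \<Rightarrow> complex) set" where
  "Sol I b = {x \<in> I \<rightarrow>\<^sub>E A'. (\<Sum>i\<in>I. b i * x i) = 0}"

definition Nondeg :: "nat set \<Rightarrow> (nat \<Rightarrow> complex) \<Rightarrow> (nat \<Rightarrow> complex) set" where
  "Nondeg J b = {x \<in> Sol J b. \<forall>K\<subseteq>J. K \<noteq> {} \<and> K \<noteq> J \<longrightarrow> (\<Sum>i\<in>K. b i * x i) \<noteq> 0}"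

lemma finite_A': "finite A'" using finite_subset[OF A(3,1)] .

lemma card_A': "card A' \<ge> 1" using finite_A' A(4) by (simp add: Suc_le_eq card_gt_0_iff)

lemma finite_Sol: "finite I \<Longrightarrow> finite (Sol I b)"
  unfolding Sol_def
  by (rule finite_subset[of _ "I \<rightarrow>\<^sub>E A'"]) (use finite_A' in \<open>auto intro!: finite_PiE\<close>)

lemma finite_Nondeg: "finite I \<Longrightarrow> finite (Nondeg I b)"
  unfolding Nondeg_def using finite_Sol by auto

text \<open>A solution in \<open>A'\<close> is its normalisation multiplied by its coordinate of
  least index, and that coordinate ranges over \<open>A'\<close>.\<close>

lemma card_Nondeg_le:
  assumes J: "finite J" "J \<noteq> {}"
  shows "card (Nondeg J b) \<le> card A' * card (Q J b)"
proof -
  have mJ: "Min J \<in> J" using J by simp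
  have nz: "x i \<noteq> 0" if "x \<in> Nondeg J b" "i \<in> J" for x i
    using that A'_U U_nz by (auto simp: Nondeg_def Sol_def PiE_iff)
  have "card (Nondeg J b) \<le> card (A' \<times> Q J b)"
  proof (rule card_inj_on_le[where f = "\<lambda>x. (x (Min J), normalize J x)"])
    show "inj_on (\<lambda>x. (x (Min J), normalize J x)) (Nondeg J b)"
    proof (rule inj_onI, clarify)
      fix x y assume xy: "x \<in> Nondeg J b" "y \<in> Nondeg J b" "x (Min J) = y (Min J)" "normalize J x = normalize J y"
      have "x i = y i" if "i \<in> J" for i
        using fun_cong[OF xy(4), of i] xy(3) that nz[OF xy(1) mJ] by (simp add: normalize_def)
      then show "x = y" using xy(1,2) by (intro PiE_ext[of x J _ y]) (auto simp: Nondeg_def Sol_def)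
    qed
    show "(\<lambda>x. (x (Min J), normalize J x)) ` Nondeg J b \<subseteq> A' \<times> Q J b"
    proof (rule image_subsetI)
      fix x assume x: "x \<in> Nondeg J b"
      have sc: "(\<Sum>i\<in>K. b i * normalize J x i) = (\<Sum>i\<in>K. b i * x i) / x (Min J)" if "K \<subseteq> J" for K
        unfolding sum_divide_distrib normalize_def by (intro sum.cong refl) (use that in auto)
      have "normalize J x i / normalize J x j \<in> D" if "i \<in> J" "j \<in> J" for i j
      proof -
        have "normalize J x i / normalize J x j = x i / x j"
          using that nz[OF x mJ] by (simp add: normalize_def)
        moreover have "x i \<in> A'" "x j \<in> A'" using x that by (auto simp: Nondeg_def Sol_def PiE_iff)
        ultimately show ?thesis unfolding D_def by blast
      qed
      moreover have "(\<Sum>i\<in>J. b i * normalize J x i) = 0" using sc[of J] x by (simp add: Nondeg_def Sol_def)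
      moreover have "(\<Sum>i\<in>K. b i * normalize J x i) \<noteq> 0" if "K \<subseteq> J" "K \<noteq> {}" "K \<noteq> J" for K
        using sc[OF that(1)] x nz[OF x mJ] that by (simp add: Nondeg_def)
      moreover have "normalize J x (Min J) = 1" "normalize J x \<in> extensional J"
        using mJ nz[OF x mJ] by (simp_all add: normalize_def)
      ultimately have "normalize J x \<in> Q J b" unfolding Q_def by blast
      moreover have "x (Min J) \<in> A'" using x mJ by (auto simp: Nondeg_def Sol_def PiE_iff)
      ultimately show "(x (Min J), normalize J x) \<in> A' \<times> Q J b" by simp
    qed
  qed (use finite_A' finite_Q[OF J] in simp)
  then show ?thesis by (simp add: card_cartesian_product)
qed

text \<open>Peeling off the minimal vanishing subsum containing a given index; the number of its
  solutions is at most the square root bound except for pairs, where the bound is attained.\<close>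

lemma card_Sol_le:
  assumes K: "K \<ge> 1"
    and Qb: "\<And>J. finite J \<Longrightarrow> J \<noteq> {} \<Longrightarrow> card J \<le> N \<Longrightarrow> real (card (Q J b)) \<le> K * sqrt (real (card A'))"
    and b: "\<And>i. b i \<noteq> 0"
    and I: "finite I" "card I \<le> N"
  shows "real (card (Sol I b)) \<le> (2 ^ N * K) ^ card I * sqrt (real (card A')) ^ card I"
  using I
proof (induction "card I" arbitrary: I rule: less_induct)
  case less
  define s where "s = sqrt (real (card A'))"
  have s1: "s \<ge> 1" using card_A' by (simp add: s_def)
  have ss: "s ^ 2 = real (card A')" by (simp add: s_def)
  \<comment> \<open>One factor \<kappa> pays for each subsum that is peeled off:
    \<open>2 ^ N\<close> for its index set and \<open>K\<close> for its solutions.\<close>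
  define \<kappa> where "\<kappa> = 2 ^ N * K"
  have \<kappa>1: "\<kappa> \<ge> 1" unfolding \<kappa>_def using K mult_mono[of 1 "2 ^ N" 1 K] by simp
  show ?case
  proof (cases "I = {}")
    case True
    have "Sol {} b = {\<lambda>_. undefined}" by (auto simp: Sol_def)
    then show ?thesis using True by simp
  next
    case False
    then obtain i0 where i0: "i0 \<in> I" by blast
    have nd: "real (card (Nondeg J b)) \<le> K * s ^ card J" if J: "J \<subseteq> I" "J \<noteq> {}" for J
    proof -
      have fJ: "finite J" using J less.prems finite_subset by blast
      have cJ: "card J \<le> N" using card_mono[OF less.prems(1) J(1)] less.prems(2) by simp
      \<comment> \<open>Single terms never vanish, and a pair has at most \<open>s ^ 2\<close>
        solutions. With three or more terms the count \<open>s ^ 2 * (K * s)\<close> is still within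
        the target, because \<open>card J\<close> is at least 3.\<close>
      consider "card J = 1" | "card J = 2" | "card J \<ge> 3" using fJ J(2) card_gt_0_iff[of J] by linarith
      then show ?thesis
      proof cases
        case 1
        then obtain j where j: "J = {j}" by (auto simp: card_1_singleton_iff)
        have "Nondeg J b = {}"
        proof (rule equals0I)
          fix x assume "x \<in> Nondeg J b"
          then have "b j * x j = 0" "x j \<in> A'" by (auto simp: Nondeg_def Sol_def j)
          then show False using b[of j] U_nz[OF A'_U] by simp
        qed
        then show ?thesis using K s1 by simp
      next
        case 2
        have "card (Q J b) \<le> 1" by (rule card_Q_le_1) (use fJ J 2 b in auto)
        then have "card A' * card (Q J b) \<le> card A' * 1" by (rule mult_le_mono2)
        then have "card (Nondeg J b) \<le> card A'" using card_Nondeg_le[OF fJ J(2), of b] by linarith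
        then have "real (card (Nondeg J b)) \<le> 1 * s ^ 2" by (simp add: ss)
        also have "\<dots> \<le> K * s ^ 2" using K by (intro mult_right_mono) auto
        finally show ?thesis by (simp add: 2)
      next
        case 3
        have "real (card (Nondeg J b)) \<le> real (card A') * real (card (Q J b))"
          using card_Nondeg_le[OF fJ J(2), of b] by (metis of_nat_le_iff of_nat_mult)
        also have "\<dots> \<le> s ^ 2 * (K * s)"
          unfolding ss[symmetric] by (intro mult_left_mono) (use Qb[OF fJ J(2) cJ] in \<open>auto simp: s_def\<close>)
        also have "\<dots> = K * s ^ 3" by (simp add: power2_eq_square power3_eq_cube)
        also have "\<dots> \<le> K * s ^ card J" using K s1 3 by (intro mult_left_mono power_increasing) auto
        finally show ?thesis .
      qed
    qed
    let ?P = "{J. J \<subseteq> I \<and> i0 \<in> J}"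
    define \<Phi> where "\<Phi> J = (\<lambda>(y, z). (\<lambda>i\<in>I. if i \<in> J then y i else z i :: complex))" for J
    have "Sol I b \<subseteq> (\<Union>J\<in>?P. \<Phi> J ` (Nondeg J b \<times> Sol (I - J) b))"
    proof
      fix x assume x: "x \<in> Sol I b"
      have s0: "sum (\<lambda>i. b i * x i) I = 0" using x by (simp add: Sol_def)
      from exists_minimal_vanishing_subset[OF less.prems(1) i0 s0]
      obtain J where J: "J \<subseteq> I" "i0 \<in> J" "(\<Sum>i\<in>J. b i * x i) = 0"
        "\<And>K. K \<subseteq> J \<Longrightarrow> K \<noteq> {} \<Longrightarrow> K \<noteq> J \<Longrightarrow> (\<Sum>i\<in>K. b i * x i) \<noteq> 0" by blast
      have xA: "x i \<in> A'" if "i \<in> I" for i using x that by (auto simp: Sol_def PiE_iff)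
      have r: "(\<Sum>i\<in>K. b i * restrict x L i) = (\<Sum>i\<in>K. b i * x i)" if "K \<subseteq> L" for K L
        by (intro sum.cong refl) (use that in auto)
      have "restrict x J \<in> Nondeg J b"
        unfolding Nondeg_def Sol_def
      proof (intro CollectI conjI allI impI)
        show "restrict x J \<in> J \<rightarrow>\<^sub>E A'" using J(1) xA by auto
        show "(\<Sum>i\<in>J. b i * restrict x J i) = 0" using J(3) r[OF subset_refl] by simp
        show "(\<Sum>i\<in>K. b i * restrict x J i) \<noteq> 0" if "K \<subseteq> J" "K \<noteq> {} \<and> K \<noteq> J" for K
          using J(4)[OF that(1)] that(2) r[OF that(1)] by simp
      qed
      moreover have "(\<Sum>i\<in>I - J. b i * x i) = 0"
        using sum_diff[OF less.prems(1) J(1), of "\<lambda>i. b i * x i"] s0 J(3) by simp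
      then have "restrict x (I - J) \<in> Sol (I - J) b" unfolding Sol_def using xA by (auto simp: r)
      moreover have "x = \<Phi> J (restrict x J, restrict x (I - J))"
        using x by (auto simp: \<Phi>_def Sol_def PiE_iff extensional_def fun_eq_iff)
      ultimately show "x \<in> (\<Union>J\<in>?P. \<Phi> J ` (Nondeg J b \<times> Sol (I - J) b))" using J(1,2) by blast
    qed
    then have "card (Sol I b) \<le> card (\<Union>J\<in>?P. \<Phi> J ` (Nondeg J b \<times> Sol (I - J) b))"
      using less.prems(1)
      by (intro card_mono finite_UN_I finite_imageI finite_cartesian_product finite_Nondeg finite_Sol)
         (auto intro: finite_subset)
    also have "\<dots> \<le> (\<Sum>J\<in>?P. card (\<Phi> J ` (Nondeg J b \<times> Sol (I - J) b)))"
      by (rule card_UN_le) (use less.prems(1) in auto)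
    also have "\<dots> \<le> (\<Sum>J\<in>?P. card (Nondeg J b) * card (Sol (I - J) b))"
    proof (rule sum_mono)
      fix J assume "J \<in> ?P"
      then have "finite (Nondeg J b \<times> Sol (I - J) b)"
        using less.prems(1) finite_subset by (intro finite_cartesian_product finite_Nondeg finite_Sol) auto
      then show "card (\<Phi> J ` (Nondeg J b \<times> Sol (I - J) b)) \<le> card (Nondeg J b) * card (Sol (I - J) b)"
        using card_image_le[of "Nondeg J b \<times> Sol (I - J) b" "\<Phi> J"] by (simp add: card_cartesian_product)
    qed
    finally have "real (card (Sol I b)) \<le> (\<Sum>J\<in>?P. real (card (Nondeg J b)) * real (card (Sol (I - J) b)))"
      by (metis (no_types, lifting) of_nat_le_iff of_nat_mult of_nat_sum sum.cong)
    also have "\<dots> \<le> (\<Sum>J\<in>?P. K * \<kappa> ^ (card I - 1) * s ^ card I)"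
    proof (rule sum_mono)
      fix J assume J: "J \<in> ?P"
      have fJ: "finite J" using J less.prems finite_subset by auto
      have cJ: "card J \<ge> 1" using J fJ by (auto simp: Suc_le_eq card_gt_0_iff)
      have cle: "card J \<le> card I" using J less.prems by (auto intro: card_mono)
      have cIJ: "card (I - J) = card I - card J" using J fJ by (auto simp: card_Diff_subset)
      have "real (card (Sol (I - J) b)) \<le> \<kappa> ^ card (I - J) * s ^ card (I - J)"
        unfolding \<kappa>_def s_def by (rule less.hyps) (use cIJ cJ cle less.prems in auto)
      also have "\<dots> \<le> \<kappa> ^ (card I - 1) * s ^ (card I - card J)"
        unfolding cIJ using cJ \<kappa>1 s1 by (intro mult_right_mono power_increasing) auto
      finally have "real (card (Nondeg J b)) * real (card (Sol (I - J) b))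
          \<le> (K * s ^ card J) * (\<kappa> ^ (card I - 1) * s ^ (card I - card J))"
        using nd[of J] J K s1 by (intro mult_mono) auto
      also have "\<dots> = K * \<kappa> ^ (card I - 1) * (s ^ card J * s ^ (card I - card J))" by (simp add: mult_ac)
      also have "s ^ card J * s ^ (card I - card J) = s ^ card I" using cle by (simp add: power_add[symmetric])
      finally show "real (card (Nondeg J b)) * real (card (Sol (I - J) b)) \<le> K * \<kappa> ^ (card I - 1) * s ^ card I" .
    qed
    also have "\<dots> = real (card ?P) * (K * \<kappa> ^ (card I - 1) * s ^ card I)" by simp
    also have "\<dots> \<le> 2 ^ N * (K * \<kappa> ^ (card I - 1) * s ^ card I)"
    proof (rule mult_right_mono)
      have "card ?P \<le> card (Pow I)" by (rule card_mono) (use less.prems(1) in auto)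
      also have "\<dots> \<le> 2 ^ N" unfolding card_Pow[OF less.prems(1)] using less.prems(2) by (intro power_increasing) auto
      finally have "real (card ?P) \<le> real (2 ^ N)" by (simp only: of_nat_le_iff)
      then show "real (card ?P) \<le> 2 ^ N" by simp
    qed (use K \<kappa>1 s1 in auto)
    also have "\<dots> = \<kappa> ^ Suc (card I - 1) * s ^ card I" by (simp add: \<kappa>_def mult_ac)
    also have "Suc (card I - 1) = card I" using False less.prems(1) by (simp add: card_gt_0_iff)
    finally show ?thesis by (simp add: \<kappa>_def s_def)
  qed
qed

text \<open>Cauchy-Schwarz for the number of representations. Pairs of \<open>h\<close>-tuples with
  equal sums are solutions of an equation in \<open>2 * h\<close> unknowns with coefficients one and
  minus one, of which there are of order |A'|^h.\<close>

lemma card_hsumset_ge: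
  assumes K: "K \<ge> 1" and h: "N = 2 * h"
    and Qb: "\<And>J b. finite J \<Longrightarrow> J \<noteq> {} \<Longrightarrow> card J \<le> N \<Longrightarrow> (\<And>i. i \<in> J \<Longrightarrow> b i \<in> F \<and> b i \<noteq> 0) \<Longrightarrow>
      real (card (Q J b)) \<le> K * sqrt (real (card A'))"
  shows "real (card A') ^ h \<le> real (card (hsumset h A')) * (2 ^ N * K) ^ N"
proof -
  define b :: "nat \<Rightarrow> complex" where "b i = (if i < h then 1 else - 1)" for i
  define W where "W = {..<h} \<rightarrow>\<^sub>E A'"
  define \<sigma> where "\<sigma> f = (\<Sum>i<h. f i)" for f :: "nat \<Rightarrow> complex"
  have finW: "finite W" unfolding W_def using finite_A' by (intro finite_PiE) auto
  have cW: "card W = card A' ^ h" by (simp add: W_def card_PiE)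
  define r where "r y = card {f \<in> W. \<sigma> f = y}" for y
  have sub: "\<sigma> ` W \<subseteq> hsumset h A'"
    unfolding W_def \<sigma>_def hsumset_def by (auto simp: PiE_iff)
  have sum_r: "(\<Sum>y\<in>\<sigma> ` W. r y) = card W"
    unfolding r_def using sum.image_gen[OF finW, of "\<lambda>_. 1::nat" \<sigma>] by simp
  define pairs where "pairs = {(f, g). f \<in> W \<and> g \<in> W \<and> \<sigma> f = \<sigma> g}"
  have "pairs \<subseteq> W \<times> W" by (auto simp: pairs_def)
  have eq: "pairs = (\<Union>y\<in>\<sigma> ` W. {f \<in> W. \<sigma> f = y} \<times> {f \<in> W. \<sigma> f = y})" by (auto simp: pairs_def)
  have "card pairs = (\<Sum>y\<in>\<sigma> ` W. card ({f \<in> W. \<sigma> f = y} \<times> {f \<in> W. \<sigma> f = y}))"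
    unfolding eq by (rule card_UN_disjoint) (use finW in auto)
  then have sum_r2: "card pairs = (\<Sum>y\<in>\<sigma> ` W. r y ^ 2)"
    by (simp add: card_cartesian_product r_def power2_eq_square)
  have "card pairs \<le> card (Sol {..<N} b)"
  proof (rule card_inj_on_le[where f = "\<lambda>(f, g). (\<lambda>i\<in>{..<N}. if i < h then f i else g (i - h))"])
    show "inj_on (\<lambda>(f, g). (\<lambda>i\<in>{..<N}. if i < h then f i else g (i - h))) pairs"
    proof (rule inj_onI, clarify)
      fix f g f' g' assume fg: "(f, g) \<in> pairs" "(f', g') \<in> pairs"
        and e: "(\<lambda>i\<in>{..<N}. if i < h then f i else g (i - h)) = (\<lambda>i\<in>{..<N}. if i < h then f' i else g' (i - h))"
      have "f i = f' i" if "i < h" for i using fun_cong[OF e, of i] that h by simp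
      moreover have "g i = g' i" if "i < h" for i using fun_cong[OF e, of "i + h"] that h by simp
      ultimately show "f = f' \<and> g = g'"
        using fg by (auto simp: pairs_def W_def intro!: PiE_ext[of _ "{..<h}" "\<lambda>_. A'"])
    qed
    show "(\<lambda>(f, g). (\<lambda>i\<in>{..<N}. if i < h then f i else g (i - h))) ` pairs \<subseteq> Sol {..<N} b"
    proof (rule image_subsetI, clarify)
      fix f g assume fg: "(f, g) \<in> pairs"
      let ?x = "\<lambda>i\<in>{..<N}. if i < h then f i else g (i - h)"
      have "(\<Sum>i<N. b i * ?x i) = (\<Sum>i<N. if i < h then f i else - g (i - h))"
        by (intro sum.cong) (auto simp: b_def)
      also have "\<dots> = (\<Sum>i<h. f i) + (\<Sum>i=h..<N. - g (i - h))"
      proof -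
        have "{..<N} = {..<h} \<union> {h..<N}" using h by auto
        then have "(\<Sum>i<N. if i < h then f i else - g (i - h)) = (\<Sum>i<h. if i < h then f i else - g (i - h))
            + (\<Sum>i=h..<N. if i < h then f i else - g (i - h))"
          by (simp add: sum.union_disjoint ivl_disj_int)
        also have "(\<Sum>i<h. if i < h then f i else - g (i - h)) = (\<Sum>i<h. f i)" by (intro sum.cong) auto
        also have "(\<Sum>i=h..<N. if i < h then f i else - g (i - h)) = (\<Sum>i=h..<N. - g (i - h))" by (intro sum.cong) auto
        finally show ?thesis .
      qed
      also have "(\<Sum>i=h..<N. - g (i - h)) = (\<Sum>i<h. - g i)"
        by (rule sum.reindex_bij_witness[of _ "\<lambda>i. i + h" "\<lambda>i. i - h"]) (use h in auto)
      also have "(\<Sum>i<h. f i) + (\<Sum>i<h. - g i) = 0" using fg by (simp add: pairs_def \<sigma>_def sum_negf)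
      finally show "?x \<in> Sol {..<N} b"
        using fg h by (auto simp: Sol_def pairs_def W_def PiE_iff)
    qed
  qed (simp add: finite_Sol)
  then have "real (card pairs) \<le> real (card (Sol {..<N} b))" by simp
  also have "\<dots> \<le> (2 ^ N * K) ^ card {..<N} * sqrt (real (card A')) ^ card {..<N}"
    by (rule card_Sol_le[OF K]) (use Qb F_1 F_minus in \<open>auto simp: b_def\<close>)
  also have "\<dots> = (2 ^ N * K) ^ N * real (card A') ^ h"
    by (simp add: h power_mult)
  finally have en: "real (card pairs) \<le> (2 ^ N * K) ^ N * real (card A') ^ h" .
  have "(\<Sum>y\<in>\<sigma> ` W. real (r y)) ^ 2 \<le> real (card (\<sigma> ` W)) * (\<Sum>y\<in>\<sigma> ` W. real (r y) ^ 2)"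
    using sum_squared_le_sum_of_squares[of "\<lambda>y. real (r y)" "\<sigma> ` W"] finW by (simp add: mult.commute)
  moreover have "(\<Sum>y\<in>\<sigma> ` W. real (r y)) = real (card A') ^ h"
    using sum_r cW by (metis of_nat_power of_nat_sum)
  moreover have "(\<Sum>y\<in>\<sigma> ` W. real (r y) ^ 2) = real (card pairs)"
    unfolding sum_r2 by simp
  moreover have "card (\<sigma> ` W) \<le> card (hsumset h A')"
    by (rule card_mono[OF finite_hsumset[OF finite_A'] sub])
  ultimately have "(real (card A') ^ h) ^ 2 \<le> real (card (hsumset h A')) * real (card pairs)"
    by (smt (verit) mult_right_mono of_nat_0_le_iff of_nat_le_iff)
  also have "\<dots> \<le> real (card (hsumset h A')) * ((2 ^ N * K) ^ N * real (card A') ^ h)"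
    using en by (intro mult_left_mono) auto
  finally have "real (card A') ^ h * real (card A') ^ h
      \<le> (real (card (hsumset h A')) * (2 ^ N * K) ^ N) * real (card A') ^ h"
    by (simp add: power2_eq_square mult_ac)
  moreover have "real (card A') ^ h > 0" using card_A' by simp
  ultimately show ?thesis by (simp add: mult_le_cancel_right_pos)
qed

text \<open>The factor \<open>card Sc\<close> in \<open>X d\<close> is raised to the power
  \<open>2 ^ N\<close>, so the root of \<open>card A\<close> it contains has to be of order
  \<open>j = 2 * 2 ^ N\<close> to end up as a square root. Replacing the square root of
  \<open>card A\<close> by that of \<open>card A'\<close> costs at most \<open>q\<close>, which is
  absorbed in \<open>K\<close>.\<close>

lemma sumset_bound:
  assumes h: "N = 2 * h" "h \<ge> 2" and q: "real (card A) \<le> q * real (card A')" "q \<ge> 1"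
    "ln q \<le> 11 * fact N ^ 2"
  shows "real (card A') ^ h \<le> real (card (hsumset h A')) * exp (real N * (real N + 25 * \<alpha> * fact N ^ 4))"
proof -
  obtain d where d: "real d + 1 \<le> 2 * \<alpha>"
    and Qd: "\<And>I b. finite I \<Longrightarrow> I \<noteq> {} \<Longrightarrow> card I \<le> N \<Longrightarrow> (\<And>i. i \<in> I \<Longrightarrow> b i \<in> F \<and> b i \<noteq> 0) \<Longrightarrow> card (Q I b) \<le> X d ^ 2 ^ N"
    using card_Q_le by blast
  \<comment> \<open>All quantities are measured in powers of \<open>f\<close>. The factorial of
    \<open>3 * fact N\<close> inside \<mu> has a logarithm of order \<open>f ^ 2\<close>, so
    \<open>ln W\<close> is of order \<open>\<alpha> * f ^ 3\<close> and, as \<open>2 ^ N\<close> is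
    at most \<open>f\<close>, \<open>ln K\<close> of order \<open>\<alpha> * f ^ 4\<close>.\<close>
  define f :: real where "f = fact N"
  note a1 = alpha_ge_1
  have N4: "N \<ge> 4" using h by simp
  have f24: "f \<ge> 24"
  proof -
    have "(fact 4 :: real) \<le> fact N" using N4 by (rule fact_mono)
    then show ?thesis by (simp add: f_def fact_numeral)
  qed
  have Nf: "real N \<le> f" unfolding f_def using fact_ge_self[of N] by (metis of_nat_fact of_nat_le_iff)
  have two: "(2::real) ^ N \<le> f"
    unfolding f_def using N4
  proof (induction N rule: dec_induct)
    case base then show ?case by (simp add: fact_numeral)
  next
    case (step n)
    have "2 * (2::real) ^ n \<le> real (Suc n) * fact n" using step by (intro mult_mono) auto
    then show ?case by simp
  qed
  define t :: nat where "t = fact (3 * fact N)"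
  have t1: "real t \<ge> 1" unfolding t_def by (simp add: fact_ge_1)
  have lnt: "ln (real t) \<le> 9 * f ^ 2"
    using ln_fact_le[of "3 * fact N"] by (simp add: t_def f_def power_mult_distrib)
  have lnf: "ln f \<le> f" "ln (real N) \<le> f" using ln_bound[of f] ln_bound[of "real N"] f24 N4 Nf by auto
  have ff: "f * 24 \<le> f * f" using f24 by (intro mult_left_mono) auto
  have ff3: "24 * f ^ 2 \<le> f ^ 3" using mult_right_mono[OF f24, of "f ^ 2"] by (simp add: power2_eq_square power3_eq_cube)
  have ff4: "24 * f ^ 3 \<le> f ^ 4" using mult_right_mono[OF f24, of "f ^ 3"] f24 by (simp add: power4_eq_xxxx power3_eq_cube mult.assoc)
  have ln\<mu>: "ln (real (\<mu> + 1)) \<le> 11 * f ^ 2"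
  proof -
    have fpos: "f \<ge> 1" using f24 by simp
    have N1: "real N ^ 4 \<ge> 1" using N4 by (intro one_le_power) simp
    have ft: "f * real t \<ge> 1" using mult_mono[of 1 f 1 "real t"] fpos t1 by simp
    have "real \<mu> = 64 * real N ^ 4 * (1 + f * real t)" by (simp add: \<mu>_def f_def t_def distrib_left)
    also have "\<dots> \<le> 64 * real N ^ 4 * (2 * (f * real t))" using ft by (intro mult_left_mono) auto
    finally have "real (\<mu> + 1) \<le> 129 * (real N ^ 4 * (f * real t))"
      using mult_mono[OF N1 ft] by simp
    also have "\<dots> \<le> exp 8 * (real N ^ 4 * (f * real t))"
    proof (rule mult_right_mono)
      have "(129::real) \<le> 2 ^ 8" by simp
      also have "\<dots> \<le> exp 1 ^ 8" using exp_ge_add_one_self[of 1] by (intro power_mono) auto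
      also have "\<dots> = exp (8::real)" by (simp add: exp_of_nat_mult[symmetric])
      finally show "129 \<le> exp (8::real)" .
    qed (use ft in auto)
    finally have "ln (real (\<mu> + 1)) \<le> ln (exp 8 * (real N ^ 4 * (f * real t)))"
      using fpos t1 N4 by (subst ln_le_cancel_iff) auto
    also have "\<dots> = 8 + (4 * ln (real N) + (ln f + ln (real t)))"
      using fpos t1 N4 by (simp add: ln_mult_pos ln_realpow)
    also have "\<dots> \<le> 8 + (4 * f + (f + 9 * f ^ 2))" using lnf lnt by linarith
    also have "\<dots> \<le> 11 * f ^ 2" unfolding power2_eq_square using ff f24 by linarith
    finally show ?thesis .
  qed
  define W :: real where "W = (2 * real (\<mu> + 1) ^ d) ^ N * (real N ^ 2 * 2 ^ N)"
  have XW: "real (X d) = real (card Sc) * W"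
    by (simp add: X_def W_def power_mult_distrib del: of_nat_add of_nat_Suc)
  have W1: "W \<ge> 1"
  proof -
    have "(2 * real (\<mu> + 1) ^ d) ^ N \<ge> 1"
      using mult_mono[of 1 2 1 "real (\<mu> + 1) ^ d"] by (intro one_le_power) (auto intro: one_le_power)
    moreover have "real N ^ 2 * 2 ^ N \<ge> 1"
      using mult_mono[of 1 "real N ^ 2" 1 "2 ^ N"] N4 by (auto intro: one_le_power)
    ultimately show ?thesis unfolding W_def using mult_mono[of 1 _ 1 "real N ^ 2 * 2 ^ N"] by fastforce
  qed
  have ln2: "ln (2::real) \<le> 1" using ln_le_minus_one[of 2] by simp
  have lnW: "ln W \<le> 23 * \<alpha> * f ^ 3"
  proof -
    have "ln W = real N * (ln 2 + real d * ln (real (\<mu> + 1))) + (2 * ln (real N) + real N * ln 2)"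
      unfolding W_def using N4 by (simp add: ln_mult_pos ln_realpow distrib_left del: of_nat_add of_nat_Suc)
    also have "\<dots> \<le> f * (1 + (2 * \<alpha> - 1) * (11 * f ^ 2)) + (2 * f + f * 1)"
    proof -
      have 1: "real d * ln (real (\<mu> + 1)) \<le> (2 * \<alpha> - 1) * (11 * f ^ 2)"
        by (rule mult_mono) (use d ln\<mu> a1 in auto)
      have "0 \<le> real d * ln (real (\<mu> + 1))" by (intro mult_nonneg_nonneg) auto
      then have 2: "real N * (ln 2 + real d * ln (real (\<mu> + 1))) \<le> f * (1 + (2 * \<alpha> - 1) * (11 * f ^ 2))"
        by (intro mult_mono[OF Nf add_mono[OF ln2 1]]) (use f24 in auto)
      have "real N * ln 2 \<le> f * 1" using Nf ln2 f24 by (intro mult_mono) auto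
      then show ?thesis using 2 lnf(2) by linarith
    qed
    also have "\<dots> \<le> 23 * \<alpha> * f ^ 3"
    proof -
      have e: "f * (1 + (2 * \<alpha> - 1) * (11 * f ^ 2)) + (2 * f + f * 1) = 4 * f + 22 * (\<alpha> * f ^ 3) - 11 * f ^ 3"
        by (simp add: algebra_simps power2_eq_square power3_eq_cube)
      have "4 * f \<le> f ^ 3" using ff ff3 f24 unfolding power2_eq_square by linarith
      moreover have "0 \<le> \<alpha> * f ^ 3" "0 \<le> f ^ 3" using a1 f24 by simp_all
      ultimately show ?thesis unfolding e mult.assoc by linarith
    qed
    finally show ?thesis .
  qed
  define j :: nat where "j = 2 * 2 ^ N"
  have j1: "j \<ge> 1" by (simp add: j_def)
  define \<beta> where "\<beta> = root j (real (card A))"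
  have \<beta>1: "\<beta> \<ge> 1" unfolding \<beta>_def using card_A j1 by simp
  have Sc: "real (card Sc) \<le> 3 * real j * \<alpha> ^ 4 * \<beta>"
  proof -
    have "1 * 1 * 1 \<le> real j * \<alpha> ^ 4 * \<beta>"
      using j1 a1 \<beta>1 by (intro mult_mono one_le_power) auto
    then show ?thesis using card_Sc[OF j1] by (simp add: \<beta>_def)
  qed
  define K where "K = (3 * real j * \<alpha> ^ 4 * W) ^ 2 ^ N * q"
  have base1: "3 * real j * \<alpha> ^ 4 * W \<ge> 1"
  proof -
    have "1 * 1 * 1 \<le> (3 * real j) * \<alpha> ^ 4 * W"
      using j1 a1 W1 by (intro mult_mono one_le_power) auto
    then show ?thesis by simp
  qed
  have K1: "K \<ge> 1"
  proof -
    have "1 \<le> (3 * real j * \<alpha> ^ 4 * W) ^ 2 ^ N" using base1 by (rule one_le_power)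
    then have "1 * 1 \<le> (3 * real j * \<alpha> ^ 4 * W) ^ 2 ^ N * q" using q(2) by (intro mult_mono) auto
    then show ?thesis by (simp add: K_def)
  qed
  have XK: "real (X d) ^ 2 ^ N \<le> K * sqrt (real (card A'))"
  proof -
    have "real (X d) ^ 2 ^ N \<le> ((3 * real j * \<alpha> ^ 4 * \<beta>) * W) ^ 2 ^ N"
      unfolding XW using Sc W1 by (intro power_mono mult_right_mono) auto
    also have "\<dots> = (3 * real j * \<alpha> ^ 4 * W) ^ 2 ^ N * \<beta> ^ 2 ^ N"
      by (simp add: power_mult_distrib mult_ac)
    also have "\<beta> ^ 2 ^ N = sqrt (real (card A))"
    proof -
      have "(\<beta> ^ 2 ^ N) ^ 2 = \<beta> ^ j" by (simp add: j_def power_mult[symmetric] mult.commute)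
      also have "\<dots> = real (card A)" unfolding \<beta>_def using j1 by simp
      finally show ?thesis using \<beta>1 by (intro real_sqrt_unique[symmetric]) auto
    qed
    also have "sqrt (real (card A)) \<le> sqrt (q ^ 2 * real (card A'))"
    proof (rule real_sqrt_le_mono)
      have "q * 1 \<le> q * q" using q(2) by (intro mult_left_mono) auto
      then have "q * real (card A') \<le> q ^ 2 * real (card A')" by (intro mult_right_mono) (auto simp: power2_eq_square)
      then show "real (card A) \<le> q ^ 2 * real (card A')" using q(1) by linarith
    qed
    also have "\<dots> = q * sqrt (real (card A'))" using q(2) by (simp add: real_sqrt_mult)
    finally show ?thesis using base1 by (simp add: K_def mult_left_mono mult_ac)
  qed
  have lnK: "ln K \<le> 25 * \<alpha> * f ^ 4"
  proof -
    have "ln (3 * real j * \<alpha> ^ 4 * W) = ln (6::real) + real N * ln 2 + 4 * ln \<alpha> + ln W"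
      using a1 W1 by (simp add: j_def ln_mult_pos ln_realpow mult.assoc[symmetric] del: mult.assoc)
    also have "\<dots> \<le> 5 + f * 1 + 4 * \<alpha> + 23 * \<alpha> * f ^ 3"
      using ln_le_minus_one[of 6] ln_bound[of \<alpha>] a1 ln2 Nf lnW f24
      by (intro add_mono mult_mono) auto
    also have "\<dots> \<le> 24 * \<alpha> * f ^ 3"
    proof -
      have "5 + f * 1 + 4 * \<alpha> \<le> \<alpha> * (9 + f)"
        using a1 f24 mult_right_mono[of 1 \<alpha> "5 + f"] by (simp add: algebra_simps)
      also have "\<dots> \<le> \<alpha> * f ^ 3"
      proof (rule mult_left_mono)
        show "9 + f \<le> f ^ 3" using ff ff3 f24 unfolding power2_eq_square by linarith
      qed (use a1 in simp)
      finally show ?thesis by simp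
    qed
    finally have lb: "ln (3 * real j * \<alpha> ^ 4 * W) \<le> 24 * \<alpha> * f ^ 3" .
    have "ln K = 2 ^ N * ln (3 * real j * \<alpha> ^ 4 * W) + ln q"
    proof -
      have pos: "3 * real j * \<alpha> ^ 4 * W > 0" using base1 by linarith
      have "ln K = ln ((3 * real j * \<alpha> ^ 4 * W) ^ 2 ^ N) + ln q"
        unfolding K_def by (rule ln_mult_pos[OF zero_less_power[OF pos]]) (use q(2) in simp)
      then show ?thesis by (simp only: ln_realpow of_nat_power of_nat_numeral)
    qed
    also have "\<dots> \<le> f * (24 * \<alpha> * f ^ 3) + 11 * f ^ 2"
      using lb two base1 q(3) f24 by (intro add_mono mult_mono) (auto simp: f_def)
    also have "\<dots> = 24 * (\<alpha> * f ^ 4) + 11 * f ^ 2" by (simp add: power3_eq_cube power4_eq_xxxx)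
    also have "\<dots> \<le> 25 * \<alpha> * f ^ 4"
    proof -
      have "11 * f ^ 2 \<le> f ^ 4" using ff3 ff4 zero_le_power2[of f] by linarith
      also have "\<dots> \<le> \<alpha> * f ^ 4" using a1 mult_right_mono[of 1 \<alpha> "f ^ 4"] by simp
      finally show ?thesis by simp
    qed
    finally show ?thesis .
  qed
  have "real (card A') ^ h \<le> real (card (hsumset h A')) * (2 ^ N * K) ^ N"
  proof (rule card_hsumset_ge[OF K1 h(1)])
    fix J :: "nat set" and b assume "finite J" "J \<noteq> {}" "card J \<le> N" "\<And>i. i \<in> J \<Longrightarrow> b i \<in> F \<and> b i \<noteq> 0"
    then have "card (Q J b) \<le> X d ^ 2 ^ N" by (rule Qd)
    then have "real (card (Q J b)) \<le> real (X d) ^ 2 ^ N" by (simp only: of_nat_le_iff of_nat_power[symmetric])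
    then show "real (card (Q J b)) \<le> K * sqrt (real (card A'))" using XK by linarith
  qed
  also have "(2 ^ N * K) ^ N \<le> exp (real N * (real N + 25 * \<alpha> * f ^ 4))"
  proof -
    have "2 ^ N * K > 0" using K1 by simp
    then have "(2 ^ N * K) ^ N = exp (real N * ln (2 ^ N * K))" by (simp add: exp_of_nat_mult)
    also have "ln (2 ^ N * K) = real N * ln 2 + ln K" using K1 by (simp add: ln_mult_pos ln_realpow)
    also have "exp (real N * (real N * ln 2 + ln K)) \<le> exp (real N * (real N + 25 * \<alpha> * f ^ 4))"
    proof -
      have "real N * ln 2 \<le> real N * 1" using ln2 by (intro mult_left_mono) auto
      then show ?thesis using lnK by (simp add: mult_left_mono)
    qed
    finally show ?thesis .
  qed
  finally show ?thesis by (simp add: mult_left_mono f_def)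
qed

end

section \<open>Absolute values of algebraic numbers\<close>

definition sring :: "'a::comm_ring_1 set \<Rightarrow> bool" where
  "sring S \<longleftrightarrow> 1 \<in> S \<and> (\<forall>x\<in>S. - x \<in> S) \<and> (\<forall>x\<in>S. \<forall>y\<in>S. x + y \<in> S) \<and> (\<forall>x\<in>S. \<forall>y\<in>S. x * y \<in> S)"

lemma sring_1: "sring S \<Longrightarrow> 1 \<in> S"
  and sring_minus: "sring S \<Longrightarrow> x \<in> S \<Longrightarrow> - x \<in> S"
  and sring_add: "sring S \<Longrightarrow> x \<in> S \<Longrightarrow> y \<in> S \<Longrightarrow> x + y \<in> S"
  and sring_mult: "sring S \<Longrightarrow> x \<in> S \<Longrightarrow> y \<in> S \<Longrightarrow> x * y \<in> S"
  by (auto simp: sring_def)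

lemma sring_0: "sring S \<Longrightarrow> 0 \<in> S"
  using sring_add[of S 1 "- 1"] sring_1 sring_minus by force

lemma sring_diff: "sring S \<Longrightarrow> x \<in> S \<Longrightarrow> y \<in> S \<Longrightarrow> x - y \<in> S"
  using sring_add[of S x "- y"] sring_minus by force

lemma sring_sum: "sring S \<Longrightarrow> (\<And>i. i \<in> A \<Longrightarrow> f i \<in> S) \<Longrightarrow> sum f A \<in> S"
  by (induction A rule: infinite_finite_induct) (auto intro: sring_0 sring_add)

lemma sring_power: "sring S \<Longrightarrow> x \<in> S \<Longrightarrow> x ^ n \<in> S"
  by (induction n) (auto intro: sring_1 sring_mult)

lemma sring_of_nat: "sring S \<Longrightarrow> of_nat n \<in> S"
  by (induction n) (auto intro: sring_0 sring_1 sring_add)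

lemma sring_of_int: "sring S \<Longrightarrow> of_int n \<in> S"
  by (cases n rule: int_cases2) (auto intro: sring_of_nat sring_minus)

definition pol :: "'a::comm_ring_1 set \<Rightarrow> 'a poly set" where
  "pol S = {p. \<forall>i. coeff p i \<in> S}"

lemma pol_coeff: "p \<in> pol S \<Longrightarrow> coeff p i \<in> S" by (simp add: pol_def)

lemma pol_add: "sring S \<Longrightarrow> p \<in> pol S \<Longrightarrow> q \<in> pol S \<Longrightarrow> p + q \<in> pol S"
  by (auto simp: pol_def sring_add)

lemma pol_minus: "sring S \<Longrightarrow> p \<in> pol S \<Longrightarrow> - p \<in> pol S"
  by (auto simp: pol_def sring_minus)

lemma pol_diff: "sring S \<Longrightarrow> p \<in> pol S \<Longrightarrow> q \<in> pol S \<Longrightarrow> p - q \<in> pol S"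
  by (auto simp: pol_def sring_diff)

lemma pol_mult: "sring S \<Longrightarrow> p \<in> pol S \<Longrightarrow> q \<in> pol S \<Longrightarrow> p * q \<in> pol S"
  by (auto simp: pol_def coeff_mult intro!: sring_sum sring_mult)

lemma pol_smult: "sring S \<Longrightarrow> c \<in> S \<Longrightarrow> p \<in> pol S \<Longrightarrow> Polynomial.smult c p \<in> pol S"
  by (auto simp: pol_def sring_mult)

lemma pol_monom: "sring S \<Longrightarrow> c \<in> S \<Longrightarrow> Polynomial.monom c n \<in> pol S"
  by (auto simp: pol_def coeff_monom sring_0)

lemma pol_pCons: "sring S \<Longrightarrow> c \<in> S \<Longrightarrow> p \<in> pol S \<Longrightarrow> pCons c p \<in> pol S"
  by (auto simp: pol_def coeff_pCons split: nat.splits)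

lemma pol_0: "sring S \<Longrightarrow> 0 \<in> pol S"
  by (auto simp: pol_def sring_0)

lemma poly_in_sring: "sring S \<Longrightarrow> p \<in> pol S \<Longrightarrow> x \<in> S \<Longrightarrow> poly p x \<in> S"
  unfolding poly_altdef by (intro sring_sum sring_mult sring_power pol_coeff)

text \<open>The ring S[x]. Over a field and for algebraic \<open>x\<close> it is again a field, so
  the same definition provides ring and field extensions.\<close>

definition adj :: "'a::comm_ring_1 set \<Rightarrow> 'a \<Rightarrow> 'a set" where
  "adj S x = {poly p x | p. p \<in> pol S}"

lemma adj_base: "sring S \<Longrightarrow> S \<subseteq> adj S x"
proof
  fix c assume "sring S" "c \<in> S"
  then have "[:c:] \<in> pol S" by (intro pol_pCons pol_0)
  then show "c \<in> adj S x" unfolding adj_def by (intro CollectI exI[of _ "[:c:]"]) simp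
qed

lemma adj_gen: "sring S \<Longrightarrow> x \<in> adj S x"
proof -
  assume S: "sring S"
  then have "[:0, 1:] \<in> pol S" by (intro pol_pCons pol_0 sring_0 sring_1)
  then show ?thesis unfolding adj_def by (intro CollectI exI[of _ "[:0, 1:]"]) simp
qed

lemma sring_adj:
  assumes S: "sring S"
  shows "sring (adj S x)"
  unfolding sring_def
proof (intro conjI ballI)
  show "1 \<in> adj S x" using adj_base[OF S] sring_1[OF S] by blast
  show "- a \<in> adj S x" if "a \<in> adj S x" for a
    using that pol_minus[OF S] unfolding adj_def by (auto simp: poly_minus[symmetric] simp del: poly_minus)
  show "a + b \<in> adj S x" if "a \<in> adj S x" "b \<in> adj S x" for a b
    using that pol_add[OF S] unfolding adj_def by (auto simp: poly_add[symmetric] simp del: poly_add)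
  show "a * b \<in> adj S x" if "a \<in> adj S x" "b \<in> adj S x" for a b
    using that pol_mult[OF S] unfolding adj_def by (auto simp: poly_mult[symmetric] simp del: poly_mult)
qed

text \<open>Chevalley's argument. By Zorn's lemma there is a maximal subring without
  \<open>1 / p\<close>. If neither \<open>x\<close> nor its inverse belonged to it,
  \<open>1 / p\<close> would be a polynomial in each of them, and the longer of two shortest such
  expressions could be shortened by means of the other.\<close>

lemma exists_valuation_ring:
  assumes p: "p \<ge> (2::nat)"
  obtains VR :: "complex set" where "sring VR" "1 / of_nat p \<notin> VR" "\<And>x. x \<in> VR \<or> x \<noteq> 0 \<and> inverse x \<in> VR"
    "\<And>b. b \<in> VR \<Longrightarrow> inverse (1 - of_nat p * b) \<in> VR"
proof -
  define \<pi> :: complex where "\<pi> = of_nat p"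
  have \<pi>0: "\<pi> \<noteq> 0" using p by (simp add: \<pi>_def)
  define \<A> where "\<A> = {R. sring R \<and> 1 / \<pi> \<notin> R}"
  have Ints: "sring (\<int> :: complex set)" by (auto simp: sring_def)
  have "1 / \<pi> \<notin> \<int>"
  proof
    assume "1 / \<pi> \<in> \<int>"
    then obtain n :: int where "1 / \<pi> = of_int n" by (elim Ints_cases)
    then have "of_int (int p * n) = (of_int 1 :: complex)" using \<pi>0 by (simp add: \<pi>_def field_simps)
    then have "int p * n = 1" by (simp only: of_int_eq_iff)
    then show False using p by (auto simp: zmult_eq_1_iff)
  qed
  then have "\<A> \<noteq> {}" using Ints by (auto simp: \<A>_def)
  moreover have "\<Union>\<C> \<in> \<A>" if C: "\<C> \<noteq> {}" "subset.chain \<A> \<C>" for \<C>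
  proof -
    have CA: "R \<in> \<A>" if "R \<in> \<C>" for R using C(2) that by (auto simp: subset.chain_def)
    have sC: "sring R" if "R \<in> \<C>" for R using CA[OF that] by (simp add: \<A>_def)
    have two: "\<exists>R\<in>\<C>. x \<in> R \<and> y \<in> R" if xy: "x \<in> \<Union>\<C>" "y \<in> \<Union>\<C>" for x y
    proof -
      obtain R1 R2 where R: "R1 \<in> \<C>" "x \<in> R1" "R2 \<in> \<C>" "y \<in> R2" using xy by blast
      then have "R1 \<subseteq> R2 \<or> R2 \<subseteq> R1" using C(2) by (auto simp: subset_chain_def)
      then show ?thesis using R by blast
    qed
    have "sring (\<Union>\<C>)"
      unfolding sring_def
    proof (intro conjI ballI)
      show "1 \<in> \<Union>\<C>" using C(1) CA by (auto simp: \<A>_def sring_def)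
      show "- x \<in> \<Union>\<C>" if "x \<in> \<Union>\<C>" for x using that sring_minus[OF sC] by blast
      show "x + y \<in> \<Union>\<C>" if "x \<in> \<Union>\<C>" "y \<in> \<Union>\<C>" for x y
        using two[OF that] sring_add[OF sC] by blast
      show "x * y \<in> \<Union>\<C>" if "x \<in> \<Union>\<C>" "y \<in> \<Union>\<C>" for x y
        using two[OF that] sring_mult[OF sC] by blast
    qed
    moreover have "1 / \<pi> \<notin> \<Union>\<C>" using CA by (auto simp: \<A>_def)
    ultimately show ?thesis by (simp add: \<A>_def)
  qed
  ultimately obtain VR where VR: "VR \<in> \<A>" and max: "\<And>X. X \<in> \<A> \<Longrightarrow> VR \<subseteq> X \<Longrightarrow> X = VR"
    using subset_Zorn_nonempty[of \<A>] by blast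
  have S: "sring VR" and nVR: "1 / \<pi> \<notin> VR" using VR by (auto simp: \<A>_def)
  have \<pi>VR: "\<pi> \<in> VR" unfolding \<pi>_def using S by (rule sring_of_nat)
  \<comment> \<open>Maximality: adjoining a new element must produce
    \<open>1 / \<pi>\<close>.\<close>
  have ext: "1 / \<pi> \<in> adj VR x" if "x \<notin> VR" for x
  proof (rule ccontr)
    assume "1 / \<pi> \<notin> adj VR x"
    then have "adj VR x \<in> \<A>" using sring_adj[OF S] by (simp add: \<A>_def)
    then have "adj VR x = VR" using max adj_base[OF S] by blast
    then show False using adj_gen[OF S] that by blast
  qed
  have jac: "1 - \<pi> * b \<noteq> 0 \<and> inverse (1 - \<pi> * b) \<in> VR" if b: "b \<in> VR" for b
  proof -
    define u where "u = 1 - \<pi> * b"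
    have u0: "u \<noteq> 0"
    proof
      assume "u = 0"
      then have "b = 1 / \<pi>" using \<pi>0 by (simp add: u_def field_simps)
      then show False using b nVR by simp
    qed
    \<comment> \<open>Otherwise \<open>1 / \<pi>\<close> is a polynomial in the inverse of
      \<open>u\<close>. Clearing denominators makes some power of \<open>u\<close> divisible by
      \<pi>, whereas every power of \<open>u\<close> is congruent to one modulo \<pi>.\<close>
    have "inverse u \<in> VR"
    proof (rule ccontr)
      assume "inverse u \<notin> VR"
      then obtain q where q: "q \<in> pol VR" "1 / \<pi> = poly q (inverse u)" using ext unfolding adj_def by blast
      define n where "n = degree q"
      have uO: "u \<in> VR" unfolding u_def by (intro sring_diff[OF S] sring_1[OF S] sring_mult[OF S] \<pi>VR b)
      define c where "c = (\<Sum>i\<le>n. coeff q i * u ^ (n - i))"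
      have cO: "c \<in> VR" unfolding c_def by (intro sring_sum[OF S] sring_mult[OF S] sring_power[OF S] uO pol_coeff[OF q(1)])
      have "u ^ n * poly q (inverse u) = c"
        unfolding poly_altdef c_def n_def[symmetric] sum_distrib_left
      proof (intro sum.cong refl)
        fix i assume "i \<in> {..n}"
        then have "u ^ n = u ^ (n - i) * u ^ i" by (simp add: power_add[symmetric])
        then show "u ^ n * (coeff q i * inverse u ^ i) = coeff q i * u ^ (n - i)"
          using u0 by (simp add: field_simps)
      qed
      then have "u ^ n * (1 / \<pi>) = c" unfolding q(2) .
      then have un: "u ^ n = \<pi> * c" using \<pi>0 by (simp add: field_simps)
      have "\<exists>b'\<in>VR. u ^ k = 1 - \<pi> * b'" for k
      proof (induction k)
        case 0 show ?case using sring_0[OF S] by (intro bexI[of _ 0]) auto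
      next
        case (Suc k)
        then obtain b' where b': "b' \<in> VR" "u ^ k = 1 - \<pi> * b'" by blast
        have "u ^ Suc k = 1 - \<pi> * (b' + b - \<pi> * b * b')" unfolding power_Suc b'(2) by (simp add: u_def algebra_simps)
        moreover have "b' + b - \<pi> * b * b' \<in> VR"
          by (intro sring_diff[OF S] sring_add[OF S] sring_mult[OF S] \<pi>VR b b')
        ultimately show ?case by blast
      qed
      then obtain b' where b': "b' \<in> VR" "u ^ n = 1 - \<pi> * b'" by blast
      have "1 = \<pi> * (c + b')" using un b'(2) by (simp add: algebra_simps)
      then have "1 / \<pi> = c + b'" using \<pi>0 by (simp add: field_simps)
      then show False using nVR sring_add[OF S cO b'(1)] by simp
    qed
    then show ?thesis using u0 by (simp add: u_def)
  qed
  \<comment> \<open>An expression of \<open>1 / \<pi>\<close> as a polynomial in \<open>x\<close> of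
    degree at most \<open>n\<close>, multiplied by \<pi>.\<close>
  define rep where "rep x n \<longleftrightarrow> (\<exists>a. (\<forall>i. a i \<in> VR) \<and> 1 = (\<Sum>i\<le>n. \<pi> * a i * x ^ i))" for x n
  have rep_ex: "\<exists>n. rep x n" if xVR: "x \<notin> VR" for x
  proof -
    obtain q where q: "q \<in> pol VR" "1 / \<pi> = poly q x" using ext[OF xVR] unfolding adj_def by blast
    have "1 = \<pi> * poly q x" using q(2)[symmetric] \<pi>0 by simp
    also have "\<dots> = (\<Sum>i\<le>degree q. \<pi> * coeff q i * x ^ i)"
      by (simp add: poly_altdef sum_distrib_left mult.assoc)
    finally show ?thesis unfolding rep_def using pol_coeff[OF q(1)] by blast
  qed
  have rep0: "\<not> rep x 0" for x
  proof
    assume "rep x 0"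
    then obtain a where a: "a 0 \<in> VR" "1 = \<pi> * a (0::nat)" unfolding rep_def by auto
    then have "1 / \<pi> = a 0" using \<pi>0 by (simp add: field_simps)
    then show False using nVR a(1) by simp
  qed
  have core: False if x: "x \<noteq> 0" and n: "rep x n" "\<And>k. k < n \<Longrightarrow> \<not> rep x k" and m: "rep (inverse x) m" "m \<le> n" for x n m
  proof -
    obtain a where a: "\<And>i. a i \<in> VR" "1 = (\<Sum>i\<le>n. \<pi> * a i * x ^ i)" using n(1) unfolding rep_def by blast
    obtain b where b: "\<And>i. b i \<in> VR" "1 = (\<Sum>i\<le>m. \<pi> * b i * inverse x ^ i)" using m(1) unfolding rep_def by blast
    have m0: "m \<noteq> 0" using rep0 m(1) by metis
    then obtain n' where n': "n = Suc n'" using m(2) by (cases n) auto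
    obtain m' where m': "m = Suc m'" using m0 by (cases m) auto
    \<comment> \<open>Because \<open>1 - \<pi> * b 0\<close> is invertible, the relation for the
      inverse of \<open>x\<close> can be solved for one and multiplied by \<open>x ^ n\<close>. This
      expresses \<open>x ^ n\<close> by lower powers and shortens the relation for
      \<open>x\<close>.\<close>
    define w where "w = inverse (1 - \<pi> * b 0)"
    have w: "w \<in> VR" "1 - \<pi> * b 0 \<noteq> 0" using jac[OF b(1)[of 0]] by (auto simp: w_def)
    have "1 - \<pi> * b 0 = (\<Sum>j\<le>m'. \<pi> * b (Suc j) * inverse x ^ Suc j)"
      using b(2) unfolding m' sum.atMost_Suc_shift by (simp add: algebra_simps)
    then have "1 = w * (\<Sum>j\<le>m'. \<pi> * b (Suc j) * inverse x ^ Suc j)"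
      using w(2) by (simp add: w_def field_simps)
    then have "x ^ n = x ^ n * (w * (\<Sum>j\<le>m'. \<pi> * b (Suc j) * inverse x ^ Suc j))" by simp
    also have "\<dots> = (\<Sum>j\<le>m'. \<pi> * w * b (Suc j) * x ^ (n' - j))"
      unfolding sum_distrib_left
    proof (intro sum.cong refl)
      fix j assume "j \<in> {..m'}"
      then have "x ^ n = x ^ (n' - j) * x ^ Suc j" using m(2) n' m' by (simp add: power_add[symmetric])
      then show "x ^ n * (w * (\<pi> * b (Suc j) * inverse x ^ Suc j)) = \<pi> * w * b (Suc j) * x ^ (n' - j)"
        using x by (simp add: power_inverse field_simps del: power_Suc)
    qed
    finally have xn: "x ^ n = (\<Sum>j\<le>m'. \<pi> * w * b (Suc j) * x ^ (n' - j))" .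
    define c where "c i = a i + (if n' - i \<le> m' then \<pi> * a n * w * b (Suc (n' - i)) else 0)" for i
    have "1 = (\<Sum>i\<le>n'. \<pi> * a i * x ^ i) + \<pi> * a n * x ^ n" using a(2) by (simp add: n')
    also have "\<pi> * a n * x ^ n = (\<Sum>j\<le>m'. \<pi> * (\<pi> * a n * w * b (Suc j)) * x ^ (n' - j))"
      unfolding xn sum_distrib_left by (intro sum.cong) (auto simp: mult_ac)
    also have "\<dots> = (\<Sum>i\<in>{i. i \<le> n' \<and> n' - i \<le> m'}. \<pi> * (\<pi> * a n * w * b (Suc (n' - i))) * x ^ i)"
      by (rule sum.reindex_bij_witness[of _ "\<lambda>i. n' - i" "\<lambda>j. n' - j"]) (use m(2) n' m' in auto)
    also have "\<dots> = (\<Sum>i\<le>n'. if n' - i \<le> m' then \<pi> * (\<pi> * a n * w * b (Suc (n' - i))) * x ^ i else 0)"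
      by (subst sum.inter_filter[symmetric]) (auto intro: sum.cong)
    finally have "1 = (\<Sum>i\<le>n'. \<pi> * c i * x ^ i)"
      unfolding sum.distrib[symmetric] c_def
      by (elim trans, intro sum.cong refl) (auto simp: algebra_simps)
    moreover have "c i \<in> VR" for i
      unfolding c_def by (auto intro!: sring_add[OF S] sring_mult[OF S] \<pi>VR a b w sring_0[OF S])
    ultimately have "rep x n'" unfolding rep_def by blast
    then show False using n(2)[of n'] n' by simp
  qed
  have val: "x \<in> VR \<or> x \<noteq> 0 \<and> inverse x \<in> VR" for x
  proof (rule ccontr)
    assume neg: "\<not> ?thesis"
    then have x: "x \<notin> VR" "inverse x \<notin> VR" "x \<noteq> 0" using sring_0[OF S] by auto
    define n where "n = (LEAST n. rep x n)"
    define m where "m = (LEAST n. rep (inverse x) n)"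
    have n: "rep x n" "\<And>k. k < n \<Longrightarrow> \<not> rep x k"
      unfolding n_def using LeastI_ex[OF rep_ex[OF x(1)]] not_less_Least by blast+
    have m: "rep (inverse x) m" "\<And>k. k < m \<Longrightarrow> \<not> rep (inverse x) k"
      unfolding m_def using LeastI_ex[OF rep_ex[OF x(2)]] not_less_Least by blast+
    show False
    proof (cases "m \<le> n")
      case True then show False using core[OF x(3) n m(1)] by blast
    next
      case False then show False using core[of "inverse x" m n] m n(1) x(3) by simp
    qed
  qed
  show ?thesis by (rule that[OF S]) (use nVR val jac in \<open>auto simp: \<pi>_def\<close>)
qed

text \<open>The \<open>p\<close>-adic absolute value on the algebraic numbers, from a valuation ring: some power of
  an algebraic number is a power of \<open>p\<close> up to a unit.\<close>

lemma exists_padic_absolute_value: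
  assumes p: "prime (p::nat)"
  obtains w :: "complex \<Rightarrow> real" where "w 0 = 0" "\<And>x. algebraic x \<Longrightarrow> x \<noteq> 0 \<Longrightarrow> w x > 0"
    "\<And>x y. algebraic x \<Longrightarrow> algebraic y \<Longrightarrow> w (x * y) = w x * w y"
    "\<And>x y. algebraic x \<Longrightarrow> algebraic y \<Longrightarrow> algebraic (x + y) \<Longrightarrow> w (x + y) \<le> max (w x) (w y)"
    "w (of_nat p) = 1 / real p" "\<And>c::int. \<not> int p dvd c \<Longrightarrow> w (of_int c) = 1"
proof -
  have p2: "p \<ge> 2" using p prime_ge_2_nat by blast
  obtain VR :: "complex set" where S: "sring VR" and nVR: "1 / of_nat p \<notin> VR"
    and val: "\<And>x. x \<in> VR \<or> x \<noteq> 0 \<and> inverse x \<in> VR" and jac: "\<And>b. b \<in> VR \<Longrightarrow> inverse (1 - of_nat p * b) \<in> VR"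
    using exists_valuation_ring[OF p2] by blast
  define \<pi> :: complex where "\<pi> = of_nat p"
  have \<pi>0: "\<pi> \<noteq> 0" using p2 by (simp add: \<pi>_def)
  have \<pi>VR: "\<pi> \<in> VR" unfolding \<pi>_def using S by (rule sring_of_nat)
  define unit where "unit x \<longleftrightarrow> x \<in> VR \<and> inverse x \<in> VR \<and> x \<noteq> 0" for x
  have unit_1: "unit 1" using sring_1[OF S] by (simp add: unit_def)
  have unit_mult: "unit (x * y)" if "unit x" "unit y" for x y
    using that sring_mult[OF S] by (auto simp: unit_def)
  have unit_inv: "unit (inverse x)" if "unit x" for x using that by (auto simp: unit_def)
  have unit_div: "unit (x / y)" if "unit x" "unit y" for x y
    using unit_mult[OF that(1) unit_inv[OF that(2)]] by (simp add: divide_inverse)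
  have unit_pow: "unit (x ^ n)" if "unit x" for x n by (induction n) (auto simp: unit_1 unit_mult that)
  have unit_powi: "unit (x powi n)" if "unit x" for x n
    using unit_pow[OF that] unit_inv[OF unit_pow[OF that]] by (auto simp: power_int_def power_inverse)
  have \<pi>_notunit: "\<not> unit (\<pi> powi n)" if "n > 0" for n
  proof
    assume u: "unit (\<pi> powi n)"
    obtain k where k: "n = int (Suc k)" using \<open>n > 0\<close> by (metis gr0_implies_Suc pos_int_cases)
    have "inverse (\<pi> powi n) * \<pi> ^ k \<in> VR" using u by (auto simp: unit_def intro!: sring_mult[OF S] sring_power[OF S] \<pi>VR)
    moreover have "inverse (\<pi> powi n) * \<pi> ^ k = 1 / \<pi>" using \<pi>0 unfolding k by (simp add: field_simps power_int_def nat_add_distrib)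
    ultimately show False using nVR by (simp add: \<pi>_def)
  qed
  have \<pi>_unit: "n = 0" if "unit (\<pi> powi n)" for n
  proof (rule ccontr)
    assume "n \<noteq> 0"
    then consider "n > 0" | "- n > 0" by linarith
    then show False
    proof cases
      case 1 then show False using \<pi>_notunit that by blast
    next
      case 2
      then show False using \<pi>_notunit[OF 2] unit_inv[OF that] by (simp add: power_int_minus)
    qed
  qed
  have coprime_unit: "unit (of_int c)" if c: "\<not> int p dvd c" for c :: int
  proof -
    have "coprime (int p) c" using p c by (intro prime_imp_coprime) auto
    then obtain u v where uv: "u * c + v * int p = 1"
      using bezout_int[of c "int p"] by (metis coprime_commute coprime_iff_gcd_eq_1)
    have "of_int (u * c + v * int p) = (1::complex)" by (simp add: uv)
    then have e: "of_int u * of_int c = 1 - of_nat p * (of_int v :: complex)" by (simp add: algebra_simps)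
    have "inverse (1 - of_nat p * (of_int v :: complex)) \<in> VR" by (rule jac) (rule sring_of_int[OF S])
    then have i: "of_int u * inverse (of_int u * of_int c :: complex) \<in> VR"
      unfolding e[symmetric] by (intro sring_mult[OF S] sring_of_int[OF S])
    have c0: "c \<noteq> 0" using c by auto
    have "u \<noteq> 0"
    proof
      assume "u = 0"
      then have "v * int p = 1" using uv by simp
      then show False using p2 by (metis abs_of_nat abs_zmult_eq_1 mult.commute of_nat_1 of_nat_eq_iff Suc_1 not_less_eq_eq le_refl)
    qed
    then have "inverse (of_int c :: complex) \<in> VR" using i c0 by (simp add: field_simps)
    then show ?thesis using c0 sring_of_int[OF S] by (simp add: unit_def)
  qed
  have int_decomp: "\<exists>k u. unit u \<and> of_int c = u * \<pi> ^ k" if c: "c \<noteq> 0" for c :: int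
  proof -
    obtain k c' where "c = int p ^ k * c'" "\<not> int p dvd c'"
      using multiplicity_decompose'[of c "int p"] c p by (metis prime_nat_int_transfer not_prime_unit)
    then show ?thesis using coprime_unit[of c'] by (intro exI[of _ k] exI[of _ "of_int c'"]) (auto simp: \<pi>_def)
  qed
  \<comment> \<open>Up to a unit, the \<open>k\<close>-th power of \<open>x\<close> is the
    \<open>m\<close>-th power of \<pi>, so that \<open>x\<close> should have valuation
    \<open>m / k\<close>.\<close>
  define R where "R x k m \<longleftrightarrow> k > 0 \<and> unit (x ^ k * \<pi> powi (- m))" for x and k :: nat and m :: int
  have powi_pow: "(\<pi> powi i) ^ j = \<pi> powi (i * int j)" for i j
    by (simp add: power_int_mult)
  have uniq: "real_of_int m / real k = real_of_int n / real l" if "R x k m" "R x l n" for x k m l n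
  proof -
    have kl: "k > 0" "l > 0" using that by (auto simp: R_def)
    have "unit ((x ^ k * \<pi> powi (- m)) ^ l / (x ^ l * \<pi> powi (- n)) ^ k)"
      using that unfolding R_def by (intro unit_div unit_pow) auto
    moreover have "x \<noteq> 0" using that kl by (auto simp: R_def unit_def)
    moreover have "(x ^ k * \<pi> powi (- m)) ^ l / (x ^ l * \<pi> powi (- n)) ^ k = \<pi> powi (n * int k - m * int l)"
      if x0: "x \<noteq> 0"
    proof -
      have "(x ^ k * \<pi> powi (- m)) ^ l / (x ^ l * \<pi> powi (- n)) ^ k
          = (x ^ (k * l) * \<pi> powi (- m * int l)) / (x ^ (k * l) * \<pi> powi (- n * int k))"
        by (simp only: power_mult_distrib powi_pow power_mult[symmetric] mult.commute[of l k])
      also have "\<dots> = \<pi> powi (- m * int l) / \<pi> powi (- n * int k)" using x0 by simp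
      also have "\<dots> = \<pi> powi (- m * int l - (- n * int k))" by (rule power_int_diff[symmetric]) (use \<pi>0 in simp)
      finally show ?thesis by (simp add: algebra_simps)
    qed
    ultimately have "n * int k - m * int l = 0" using \<pi>_unit by metis
    then have "real_of_int (n * int k) = real_of_int (m * int l)" by simp
    then show ?thesis using kl by (simp add: field_simps)
  qed
  define w where "w x = (if x = 0 then 0 else real p powr (- (case (SOME (k, m). R x k m) of (k, m) \<Rightarrow> real_of_int m / real k)))" for x
  have w_eq: "w x = real p powr (- (real_of_int m / real k))" if "R x k m" for x k m
  proof -
    obtain k' m' where km: "(SOME (k, m). R x k m) = (k', m')" by fastforce
    have "case (SOME (k, m). R x k m) of (k, m) \<Rightarrow> R x k m"
      by (rule someI[of "\<lambda>(k, m). R x k m" "(k, m)"]) (use that in simp)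
    then have "R x k' m'" by (simp add: km)
    then have "real_of_int m' / real k' = real_of_int m / real k" using uniq that by blast
    moreover have "x \<noteq> 0" using that by (auto simp: R_def unit_def)
    ultimately show ?thesis by (simp add: w_def km)
  qed
  \<comment> \<open>A valuation ring is local: of two non-zero elements one divides the other, so a
    unit sum would make a summand a unit.\<close>
  have nonunit_add: "\<not> unit (x + y)" if x: "x \<in> VR" "\<not> unit x" and y: "y \<in> VR" "\<not> unit y" for x y
  proof -
    have key: "\<not> unit (x + y)" if xy: "x \<in> VR" "y \<in> VR" "\<not> unit y" "y \<noteq> 0" "x / y \<in> VR" for x y
    proof
      assume "unit (x + y)"
      moreover have "x + y = y * (1 + x / y)" using xy(4) by (simp add: field_simps)
      ultimately have u: "unit (y * (1 + x / y))" by simp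
      then have iu: "inverse (y * (1 + x / y)) \<in> VR" and nz: "1 + x / y \<noteq> 0" unfolding unit_def by auto
      have "(1 + x / y) * inverse (y * (1 + x / y)) \<in> VR"
        by (intro sring_mult[OF S] sring_add[OF S] sring_1[OF S] iu xy(5))
      moreover have "(1 + x / y) * inverse (y * (1 + x / y)) = inverse y"
        using nz by (subst inverse_mult_distrib) simp
      ultimately have "inverse y \<in> VR" by (simp only:)
      then show False using xy(2-4) unfolding unit_def by simp
    qed
    show ?thesis
    proof (cases "x = 0 \<or> y = 0")
      case True then show ?thesis using x y by auto
    next
      case False
      consider "x / y \<in> VR" | "y / x \<in> VR" using val[of "x / y"] False by auto
      then show ?thesis
      proof cases
        case 1 then show ?thesis using key[of x y] x y False by blast
      next
        case 2 then show ?thesis using key[of y x] x y False by (simp add: add.commute)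
      qed
    qed
  qed
  have nonunit_sum: "finite I \<Longrightarrow> (\<And>i. i \<in> I \<Longrightarrow> f i \<in> VR \<and> \<not> unit (f i)) \<Longrightarrow> sum f I \<in> VR \<and> \<not> unit (sum f I)"
    for f :: "nat \<Rightarrow> complex" and I
  proof (induction I rule: finite_induct)
    case empty then show ?case using sring_0[OF S] by (simp add: unit_def)
  next
    case (insert i I)
    then show ?case using nonunit_add[of "f i" "sum f I"] sring_add[OF S] by auto
  qed
  \<comment> \<open>Among the terms of an integral equation of \<open>x\<close>, one divides all
    others. The quotients by it sum to minus one, so some quotient is a unit. Two terms thus agree
    up to a unit, and as their coefficients are powers of \<pi> up to units, so is a power of
    \<open>x\<close>.\<close>
  have R_ex: "\<exists>k m. R x k m" if alg: "algebraic x" and x0: "x \<noteq> 0" for x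
  proof -
    obtain q where q: "\<And>i. coeff q i \<in> \<int>" "q \<noteq> 0" "poly q x = 0" using alg by (rule algebraicE) blast
    define I where "I = {i. i \<le> degree q \<and> coeff q i \<noteq> 0}"
    define t where "t i = coeff q i * x ^ i" for i
    have finI: "finite I" by (simp add: I_def)
    have t0: "t i \<noteq> 0" if "i \<in> I" for i using that x0 by (auto simp: I_def t_def)
    have sum0: "(\<Sum>i\<in>I. t i) = 0"
    proof -
      have "(\<Sum>i\<in>I. t i) = (\<Sum>i\<le>degree q. t i)" by (rule sum.mono_neutral_left) (auto simp: I_def t_def)
      then show ?thesis using q(3) by (simp add: poly_altdef t_def)
    qed
    have "degree q \<in> I" using q(2) by (simp add: I_def)
    then have "I \<noteq> {}" by blast
    have minimal: "\<exists>j\<in>J. \<forall>i\<in>J. t i / t j \<in> VR" if "J \<subseteq> I" "J \<noteq> {}" for J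
    proof -
      have "finite J" using that(1) finI finite_subset by blast
      then show ?thesis using that(2,1)
      proof (induction J rule: finite_ne_induct)
        case (singleton i)
        then show ?case using t0[of i] sring_1[OF S] by simp
      next
        case (insert i J)
        then obtain j where j: "j \<in> J" "\<And>i. i \<in> J \<Longrightarrow> t i / t j \<in> VR" by auto
        have nz: "t i \<noteq> 0" "t j \<noteq> 0" using t0 insert.prems j(1) by auto
        show ?case
        proof (cases "t i / t j \<in> VR")
          case True then show ?thesis using j by blast
        next
          case False
          then have ji: "t j / t i \<in> VR" using val[of "t i / t j"] by simp
          have "t l / t i \<in> VR" if "l \<in> insert i J" for l
          proof (cases "l = i")
            case True then show ?thesis using nz sring_1[OF S] by simp
          next
            case False
            then have "t l / t j * (t j / t i) \<in> VR" using that j(2) ji by (intro sring_mult[OF S]) auto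
            then show ?thesis using nz by simp
          qed
          then show ?thesis by blast
        qed
      qed
    qed
    obtain j where j: "j \<in> I" "\<And>i. i \<in> I \<Longrightarrow> t i / t j \<in> VR" using minimal[OF order_refl \<open>I \<noteq> {}\<close>] by auto
    have "\<exists>i\<in>I - {j}. unit (t i / t j)"
    proof (rule ccontr)
      assume "\<not> ?thesis"
      then have "\<not> unit (\<Sum>i\<in>I - {j}. t i / t j)"
        using nonunit_sum[of "I - {j}" "\<lambda>i. t i / t j"] finI j(2) by auto
      moreover have "(\<Sum>i\<in>I - {j}. t i / t j) = - 1"
      proof -
        have "t j + (\<Sum>i\<in>I - {j}. t i) = 0" using sum.remove[OF finI j(1), of t] sum0 by simp
        then have "(\<Sum>i\<in>I - {j}. t i) = - t j" by (simp add: eq_neg_iff_add_eq_0 add.commute)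
        then show ?thesis using t0[OF j(1)] by (simp add: sum_divide_distrib[symmetric])
      qed
      moreover have "unit (- 1)" using sring_minus[OF S sring_1[OF S]] by (simp add: unit_def)
      ultimately show False by simp
    qed
    then obtain i where i: "i \<in> I" "i \<noteq> j" "unit (t i / t j)" by blast
    have key: "\<exists>k m. R x k m" if ab: "a \<in> I" "b \<in> I" "a < b" "unit (t b / t a)" for a b
    proof -
      obtain ca cb :: int where cc: "coeff q a = of_int ca" "coeff q b = of_int cb"
        using q(1) by (metis Ints_cases)
      then have "ca \<noteq> 0" "cb \<noteq> 0" using ab by (auto simp: I_def)
      then obtain ka ua kb ub where d: "unit ua" "of_int ca = ua * \<pi> ^ ka" "unit ub" "of_int cb = ub * \<pi> ^ kb"
        using int_decomp by metis
      have xb: "x ^ b = x ^ (b - a) * x ^ a" using ab(3) by (simp add: power_add[symmetric])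
      have "unit (t b / t a * (ua / ub))" by (intro unit_mult[OF ab(4)] unit_div d(1) d(3))
      moreover have "t b / t a * (ua / ub) = x ^ (b - a) * (\<pi> ^ kb / \<pi> ^ ka)"
        using d(1,3) x0 \<pi>0 unfolding t_def cc d(2,4) xb by (simp add: unit_def field_simps)
      moreover have "\<pi> ^ kb / \<pi> ^ ka = \<pi> powi (- (int ka - int kb))"
        using \<pi>0 by (simp add: power_int_diff)
      ultimately have "R x (b - a) (int ka - int kb)" using ab(3) by (simp add: R_def)
      then show ?thesis by blast
    qed
    show ?thesis
    proof (cases "i < j")
      case True
      have "unit (t j / t i)" using unit_inv[OF i(3)] by simp
      then show ?thesis using key[OF i(1) j(1) True] by blast
    next
      case False
      then show ?thesis using key[OF j(1) i(1) _ i(3)] i(2) by simp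
    qed
  qed
  have R_mult: "R (x * y) (k * l) (m * int l + n * int k)" if "R x k m" "R y l n" for x y k l m n
  proof -
    have "unit ((x ^ k * \<pi> powi (- m)) ^ l * (y ^ l * \<pi> powi (- n)) ^ k)"
      by (rule unit_mult[OF unit_pow unit_pow]) (use that in \<open>auto simp: R_def\<close>)
    also have "(x ^ k * \<pi> powi (- m)) ^ l * (y ^ l * \<pi> powi (- n)) ^ k
        = (x * y) ^ (k * l) * \<pi> powi (- (m * int l + n * int k))"
    proof -
      have "(x ^ k * \<pi> powi (- m)) ^ l * (y ^ l * \<pi> powi (- n)) ^ k
          = (x * y) ^ (k * l) * (\<pi> powi (- m * int l) * \<pi> powi (- n * int k))"
        by (simp only: power_mult_distrib powi_pow power_mult[symmetric] mult.commute[of l k] mult_ac)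
      also have "\<pi> powi (- m * int l) * \<pi> powi (- n * int k) = \<pi> powi (- (m * int l + n * int k))"
        using \<pi>0 by (simp add: power_int_add[symmetric])
      finally show ?thesis .
    qed
    finally show ?thesis using that by (simp add: R_def)
  qed
  have R_inv: "R (inverse x) k (- m)" if "R x k m" for x k m
  proof -
    have "unit (inverse (x ^ k * \<pi> powi (- m)))" by (rule unit_inv) (use that in \<open>simp add: R_def\<close>)
    then show ?thesis using that by (simp add: R_def power_inverse power_int_minus)
  qed
  have w_mult: "w (x * y) = w x * w y" if R: "R x k m" "R y l n" for x y k m l n
  proof -
    have kl: "k > 0" "l > 0" using R by (auto simp: R_def)
    have "real_of_int (m * int l + n * int k) / real (k * l) = real_of_int m / real k + real_of_int n / real l"
      using kl by (simp add: field_simps)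
    then show ?thesis unfolding w_eq[OF R_mult[OF R]] w_eq[OF R(1)] w_eq[OF R(2)] by (simp add: powr_add[symmetric])
  qed
  have w_le1: "w x \<le> 1" if R: "R x k m" and xO: "x \<in> VR" for x k m
  proof -
    have "m \<ge> 0"
    proof (rule ccontr)
      assume "\<not> m \<ge> 0"
      then obtain n where n: "- m = int (Suc n)" by (metis add.inverse_inverse neg_int_cases not_le zero_less_imp_eq_int gr0_implies_Suc)
      have "unit (x ^ k * \<pi> powi (- m))" using R by (simp add: R_def)
      then have u: "unit (x ^ k * \<pi> ^ n * \<pi>)" unfolding n power_int_of_nat by (simp add: mult_ac)
      have "x ^ k * \<pi> ^ n * inverse (x ^ k * \<pi> ^ n * \<pi>) \<in> VR"
        using u by (intro sring_mult[OF S] sring_power[OF S] xO \<pi>VR) (auto simp: unit_def)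
      moreover have "x ^ k * \<pi> ^ n * inverse (x ^ k * \<pi> ^ n * \<pi>) = 1 / \<pi>" using u \<pi>0 by (simp add: unit_def field_simps)
      ultimately show False using nVR by (simp add: \<pi>_def)
    qed
    then have "real_of_int m / real k \<ge> 0" by simp
    then show ?thesis unfolding w_eq[OF R] using p2 powr_mono[of "- (real_of_int m / real k)" 0 "real p"] by simp
  qed
  have w0: "w 0 = 0" by (simp add: w_def)
  have wpos: "w x > 0" if x: "algebraic x" "x \<noteq> 0" for x
  proof -
    obtain k m where R: "R x k m" using R_ex[OF x] by blast
    show ?thesis unfolding w_eq[OF R] using p2 by simp
  qed
  have wge: "w x \<ge> 0" for x by (simp add: w_def)
  show ?thesis
  proof (rule that[of w])
    show "w 0 = 0" by (rule w0)
    show "w x > 0" if "algebraic x" "x \<noteq> 0" for x using wpos that .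
    show "w (x * y) = w x * w y" if xy: "algebraic x" "algebraic y" for x y
    proof (cases "x = 0 \<or> y = 0")
      case True then show ?thesis using w0 by auto
    next
      case False
      then obtain k m l n where "R x k m" "R y l n" using R_ex[OF xy(1)] R_ex[OF xy(2)] by blast
      then show ?thesis by (rule w_mult)
    qed
    show "w (x + y) \<le> max (w x) (w y)" if alg: "algebraic x" "algebraic y" "algebraic (x + y)" for x y
    proof -
      have key: "w (x + y) \<le> w y" if a: "algebraic x" "algebraic y" "algebraic (x + y)" "y \<noteq> 0" "x + y \<noteq> 0" "x / y \<in> VR" for x y
      proof -
        obtain k m where ky: "R y k m" using R_ex[OF a(2,4)] by blast
        obtain l n where ls: "R (x + y) l n" using R_ex[OF a(3,5)] by blast
        have e: "(x + y) * inverse y = 1 + x / y" using a(4) by (simp add: field_simps)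
        have Rq: "R (1 + x / y) (l * k) (n * int k + (- m) * int l)"
          using R_mult[OF ls R_inv[OF ky]] unfolding e .
        have "x + y = (1 + x / y) * y" using a(4) by (simp add: field_simps)
        then have "w (x + y) = w ((1 + x / y) * y)" by (rule arg_cong)
        also have "\<dots> = w (1 + x / y) * w y" by (rule w_mult[OF Rq ky])
        also have "\<dots> \<le> 1 * w y"
          using w_le1[OF Rq sring_add[OF S sring_1[OF S] a(6)]] wge by (intro mult_right_mono) auto
        finally show ?thesis by simp
      qed
      consider "x = 0 \<or> y = 0 \<or> x + y = 0" | "x \<noteq> 0" "y \<noteq> 0" "x + y \<noteq> 0" by blast
      then show ?thesis
      proof cases
        case 1 then show ?thesis using w0 wge[of x] wge[of y] by (auto simp: le_max_iff_disj)
      next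
        case 2
        consider "x / y \<in> VR" | "y / x \<in> VR" using val[of "x / y"] 2 by auto
        then show ?thesis
        proof cases
          case 1 then show ?thesis using key[OF alg 2(2,3)] by (simp add: le_max_iff_disj)
        next
          case 2 then show ?thesis using key[of y x] alg \<open>x \<noteq> 0\<close> \<open>x + y \<noteq> 0\<close> by (simp add: le_max_iff_disj add.commute)
        qed
      qed
    qed
    have "R \<pi> 1 1" using \<pi>0 unit_1 by (simp add: R_def power_int_minus)
    from w_eq[OF this] show "w (of_nat p) = 1 / real p" using p2 by (simp add: \<pi>_def powr_minus divide_inverse)
    show "w (of_int c) = 1" if "\<not> int p dvd c" for c :: int
    proof -
      have "R (of_int c) 1 0" using coprime_unit[OF that] by (simp add: R_def)
      from w_eq[OF this] show ?thesis using p2 by simp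
    qed
  qed
qed

section \<open>Homomorphisms on subrings, polynomial division and resultants\<close>

definition sfield :: "'a::field set \<Rightarrow> bool" where
  "sfield S \<longleftrightarrow> sring S \<and> (\<forall>x\<in>S. inverse x \<in> S)"

definition rhom :: "'a::comm_ring_1 set \<Rightarrow> ('a \<Rightarrow> 'b::comm_ring_1) \<Rightarrow> bool" where
  "rhom S \<sigma> \<longleftrightarrow> \<sigma> 1 = 1 \<and> (\<forall>x\<in>S. \<forall>y\<in>S. \<sigma> (x + y) = \<sigma> x + \<sigma> y \<and> \<sigma> (x * y) = \<sigma> x * \<sigma> y)"

lemma rhom_1: "rhom S \<sigma> \<Longrightarrow> \<sigma> 1 = 1"
  and rhom_add: "rhom S \<sigma> \<Longrightarrow> x \<in> S \<Longrightarrow> y \<in> S \<Longrightarrow> \<sigma> (x + y) = \<sigma> x + \<sigma> y"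
  and rhom_mult: "rhom S \<sigma> \<Longrightarrow> x \<in> S \<Longrightarrow> y \<in> S \<Longrightarrow> \<sigma> (x * y) = \<sigma> x * \<sigma> y"
  by (simp_all add: rhom_def)

lemma rhom_0: "sring S \<Longrightarrow> rhom S \<sigma> \<Longrightarrow> \<sigma> 0 = 0"
  using rhom_add[of S \<sigma> 0 0] sring_0[of S] by simp

lemma rhom_minus: "sring S \<Longrightarrow> rhom S \<sigma> \<Longrightarrow> x \<in> S \<Longrightarrow> \<sigma> (- x) = - \<sigma> x"
  using rhom_add[of S \<sigma> x "- x"] rhom_0[of S \<sigma>] sring_minus[of S x] by (simp add: eq_neg_iff_add_eq_0 add.commute)

lemma rhom_sum: "sring S \<Longrightarrow> rhom S \<sigma> \<Longrightarrow> (\<And>i. i \<in> I \<Longrightarrow> f i \<in> S) \<Longrightarrow> \<sigma> (sum f I) = (\<Sum>i\<in>I. \<sigma> (f i))"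
  by (induction I rule: infinite_finite_induct) (simp_all add: rhom_0 rhom_add sring_sum)

lemma rhom_power: "sring S \<Longrightarrow> rhom S \<sigma> \<Longrightarrow> x \<in> S \<Longrightarrow> \<sigma> (x ^ n) = \<sigma> x ^ n"
  by (induction n) (simp_all add: rhom_1 rhom_mult sring_power)

lemma rhom_of_nat: "sring S \<Longrightarrow> rhom S \<sigma> \<Longrightarrow> \<sigma> (of_nat n) = of_nat n"
  by (induction n) (simp_all add: rhom_0 rhom_1 rhom_add sring_1 sring_of_nat)

lemma rhom_nonzero:
  fixes \<sigma> :: "'a::field \<Rightarrow> 'b::field"
  assumes "sfield S" "rhom S \<sigma>" "x \<in> S" "x \<noteq> 0"
  shows "\<sigma> x \<noteq> 0"
  using assms rhom_mult[OF assms(2,3), of "inverse x"] by (auto simp: sfield_def rhom_1)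

lemma coeff_mp: "sring S \<Longrightarrow> rhom S \<sigma> \<Longrightarrow> coeff (map_poly \<sigma> p) i = \<sigma> (coeff p i)"
  by (simp add: coeff_map_poly rhom_0)

lemma mp_add: "sring S \<Longrightarrow> rhom S \<sigma> \<Longrightarrow> p \<in> pol S \<Longrightarrow> q \<in> pol S \<Longrightarrow> map_poly \<sigma> (p + q) = map_poly \<sigma> p + map_poly \<sigma> q"
  by (intro poly_eqI) (simp add: coeff_mp rhom_add pol_coeff)

lemma mp_minus: "sring S \<Longrightarrow> rhom S \<sigma> \<Longrightarrow> p \<in> pol S \<Longrightarrow> map_poly \<sigma> (- p) = - map_poly \<sigma> p"
  by (intro poly_eqI) (simp add: coeff_mp rhom_minus pol_coeff)

lemma mp_mult: "sring S \<Longrightarrow> rhom S \<sigma> \<Longrightarrow> p \<in> pol S \<Longrightarrow> q \<in> pol S \<Longrightarrow> map_poly \<sigma> (p * q) = map_poly \<sigma> p * map_poly \<sigma> q"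
  by (intro poly_eqI) (simp add: coeff_mp coeff_mult rhom_sum rhom_mult sring_mult pol_coeff)

lemma mp_smult: "sring S \<Longrightarrow> rhom S \<sigma> \<Longrightarrow> c \<in> S \<Longrightarrow> p \<in> pol S \<Longrightarrow> map_poly \<sigma> (Polynomial.smult c p) = Polynomial.smult (\<sigma> c) (map_poly \<sigma> p)"
  by (intro poly_eqI) (simp add: coeff_mp rhom_mult pol_coeff)

text \<open>In a ring the leading coefficient of \<open>f\<close> need not be invertible, so each
  division step multiplies by it instead. This is needed for the finitely generated rings to be
  specialised.\<close>

lemma pol_pseudo_division:
  fixes f :: "'a::idom poly"
  assumes R: "sring S" and f: "f \<in> pol S" "f \<noteq> 0" and g: "g \<in> pol S"
  obtains k q r where "q \<in> pol S" "r \<in> pol S" "Polynomial.smult (lead_coeff f ^ k) g = q * f + r"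
    "r = 0 \<or> degree r < degree f"
proof -
  define l where "l = lead_coeff f"
  have lS: "l \<in> S" using f(1) by (simp add: l_def pol_def)
  have "\<exists>k q r. q \<in> pol S \<and> r \<in> pol S \<and> Polynomial.smult (l ^ k) g = q * f + r \<and> (r = 0 \<or> degree r < degree f)" using g
  proof (induction "if g = 0 then 0 else Suc (degree g)" arbitrary: g rule: less_induct)
    case less
    show ?case
    proof (cases "g = 0 \<or> degree g < degree f")
      case True
      then show ?thesis using less.prems pol_0[OF R] by (intro exI[of _ 0] exI[of _ 0] exI[of _ g]) auto
    next
      case False
      define m where "m = Polynomial.monom (lead_coeff g) (degree g - degree f)"
      have mS: "m \<in> pol S" unfolding m_def using less.prems by (intro pol_monom[OF R]) (simp add: pol_def)
      define g' where "g' = Polynomial.smult l g - m * f"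
      have g'S: "g' \<in> pol S" unfolding g'_def by (intro pol_diff[OF R] pol_mult[OF R] pol_smult[OF R] lS mS f(1) less.prems)
      have m0: "m \<noteq> 0" using False by (simp add: m_def)
      have dm: "degree m = degree g - degree f" using False unfolding m_def by (intro degree_monom_eq) simp
      then have dmf: "degree (m * f) = degree g" using False f(2) m0 by (simp add: degree_mult_eq)
      have lm: "lead_coeff m = lead_coeff g" unfolding dm by (simp add: m_def)
      have "coeff (m * f) (degree g) = l * lead_coeff g"
        using lead_coeff_mult[of m f] unfolding dmf lm by (simp add: l_def mult.commute)
      then have "coeff g' (degree g) = 0" by (simp add: g'_def)
      moreover have "degree g' \<le> degree g"
        unfolding g'_def using dmf degree_smult_le[of l g] by (intro degree_diff_le) auto
      ultimately have "g' = 0 \<or> degree g' < degree g" using degree_less_if_less_eqI by blast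
      then have "(if g' = 0 then 0 else Suc (degree g')) < (if g = 0 then 0 else Suc (degree g))"
        using False by auto
      from less.hyps[OF this g'S] obtain k q r where qr: "q \<in> pol S" "r \<in> pol S" "Polynomial.smult (l ^ k) g' = q * f + r"
        "r = 0 \<or> degree r < degree f" by blast
      have "Polynomial.smult (l ^ Suc k) g = Polynomial.smult (l ^ k) g' + Polynomial.smult (l ^ k) m * f"
        by (simp add: g'_def smult_diff_right mult.commute)
      then have "Polynomial.smult (l ^ Suc k) g = (q + Polynomial.smult (l ^ k) m) * f + r"
        unfolding qr(3) by (simp add: algebra_simps)
      moreover have "q + Polynomial.smult (l ^ k) m \<in> pol S"
        by (intro pol_add[OF R] pol_smult[OF R] sring_power[OF R] lS mS qr(1))
      ultimately show ?thesis using qr(2,4) by blast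
    qed
  qed
  then show ?thesis using that unfolding l_def by blast
qed

lemma pol_division:
  fixes f :: "'a::field poly"
  assumes S: "sfield S" and f: "f \<in> pol S" "f \<noteq> 0" and g: "g \<in> pol S"
  obtains q r where "q \<in> pol S" "r \<in> pol S" "g = q * f + r" "r = 0 \<or> degree r < degree f"
proof -
  have R: "sring S" using S by (simp add: sfield_def)
  obtain k q r where qr: "q \<in> pol S" "r \<in> pol S" "Polynomial.smult (lead_coeff f ^ k) g = q * f + r"
    "r = 0 \<or> degree r < degree f"
    by (rule pol_pseudo_division[OF R f g])
  define c where "c = inverse (lead_coeff f ^ k)"
  have cS: "c \<in> S" using S f(1) sring_power[OF R] by (simp add: c_def sfield_def pol_def)
  have "g = Polynomial.smult c (Polynomial.smult (lead_coeff f ^ k) g)" using f(2) by (simp add: c_def)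
  then have "g = Polynomial.smult c q * f + Polynomial.smult c r" unfolding qr(3) by (simp add: smult_add_right)
  moreover have "Polynomial.smult c r = 0 \<or> degree (Polynomial.smult c r) < degree f"
    using qr(4) degree_smult_le[of c r] by auto
  ultimately show ?thesis using that pol_smult[OF R cS qr(1)] pol_smult[OF R cS qr(2)] by blast
qed

text \<open>The product of the values of \<open>g\<close> at the roots of a monic polynomial \<open>f\<close> is a
  resultant; Euclid's algorithm shows that it is compatible with homomorphisms.\<close>

lemma resultant_rhom:
  fixes f :: "complex poly"
  assumes S: "sfield S" and f: "f \<in> pol S" "lead_coeff f = 1" and g: "g \<in> pol S"
  shows "\<exists>c\<in>S. \<forall>\<sigma> Z. rhom S \<sigma> \<longrightarrow> size Z = degree f \<longrightarrow> map_poly \<sigma> f = (\<Prod>z\<in>#Z. [:- z, 1:]) \<longrightarrow>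
    (\<Prod>z\<in>#Z. poly (map_poly \<sigma> g) z) = (\<sigma> c :: complex)"
  using f g
proof (induction "degree f" arbitrary: f g rule: less_induct)
  case less
  have R: "sring S" using S by (simp add: sfield_def)
  have f0: "f \<noteq> 0" using less.prems(2) by auto
  obtain q r where qr: "q \<in> pol S" "r \<in> pol S" "g = q * f + r" "r = 0 \<or> degree r < degree f"
    using pol_division[OF S less.prems(1) f0 less.prems(3)] by blast
  have gr: "(\<Prod>z\<in>#Z. poly (map_poly \<sigma> g) z) = (\<Prod>z\<in>#Z. poly (map_poly \<sigma> r) z)"
    if \<sigma>: "rhom S \<sigma>" and Z: "map_poly \<sigma> f = (\<Prod>z\<in>#Z. [:- z, 1:])" for \<sigma> :: "complex \<Rightarrow> complex" and Z
  proof -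
    have mg: "map_poly \<sigma> g = map_poly \<sigma> q * map_poly \<sigma> f + map_poly \<sigma> r"
      unfolding qr(3) using qr less.prems(1) by (simp add: mp_add[OF R \<sigma>] mp_mult[OF R \<sigma>] pol_mult[OF R])
    have "poly (map_poly \<sigma> f) z = 0" if "z \<in># Z" for z
      unfolding Z poly_prod_mset using that by auto
    then show ?thesis unfolding mg by (intro arg_cong[where f = prod_mset] image_mset_cong) simp
  qed
  show ?case
  proof (cases "r = 0")
    case True
    show ?thesis
    proof (cases "degree f = 0")
      case True
      then show ?thesis using sring_1[OF R] by (intro bexI[of _ 1]) (auto simp: rhom_1)
    next
      case False
      show ?thesis
      proof (intro bexI[of _ 0] allI impI)
        fix \<sigma> :: "complex \<Rightarrow> complex" and Z
        assume \<sigma>: "rhom S \<sigma>" and Z: "size Z = degree f" "map_poly \<sigma> f = (\<Prod>z\<in>#Z. [:- z, 1:])"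
        have "Z \<noteq> {#}" using False Z(1) by auto
        then show "(\<Prod>z\<in>#Z. poly (map_poly \<sigma> g) z) = \<sigma> 0"
          unfolding gr[OF \<sigma> Z(2)] using \<open>r = 0\<close> rhom_0[OF R \<sigma>] by (cases Z) auto
      qed (rule sring_0[OF R])
    qed
  next
    case False
    then have dr: "degree r < degree f" using qr(4) by blast
    define l where "l = lead_coeff r"
    have l: "l \<in> S" "l \<noteq> 0" using qr(2) False by (auto simp: l_def pol_def)
    have il: "inverse l \<in> S" using l S by (simp add: sfield_def)
    define g1 where "g1 = Polynomial.smult (inverse l) r"
    have g1: "g1 \<in> pol S" "lead_coeff g1 = 1" "degree g1 = degree r"
      using pol_smult[OF R il qr(2)] l(2) by (auto simp: g1_def l_def)
    have rg1: "r = Polynomial.smult l g1" using l by (simp add: g1_def)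
    obtain c1 where c1: "c1 \<in> S" "\<And>\<sigma> Z. rhom S \<sigma> \<Longrightarrow> size Z = degree g1 \<Longrightarrow> map_poly \<sigma> g1 = (\<Prod>z\<in>#Z. [:- z, 1:]) \<Longrightarrow>
      (\<Prod>z\<in>#Z. poly (map_poly \<sigma> f) z) = (\<sigma> c1 :: complex)"
      using less.hyps[of g1 f] g1 dr less.prems(1) by auto
    define n where "n = degree f"
    define m where "m = degree r"
    \<comment> \<open>The reciprocity of resultants: exchanging the two polynomials contributes the
      sign, and making the remainder \<open>r\<close> monic contributes the power of
      \<open>l\<close>.\<close>
    show ?thesis
    proof (intro bexI[of _ "l ^ n * ((- 1) ^ (n * m) * c1)"] allI impI)
      fix \<sigma> :: "complex \<Rightarrow> complex" and Z
      assume \<sigma>: "rhom S \<sigma>" and Z: "size Z = degree f" "map_poly \<sigma> f = (\<Prod>z\<in>#Z. [:- z, 1:])"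
      have lc: "coeff (map_poly \<sigma> g1) m = 1" using g1(2,3) by (simp add: coeff_mp[OF R \<sigma>] rhom_1[OF \<sigma>] m_def)
      have d: "degree (map_poly \<sigma> g1) = m"
        using degree_map_poly_le[of \<sigma> g1] le_degree[of "map_poly \<sigma> g1" m] lc g1(3) by (simp add: m_def)
      have "map_poly \<sigma> g1 \<noteq> 0" using lc by auto
      then obtain Y where Y: "size Y = degree g1" "map_poly \<sigma> g1 = (\<Prod>z\<in>#Y. [:- z, 1:])"
        using alg_closed_imp_factorization[of "map_poly \<sigma> g1"] lc d g1(3) by (auto simp: m_def)
      have "(\<Prod>z\<in>#Z. poly (map_poly \<sigma> g) z) = (\<Prod>z\<in>#Z. \<sigma> l * (\<Prod>y\<in>#Y. z - y))"
        unfolding gr[OF \<sigma> Z(2)] rg1 mp_smult[OF R \<sigma> l(1) g1(1)] Y(2)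
        by (intro arg_cong[where f = prod_mset] image_mset_cong) (simp add: poly_prod_mset)
      also have "\<dots> = \<sigma> l ^ n * (\<Prod>z\<in>#Z. \<Prod>y\<in>#Y. z - y)"
        by (simp add: prod_mset.distrib Z(1) n_def)
      also have "(\<Prod>z\<in>#Z. \<Prod>y\<in>#Y. z - y) = (\<Prod>z\<in>#Z. (- 1) ^ m * (\<Prod>y\<in>#Y. y - z))"
      proof (intro arg_cong[where f = prod_mset] image_mset_cong)
        fix z
        have "(\<Prod>y\<in>#Y. z - y) = (\<Prod>y\<in>#Y. (- 1) * (y - z))" by simp
        then show "(\<Prod>y\<in>#Y. z - y) = (- 1) ^ m * (\<Prod>y\<in>#Y. y - z)"
          unfolding prod_mset.distrib using Y(1) g1(3) by (simp add: m_def)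
      qed
      also have "\<dots> = (- 1) ^ (n * m) * (\<Prod>y\<in>#Y. \<Prod>z\<in>#Z. y - z)"
        by (subst prod_mset.swap) (simp add: prod_mset.distrib Z(1) n_def power_mult[symmetric] mult.commute)
      also have "(\<Prod>y\<in>#Y. \<Prod>z\<in>#Z. y - z) = (\<Prod>y\<in>#Y. poly (map_poly \<sigma> f) y)"
        unfolding Z(2)
        by (intro arg_cong[where f = prod_mset] image_mset_cong) (simp add: poly_prod_mset)
      also have "\<dots> = \<sigma> c1" by (rule c1(2)[OF \<sigma> Y])
      finally show "(\<Prod>z\<in>#Z. poly (map_poly \<sigma> g) z) = \<sigma> (l ^ n * ((- 1) ^ (n * m) * c1))"
        using l(1) c1(1) sring_minus[OF R sring_1[OF R]]
        by (simp add: rhom_mult[OF \<sigma>] rhom_power[OF R \<sigma>] rhom_minus[OF R \<sigma>] rhom_1[OF \<sigma>] sring_1[OF R] sring_mult[OF R] sring_power[OF R])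
    qed (intro sring_mult[OF R] sring_power[OF R] sring_minus[OF R] sring_1[OF R] l(1) c1(1))
  qed
qed

section \<open>Conjugates\<close>

lemma exists_minimal_polynomial:
  fixes t :: "'a::field"
  assumes S: "sfield S" and g: "g \<in> pol S" "g \<noteq> 0" "poly g t = 0"
  obtains f where "f \<in> pol S" "lead_coeff f = 1" "poly f t = 0" "degree f > 0"
    "\<And>h. h \<in> pol S \<Longrightarrow> poly h t = 0 \<Longrightarrow> \<exists>q\<in>pol S. h = q * f"
    "\<And>h. h \<in> pol S \<Longrightarrow> poly h t = 0 \<Longrightarrow> degree h < degree f \<Longrightarrow> h = 0"
proof -
  have R: "sring S" using S by (simp add: sfield_def)
  define Q where "Q f \<longleftrightarrow> f \<in> pol S \<and> f \<noteq> 0 \<and> poly f t = 0" for f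
  have "\<exists>f. Q f \<and> (\<forall>h. Q h \<longrightarrow> degree f \<le> degree h)"
    using ex_has_least_nat[of Q g degree] g by (auto simp: Q_def)
  then obtain f0 where f0: "Q f0" "\<And>h. Q h \<Longrightarrow> degree f0 \<le> degree h" by blast
  define l where "l = lead_coeff f0"
  have l: "l \<in> S" "l \<noteq> 0" using f0(1) by (auto simp: Q_def pol_def l_def)
  define f where "f = Polynomial.smult (inverse l) f0"
  have fS: "f \<in> pol S" unfolding f_def using S l f0(1) by (intro pol_smult[OF R]) (auto simp: sfield_def Q_def)
  have f1: "lead_coeff f = 1" using l by (simp add: f_def l_def)
  have ft: "poly f t = 0" using f0(1) by (simp add: f_def Q_def)
  have df: "degree f = degree f0" using l by (simp add: f_def)
  have fnz: "f \<noteq> 0" using f1 by auto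
  have small: "h = 0" if "h \<in> pol S" "poly h t = 0" "degree h < degree f" for h
    using f0(2)[of h] that df by (auto simp: Q_def)
  have "degree f > 0"
  proof (rule ccontr)
    assume "\<not> degree f > 0"
    then obtain c where "f = [:c:]" by (auto elim: degree_eq_zeroE)
    then have "f = 1" using f1 by (simp add: one_pCons)
    then show False using ft by simp
  qed
  moreover have "\<exists>q\<in>pol S. h = q * f" if h: "h \<in> pol S" "poly h t = 0" for h
  proof -
    obtain q r where qr: "q \<in> pol S" "r \<in> pol S" "h = q * f + r" "r = 0 \<or> degree r < degree f"
      by (rule pol_division[OF S fS fnz h(1)])
    have "poly r t = 0" using h(2) ft unfolding qr(3) by simp
    then have "r = 0" using small qr by blast
    then show ?thesis using qr by auto
  qed
  ultimately show ?thesis using that[of f] fS f1 ft small by blast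
qed

text \<open>A substitute for inverses over a ring, by Euclid's algorithm: \<open>h\<close> is
  reduced modulo \<open>f\<close>, then \<open>f\<close> modulo \<open>h\<close>, and so on with
  falling degree. Minimality of \<open>f\<close> prevents the process from ending with a
  non-constant \<open>h\<close>.\<close>

lemma exists_multiple_in_base:
  fixes t :: "'a::idom"
  assumes R: "sring S" and f: "f \<in> pol S" "f \<noteq> 0" "poly f t = 0"
    and small: "\<And>h. h \<in> pol S \<Longrightarrow> poly h t = 0 \<Longrightarrow> degree h < degree f \<Longrightarrow> h = 0"
    and h: "h \<in> pol S" "poly h t \<noteq> 0"
  shows "\<exists>u\<in>pol S. poly u t * poly h t \<in> S - {0}"
  using h
proof (induction "degree h" arbitrary: h rule: less_induct)
  case less
  have h0: "h \<noteq> 0" using less.prems by auto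
  show ?case
  proof (cases "degree h < degree f")
    case False
    obtain k q r where qr: "q \<in> pol S" "r \<in> pol S" "Polynomial.smult (lead_coeff f ^ k) h = q * f + r"
      "r = 0 \<or> degree r < degree f"
      by (rule pol_pseudo_division[OF R f(1,2) less.prems(1)])
    define c where "c = lead_coeff f ^ k"
    have c: "c \<in> S" "c \<noteq> 0" using f(1,2) sring_power[OF R] by (auto simp: c_def pol_def)
    have e: "poly r t = c * poly h t" using arg_cong[OF qr(3), of "\<lambda>p. poly p t"] f(3) by (simp add: c_def)
    then have rt: "poly r t \<noteq> 0" using c(2) less.prems(2) by simp
    then have "degree r < degree h" using qr(4) False by auto
    then obtain u where u: "u \<in> pol S" "poly u t * poly r t \<in> S - {0}" using less.hyps[of r] qr(2) rt by blast
    have "poly (Polynomial.smult c u) t * poly h t = poly u t * poly r t" by (simp add: e)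
    then show ?thesis using u pol_smult[OF R c(1) u(1)] by metis
  next
    case True
    obtain k q r where qr: "q \<in> pol S" "r \<in> pol S" "Polynomial.smult (lead_coeff h ^ k) f = q * h + r"
      "r = 0 \<or> degree r < degree h"
      by (rule pol_pseudo_division[OF R less.prems(1) h0 f(1)])
    define c where "c = lead_coeff h ^ k"
    have c0: "c \<noteq> 0" using h0 by (simp add: c_def)
    have e: "poly q t * poly h t + poly r t = 0"
      using arg_cong[OF qr(3), of "\<lambda>p. poly p t"] f(3) by simp
    show ?thesis
    proof (cases "r = 0")
      case True
      \<comment> \<open>A factor \<open>q\<close> of \<open>f\<close> that vanishes at
        \<open>t\<close> cannot have smaller degree, hence \<open>h\<close> is constant.\<close>
      then have fq: "Polynomial.smult c f = q * h" using qr(3) by (simp add: c_def)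
      have "q \<noteq> 0" using fq c0 f(2) by auto
      moreover have "poly q t = 0" using e True less.prems(2) by simp
      ultimately have "\<not> degree q < degree f" using small qr(1) by blast
      moreover have "degree f = degree q + degree h"
        using arg_cong[OF fq, of degree] degree_mult_eq[of q h] \<open>q \<noteq> 0\<close> h0 c0 by simp
      ultimately have "degree h = 0" by simp
      then obtain a where a: "h = [:a:]" by (auto elim: degree_eq_zeroE)
      have "a \<in> S" using pol_coeff[OF less.prems(1), of 0] a by simp
      moreover have "1 \<in> pol S" using pol_monom[OF R sring_1[OF R], of 0] by simp
      ultimately show ?thesis using a h0 by (intro bexI[of _ 1]) auto
    next
      case False
      then have dr: "degree r < degree h" using qr(4) by blast
      then have "poly r t \<noteq> 0" using small[of r] qr(2) False \<open>degree h < degree f\<close> by auto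
      then obtain u where u: "u \<in> pol S" "poly u t * poly r t \<in> S - {0}" using less.hyps[OF dr qr(2)] by blast
      have "poly r t = - (poly q t * poly h t)" using e by (simp add: eq_neg_iff_add_eq_0 add.commute)
      then have "poly (- (u * q)) t * poly h t = poly u t * poly r t" by (simp add: mult.assoc)
      moreover have "- (u * q) \<in> pol S" by (intro pol_minus[OF R] pol_mult[OF R] u qr)
      ultimately show ?thesis using u(2) by metis
    qed
  qed
qed

lemma sfield_adj:
  fixes t :: "'a::field"
  assumes S: "sfield S" and g: "g \<in> pol S" "g \<noteq> 0" "poly g t = 0"
  shows "sfield (adj S t)"
proof -
  have R: "sring S" using S by (simp add: sfield_def)
  obtain f where f: "f \<in> pol S" "lead_coeff f = 1" "poly f t = 0"
    and small: "\<And>h. h \<in> pol S \<Longrightarrow> poly h t = 0 \<Longrightarrow> degree h < degree f \<Longrightarrow> h = 0"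
    by (rule exists_minimal_polynomial[OF S g]) blast
  have f0: "f \<noteq> 0" using f(2) by auto
  have "inverse x \<in> adj S t" if xS: "x \<in> adj S t" for x
  proof (cases "x = 0")
    case True then show ?thesis using xS by simp
  next
    case False
    obtain h where h: "h \<in> pol S" "x = poly h t" using xS unfolding adj_def by blast
    then obtain u where u: "u \<in> pol S" "poly u t * poly h t \<in> S - {0}"
      using exists_multiple_in_base[OF R f(1) f0 f(3) small h(1)] False by blast
    define c where "c = poly u t * x"
    have c: "inverse c \<in> S" "c \<noteq> 0" using u(2) h(2) S by (auto simp: c_def sfield_def)
    have "inverse x = inverse c * poly u t" using c(2) False by (simp add: c_def field_simps)
    then have "inverse x = poly (Polynomial.smult (inverse c) u) t" by simp
    then show ?thesis using pol_smult[OF R c(1) u(1)] unfolding adj_def by blast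
  qed
  then show ?thesis using sring_adj[OF R] by (simp add: sfield_def)
qed

text \<open>A number field in terms of its embeddings: the product over the list is the norm. Its
  rationality, which replaces Galois theory here, is what the product formula is built on.\<close>

definition conj_data :: "complex set \<Rightarrow> (complex \<Rightarrow> complex) list \<Rightarrow> bool" where
  "conj_data F \<Sigma> \<longleftrightarrow> sfield F \<and> countable F \<and> (\<exists>\<sigma>\<in>set \<Sigma>. \<forall>x\<in>F. \<sigma> x = x) \<and> (\<forall>\<sigma>\<in>set \<Sigma>. rhom F \<sigma>)
    \<and> (\<forall>x\<in>F. (\<Prod>\<sigma>\<leftarrow>\<Sigma>. \<sigma> x) \<in> \<rat>)"

lemma sring_Rats: "sring (\<rat> :: 'a::field_char_0 set)" by (simp add: sring_def)

lemma conj_data_Rats: "conj_data \<rat> [\<lambda>x. x]"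
  by (simp add: conj_data_def sfield_def sring_Rats rhom_def countable_rat)

lemma countable_adj:
  assumes "countable S"
  shows "countable (adj S t)"
proof -
  have "adj S t \<subseteq> (\<lambda>cs. poly (Poly cs) t) ` lists S"
  proof
    fix x assume "x \<in> adj S t"
    then obtain p where p: "p \<in> pol S" "x = poly p t" unfolding adj_def by blast
    have "set (coeffs p) \<subseteq> S" using p(1) by (auto simp: pol_def coeffs_def)
    then show "x \<in> (\<lambda>cs. poly (Poly cs) t) ` lists S" using p(2) by (intro image_eqI[of _ _ "coeffs p"]) auto
  qed
  then show ?thesis using assms by (meson countable_image countable_lists countable_subset)
qed

lemma prod_list_map_concat: "prod_list (map h (concat xss)) = prod_list (map (\<lambda>xs. prod_list (map h xs)) xss)"
  by (induction xss) auto

text \<open>Let \<open>f\<close> be the minimal polynomial of \<open>t\<close>. Each embedding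
  \<sigma> extends once for every root of the image of \<open>f\<close>, by sending \<open>t\<close>
  to that root. The product over these extensions is a resultant, thus \<sigma> of an element of
  \<open>F\<close> that is the same for all \<sigma>, and the norm of this element is
  rational.\<close>

lemma conj_data_adj:
  assumes cd: "conj_data F \<Sigma>" and g: "g \<in> pol F" "g \<noteq> 0" "poly g t = 0"
  shows "\<exists>\<Sigma>'. conj_data (adj F t) \<Sigma>'"
proof -
  have S: "sfield F" using cd by (simp add: conj_data_def)
  then have R: "sring F" by (simp add: sfield_def)
  have hom: "rhom F \<sigma>" if "\<sigma> \<in> set \<Sigma>" for \<sigma> using cd that by (simp add: conj_data_def)
  obtain f where f: "f \<in> pol F" "lead_coeff f = 1" "poly f t = 0" "degree f > 0"
    and dv: "\<And>h. h \<in> pol F \<Longrightarrow> poly h t = 0 \<Longrightarrow> \<exists>q\<in>pol F. h = q * f"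
    by (rule exists_minimal_polynomial[OF S g]) blast
  have "\<exists>zs. length zs = degree f \<and> map_poly \<sigma> f = (\<Prod>z\<in>#mset zs. [:- z, 1:])" if \<sigma>: "rhom F \<sigma>" for \<sigma> :: "complex \<Rightarrow> complex"
  proof -
    have lc: "coeff (map_poly \<sigma> f) (degree f) = 1" using f(2) by (simp add: coeff_mp[OF R \<sigma>] rhom_1[OF \<sigma>])
    have d: "degree (map_poly \<sigma> f) = degree f"
      using degree_map_poly_le[of \<sigma> f] le_degree[of "map_poly \<sigma> f" "degree f"] lc by simp
    have "map_poly \<sigma> f \<noteq> 0" using lc by auto
    then obtain Z where Z: "size Z = degree f" "map_poly \<sigma> f = (\<Prod>z\<in>#Z. [:- z, 1:])"
      using alg_closed_imp_factorization[of "map_poly \<sigma> f"] lc d by auto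
    obtain zs where "mset zs = Z" using ex_mset by blast
    then show ?thesis using Z by (intro exI[of _ zs]) auto
  qed
  then obtain rs where rs: "\<And>\<sigma> :: complex \<Rightarrow> complex. rhom F \<sigma> \<Longrightarrow> length (rs \<sigma>) = degree f"
    "\<And>\<sigma> :: complex \<Rightarrow> complex. rhom F \<sigma> \<Longrightarrow> map_poly \<sigma> f = (\<Prod>z\<in>#mset (rs \<sigma>). [:- z, 1:])" by metis
  \<comment> \<open>Two polynomials that represent the same element differ by a multiple of
    \<open>f\<close>, whose image vanishes at the root \<open>z\<close>; the choice is therefore
    immaterial.\<close>
  define ext where "ext \<sigma> z x = poly (map_poly \<sigma> (SOME h. h \<in> pol F \<and> poly h t = x)) z" for \<sigma> :: "complex \<Rightarrow> complex" and z x
  have ext: "ext \<sigma> z (poly h t) = poly (map_poly \<sigma> h) z"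
    if \<sigma>: "rhom F \<sigma>" and z: "z \<in> set (rs \<sigma>)" and h: "h \<in> pol F" for \<sigma> z h
  proof -
    define h' where "h' = (SOME h'. h' \<in> pol F \<and> poly h' t = poly h t)"
    have h': "h' \<in> pol F \<and> poly h' t = poly h t"
      unfolding h'_def by (rule someI[of _ h]) (use h in simp)
    then have "h' - h \<in> pol F" "poly (h' - h) t = 0" using pol_diff[OF R] h by auto
    then obtain q where q: "q \<in> pol F" "h' - h = q * f" using dv by blast
    have "h' = q * f + h" using q(2) by (simp add: algebra_simps)
    then have "map_poly \<sigma> h' = map_poly \<sigma> q * map_poly \<sigma> f + map_poly \<sigma> h"
      using q(1) f(1) h by (simp add: mp_add[OF R \<sigma>] mp_mult[OF R \<sigma>] pol_mult[OF R])
    moreover have "poly (map_poly \<sigma> f) z = 0" unfolding rs(2)[OF \<sigma>] poly_prod_mset using z by auto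
    ultimately show ?thesis by (simp add: ext_def h'_def)
  qed
  define \<Sigma>' where "\<Sigma>' = concat (map (\<lambda>\<sigma>. map (ext \<sigma>) (rs \<sigma>)) \<Sigma>)"
  have "\<exists>\<tau>\<in>set \<Sigma>'. \<forall>x\<in>adj F t. \<tau> x = x"
  proof -
    obtain \<sigma> where \<sigma>: "\<sigma> \<in> set \<Sigma>" "\<And>x. x \<in> F \<Longrightarrow> \<sigma> x = x" using cd by (auto simp: conj_data_def)
    have mp: "map_poly \<sigma> h = h" if "h \<in> pol F" for h
      by (intro poly_eqI) (simp add: coeff_mp[OF R hom[OF \<sigma>(1)]] \<sigma>(2) pol_coeff[OF that])
    have "poly (\<Prod>z\<in>#mset (rs \<sigma>). [:- z, 1:]) t = 0"
      unfolding rs(2)[OF hom[OF \<sigma>(1)], symmetric] mp[OF f(1)] by (rule f(3))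
    \<comment> \<open>For the embedding that fixes \<open>F\<close>, \<open>t\<close> itself is one
      of the roots and yields the identity.\<close>
    then have tz: "t \<in> set (rs \<sigma>)" unfolding poly_prod_mset by auto
    have "ext \<sigma> t x = x" if "x \<in> adj F t" for x
      using that ext[OF hom[OF \<sigma>(1)] tz] mp unfolding adj_def by auto
    moreover have "ext \<sigma> t \<in> set \<Sigma>'" using \<sigma>(1) tz by (auto simp: \<Sigma>'_def)
    ultimately show ?thesis by blast
  qed
  moreover have "rhom (adj F t) \<tau>" if \<tau>: "\<tau> \<in> set \<Sigma>'" for \<tau>
  proof -
    obtain \<sigma> z where sz: "\<sigma> \<in> set \<Sigma>" "z \<in> set (rs \<sigma>)" "\<tau> = ext \<sigma> z" using \<tau> by (auto simp: \<Sigma>'_def)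
    note e = ext[OF hom[OF sz(1)] sz(2)]
    note \<sigma> = hom[OF sz(1)]
    have one: "1 \<in> pol F" using pol_monom[OF R sring_1[OF R], of 0] by simp
    have "\<tau> 1 = 1" using e[OF one] by (simp add: sz(3) map_poly_1 rhom_1[OF \<sigma>])
    moreover have "\<tau> (x + y) = \<tau> x + \<tau> y \<and> \<tau> (x * y) = \<tau> x * \<tau> y" if xy: "x \<in> adj F t" "y \<in> adj F t" for x y
    proof -
      obtain p q where pq: "p \<in> pol F" "q \<in> pol F" "x = poly p t" "y = poly q t" using xy unfolding adj_def by blast
      have "x + y = poly (p + q) t" "x * y = poly (p * q) t" using pq by auto
      then show ?thesis
        unfolding sz(3) using pq e[OF pol_add[OF R pq(1,2)]] e[OF pol_mult[OF R pq(1,2)]]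
        by (simp add: e mp_add[OF R \<sigma>] mp_mult[OF R \<sigma>])
    qed
    ultimately show ?thesis by (simp add: rhom_def)
  qed
  moreover have "(\<Prod>\<tau>\<leftarrow>\<Sigma>'. \<tau> x) \<in> \<rat>" if "x \<in> adj F t" for x
  proof -
    obtain h where h: "h \<in> pol F" "x = poly h t" using \<open>x \<in> adj F t\<close> unfolding adj_def by blast
    obtain c where c: "c \<in> F" "\<And>\<sigma> Z. rhom F \<sigma> \<Longrightarrow> size Z = degree f \<Longrightarrow> map_poly \<sigma> f = (\<Prod>z\<in>#Z. [:- z, 1:]) \<Longrightarrow>
      (\<Prod>z\<in>#Z. poly (map_poly \<sigma> h) z) = (\<sigma> c :: complex)"
      using resultant_rhom[OF S f(1,2) h(1)] by blast
    have "(\<Prod>\<tau>\<leftarrow>\<Sigma>'. \<tau> x) = (\<Prod>\<sigma>\<leftarrow>\<Sigma>. \<Prod>z\<leftarrow>rs \<sigma>. ext \<sigma> z x)"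
      by (simp add: \<Sigma>'_def prod_list_map_concat comp_def)
    also have "\<dots> = (\<Prod>\<sigma>\<leftarrow>\<Sigma>. \<sigma> c)"
    proof (intro arg_cong[where f = prod_list] map_cong refl)
      fix \<sigma> assume \<sigma>: "\<sigma> \<in> set \<Sigma>"
      have "(\<Prod>z\<leftarrow>rs \<sigma>. ext \<sigma> z x) = (\<Prod>z\<leftarrow>rs \<sigma>. poly (map_poly \<sigma> h) z)"
        by (intro arg_cong[where f = prod_list] map_cong refl) (simp add: h ext[OF hom[OF \<sigma>]])
      also have "\<dots> = (\<Prod>z\<in>#mset (rs \<sigma>). poly (map_poly \<sigma> h) z)"
        by (simp only: mset_map[symmetric] prod_mset_prod_list)
      also have "\<dots> = \<sigma> c" by (rule c(2)[OF hom[OF \<sigma>] _ rs(2)[OF hom[OF \<sigma>]]]) (simp add: rs(1)[OF hom[OF \<sigma>]])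
      finally show "(\<Prod>z\<leftarrow>rs \<sigma>. ext \<sigma> z x) = \<sigma> c" .
    qed
    also have "\<dots> \<in> \<rat>" using cd c(1) by (simp add: conj_data_def)
    finally show ?thesis .
  qed
  moreover have "countable (adj F t)" using cd by (intro countable_adj) (simp add: conj_data_def)
  ultimately have "conj_data (adj F t) \<Sigma>'" using sfield_adj[OF S g] by (simp add: conj_data_def)
  then show ?thesis by blast
qed

text \<open>Newton interpolation at integers: splitting off one node leaves a quotient that takes
  rational values at all later ones.\<close>

lemma pol_Rats_if_rational_values:
  fixes p :: "'a::field_char_0 poly"
  assumes "\<And>m. m \<ge> k \<Longrightarrow> poly p (of_nat m) \<in> \<rat>"
  shows "p \<in> pol \<rat>"
  using assms
proof (induction "degree p" arbitrary: p k)
  case 0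
  then obtain c where "p = [:c:]" by (metis degree_eq_zeroE)
  then show ?case using "0.prems"[of k] by (auto simp: pol_def coeff_pCons split: nat.splits)
next
  case (Suc n)
  define q where "q = synthetic_div p (of_nat k)"
  have e: "[:- of_nat k, 1:] * q + [:poly p (of_nat k):] = p" unfolding q_def by (rule synthetic_div_correct')
  have "poly q (of_nat m) \<in> \<rat>" if m: "m \<ge> Suc k" for m
  proof -
    have "poly p (of_nat m) = (of_nat m - of_nat k) * poly q (of_nat m) + poly p (of_nat k)"
      by (subst e[symmetric]) (simp add: algebra_simps)
    moreover have "(of_nat m :: 'a) - of_nat k \<noteq> 0" using m by simp
    ultimately have "poly q (of_nat m) = (poly p (of_nat m) - poly p (of_nat k)) / (of_nat m - of_nat k)"
      by (simp add: field_simps)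
    also have "\<dots> \<in> \<rat>" using Suc.prems[of m] Suc.prems[of k] m by (intro Rats_divide Rats_diff) auto
    finally show ?thesis .
  qed
  then have "q \<in> pol \<rat>" using Suc.hyps(1)[of q "Suc k"] Suc.hyps(2) by (simp add: q_def degree_synthetic_div)
  then show ?case
    by (subst e[symmetric], intro pol_add pol_mult pol_pCons pol_0 sring_Rats) (auto intro: Suc.prems)
qed

text \<open>The characteristic polynomial, with the conjugates of \<open>x\<close> as roots, takes
  at an integer \<open>m\<close> the norm of \<open>m - x\<close>. Its values there are rational,
  and so are its coefficients.\<close>

lemma conj_data_algebraic:
  assumes cd: "conj_data F \<Sigma>" and x: "x \<in> F"
  shows "algebraic x" "\<sigma> \<in> set \<Sigma> \<Longrightarrow> algebraic (\<sigma> x)"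
proof -
  have S: "sfield F" using cd by (simp add: conj_data_def)
  then have R: "sring F" by (simp add: sfield_def)
  have hom: "rhom F \<sigma>" if "\<sigma> \<in> set \<Sigma>" for \<sigma> using cd that by (simp add: conj_data_def)
  show alg: "algebraic (\<sigma> x)" if \<sigma>: "\<sigma> \<in> set \<Sigma>" for \<sigma>
  proof -
    define cp where "cp = (\<Prod>\<tau>\<leftarrow>\<Sigma>. [:- \<tau> x, 1:])"
    have val: "poly cp y = (\<Prod>\<tau>\<leftarrow>\<Sigma>. y - \<tau> x)" for y
      unfolding cp_def by (induction \<Sigma>) (auto simp: algebra_simps)
    have "poly cp (of_nat m) \<in> \<rat>" for m
    proof -
      have "poly cp (of_nat m) = (\<Prod>\<tau>\<leftarrow>\<Sigma>. \<tau> (of_nat m + - x))"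
        unfolding val
      proof (intro arg_cong[where f = prod_list] map_cong refl)
        fix \<tau> assume "\<tau> \<in> set \<Sigma>"
        then have \<tau>: "rhom F \<tau>" by (rule hom)
        have "\<tau> (of_nat m + - x) = of_nat m + - \<tau> x"
          using rhom_add[OF \<tau> sring_of_nat[OF R] sring_minus[OF R x], of m]
          by (simp only: rhom_minus[OF R \<tau> x] rhom_of_nat[OF R \<tau>])
        then show "of_nat m - \<tau> x = \<tau> (of_nat m + - x)" by simp
      qed
      moreover have "of_nat m + - x \<in> F" by (intro sring_add[OF R] sring_of_nat[OF R] sring_minus[OF R] x)
      ultimately show ?thesis using cd by (simp add: conj_data_def)
    qed
    then have "cp \<in> pol \<rat>" by (intro pol_Rats_if_rational_values)
    moreover have "cp \<noteq> 0" by (auto simp: cp_def prod_list_zero_iff)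
    moreover have "poly cp (\<sigma> x) = 0" unfolding val using \<sigma> by (auto simp: prod_list_zero_iff)
    ultimately show ?thesis by (intro algebraicI'[of cp]) (auto simp: pol_def)
  qed
  then show "algebraic x" using cd x unfolding conj_data_def by metis
qed

lemma exists_conj_data:
  assumes "finite A" "\<And>a. a \<in> A \<Longrightarrow> algebraic (a::complex)"
  obtains F \<Sigma> where "conj_data F \<Sigma>" "A \<subseteq> F"
proof -
  have "\<exists>F \<Sigma>. conj_data F \<Sigma> \<and> A \<subseteq> F" using assms
  proof (induction A rule: finite_induct)
    case empty
    then show ?case using conj_data_Rats by auto
  next
    case (insert a A)
    then obtain F \<Sigma> where F: "conj_data F \<Sigma>" "A \<subseteq> F" by auto
    have R: "sring F" using F(1) by (simp add: conj_data_def sfield_def)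
    have "algebraic a" using insert.prems by simp
    then obtain q where q: "\<And>i. coeff q i \<in> \<int>" "q \<noteq> 0" "poly q a = 0" by (rule algebraicE) blast
    have "q \<in> pol F" unfolding pol_def using q(1) sring_of_int[OF R] by (auto elim!: Ints_cases) (metis Ints_cases)
    then obtain \<Sigma>' where "conj_data (adj F a) \<Sigma>'" using conj_data_adj[OF F(1) _ q(2,3)] by blast
    then show ?case using adj_base[OF R] adj_gen[OF R] F(2) by blast
  qed
  then show ?thesis using that by blast
qed

text \<open>Both numbers lie in a common field with conjugates, all of whose elements are
  algebraic.\<close>

lemma algebraic_plus_mult:
  assumes "algebraic (x::complex)" "algebraic y"
  shows "algebraic (x + y)" "algebraic (x * y)"
proof -
  obtain F \<Sigma> where F: "conj_data F \<Sigma>" "{x, y} \<subseteq> F"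
    using exists_conj_data[of "{x, y}"] assms by auto
  have R: "sring F" using F(1) by (simp add: conj_data_def sfield_def)
  show "algebraic (x + y)" "algebraic (x * y)"
    using conj_data_algebraic(1)[OF F(1)] F(2) sring_add[OF R] sring_mult[OF R] by auto
qed

section \<open>Construction of places\<close>

definition padic :: "nat \<Rightarrow> (complex \<Rightarrow> real) \<Rightarrow> bool" where
  "padic p w \<longleftrightarrow> w 0 = 0 \<and> (\<forall>x. algebraic x \<longrightarrow> x \<noteq> 0 \<longrightarrow> w x > 0)
    \<and> (\<forall>x y. algebraic x \<longrightarrow> algebraic y \<longrightarrow> w (x * y) = w x * w y)
    \<and> (\<forall>x y. algebraic x \<longrightarrow> algebraic y \<longrightarrow> w (x + y) \<le> max (w x) (w y))
    \<and> w (of_nat p) = 1 / real p \<and> (\<forall>c::int. \<not> int p dvd c \<longrightarrow> w (of_int c) = 1)"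

text \<open>Closure of the algebraic numbers under addition removes the condition on
  \<open>x + y\<close> from the ultrametric inequality.\<close>

lemma exists_padic:
  assumes "prime p"
  shows "\<exists>w. padic p w"
proof -
  obtain w :: "complex \<Rightarrow> real" where "w 0 = 0" "\<And>x. algebraic x \<Longrightarrow> x \<noteq> 0 \<Longrightarrow> w x > 0"
    "\<And>x y. algebraic x \<Longrightarrow> algebraic y \<Longrightarrow> w (x * y) = w x * w y"
    "\<And>x y. algebraic x \<Longrightarrow> algebraic y \<Longrightarrow> algebraic (x + y) \<Longrightarrow> w (x + y) \<le> max (w x) (w y)"
    "w (of_nat p) = 1 / real p" "\<And>c::int. \<not> int p dvd c \<Longrightarrow> w (of_int c) = 1"
    by (rule exists_padic_absolute_value[OF assms]) blast
  then have "padic p w" unfolding padic_def by (simp add: algebraic_plus_mult(1))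
  then show ?thesis by blast
qed

lemma padicD:
  assumes "padic p w"
  shows padic_0: "w 0 = 0" and padic_pos: "algebraic x \<Longrightarrow> x \<noteq> 0 \<Longrightarrow> w x > 0"
    and padic_mult: "algebraic x \<Longrightarrow> algebraic y \<Longrightarrow> w (x * y) = w x * w y"
    and padic_add: "algebraic x \<Longrightarrow> algebraic y \<Longrightarrow> w (x + y) \<le> max (w x) (w y)"
    and padic_p: "w (of_nat p) = 1 / real p" and padic_coprime: "\<not> int p dvd c \<Longrightarrow> w (of_int c) = 1"
  using assms by (simp_all add: padic_def)

lemma algebraic_sum: "(\<And>i. i \<in> I \<Longrightarrow> algebraic (f i :: complex)) \<Longrightarrow> algebraic (sum f I)"
  by (induction I rule: infinite_finite_induct) (auto intro: algebraic_plus_mult)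

lemma algebraic_power_complex: "algebraic (x :: complex) \<Longrightarrow> algebraic (x ^ n)"
  by (induction n) (auto intro: algebraic_plus_mult)

lemma algebraic_prod_list: "(\<And>x. x \<in> set xs \<Longrightarrow> algebraic (x :: complex)) \<Longrightarrow> algebraic (prod_list xs)"
  by (induction xs) (auto intro: algebraic_plus_mult)

lemma padic_nonneg: "padic p w \<Longrightarrow> algebraic x \<Longrightarrow> w x \<ge> 0"
  using padic_pos[of p w x] padic_0[of p w] by (cases "x = 0") auto

lemma padic_1:
  assumes "prime p" "padic p w"
  shows "w 1 = 1" "w (- 1) = 1"
proof -
  have "\<not> int p dvd 1" "\<not> int p dvd - 1" using prime_gt_1_nat[OF assms(1)] by auto
  then show "w 1 = 1" "w (- 1) = 1" using padic_coprime[OF assms(2), of 1] padic_coprime[OF assms(2), of "- 1"] by simp_all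
qed

lemma padic_minus: "prime p \<Longrightarrow> padic p w \<Longrightarrow> algebraic x \<Longrightarrow> w (- x) = w x"
  using padic_mult[of p w "- 1" x] padic_1 by simp

lemma padic_of_nat_le: "prime p \<Longrightarrow> padic p w \<Longrightarrow> w (of_nat n) \<le> 1"
proof (induction n)
  case 0 then show ?case by (simp add: padic_0)
next
  case (Suc n)
  then show ?case using padic_add[of p w 1 "of_nat n"] padic_1[of p w] by simp
qed

lemma padic_of_int_le: "prime p \<Longrightarrow> padic p w \<Longrightarrow> w (of_int n) \<le> 1"
  using padic_of_nat_le[of p w] padic_minus[of p w] by (cases n rule: int_cases2) auto

lemma padic_sum_le:
  assumes "padic p w" "M \<ge> 0" "\<And>i. i \<in> I \<Longrightarrow> algebraic (f i) \<and> w (f i) \<le> M"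
  shows "w (sum f I) \<le> M"
  using assms(3)
proof (induction I rule: infinite_finite_induct)
  case (insert i I)
  have "w (f i + sum f I) \<le> max (w (f i)) (w (sum f I))"
    using insert.prems by (intro padic_add[OF assms(1)] algebraic_sum) auto
  then show ?case using insert by force
qed (simp_all add: padic_0[OF assms(1)] assms(2))

lemma padic_power: "prime p \<Longrightarrow> padic p w \<Longrightarrow> algebraic x \<Longrightarrow> w (x ^ n) = w x ^ n"
  by (induction n) (auto simp: padic_1 padic_mult algebraic_power_complex)

lemma padic_prod_list: "prime p \<Longrightarrow> padic p w \<Longrightarrow> (\<And>x. x \<in> set xs \<Longrightarrow> algebraic x) \<Longrightarrow> w (prod_list xs) = (\<Prod>x\<leftarrow>xs. w x)"
  by (induction xs) (auto simp: padic_1 padic_mult algebraic_prod_list)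

text \<open>The number \<open>c\<close> is the leading coefficient of an integral equation of
  \<open>x\<close>. If \<open>p\<close> does not divide it and \<open>w x\<close> exceeds one, the
  leading term is larger than all others together.\<close>

lemma padic_le_1_almost_everywhere:
  assumes "algebraic (x :: complex)"
  obtains c :: int where "c \<noteq> 0" "\<And>p w. prime p \<Longrightarrow> padic p w \<Longrightarrow> \<not> int p dvd c \<Longrightarrow> w x \<le> 1"
proof -
  obtain q where q: "\<And>i. coeff q i \<in> \<int>" "q \<noteq> 0" "poly q x = 0" using assms by (rule algebraicE) blast
  define n where "n = degree q"
  obtain c :: int where c: "coeff q n = of_int c" using q(1) by (metis Ints_cases)
  have c0: "c \<noteq> 0" using c q(2) by (auto simp: n_def)
  have n0: "n > 0"
  proof (rule ccontr)
    assume "\<not> n > 0"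
    then obtain c where "q = [:c:]" by (auto simp: n_def elim: degree_eq_zeroE)
    then show False using q by simp
  qed
  have "w x \<le> 1" if p: "prime p" "padic p w" and pc: "\<not> int p dvd c" for p w
  proof (rule ccontr)
    assume "\<not> w x \<le> 1"
    then have w1: "w x > 1" by simp
    have ax: "algebraic (x ^ i)" for i using assms by (rule algebraic_power_complex)
    have ac: "algebraic (coeff q i)" for i using q(1)[of i] by (elim Ints_cases) simp
    have "{..n} = insert n {..<n}" by auto
    then have "coeff q n * x ^ n = - (\<Sum>i<n. coeff q i * x ^ i)"
      using q(3) unfolding poly_altdef n_def[symmetric] by (simp add: eq_neg_iff_add_eq_0)
    moreover have "w (coeff q n * x ^ n) = w x ^ n"
      unfolding padic_mult[OF p(2) ac ax] padic_power[OF p assms] using padic_coprime[OF p(2) pc] by (simp add: c)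
    moreover have "w (- (\<Sum>i<n. coeff q i * x ^ i)) \<le> w x ^ (n - 1)"
    proof -
      have "w (\<Sum>i<n. coeff q i * x ^ i) \<le> w x ^ (n - 1)"
      proof (rule padic_sum_le[OF p(2)])
        fix i assume i: "i \<in> {..<n}"
        have "w (coeff q i * x ^ i) = w (coeff q i) * w x ^ i"
          unfolding padic_mult[OF p(2) ac ax] padic_power[OF p assms] ..
        also have "\<dots> \<le> 1 * w x ^ (n - 1)"
          using i w1 q(1)[of i] padic_of_int_le[OF p]
          by (intro mult_mono power_increasing) (auto elim!: Ints_cases)
        finally show "algebraic (coeff q i * x ^ i) \<and> w (coeff q i * x ^ i) \<le> w x ^ (n - 1)"
          using algebraic_plus_mult(2)[OF ac ax] by simp
      qed (use w1 in simp)
      then show ?thesis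
        by (subst padic_minus[OF p]) (auto intro!: algebraic_sum algebraic_plus_mult(2) ac ax)
    qed
    ultimately have "w x ^ n \<le> w x ^ (n - 1)" by simp
    then show False using w1 n0 power_strict_increasing[of "n - 1" n "w x"] by simp
  qed
  then show ?thesis using that c0 by blast
qed

text \<open>The function \<open>h\<close> is multiplicative, equal to one at the primes of
  \<open>P\<close> and to \<open>q\<close> at any other prime \<open>q\<close>. Integrality outside
  \<open>P\<close> confines the denominator to primes of \<open>P\<close>, so that the numerator, a
  non-zero integer, decides.\<close>

lemma product_formula_rational:
  fixes w :: "nat \<Rightarrow> complex \<Rightarrow> real"
  assumes P: "finite P" "\<And>p. p \<in> P \<Longrightarrow> prime p" and w: "\<And>p. prime p \<Longrightarrow> padic p (w p)"
    and r: "r \<in> \<rat>" "r \<noteq> 0" and int: "\<And>p. prime p \<Longrightarrow> p \<notin> P \<Longrightarrow> w p r \<le> 1"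
  shows "cmod r * (\<Prod>p\<in>P. w p r) \<ge> 1"
proof -
  define h where "h x = cmod x * (\<Prod>p\<in>P. w p x)" for x
  have wP: "padic p (w p)" if "p \<in> P" for p using w P(2) that by blast
  have h_mult: "h (x * y) = h x * h y" if "algebraic x" "algebraic y" for x y
    using padic_mult[OF wP that] by (simp add: h_def norm_mult prod.distrib)
  have h_minus: "h (- x) = h x" if "algebraic x" for x
    unfolding h_def using padic_minus[OF P(2) wP that] by simp
  have h_prime: "h (of_nat q) = (if q \<in> P then 1 else real q)" if q: "prime q" for q
  proof -
    have "w p (of_nat q) = (if p = q then 1 / real q else 1)" if p: "p \<in> P" for p
    proof (cases "p = q")
      case True then show ?thesis using padic_p[OF wP[OF p]] by simp
    next
      case False
      have "\<not> p dvd q" using q P(2)[OF p] False using primes_dvd_imp_eq by blast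
      then show ?thesis using padic_coprime[OF wP[OF p], of "int q"] False by simp
    qed
    then have "(\<Prod>p\<in>P. w p (of_nat q)) = (\<Prod>p\<in>P. if p = q then 1 / real q else 1)" by simp
    also have "\<dots> = (if q \<in> P then 1 / real q else 1)" using P(1) by (simp add: prod.delta)
    finally show ?thesis using prime_gt_0_nat[OF q] by (simp add: h_def)
  qed
  have h_nat: "h (of_nat m) \<ge> 1 \<and> ((\<forall>p. prime p \<longrightarrow> p dvd m \<longrightarrow> p \<in> P) \<longrightarrow> h (of_nat m) = 1)" if "m > 0" for m
    using that
  proof (induction m rule: less_induct)
    case (less m)
    show ?case
    proof (cases "m = 1")
      case True
      then show ?thesis using padic_1(1)[OF P(2) wP] by (simp add: h_def)
    next
      case False
      then obtain q where q: "prime q" "q dvd m" using prime_factor_nat[of m] by auto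
      then obtain k where k: "m = q * k" by auto
      have k0: "k > 0" "k < m" using k less.prems prime_gt_1_nat[OF q(1)] by auto
      have "h (of_nat m) = h (of_nat q) * h (of_nat k)" using h_mult[of "of_nat q" "of_nat k"] by (simp add: k)
      moreover have "h (of_nat q) \<ge> 1" using h_prime[OF q(1)] prime_gt_0_nat[OF q(1)] by auto
      ultimately show ?thesis
        using less.IH[OF k0(2,1)] h_prime[OF q(1)] q k
          mult_mono[of 1 "h (of_nat q)" 1 "h (of_nat k)"] by auto
    qed
  qed
  obtain i j where ij: "j > 0" "coprime i j" "r = of_int i / of_int j"
    using r(1) by (rule Rats_cases')
  define b where "b = nat j"
  have b: "j = int b" "b > 0" using ij(1) by (auto simp: b_def)
  have alg: "algebraic r" using r(1) by (rule rat_imp_algebraic)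
  have rb: "r * of_nat b = of_int i" using ij(3) b by simp
  have i0: "i \<noteq> 0" using r(2) ij(3) by auto
  have "h (of_int i) \<ge> 1"
  proof (cases i rule: int_cases2)
    case (nonneg n)
    then show ?thesis using h_nat[of n] i0 by simp
  next
    case (nonpos n)
    then show ?thesis using h_nat[of n] h_minus[of "of_nat n"] i0 by simp
  qed
  moreover have "h (of_nat b) = 1"
  proof -
    have "p \<in> P" if p: "prime p" "p dvd b" for p
    proof (rule ccontr)
      assume pP: "p \<notin> P"
      note wp = w[OF p(1)]
      obtain k where k: "b = p * k" using p(2) by auto
      have "int p dvd j" using p(2) b(1) by simp
      then have "\<not> int p dvd i" using ij(2) p(1) by (meson coprime_common_divisor not_prime_unit prime_nat_int_transfer)
      then have "w p (of_int i) = 1" by (rule padic_coprime[OF wp])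
      then have e: "w p r * w p (of_nat b) = 1" using padic_mult[OF wp alg, of "of_nat b"] rb by simp
      have "w p (of_nat b) = 1 / real p * w p (of_nat k)"
        using padic_mult[OF wp, of "of_nat p" "of_nat k"] padic_p[OF wp] by (simp add: k)
      also have "\<dots> \<le> 1 / real p * 1" by (intro mult_left_mono padic_of_nat_le[OF p(1) wp]) simp
      also have "\<dots> < 1" using prime_gt_1_nat[OF p(1)] by simp
      finally have "w p (of_nat b) < 1" .
      moreover have "w p r \<le> 1" by (rule int[OF p(1) pP])
      moreover have "w p r > 0" using padic_pos[OF wp alg r(2)] .
      ultimately have "w p r * w p (of_nat b) < 1 * 1"
        using padic_nonneg[OF wp, of "of_nat b"] by (intro mult_le_less_imp_less) auto
      then show False using e by simp
    qed
    then show ?thesis using h_nat[OF b(2)] by blast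
  qed
  moreover have "h (of_int i) = h r * h (of_nat b)" using h_mult[OF alg, of "of_nat b"] rb by simp
  ultimately show ?thesis by (simp add: h_def)
qed

text \<open>Every embedding is followed by the complex absolute value and by one p-adic absolute
  value for each relevant prime. As conjugates are listed individually, every place occurs with its
  local degree, and the product over all of them is the rational product formula for the
  norm.\<close>

lemma exists_places:
  assumes cd: "conj_data F \<Sigma>" and A: "finite A" "A \<subseteq> F" "0 \<notin> A" and P: "finite P" "\<And>p. p \<in> P \<Longrightarrow> prime p"
  obtains R V Vinf d av Vp where "places F R V Vinf d av P Vp" "A \<subseteq> R" "inverse ` A \<subseteq> R"
proof -
  have S: "sfield F" using cd by (simp add: conj_data_def)
  then have RF: "sring F" by (simp add: sfield_def)
  have hom: "rhom F \<sigma>" if "\<sigma> \<in> set \<Sigma>" for \<sigma> using cd that by (simp add: conj_data_def)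
  have alg: "algebraic (\<sigma> x)" if "\<sigma> \<in> set \<Sigma>" "x \<in> F" for \<sigma> x using conj_data_algebraic(2)[OF cd] that by blast
  have nz: "\<sigma> x \<noteq> 0" if "\<sigma> \<in> set \<Sigma>" "x \<in> F" "x \<noteq> 0" for \<sigma> x using rhom_nonzero[OF S hom] that by blast
  obtain w where w: "\<And>p. prime p \<Longrightarrow> padic p (w p)" using exists_padic by metis
  define A' where "A' = A \<union> inverse ` A"
  have A'F: "A' \<subseteq> F" using A(2) S by (auto simp: A'_def sfield_def)
  define bad where "bad = (\<Union>x\<in>A'. \<Union>\<sigma>\<in>set \<Sigma>. {p. prime p \<and> w p (\<sigma> x) > 1})"
  have "finite {p. prime p \<and> w p (\<sigma> x) > 1}" if sx: "\<sigma> \<in> set \<Sigma>" "x \<in> A'" for \<sigma> x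
  proof -
    have a: "algebraic (\<sigma> x)" using alg sx A'F by blast
    obtain c :: int where c: "c \<noteq> 0" "\<And>p w. prime p \<Longrightarrow> padic p w \<Longrightarrow> \<not> int p dvd c \<Longrightarrow> w (\<sigma> x) \<le> 1"
      using padic_le_1_almost_everywhere[OF a] by metis
    have "p dvd nat \<bar>c\<bar>" if "prime p" "w p (\<sigma> x) > 1" for p
      using c(2)[OF that(1) w[OF that(1)]] that(2) by fastforce
    then have "{p. prime p \<and> w p (\<sigma> x) > 1} \<subseteq> {p. p dvd nat \<bar>c\<bar>}" by blast
    moreover have "finite {p. p dvd nat \<bar>c\<bar>}" by (rule finite_divisors_nat) (use c(1) in simp)
    ultimately show ?thesis by (rule finite_subset)
  qed
  then have "finite bad" using A(1) by (auto simp: bad_def A'_def)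
  \<comment> \<open>Besides the prescribed primes these are the finitely many at which an element of
    \<open>A\<close> or its inverse fails to be integral.\<close>
  define Q where "Q = P \<union> bad"
  have Q: "finite Q" "\<And>p. p \<in> Q \<Longrightarrow> prime p" using P \<open>finite bad\<close> by (auto simp: Q_def bad_def)
  have Q0: "0 \<notin> Q" using Q(2) not_prime_0 by blast
  define R where "R = {x\<in>F. \<forall>p \<sigma>. prime p \<longrightarrow> p \<notin> Q \<longrightarrow> \<sigma> \<in> set \<Sigma> \<longrightarrow> w p (\<sigma> x) \<le> 1}"
  define d where "d = length \<Sigma>"
  have d0: "d > 0" using cd by (auto simp: d_def conj_data_def)
  have nth: "\<Sigma> ! i \<in> set \<Sigma>" if "i < d" for i using that by (simp add: d_def)
  \<comment> \<open>A place is encoded as a pair of a prime and the position of an embedding; zero,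
    which is no prime, stands for infinity.\<close>
  define av where "av v x = (case prod_decode v of (k, i) \<Rightarrow> if k = 0 then cmod ((\<Sigma> ! i) x) else w k ((\<Sigma> ! i) x))" for v x
  have av: "av (prod_encode (k, i)) x = (if k = 0 then cmod ((\<Sigma> ! i) x) else w k ((\<Sigma> ! i) x))" for k i x
    by (simp add: av_def)
  define V where "V = prod_encode ` (insert 0 Q \<times> {..<d})"
  define Vp where "Vp p = prod_encode ` ({p} \<times> {..<d})" for p
  have inj: "inj_on prod_encode X" for X by (rule inj_prod_encode)
  have V_cases: "\<exists>\<sigma>\<in>set \<Sigma>. (\<forall>x. av v x = cmod (\<sigma> x)) \<or> (\<exists>p\<in>Q. \<forall>x. av v x = w p (\<sigma> x))" if v: "v \<in> V" for v
  proof -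
    obtain k i where ki: "v = prod_encode (k, i)" "k \<in> insert 0 Q" "i < d" using v by (auto simp: V_def)
    then show ?thesis using nth[OF ki(3)] Q0 by (intro bexI[of _ "\<Sigma> ! i"]) (auto simp: av)
  qed
  have V_fin: "\<exists>\<sigma>\<in>set \<Sigma>. \<exists>p\<in>Q. \<forall>x. av v x = w p (\<sigma> x)" if v: "v \<in> V - Vp 0" for v
  proof -
    obtain k i where ki: "v = prod_encode (k, i)" "k \<in> insert 0 Q" "i < d" "k \<noteq> 0" using v by (auto simp: V_def Vp_def)
    then show ?thesis using nth[OF ki(3)] by (intro bexI[of _ "\<Sigma> ! i"]) (auto simp: av)
  qed
  have V_inf: "\<exists>\<sigma>\<in>set \<Sigma>. \<forall>x. av v x = cmod (\<sigma> x)" if v: "v \<in> Vp 0" for v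
    using v nth by (auto simp: Vp_def av)
  have wQ: "padic p (w p)" if "p \<in> Q" for p using w Q(2) that by blast
  have add: "w p (\<sigma> (x + y)) \<le> max (w p (\<sigma> x)) (w p (\<sigma> y))" if "prime p" "\<sigma> \<in> set \<Sigma>" "x \<in> F" "y \<in> F" for p \<sigma> x y
    unfolding rhom_add[OF hom[OF that(2)] that(3,4)] by (intro padic_add[OF w[OF that(1)]] alg that)
  have mult: "w p (\<sigma> (x * y)) = w p (\<sigma> x) * w p (\<sigma> y)" if "prime p" "\<sigma> \<in> set \<Sigma>" "x \<in> F" "y \<in> F" for p \<sigma> x y
    unfolding rhom_mult[OF hom[OF that(2)] that(3,4)] by (intro padic_mult[OF w[OF that(1)]] alg that)
  have "places F R V (Vp 0) d av P Vp"
  proof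
    show "1 \<in> F" "x \<in> F \<Longrightarrow> y \<in> F \<Longrightarrow> x + y \<in> F" "x \<in> F \<Longrightarrow> - x \<in> F" "x \<in> F \<Longrightarrow> y \<in> F \<Longrightarrow> x * y \<in> F" for x y
      by (fact sring_1[OF RF] sring_add[OF RF] sring_minus[OF RF] sring_mult[OF RF])+
    show "x \<in> F \<Longrightarrow> inverse x \<in> F" for x using S by (simp add: sfield_def)
    show "countable F" using cd by (simp add: conj_data_def)
    show "R \<subseteq> F" by (auto simp: R_def)
    show "1 \<in> R" using padic_1(1)[OF _ w] hom by (auto simp: R_def sring_1[OF RF] rhom_1[of F])
    show "x + y \<in> R" if "x \<in> R" "y \<in> R" for x y
    proof -
      have "w p (\<sigma> (x + y)) \<le> 1" if p: "prime p" "p \<notin> Q" "\<sigma> \<in> set \<Sigma>" for p \<sigma>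
      proof (rule order_trans[OF add[OF p(1,3)]])
        show "max (w p (\<sigma> x)) (w p (\<sigma> y)) \<le> 1" using \<open>x \<in> R\<close> \<open>y \<in> R\<close> p by (simp add: R_def)
      qed (use \<open>x \<in> R\<close> \<open>y \<in> R\<close> in \<open>simp_all add: R_def\<close>)
      then show ?thesis using that by (simp add: R_def sring_add[OF RF])
    qed
    show "- x \<in> R" if "x \<in> R" for x
      using that alg padic_minus[OF _ w] hom by (auto simp: R_def sring_minus[OF RF] rhom_minus[OF RF])
    show "x * y \<in> R" if "x \<in> R" "y \<in> R" for x y
    proof -
      have "w p (\<sigma> (x * y)) \<le> 1" if p: "prime p" "p \<notin> Q" "\<sigma> \<in> set \<Sigma>" for p \<sigma>
        using \<open>x \<in> R\<close> \<open>y \<in> R\<close> p alg padic_nonneg[OF w] by (subst mult) (auto simp: R_def intro!: mult_le_one)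
      then show ?thesis using that by (simp add: R_def sring_mult[OF RF])
    qed
    show "finite V" using Q(1) by (simp add: V_def)
    show "Vp 0 \<subseteq> V" by (auto simp: Vp_def V_def)
    show "card (Vp 0) = d" using card_image[OF inj] by (simp add: Vp_def)
    show "d > 0" by (rule d0)
    show "av v 0 = 0" if "v \<in> V" for v
    proof -
      obtain \<sigma> where \<sigma>: "\<sigma> \<in> set \<Sigma>" "(\<forall>x. av v x = cmod (\<sigma> x)) \<or> (\<exists>p\<in>Q. \<forall>x. av v x = w p (\<sigma> x))"
        using V_cases[OF \<open>v \<in> V\<close>] by blast
      then show ?thesis using rhom_0[OF RF hom[OF \<sigma>(1)]] padic_0[OF wQ] by auto
    qed
    show "av v x > 0" if "v \<in> V" "x \<in> F" "x \<noteq> 0" for v x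
      using V_cases[OF that(1)] nz alg that padic_pos[OF wQ] by auto
    show "av v (x * y) = av v x * av v y" if "v \<in> V" "x \<in> F" "y \<in> F" for v x y
      using V_cases[OF that(1)] mult[OF Q(2)] that hom by (auto simp: rhom_mult[of F] norm_mult)
    show "av v (x + y) \<le> av v x + av v y" if "v \<in> Vp 0" "x \<in> F" "y \<in> F" for v x y
      using V_inf[OF that(1)] that hom by (auto simp: rhom_add[of F] norm_triangle_ineq)
    show "av v (x + y) \<le> max (av v x) (av v y)" if "v \<in> V - Vp 0" "x \<in> F" "y \<in> F" for v x y
      using V_fin[OF that(1)] that add[OF Q(2)] by auto
    show "prime p" if "p \<in> P" for p using P(2) that .
    show "Vp p \<subseteq> V - Vp 0" if "p \<in> P" for p
      using that Q0 by (auto simp: Vp_def V_def Q_def)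
    show "card (Vp p) = d" for p using card_image[OF inj] by (simp add: Vp_def)
    show "av v (of_nat p) = 1 / real p" if "p \<in> P" "v \<in> Vp p" for p v
      using that prime_gt_0_nat[OF P(2)[OF that(1)]] padic_p[OF w[OF P(2)]] rhom_of_nat[OF RF hom[OF nth]]
      by (auto simp: Vp_def av)
    show "(\<Prod>v\<in>V. av v y) \<ge> 1" if y: "y \<in> R" "y \<noteq> 0" for y
    proof -
      define n where "n = (\<Prod>\<sigma>\<leftarrow>\<Sigma>. \<sigma> y)"
      have yF: "y \<in> F" using y(1) by (simp add: R_def)
      have n: "n \<in> \<rat>" "n \<noteq> 0"
        using cd yF nz[OF _ yF y(2)] by (auto simp: n_def conj_data_def prod_list_zero_iff)
      have wn: "w p n = (\<Prod>i<d. w p ((\<Sigma> ! i) y))" if "prime p" for p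
      proof -
        have "w p n = (\<Prod>\<sigma>\<leftarrow>\<Sigma>. w p (\<sigma> y))"
          unfolding n_def using alg[OF _ yF] by (subst padic_prod_list[OF that w[OF that]]) (auto simp: comp_def)
        then show ?thesis by (simp add: prod.list_conv_set_nth d_def atLeast0LessThan)
      qed
      have cn: "cmod n = (\<Prod>i<d. cmod ((\<Sigma> ! i) y))"
        unfolding n_def prod.list_conv_set_nth by (simp add: prod_norm[symmetric] d_def atLeast0LessThan)
      have "(\<Prod>v\<in>V. av v y) = (\<Prod>k\<in>insert 0 Q. \<Prod>i<d. av (prod_encode (k, i)) y)"
        unfolding V_def by (simp add: prod.reindex[OF inj] prod.cartesian_product case_prod_unfold)
      also have "\<dots> = (\<Prod>i<d. cmod ((\<Sigma> ! i) y)) * (\<Prod>k\<in>Q. \<Prod>i<d. av (prod_encode (k, i)) y)"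
        using Q(1) Q0 by (simp add: av)
      also have "(\<Prod>k\<in>Q. \<Prod>i<d. av (prod_encode (k, i)) y) = (\<Prod>k\<in>Q. w k n)"
        using Q0 by (intro prod.cong refl) (auto simp: av wn Q(2) intro!: prod.cong)
      finally have "(\<Prod>v\<in>V. av v y) = cmod n * (\<Prod>k\<in>Q. w k n)" unfolding cn .
      moreover have "w p n \<le> 1" if "prime p" "p \<notin> Q" for p
        unfolding wn[OF that(1)] using y(1) that nth padic_nonneg[OF w[OF that(1)] alg[OF _ yF]]
        by (intro prod_le_1) (auto simp: R_def)
      ultimately show ?thesis using product_formula_rational[OF Q w n] by simp
    qed
  qed
  moreover have "A' \<subseteq> R"
  proof
    fix x assume x: "x \<in> A'"
    have "w p (\<sigma> x) \<le> 1" if "prime p" "p \<notin> Q" "\<sigma> \<in> set \<Sigma>" for p \<sigma>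
      using that x by (fastforce simp: Q_def bad_def not_less)
    then show "x \<in> R" using x A'F by (auto simp: R_def)
  qed
  ultimately show ?thesis using that by (auto simp: A'_def)
qed

section \<open>Specialisation to algebraic numbers\<close>

text \<open>The set \<open>Y\<close> is arbitrary because adjoining an element requires further
  elements of the smaller ring to stay non-zero; the induction would fail for a fixed set.\<close>

definition specialisable :: "'a::field_char_0 set \<Rightarrow> bool" where
  "specialisable S \<longleftrightarrow> sring S \<and> (\<forall>Y. finite Y \<longrightarrow> Y \<subseteq> S - {0} \<longrightarrow>
    (\<exists>\<phi> F \<Sigma>. rhom S \<phi> \<and> conj_data F \<Sigma> \<and> \<phi> ` S \<subseteq> F \<and> 0 \<notin> \<phi> ` Y))"

lemma specialisableE:
  assumes "specialisable S" "finite Y" "Y \<subseteq> S - {0}"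
  obtains \<phi> F \<Sigma> where "rhom S \<phi>" "conj_data F \<Sigma>" "\<phi> ` S \<subseteq> F" "0 \<notin> \<phi> ` Y"
  using assms unfolding specialisable_def by metis

lemma specialisable_Ints: "specialisable (\<int> :: 'a::field_char_0 set)"
proof -
  define \<phi> :: "'a \<Rightarrow> complex" where "\<phi> x = of_int (THE n. x = of_int n)" for x
  have \<phi>: "\<phi> (of_int n) = of_int n" for n by (simp add: \<phi>_def)
  have "rhom \<int> \<phi>"
    using \<phi>[of 1] by (auto simp: rhom_def elim!: Ints_cases simp flip: of_int_add of_int_mult simp: \<phi>)
  moreover have "\<phi> ` \<int> \<subseteq> \<rat>" by (auto simp: \<phi> elim!: Ints_cases)
  moreover have "0 \<notin> \<phi> ` Y" if "Y \<subseteq> \<int> - {0}" for Y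
    using that by (auto simp: \<phi> elim!: Ints_cases)
  moreover have "sring (\<int> :: 'a set)" by (simp add: sring_def)
  ultimately show ?thesis using conj_data_Rats unfolding specialisable_def by blast
qed

lemma rhom_adj:
  assumes R: "sring S" and \<phi>: "rhom S \<phi>"
    and root: "\<And>h. h \<in> pol S \<Longrightarrow> poly h a = 0 \<Longrightarrow> poly (map_poly \<phi> h) t = 0"
  obtains \<psi> where "rhom (adj S a) \<psi>" "\<And>h. h \<in> pol S \<Longrightarrow> \<psi> (poly h a) = poly (map_poly \<phi> h) t"
proof -
  define \<psi> where "\<psi> x = poly (map_poly \<phi> (SOME h. h \<in> pol S \<and> poly h a = x)) t" for x
  have \<psi>: "\<psi> (poly h a) = poly (map_poly \<phi> h) t" if h: "h \<in> pol S" for h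
  proof -
    define h' where "h' = (SOME h'. h' \<in> pol S \<and> poly h' a = poly h a)"
    have h': "h' \<in> pol S \<and> poly h' a = poly h a"
      unfolding h'_def by (rule someI[of _ h]) (use h in simp)
    have "map_poly \<phi> h' = map_poly \<phi> ((h' - h) + h)" by simp
    also have "\<dots> = map_poly \<phi> (h' - h) + map_poly \<phi> h"
      using h h' by (intro mp_add[OF R \<phi>] pol_diff[OF R]) auto
    finally show ?thesis
      using root[OF pol_diff[OF R, of h' h]] h h' by (simp add: \<psi>_def h'_def[symmetric])
  qed
  have one: "1 \<in> pol S" using pol_monom[OF R sring_1[OF R], of 0] by simp
  have "\<psi> 1 = 1" using \<psi>[OF one] by (simp add: map_poly_1 rhom_1[OF \<phi>])
  moreover have "\<psi> (x + y) = \<psi> x + \<psi> y \<and> \<psi> (x * y) = \<psi> x * \<psi> y" if xy: "x \<in> adj S a" "y \<in> adj S a" for x y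
  proof -
    obtain p q where pq: "p \<in> pol S" "q \<in> pol S" "x = poly p a" "y = poly q a" using xy unfolding adj_def by blast
    have "x + y = poly (p + q) a" "x * y = poly (p * q) a" using pq by auto
    then show ?thesis
      using pq \<psi>[OF pol_add[OF R pq(1,2)]] \<psi>[OF pol_mult[OF R pq(1,2)]]
      by (simp add: \<psi> mp_add[OF R \<phi>] mp_mult[OF R \<phi>])
  qed
  ultimately show ?thesis using that[of \<psi>] \<psi> by (simp add: rhom_def)
qed

text \<open>If \<open>a\<close> is transcendental over \<open>S\<close>, the leading coefficients
  are kept non-zero and \<open>a\<close> is sent to a natural number that avoids finitely many
  roots. If \<open>a\<close> is algebraic, the leading coefficient of an equation \<open>f\<close>
  of least degree is kept non-zero and \<open>a\<close> is sent to a root of the image of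
  \<open>f\<close>, which requires an extension of the number field.\<close>

lemma specialisable_adj:
  assumes sp: "specialisable S"
  shows "specialisable (adj S a)"
  unfolding specialisable_def
proof (intro conjI allI impI)
  have R: "sring S" using sp by (simp add: specialisable_def)
  show "sring (adj S a)" by (rule sring_adj[OF R])
  fix Y assume Y: "finite Y" "Y \<subseteq> adj S a - {0}"
  have "\<forall>y\<in>Y. \<exists>p. p \<in> pol S \<and> poly p a = y" using Y(2) unfolding adj_def by blast
  then obtain p where p: "\<And>y. y \<in> Y \<Longrightarrow> p y \<in> pol S" "\<And>y. y \<in> Y \<Longrightarrow> poly (p y) a = y" by metis
  have p0: "p y \<noteq> 0" if "y \<in> Y" for y using p(2)[OF that] Y(2) that by auto
  have "\<exists>\<phi> F \<Sigma>' t. rhom S \<phi> \<and> conj_data F \<Sigma>' \<and> \<phi> ` S \<subseteq> F \<and> t \<in> F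
    \<and> (\<forall>h\<in>pol S. poly h a = 0 \<longrightarrow> poly (map_poly \<phi> h) t = 0) \<and> (\<forall>y\<in>Y. poly (map_poly \<phi> (p y)) t \<noteq> 0)"
  proof (cases "\<forall>h\<in>pol S. poly h a = 0 \<longrightarrow> h = 0")
    case True
    have sub: "(\<lambda>y. lead_coeff (p y)) ` Y \<subseteq> S - {0}" using p(1) p0 by (auto simp: pol_def)
    obtain \<phi> F \<Sigma> where \<phi>: "rhom S \<phi>" "conj_data F \<Sigma>" "\<phi> ` S \<subseteq> F" "0 \<notin> \<phi> ` (\<lambda>y. lead_coeff (p y)) ` Y"
      by (rule specialisableE[OF sp finite_imageI[OF Y(1)] sub])
    have RF: "sring F" using \<phi>(2) by (simp add: conj_data_def sfield_def)
    have "map_poly \<phi> (p y) \<noteq> 0" if "y \<in> Y" for y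
      using \<phi>(4) that coeff_mp[OF R \<phi>(1), of "p y" "degree (p y)"] by force
    then have fin: "finite (\<Union>y\<in>Y. {t. poly (map_poly \<phi> (p y)) t = 0})" using Y(1) by (auto intro: poly_roots_finite)
    have "infinite (range (of_nat :: nat \<Rightarrow> complex))" by (simp add: finite_image_iff inj_of_nat)
    then have "\<not> range (of_nat :: nat \<Rightarrow> complex) \<subseteq> (\<Union>y\<in>Y. {t. poly (map_poly \<phi> (p y)) t = 0})"
      using finite_subset[OF _ fin] by blast
    then obtain n :: nat where "\<forall>y\<in>Y. poly (map_poly \<phi> (p y)) (of_nat n) \<noteq> 0" by blast
    moreover have "\<forall>h\<in>pol S. poly h a = 0 \<longrightarrow> poly (map_poly \<phi> h) (of_nat n) = 0" using True by auto
    moreover have "of_nat n \<in> F" by (rule sring_of_nat[OF RF])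
    ultimately show ?thesis using \<phi>(1-3)
      by (intro exI[of _ \<phi>] exI[of _ F] exI[of _ \<Sigma>] exI[of _ "of_nat n"] conjI)
  next
    case False
    define Z where "Z f \<longleftrightarrow> f \<in> pol S \<and> f \<noteq> 0 \<and> poly f a = 0" for f
    obtain f where f: "Z f" "\<And>h. Z h \<Longrightarrow> degree f \<le> degree h"
      using False ex_has_least_nat[of Z _ degree] unfolding Z_def by metis
    have fS: "f \<in> pol S" "f \<noteq> 0" "poly f a = 0" using f(1) by (auto simp: Z_def)
    have small: "h = 0" if "h \<in> pol S" "poly h a = 0" "degree h < degree f" for h
      using f(2)[of h] that by (auto simp: Z_def)
    define l where "l = lead_coeff f"
    have l: "l \<in> S" "l \<noteq> 0" using fS by (auto simp: l_def pol_def)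
    \<comment> \<open>Every \<open>y\<close> has a non-zero multiple in \<open>S\<close>; if the
      image of that multiple is non-zero, so is the image of \<open>y\<close>.\<close>
    have "\<forall>y\<in>Y. \<exists>u\<in>pol S. poly u a * y \<in> S - {0}"
    proof
      fix y assume "y \<in> Y"
      then show "\<exists>u\<in>pol S. poly u a * y \<in> S - {0}"
        using exists_multiple_in_base[OF R fS small p(1), of y] p(2) Y(2) by auto
    qed
    then obtain u where u: "\<And>y. y \<in> Y \<Longrightarrow> u y \<in> pol S" "\<And>y. y \<in> Y \<Longrightarrow> poly (u y) a * y \<in> S - {0}" by metis
    have sub: "insert l ((\<lambda>y. poly (u y) a * y) ` Y) \<subseteq> S - {0}" using l u(2) by auto
    obtain \<phi> F \<Sigma> where \<phi>: "rhom S \<phi>" "conj_data F \<Sigma>" "\<phi> ` S \<subseteq> F" "0 \<notin> \<phi> ` insert l ((\<lambda>y. poly (u y) a * y) ` Y)"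
      by (rule specialisableE[OF sp _ sub]) (use Y(1) in simp)
    have RF: "sring F" using \<phi>(2) by (simp add: conj_data_def sfield_def)
    have mpF: "map_poly \<phi> h \<in> pol F" if "h \<in> pol S" for h
      using that \<phi>(3) by (auto simp: pol_def coeff_mp[OF R \<phi>(1)])
    have lc: "coeff (map_poly \<phi> f) (degree f) = \<phi> l" by (simp add: coeff_mp[OF R \<phi>(1)] l_def)
    have f0: "map_poly \<phi> f \<noteq> 0" using lc \<phi>(4) by auto
    have "degree f > 0"
    proof (rule ccontr)
      assume "\<not> degree f > 0"
      then obtain c where "f = [:c:]" by (auto elim: degree_eq_zeroE)
      then show False using fS by simp
    qed
    then have "degree (map_poly \<phi> f) > 0"
      using le_degree[of "map_poly \<phi> f" "degree f"] lc \<phi>(4) by auto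
    then obtain t where t: "poly (map_poly \<phi> f) t = 0" using alg_closed_imp_poly_has_root by blast
    obtain \<Sigma>' where \<Sigma>': "conj_data (adj F t) \<Sigma>'" using conj_data_adj[OF \<phi>(2) mpF[OF fS(1)] f0 t] by blast
    \<comment> \<open>Pseudo-division makes \<open>l ^ k\<close> times \<open>h\<close> a multiple
      of \<open>f\<close>, and the image of \<open>l\<close> can be cancelled.\<close>
    have root: "poly (map_poly \<phi> h) t = 0" if h: "h \<in> pol S" "poly h a = 0" for h
    proof -
      obtain k q r where qr: "q \<in> pol S" "r \<in> pol S" "Polynomial.smult (l ^ k) h = q * f + r"
        "r = 0 \<or> degree r < degree f"
        unfolding l_def by (rule pol_pseudo_division[OF R fS(1,2) h(1)])
      have "poly r a = 0" using arg_cong[OF qr(3), of "\<lambda>p. poly p a"] h fS by simp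
      then have "r = 0" using small qr by blast
      then have "Polynomial.smult (l ^ k) h = q * f" using qr(3) by simp
      then have "map_poly \<phi> (Polynomial.smult (l ^ k) h) = map_poly \<phi> (q * f)" by simp
      then have "Polynomial.smult (\<phi> l ^ k) (map_poly \<phi> h) = map_poly \<phi> q * map_poly \<phi> f"
        using h(1) qr(1) fS(1) l(1)
        by (simp add: mp_smult[OF R \<phi>(1)] mp_mult[OF R \<phi>(1)] rhom_power[OF R \<phi>(1)] sring_power[OF R])
      from arg_cong[OF this, of "\<lambda>p. poly p t"] show ?thesis using t \<phi>(4) by simp
    qed
    have "poly (map_poly \<phi> (p y)) t \<noteq> 0" if y: "y \<in> Y" for y
    proof
      assume z: "poly (map_poly \<phi> (p y)) t = 0"
      define c where "c = poly (u y) a * y"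
      have c: "c \<in> S" "\<phi> c \<noteq> 0" using u(2)[OF y] \<phi>(4) y by (auto simp: c_def)
      have cS: "[:c:] \<in> pol S" by (intro pol_pCons pol_0 R c)
      have up: "u y * p y \<in> pol S" by (intro pol_mult[OF R] u(1)[OF y] p(1)[OF y])
      have "poly (u y * p y - [:c:]) a = 0" by (simp add: p(2)[OF y] c_def)
      then have "poly (map_poly \<phi> (u y * p y - [:c:])) t = 0" by (rule root[OF pol_diff[OF R up cS]])
      moreover have "map_poly \<phi> (u y * p y - [:c:]) = map_poly \<phi> (u y) * map_poly \<phi> (p y) - map_poly \<phi> [:c:]"
        by (simp only: diff_conv_add_uminus mp_add[OF R \<phi>(1) up pol_minus[OF R cS]] mp_minus[OF R \<phi>(1) cS]
            mp_mult[OF R \<phi>(1) u(1)[OF y] p(1)[OF y]])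
      moreover have "map_poly \<phi> [:c:] = [:\<phi> c:]" using c(2) rhom_0[OF R \<phi>(1)] by (intro poly_eqI) (simp add: coeff_mp[OF R \<phi>(1)] coeff_pCons split: nat.split)
      ultimately show False using z c(2) by simp
    qed
    moreover have "\<phi> ` S \<subseteq> adj F t" using \<phi>(3) adj_base[OF RF, of t] by blast
    ultimately show ?thesis using \<phi>(1) \<Sigma>' root adj_gen[OF RF, of t]
      by (intro exI[of _ \<phi>] exI[of _ "adj F t"] exI[of _ \<Sigma>'] exI[of _ t] conjI) blast+
  qed
  then obtain \<phi> F \<Sigma> t where \<phi>: "rhom S \<phi>" "conj_data F \<Sigma>" "\<phi> ` S \<subseteq> F" "t \<in> F"
    "\<And>h. h \<in> pol S \<Longrightarrow> poly h a = 0 \<Longrightarrow> poly (map_poly \<phi> h) t = 0"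
    "\<And>y. y \<in> Y \<Longrightarrow> poly (map_poly \<phi> (p y)) t \<noteq> 0" by blast
  have RF: "sring F" using \<phi>(2) by (simp add: conj_data_def sfield_def)
  obtain \<psi> where \<psi>: "rhom (adj S a) \<psi>" "\<And>h. h \<in> pol S \<Longrightarrow> \<psi> (poly h a) = poly (map_poly \<phi> h) t"
    using rhom_adj[OF R \<phi>(1,5)] by blast
  have "\<psi> ` adj S a \<subseteq> F"
  proof (intro image_subsetI)
    fix x assume "x \<in> adj S a"
    then obtain h where h: "h \<in> pol S" "x = poly h a" unfolding adj_def by blast
    have "map_poly \<phi> h \<in> pol F" using h(1) \<phi>(3) by (auto simp: pol_def coeff_mp[OF R \<phi>(1)])
    then show "\<psi> x \<in> F" unfolding h(2) \<psi>(2)[OF h(1)] by (rule poly_in_sring[OF RF _ \<phi>(4)])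
  qed
  moreover have "0 \<notin> \<psi> ` Y"
  proof
    assume "0 \<in> \<psi> ` Y"
    then obtain y where "y \<in> Y" "\<psi> y = 0" by auto
    then show False using \<psi>(2)[OF p(1), of y] p(2) \<phi>(6) by metis
  qed
  ultimately show "\<exists>\<phi> F \<Sigma>. rhom (adj S a) \<phi> \<and> conj_data F \<Sigma> \<and> \<phi> ` adj S a \<subseteq> F \<and> 0 \<notin> \<phi> ` Y"
    using \<psi>(1) \<phi>(2) by blast
qed

lemma exists_specialisable:
  assumes "finite A"
  obtains S where "specialisable S" "A \<subseteq> S"
proof -
  have "\<exists>S. specialisable S \<and> A \<subseteq> S" using assms
  proof (induction A rule: finite_induct)
    case empty then show ?case using specialisable_Ints by blast
  next
    case (insert a A)
    then obtain S where S: "specialisable S" "A \<subseteq> S" by blast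
    then have "sring S" by (simp add: specialisable_def)
    then show ?case using specialisable_adj[OF S(1), of a] S(2) adj_base[of S a] adj_gen[of S a] by blast
  qed
  then show ?thesis using that by blast
qed

text \<open>A homomorphism maps products to products and sums to sums, so neither kind of set grows.
  The doubling hypothesis is thus inherited, and lower bounds for the sumsets of the image carry
  back.\<close>

lemma exists_algebraic_model:
  fixes A :: "'a::field_char_0 set"
  assumes A: "finite A" "0 \<notin> A"
  obtains B :: "complex set" where "finite B" "0 \<notin> B" "\<And>b. b \<in> B \<Longrightarrow> algebraic b" "card B = card A"
    "card (prodset B) \<le> card (prodset A)" "\<And>h. card (hsumset h B) \<le> card (hsumset h A)"
proof -
  obtain S where S: "specialisable S" "A \<subseteq> S" using exists_specialisable[OF A(1)] by blast
  then have R: "sring S" by (simp add: specialisable_def)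
  \<comment> \<open>Differences that stay non-zero make the specialisation injective on
    \<open>A\<close>.\<close>
  define Y where "Y = A \<union> ((\<lambda>(a, b). a - b) ` (A \<times> A) - {0})"
  have Y: "finite Y" "Y \<subseteq> S - {0}" using A S(2) sring_diff[OF R] by (auto simp: Y_def)
  obtain \<phi> F \<Sigma> where \<phi>: "rhom S \<phi>" "conj_data F \<Sigma>" "\<phi> ` S \<subseteq> F" "0 \<notin> \<phi> ` Y"
    by (rule specialisableE[OF S(1) Y])
  have "\<phi> a \<noteq> \<phi> b" if ab: "a \<in> A" "b \<in> A" "a \<noteq> b" for a b
  proof
    assume e: "\<phi> a = \<phi> b"
    have "a - b \<in> Y" using ab by (auto simp: Y_def)
    moreover have "a \<in> S" "b \<in> S" using ab S(2) by auto
    then have "\<phi> (a - b) = 0"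
      using rhom_add[OF \<phi>(1), of a "- b"] rhom_minus[OF R \<phi>(1), of b] sring_minus[OF R, of b] e by simp
    ultimately show False using \<phi>(4) by force
  qed
  then have "inj_on \<phi> A" by (auto simp: inj_on_def)
  then have "card (\<phi> ` A) = card A" by (rule card_image)
  moreover have "prodset (\<phi> ` A) \<subseteq> \<phi> ` prodset A"
    using S(2) by (force simp: prodset_def rhom_mult[OF \<phi>(1), symmetric] subset_iff)
  moreover have "hsumset h (\<phi> ` A) \<subseteq> \<phi> ` hsumset h A" for h
  proof
    fix x assume "x \<in> hsumset h (\<phi> ` A)"
    then obtain g where g: "x = (\<Sum>i<h. g i)" "\<forall>i<h. g i \<in> \<phi> ` A" by (auto simp: hsumset_def)
    have "\<forall>i. \<exists>a. i < h \<longrightarrow> a \<in> A \<and> g i = \<phi> a" using g(2) by blast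
    then obtain f where "\<forall>i. i < h \<longrightarrow> f i \<in> A \<and> g i = \<phi> (f i)" by (rule choice[THEN exE])
    then have f: "f i \<in> A" "g i = \<phi> (f i)" if "i < h" for i using that by auto
    have "x = \<phi> (\<Sum>i<h. f i)"
      unfolding g(1) using f S(2) by (subst rhom_sum[OF R \<phi>(1)]) (auto intro: sum.cong)
    then show "x \<in> \<phi> ` hsumset h A" using f unfolding hsumset_def by blast
  qed
  moreover have "algebraic b" if "b \<in> \<phi> ` A" for b
    using conj_data_algebraic(1)[OF \<phi>(2)] \<phi>(3) S(2) that by blast
  moreover have "0 \<notin> \<phi> ` A" using \<phi>(4) by (auto simp: Y_def)
  ultimately show ?thesis
    using that[of "\<phi> ` A"] A(1) finite_prodset[OF A(1)] finite_hsumset[OF A(1)]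
    by (meson card_mono card_image_le finite_imageI le_trans)
qed

section \<open>The sumset bound\<close>

lemma Im_Ln_quotients:
  assumes "a \<noteq> 0" "b \<noteq> 0" "c \<noteq> 0" "d \<noteq> 0" and w: "w < pi"
    and ab: "\<bar>Im (Ln a) - Im (Ln b)\<bar> \<le> w / 2" and cd: "\<bar>Im (Ln c) - Im (Ln d)\<bar> \<le> w / 2"
  shows "\<bar>Im (Ln ((a / b) * (c / d)))\<bar> \<le> w"
proof -
  define z where "z = Ln a - Ln b + (Ln c - Ln d)"
  have "(a / b) * (c / d) = exp z" using assms(1-4) by (simp add: z_def exp_add exp_diff)
  moreover have "\<bar>Im z\<bar> \<le> w" unfolding z_def using ab cd abs_triangle_ineq[of "Im (Ln a) - Im (Ln b)" "Im (Ln c) - Im (Ln d)"]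
    by (simp del: abs_triangle_ineq)
  moreover from this have "Ln (exp z) = z" using w by (intro Ln_exp) auto
  ultimately show ?thesis by simp
qed

lemma exists_large_sector:
  assumes B: "finite B" "B \<noteq> {}" "0 \<notin> B" and q: "q \<ge> (6::nat)"
  obtains A where "A \<subseteq> B" "A \<noteq> {}" "real (card B) \<le> real q * real (card A)"
    "\<And>a b c d. a \<in> A \<Longrightarrow> b \<in> A \<Longrightarrow> c \<in> A \<Longrightarrow> d \<in> A \<Longrightarrow> \<bar>Im (Ln ((a / b) * (c / d)))\<bar> \<le> 4 * pi / (real q - 1)"
proof -
  \<comment> \<open>The width is \<open>2 * pi / (q - 1)\<close> and not \<open>2 * pi / q\<close>,
    because the imaginary part of \<open>Ln\<close> attains its upper bound pi: the indices then run
    from zero to \<open>q - 1\<close> inclusive.\<close>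
  define w where "w = 2 * pi / (real q - 1)"
  have w0: "w > 0" using q by (simp add: w_def)
  define k where "k b = nat \<lfloor>(Im (Ln b) + pi) / w\<rfloor>" for b
  have ge0: "(Im (Ln b) + pi) / w \<ge> 0" if "b \<in> B" for b
  proof -
    have "- pi < Im (Ln b)" using B(3) that by (intro mpi_less_Im_Ln) auto
    then show ?thesis using w0 by simp
  qed
  have "k b < q" if b: "b \<in> B" for b
  proof -
    have "Im (Ln b) + pi \<le> 2 * pi" using B(3) b Im_Ln_le_pi[of b] by auto
    also have "\<dots> = (real q - 1) * w" using q by (simp add: w_def)
    finally have "(Im (Ln b) + pi) / w \<le> real q - 1" using w0 by (simp add: divide_le_eq)
    then have "\<lfloor>(Im (Ln b) + pi) / w\<rfloor> < int q" by linarith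
    then show ?thesis using q by (simp add: k_def nat_less_iff)
  qed
  then have "k \<in> B \<rightarrow> {..<q}" by auto
  then obtain j where j: "card (k -` {j} \<inter> B) * card {..<q} \<ge> card B"
    using pigeonhole_card[of k B "{..<q}"] B(1) q by (auto simp: lessThan_empty_iff)
  define A where "A = k -` {j} \<inter> B"
  have "A \<subseteq> B" by (simp add: A_def)
  moreover have "A \<noteq> {}" using j B by (auto simp: A_def[symmetric] card_gt_0_iff)
  moreover have "real (card B) \<le> real q * real (card A)"
    using j unfolding A_def[symmetric] by (simp add: mult.commute flip: of_nat_mult)
  moreover have "\<bar>Im (Ln ((a / b) * (c / d)))\<bar> \<le> 2 * w" if "a \<in> A" "b \<in> A" "c \<in> A" "d \<in> A" for a b c d
  proof -
    have close: "\<bar>Im (Ln a) - Im (Ln b)\<bar> \<le> w" if ab: "a \<in> A" "b \<in> A" for a b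
    proof -
      have "k a = k b" "a \<in> B" "b \<in> B" using ab by (auto simp: A_def)
      then have "\<lfloor>(Im (Ln a) + pi) / w\<rfloor> = \<lfloor>(Im (Ln b) + pi) / w\<rfloor>"
        using ge0[of a] ge0[of b] unfolding k_def by (subst (asm) eq_nat_nat_iff) (simp_all add: le_floor_iff)
      then have "\<bar>(Im (Ln a) + pi) / w - (Im (Ln b) + pi) / w\<bar> \<le> 1" by linarith
      then have "\<bar>(Im (Ln a) - Im (Ln b)) / w\<bar> \<le> 1" by (simp add: diff_divide_distrib[symmetric])
      then show ?thesis using w0 by (simp add: abs_divide divide_le_eq)
    qed
    \<comment> \<open>Here \<open>q\<close> has to exceed five; below pi the sum of the logarithms
      is the principal logarithm of the product.\<close>
    have "2 * w < pi"
    proof -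
      have "4 < real q - 1" using q by simp
      then show ?thesis by (simp add: w_def divide_less_eq)
    qed
    then show ?thesis using that close B(3) \<open>A \<subseteq> B\<close> by (intro Im_Ln_quotients) auto
  qed
  moreover have "2 * w = 4 * pi / (real q - 1)" by (simp add: w_def)
  ultimately show ?thesis using that by metis
qed

text \<open>With this number \<open>q\<close> of sectors, \<open>2 * N\<close> times the factorial
  of \<open>3 * fact N\<close> times the angle equals \<open>q * pi / (q - 1)\<close>, which is
  below \<open>2 * pi\<close> as the locale requires. Passing to one sector costs the factor
  \<open>q ^ h\<close>.\<close>

lemma algebraic_sumset_bound:
  fixes B :: "complex set"
  assumes B: "finite B" "B \<noteq> {}" "0 \<notin> B" "\<And>b. b \<in> B \<Longrightarrow> algebraic b"
    and doubling: "real (card (prodset B)) \<le> \<alpha> * real (card B)" and h: "h \<ge> 2" and N: "N = 2 * h"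
    and q: "q = 8 * N * fact (3 * fact N)"
  shows "real (card B) ^ h \<le> real (card (hsumset h B)) * (real q ^ h * exp (real N * (real N + 25 * \<alpha> * fact N ^ 4)))"
proof -
  obtain F \<Sigma> where F: "conj_data F \<Sigma>" "B \<subseteq> F" using exists_conj_data[OF B(1,4)] by blast
  define P where "P = {p::nat. prime p \<and> p \<le> 1 + fact N * fact (3 * fact N)}"
  have "P \<subseteq> {..1 + fact N * fact (3 * fact N)}" by (auto simp: P_def)
  then have "finite P" using finite_subset by blast
  then obtain R V Vinf d av Vp where pl: "places F R V Vinf d av P Vp" and BR: "B \<subseteq> R" "inverse ` B \<subseteq> R"
    using exists_places[OF F(1) B(1) F(2) B(3), of P] by (metis (mono_tags, lifting) P_def mem_Collect_eq)
  have t1: "(fact (3 * fact N) :: nat) \<ge> 1" by simp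
  have N4: "N \<ge> 4" using h N by simp
  have qN: "q \<ge> 8 * N" using t1 unfolding q by simp
  then have q6: "q \<ge> 6" using N4 by simp
  obtain A' where A': "A' \<subseteq> B" "A' \<noteq> {}" "real (card B) \<le> real q * real (card A')"
    and arg: "\<And>a b c d. a \<in> A' \<Longrightarrow> b \<in> A' \<Longrightarrow> c \<in> A' \<Longrightarrow> d \<in> A' \<Longrightarrow> \<bar>Im (Ln ((a / b) * (c / d)))\<bar> \<le> 4 * pi / (real q - 1)"
    using exists_large_sector[OF B(1-3) q6] by blast
  have sd: "small_doubling F R V Vinf d av P Vp B A' \<alpha> (4 * pi / (real q - 1)) N"
  proof (intro small_doubling.intro small_doubling_axioms.intro pl)
    show "finite B" by (rule B(1))
    show "B \<subseteq> places.U R" using BR B(3) by (auto simp: places.U_def[OF pl])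
    show "A' \<subseteq> B" "A' \<noteq> {}" by (fact A')+
    show "real (card (prodset B)) \<le> \<alpha> * real (card B)" by (rule doubling)
    show "N \<ge> 2" using N4 by simp
    show "p \<in> P" if "prime p" "p \<le> 1 + fact N * fact (3 * fact N)" for p using that by (simp add: P_def)
    show "\<bar>Im (Ln ((a / b) * (c / d)))\<bar> \<le> 4 * pi / (real q - 1)" if "a \<in> A'" "b \<in> A'" "c \<in> A'" "d \<in> A'" for a b c d
      using arg that .
    have "2 * real N * real (fact (3 * fact N)) * 4 = real q" by (simp add: q)
    then have "2 * real N * real (fact (3 * fact N)) * (4 * pi / (real q - 1)) = real q * (pi / (real q - 1))"
      by (simp add: field_simps)
    also have "\<dots> < 2 * pi" using q6 by (simp add: field_simps)
    finally show "2 * real N * real (fact (3 * fact N)) * (4 * pi / (real q - 1)) < 2 * pi" .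
  qed
  define f :: real where "f = fact N"
  have fN: "f \<ge> real N"
    unfolding f_def using fact_ge_self[of N] by (metis of_nat_fact of_nat_le_iff)
  have "(fact 4 :: real) \<le> fact N" using N4 by (intro fact_mono)
  then have f24: "f \<ge> 24" by (simp add: f_def fact_numeral)
  have lq: "ln (real q) \<le> 11 * fact N ^ 2"
  proof -
    have "ln (real q) = ln (8 * real N) + ln (fact (3 * fact N))"
      unfolding q using N4 by (simp add: ln_mult)
    also have "ln (8 * real N) \<le> 8 * real N" using N4 by (intro ln_bound) simp
    also have "8 * real N \<le> f * f" using fN f24 by (intro mult_mono) auto
    also have "ln (fact (3 * fact N)) \<le> real (3 * fact N) ^ 2" by (rule ln_fact_le)
    also have "\<dots> = 9 * (f * f)" by (simp add: f_def power2_eq_square)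
    finally have "ln (real q) \<le> 10 * (f * f)" by simp
    also have "\<dots> \<le> 11 * fact N ^ 2" using f24 by (simp add: f_def power2_eq_square)
    finally show ?thesis .
  qed
  have bd: "real (card A') ^ h \<le> real (card (hsumset h A')) * exp (real N * (real N + 25 * \<alpha> * fact N ^ 4))"
    using small_doubling.sumset_bound[OF sd N h A'(3) _ lq] q6 by simp
  have sub: "hsumset h A' \<subseteq> hsumset h B" using A'(1) unfolding hsumset_def by blast
  have "card (hsumset h A') \<le> card (hsumset h B)" by (rule card_mono[OF finite_hsumset[OF B(1)] sub])
  then have cm: "real (card (hsumset h A')) \<le> real (card (hsumset h B))" by simp
  have "real (card B) ^ h \<le> (real q * real (card A')) ^ h" by (intro power_mono A'(3)) simp
  also have "\<dots> = real q ^ h * real (card A') ^ h" by (rule power_mult_distrib)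
  also have "\<dots> \<le> real q ^ h * (real (card (hsumset h B)) * exp (real N * (real N + 25 * \<alpha> * fact N ^ 4)))"
    using bd cm by (intro mult_left_mono order_trans[OF bd] mult_right_mono) auto
  finally show ?thesis by (simp add: mult_ac)
qed

text \<open>For \<open>h\<close> at least two, \<open>2 * h\<close> is at most \<open>h ^ 2\<close>,
  so the factorial is at most \<open>h ^ (4 * h)\<close> and its seventh power at most
  \<open>h ^ (28 * h)\<close>.\<close>

lemma fact_power_bound:
  assumes "h \<ge> 2"
  shows "(fact (2 * h) :: real) ^ 7 \<le> real h ^ (65 * h)"
proof -
  have "(fact (2 * h) :: real) \<le> of_nat ((2 * h) ^ (2 * h))" by (rule fact_le_power)
  also have "\<dots> = (2 * real h) ^ (2 * h)" by simp
  also have "\<dots> \<le> (real h * real h) ^ (2 * h)" using assms by (intro power_mono mult_right_mono) auto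
  also have "\<dots> = real h ^ (4 * h)" by (simp add: power_mult_distrib power_add[symmetric])
  finally have "(fact (2 * h) :: real) ^ 7 \<le> (real h ^ (4 * h)) ^ 7" by (intro power_mono) auto
  also have "\<dots> = real h ^ (28 * h)" by (simp add: power_mult[symmetric] mult.commute)
  also have "\<dots> \<le> real h ^ (65 * h)" using assms by (intro power_increasing) auto
  finally show ?thesis .
qed

text \<open>Again everything is measured in \<open>f = fact N\<close>, which is at least 24. The
  dominant contribution is \<open>N * 50 * \<alpha> * f ^ 4\<close>; two further powers of
  \<open>f\<close> absorb the factor 50, whence the exponent seven. The factor two before
  \<open>q\<close> and before \<alpha> accounts for the removal of zero from the set.\<close>

lemma loss_bound:
  assumes h: "h \<ge> 2" and \<alpha>: "\<alpha> > (0::real)" and N: "N = 2 * h" and q: "q = 8 * N * fact (3 * fact N)"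
  shows "(2 * real q) ^ h * exp (real N * (real N + 25 * (2 * \<alpha>) * fact N ^ 4)) \<le> exp (real h ^ (65 * h) * (\<alpha> + 1))"
proof -
  define f :: real where "f = fact N"
  have N4: "N \<ge> 4" using h N by simp
  have fN: "f \<ge> real N"
    unfolding f_def using fact_ge_self[of N] by (metis of_nat_fact of_nat_le_iff)
  have "(fact 4 :: real) \<le> fact N" using N4 by (intro fact_mono)
  then have f24: "f \<ge> 24" by (simp add: f_def fact_numeral)
  have q0: "real q > 0" using N4 by (simp add: q)
  have lq: "ln (2 * real q) \<le> 11 * f ^ 2"
  proof -
    have "ln (2 * real q) = ln (16 * real N) + ln (fact (3 * fact N))"
      unfolding q using N4 by (subst ln_mult_pos[symmetric]) (auto simp: algebra_simps)
    also have "ln (16 * real N) \<le> 16 * real N" using N4 by (intro ln_bound) simp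
    also have "16 * real N \<le> f * f" using fN f24 by (intro mult_mono) auto
    also have "ln (fact (3 * fact N)) \<le> real (3 * fact N) ^ 2" by (rule ln_fact_le)
    also have "\<dots> = 9 * (f * f)" by (simp add: f_def power2_eq_square)
    finally have "ln (2 * real q) \<le> 10 * (f * f)" by simp
    also have "\<dots> \<le> 11 * f ^ 2" using f24 by (simp add: power2_eq_square)
    finally show ?thesis .
  qed
  have "(2 * real q) ^ h = exp (real h * ln (2 * real q))"
    using q0 by (simp add: exp_of_nat_mult)
  then have "(2 * real q) ^ h * exp (real N * (real N + 25 * (2 * \<alpha>) * fact N ^ 4))
      = exp (real h * ln (2 * real q) + real N * (real N + 25 * (2 * \<alpha>) * f ^ 4))"
    by (simp add: exp_add f_def)
  also have "\<dots> \<le> exp (f ^ 7 * (\<alpha> + 1))"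
  proof -
    have hf: "real h \<le> f" using fN N by simp
    have "real h * ln (2 * real q) \<le> f * (11 * f ^ 2)" 
    proof (intro mult_mono hf lq)
      have "2 * real q \<ge> 1" using q0 by simp
      then show "0 \<le> ln (2 * real q)" by simp
    qed (use f24 in auto)
    also have "\<dots> = 11 * f ^ 3" by (simp add: power_numeral_reduce)
    finally have 1: "real h * ln (2 * real q) \<le> 11 * f ^ 3" .
    have 2: "real N * real N \<le> f * f" using fN by (intro mult_mono) auto
    have 3: "real N * (50 * \<alpha> * f ^ 4) \<le> f * (50 * \<alpha> * f ^ 4)" using fN \<alpha> f24 by (intro mult_right_mono) auto
    have 4: "50 \<le> f ^ 2" using power_mono[of 24 f 2] f24 by simp
    have 5: "50 * f ^ 5 \<le> f ^ 2 * f ^ 5" using 4 f24 by (intro mult_right_mono) auto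
    have 6: "f ^ 2 * f ^ 5 = f ^ 7" by (simp add: power_add[symmetric])
    have 7: "12 * f ^ 3 \<le> f ^ 7"
    proof -
      have "12 * f ^ 3 \<le> f ^ 4 * f ^ 3" using order_trans[OF 4 power_increasing[of 2 4 f]] f24 by (intro mult_right_mono) auto
      then show ?thesis by (simp add: power_add[symmetric])
    qed
    have 8: "f * f \<le> f ^ 3" using f24 power_increasing[of 2 3 f] by (simp add: power2_eq_square)
    have 9: "f * (50 * \<alpha> * f ^ 4) \<le> \<alpha> * f ^ 7"
    proof -
      have "f * (50 * \<alpha> * f ^ 4) = \<alpha> * (50 * f ^ 5)" by (simp add: power_numeral_reduce)
      also have "\<dots> \<le> \<alpha> * f ^ 7" using 5 6 \<alpha> by (intro mult_left_mono) auto
      finally show ?thesis .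
    qed
    have "real h * ln (2 * real q) + real N * (real N + 25 * (2 * \<alpha>) * f ^ 4)
        = real h * ln (2 * real q) + real N * real N + real N * (50 * \<alpha> * f ^ 4)" by (simp add: algebra_simps)
    also have "\<dots> \<le> f ^ 7 + \<alpha> * f ^ 7" using 1 2 3 7 8 9 by linarith
    finally show ?thesis by (simp add: algebra_simps)
  qed
  also have "\<dots> \<le> exp (real h ^ (65 * h) * (\<alpha> + 1))"
    using fact_power_bound[OF h] \<alpha> by (simp add: f_def N mult_right_mono)
  finally show ?thesis .
qed

theorem theorem2:
  fixes A :: "'a::{alg_closed_field, field_char_0} set"
    and \<alpha> :: real and h :: nat
  assumes "finite A"
    and "\<alpha> > 0"
    and "real (card (prodset A)) \<le> \<alpha> * real (card A)"
    and "h \<ge> 2"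
  shows "real (card (hsumset h A)) \<ge> exp (- (real h ^ (65 * h)) * (\<alpha> + 1)) * real (card A) ^ h"
proof -
  define E where "E = real h ^ (65 * h) * (\<alpha> + 1)"
  have E0: "E \<ge> 0" using assms(2) by (simp add: E_def)
  \<comment> \<open>Units must be non-zero. Discarding zero at most halves a set with another
    element, so the doubling constant becomes at most \<open>2 * \<alpha>\<close> and
    \<open>card A ^ h\<close> loses at most \<open>2 ^ h\<close>.\<close>
  define A1 where "A1 = A - {0}"
  have A1: "finite A1" "0 \<notin> A1" using assms(1) by (auto simp: A1_def)
  have "hsumset h A1 \<subseteq> hsumset h A" unfolding hsumset_def A1_def by blast
  then have hA: "real (card (hsumset h A1)) \<le> real (card (hsumset h A))"
    using card_mono[OF finite_hsumset[OF assms(1)]] by simp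
  have cA: "card A \<le> card A1 + 1" using assms(1) card_Suc_Diff1[OF assms(1), of 0]
    by (cases "0 \<in> A") (auto simp: A1_def)
  have goal: "real (card A) ^ h \<le> real (card (hsumset h A)) * exp E"
  proof (cases "A1 = {}")
    case True
    then consider "A = {}" | "A = {0}" by (auto simp: A1_def)
    then show ?thesis
    proof cases
      case 1
      then have "real (card A) ^ h = 0" using assms(4) by simp
      then show ?thesis by (simp only:) simp
    next
      case 2
      then have "hsumset h A = {0}" by (auto simp: hsumset_def intro!: exI[of _ "\<lambda>_. 0"])
      then show ?thesis using 2 E0 by simp
    qed
  next
    case False
    then have c1: "card A1 \<ge> 1" using A1(1) by (simp add: Suc_le_eq card_gt_0_iff)
    then have c2: "real (card A) \<le> 2 * real (card A1)" using cA by linarith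
    obtain B :: "complex set" where B: "finite B" "0 \<notin> B" "\<And>b. b \<in> B \<Longrightarrow> algebraic b" "card B = card A1"
      "card (prodset B) \<le> card (prodset A1)" "\<And>h. card (hsumset h B) \<le> card (hsumset h A1)"
      using exists_algebraic_model[OF A1] by blast
    have "card (prodset A1) \<le> card (prodset A)"
      by (intro card_mono finite_prodset assms(1)) (auto simp: prodset_def A1_def)
    then have "real (card (prodset B)) \<le> \<alpha> * real (card A)" using B(5) assms(3) by linarith
    also have "\<dots> \<le> \<alpha> * (2 * real (card A1))" using c2 assms(2) by (intro mult_left_mono) auto
    finally have db: "real (card (prodset B)) \<le> 2 * \<alpha> * real (card B)" by (simp add: B(4))
    have "B \<noteq> {}" using B(4) c1 by auto
    define N where "N = 2 * h"
    define q :: nat where "q = 8 * N * fact (3 * fact N)"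
    have "real (card A) ^ h \<le> (2 * real (card B)) ^ h" using c2 B(4) by (intro power_mono) auto
    also have "\<dots> = 2 ^ h * real (card B) ^ h" by (rule power_mult_distrib)
    also have "\<dots> \<le> 2 ^ h * (real (card (hsumset h B)) * (real q ^ h * exp (real N * (real N + 25 * (2 * \<alpha>) * fact N ^ 4))))"
      by (intro mult_left_mono algebraic_sumset_bound[OF B(1) \<open>B \<noteq> {}\<close> B(2,3) db assms(4) N_def q_def]) auto
    also have "\<dots> = real (card (hsumset h B)) * ((2 * real q) ^ h * exp (real N * (real N + 25 * (2 * \<alpha>) * fact N ^ 4)))"
      by (simp add: power_mult_distrib mult_ac)
    also have "\<dots> \<le> real (card (hsumset h A)) * exp E"
      unfolding E_def using B(6)[of h] hA loss_bound[OF assms(4,2) N_def q_def] by (intro mult_mono) auto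
    finally show ?thesis .
  qed
  have "exp (- E) * real (card A) ^ h \<le> exp (- E) * (real (card (hsumset h A)) * exp E)"
    by (intro mult_left_mono goal) simp
  also have "\<dots> = real (card (hsumset h A))" by (simp add: exp_minus)
  finally show ?thesis by (simp add: E_def)
qed

end
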